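(* Let $\mathcal{N}$ be a factor of Connes' type, i.e. a factor not anti-isomorphic to itself. Then no natural Choi--Jamiołkowski type isomorphism for $\mathcal{N}$ exists. Equivalently, there is no way of assigning to every $\phi\in\mathcal{N}\mathrm{or}(\mathcal{M},\mathcal{N}_* )$ (where $\mathcal{M}$ ranges over von Neumann algebras) a normal functional on $\mathcal{M}\overline{\otimes}\mathcal{N}$, compatibly with the corners $\alpha_p$ and matching complete positivity with positivity.
   Context: For von Neumann algebras $\mathcal{M},\mathcal{N}$: ${}_*$ denotes the predual (normal functionals), $\mathcal{M}\overline{\otimes}\mathcal{N}$ the spatial von Neumann tensor product, $(\mathcal{M}\overline{\otimes}\mathcal{N})_*^+$ the cone of positive normal functionals. $\mathcal{N}$ is anti-isomorphic to itself if there is a normal linear bijection $\alpha:\mathcal{N}\to\mathcal{N}$ with $\alpha(x^* )=\alpha(x)^*$ and $\alpha(xy)=\alpha(y)\alpha(x)$ for all $x,y\in\mathcal{N}$; equivalently, $\mathcal{N}$ is $*$-isomorphic to its opposite algebra $\mathcal{N}^\circ$. Matrix order on $\mathcal{N}_*$: $M_n(\mathcal{N}_* )$ is identified with $(M_n(\mathcal{N}))_*$ through the trace pairing $\langle[\psi_{ij}],[b_{ij}]\rangle=\sum_{i,j=1}^n\psi_{ij}(b_{ji})$, and $M_n(\mathcal{N}_* )^+$ is the preimage of the cone of positive normal functionals on $M_n(\mathcal{N})$. A linear map $\phi:\mathcal{M}\to\mathcal{N}_*$ is completely positive if $\phi^{(n)}(M_n(\mathcal{M})^+)\subseteq M_n(\mathcal{N}_*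 )^+$ for every $n\in\mathbb{N}$, where $\phi^{(n)}([x_{ij}])=[\phi(x_{ij})]$. The space $\mathcal{N}\mathrm{or}(\mathcal{M},\mathcal{N}_* )$: let $\mathcal{M}_*\widehat{\otimes}\mathcal{N}_*$ be the operator space projective tensor product; it is completely isometrically isomorphic to $(\mathcal{M}\overline{\otimes}\mathcal{N})_*$ via $\langle\rho\otimes\nu,x\otimes y\rangle=\rho(x)\nu(y)$. The elementary tensor $\mu\otimes\nu$ acts on $\mathcal{M}$ as the map $x\mapsto\mu(x)\nu$, and this extends to a map (which the paper takes to be a completely isometric embedding) of $\mathcal{M}_*\widehat{\otimes}\mathcal{N}_*$ into the space $\mathrm{CB}(\mathcal{M},\mathcal{N}_* )$ of completely bounded maps. $\mathcal{N}\mathrm{or}(\mathcal{M},\mathcal{N}_* )$ is the image of this map, equipped with the cb-norm. A Choi--Jamiołkowski type isomorphism is a linear homeomorphism $\mathcal{J}:\mathcal{N}\mathrm{or}(\mathcal{M},\mathcal{N}_* )\to(\mathcal{M}\overline{\otimes}\mathcal{N})_*$ such that $\phi$ is completely positive if and only if $\mathcal{J}(\phi)\in(\mathcal{M}\overline{\otimes}\mathcal{N})_*^+$. A natural Choi--Jamiołkowski type isomorphism for $\mathcal{N}$ is a family $(\mathcal{J}_{\mathcal{M}})_{\mathcal{M}}$ of Choi--Jamiołkowski type isomorphisms $\mathcal{J}_{\mathcal{M}}:\mathcal{N}\mathrm{or}(\mathcal{M},\mathcal{N}_* )\to(\mathcal{M}\overline{\otimes}\mathcal{N})_*$, indexed by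 all von Neumann algebras $\mathcal{M}$, that is a natural transformation: $\mathcal{J}_{\mathcal{M}_1}(\phi\circ\alpha)=\mathcal{J}_{\mathcal{M}_2}(\phi)\circ(\alpha\otimes\mathrm{id}_{\mathcal{N}})$ for every normal (not necessarily unital) $*$-homomorphism $\alpha:\mathcal{M}_1\to\mathcal{M}_2$ of von Neumann algebras and every $\phi\in\mathcal{N}\mathrm{or}(\mathcal{M}_2,\mathcal{N}_* )$. The corners are the morphisms $\alpha_p:\mathbb{C}\to M_n(\mathbb{C})$, $\alpha_p(\lambda)=\lambda p$, where $n\in\mathbb{N}$ and $p\in M_n(\mathbb{C})$ is a projection. Compatibility of an assignment with the corners means that the displayed naturality identity holds for every $\alpha=\alpha_p$; matching complete positivity with positivity means that $\phi$ is completely positive if and only if the functional assigned to it is positive.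
   Formalization: In the second sentence the assignments are additionally required to be onto: every normal functional on the tensor product must be assigned to some φ. Without this the claim fails for some factors of Connes' type, such as certain free products N containing a copy of the opposite algebra. *)

theory Defs
  imports "HOL-Analysis.Analysis" "HOL-Library.Function_Algebras"
begin

text \<open>
  Every complex Hilbert space has an orthonormal basis, so Hilbert spaces are taken in the form
  \<open>\<ell>\<^sup>2(I)\<close> for an index set \<open>I\<close>.  All objects are total functions which are \<open>0\<close> outside their
  domain (vectors outside \<open>I\<close>, operators outside \<open>\<ell>\<^sup>2(I)\<close>, functionals and maps outside the algebra),
  so that they are determined by their values on the domain and the pointwise operations of
  \<open>Function_Algebras\<close> are the vector space operations.
\<close>

type_synonym 'i vec = "'i \<Rightarrow> complex"
type_synonym 'i opr = "'i vec \<Rightarrow> 'i vec"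

definition smul1 :: "complex \<Rightarrow> ('a \<Rightarrow> complex) \<Rightarrow> 'a \<Rightarrow> complex" where
  "smul1 c f = (\<lambda>i. c * f i)"

definition smul2 :: "complex \<Rightarrow> ('a \<Rightarrow> 'b \<Rightarrow> complex) \<Rightarrow> 'a \<Rightarrow> 'b \<Rightarrow> complex" where
  "smul2 c x = (\<lambda>f i. c * x f i)"

text \<open>Complex linearity on \<open>S\<close>, where \<open>sA\<close> and \<open>sB\<close> are the scalar multiplications of the domain and
  of the codomain.\<close>

definition linear_on ::
  "'a set \<Rightarrow> (complex \<Rightarrow> 'a \<Rightarrow> 'a) \<Rightarrow> (complex \<Rightarrow> 'b \<Rightarrow> 'b) \<Rightarrow> ('a::plus \<Rightarrow> 'b::plus) \<Rightarrow> bool" where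
  "linear_on S sA sB f \<longleftrightarrow>
     (\<forall>x\<in>S. \<forall>y\<in>S. f (x + y) = f x + f y) \<and> (\<forall>c. \<forall>x\<in>S. f (sA c x) = sB c (f x))"


subsection \<open>Hilbert spaces and bounded operators\<close>

definition l2 :: "'i set \<Rightarrow> 'i vec set" where
  "l2 I = {f. (\<forall>i. i \<notin> I \<longrightarrow> f i = 0) \<and> (\<lambda>i. (cmod (f i))\<^sup>2) summable_on UNIV}"

definition inner2 :: "'i vec \<Rightarrow> 'i vec \<Rightarrow> complex" where
  "inner2 f g = (\<Sum>\<^sub>\<infinity>i. f i * cnj (g i))"

definition norm2 :: "'i vec \<Rightarrow> real" where
  "norm2 f = sqrt (\<Sum>\<^sub>\<infinity>i. (cmod (f i))\<^sup>2)"

definition bounded_ops :: "'i set \<Rightarrow> 'i opr set" where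
  "bounded_ops I = {x. (\<forall>f. f \<notin> l2 I \<longrightarrow> x f = 0) \<and> (\<forall>f\<in>l2 I. x f \<in> l2 I) \<and>
     linear_on (l2 I) smul1 smul1 x \<and> (\<exists>C. \<forall>f\<in>l2 I. norm2 (x f) \<le> C * norm2 f)}"

definition id_op :: "'i set \<Rightarrow> 'i opr" where
  "id_op I = (\<lambda>f. if f \<in> l2 I then f else 0)"

definition op_norm :: "'i set \<Rightarrow> 'i opr \<Rightarrow> real" where
  "op_norm I x = (SUP f\<in>{f \<in> l2 I. norm2 f \<le> 1}. norm2 (x f))"

definition adj :: "'i set \<Rightarrow> 'i opr \<Rightarrow> 'i opr" where
  "adj I x = (THE y. y \<in> bounded_ops I \<and>
     (\<forall>f\<in>l2 I. \<forall>g\<in>l2 I. inner2 (x f) g = inner2 f (y g)))"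

definition positive_op :: "'i set \<Rightarrow> 'i opr \<Rightarrow> bool" where
  "positive_op I x \<longleftrightarrow> x \<in> bounded_ops I \<and> (\<forall>f\<in>l2 I. inner2 (x f) f \<in> \<real>\<^sub>\<ge>\<^sub>0)"

definition projection :: "'i set \<Rightarrow> 'i opr \<Rightarrow> bool" where
  "projection I p \<longleftrightarrow> p \<in> bounded_ops I \<and> p \<circ> p = p \<and> adj I p = p"


subsection \<open>Von Neumann algebras, normal maps and preduals\<close>

datatype 'i opalg = OpAlg (index: "'i set") (elems: "'i opr set")

definition commutant :: "'i set \<Rightarrow> 'i opr set \<Rightarrow> 'i opr set" where
  "commutant I S = {t \<in> bounded_ops I. \<forall>x\<in>S. t \<circ> x = x \<circ> t}"

definition von_neumann_algebra :: "'i opalg \<Rightarrow> bool" where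
  "von_neumann_algebra A \<longleftrightarrow> elems A \<subseteq> bounded_ops (index A) \<and>
     (\<forall>x\<in>elems A. adj (index A) x \<in> elems A) \<and>
     commutant (index A) (commutant (index A) (elems A)) = elems A"

definition is_factor :: "'i opalg \<Rightarrow> bool" where
  "is_factor A \<longleftrightarrow> von_neumann_algebra A \<and>
     elems A \<inter> commutant (index A) (elems A) = range (\<lambda>c. smul2 c (id_op (index A)))"

definition ultraweak :: "'i opalg \<Rightarrow> 'i opr topology" where
  "ultraweak A = topology_generated_by
     {{x \<in> elems A. (\<Sum>k. inner2 (x (\<xi> k)) (\<eta> k)) \<in> U} | (\<xi> :: nat \<Rightarrow> 'i vec) \<eta> U.
        range \<xi> \<subseteq> l2 (index A) \<and> range \<eta> \<subseteq> l2 (index A) \<and>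
        summable (\<lambda>k. (norm2 (\<xi> k))\<^sup>2) \<and> summable (\<lambda>k. (norm2 (\<eta> k))\<^sup>2) \<and> open U}"

text \<open>Normal means ultraweakly continuous; in particular \<open>\<alpha>\<close> maps \<open>elems A\<close> into \<open>elems B\<close>.\<close>

definition normal_map :: "'i opalg \<Rightarrow> 'j opalg \<Rightarrow> ('i opr \<Rightarrow> 'j opr) \<Rightarrow> bool" where
  "normal_map A B \<alpha> \<longleftrightarrow>
     linear_on (elems A) smul2 smul2 \<alpha> \<and> continuous_map (ultraweak A) (ultraweak B) \<alpha>"

definition normal_star_hom :: "'i opalg \<Rightarrow> 'j opalg \<Rightarrow> ('i opr \<Rightarrow> 'j opr) \<Rightarrow> bool" where
  "normal_star_hom A B \<alpha> \<longleftrightarrow> normal_map A B \<alpha> \<and>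
     (\<forall>x\<in>elems A. \<alpha> (adj (index A) x) = adj (index B) (\<alpha> x)) \<and>
     (\<forall>x\<in>elems A. \<forall>y\<in>elems A. \<alpha> (x \<circ> y) = \<alpha> x \<circ> \<alpha> y)"

definition anti_isomorphic_to_itself :: "'i opalg \<Rightarrow> bool" where
  "anti_isomorphic_to_itself A \<longleftrightarrow> (\<exists>\<alpha>. normal_map A A \<alpha> \<and> bij_betw \<alpha> (elems A) (elems A) \<and>
     (\<forall>x\<in>elems A. \<alpha> (adj (index A) x) = adj (index A) (\<alpha> x)) \<and>
     (\<forall>x\<in>elems A. \<forall>y\<in>elems A. \<alpha> (x \<circ> y) = \<alpha> y \<circ> \<alpha> x))"

definition predual :: "'i opalg \<Rightarrow> ('i opr \<Rightarrow> complex) set" where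
  "predual A = {\<omega>. (\<forall>x. x \<notin> elems A \<longrightarrow> \<omega> x = 0) \<and> linear_on (elems A) smul2 (*) \<omega> \<and>
     continuous_map (ultraweak A) euclidean \<omega>}"

definition predual_pos :: "'i opalg \<Rightarrow> ('i opr \<Rightarrow> complex) set" where
  "predual_pos A = {\<omega> \<in> predual A. \<forall>x\<in>elems A. positive_op (index A) x \<longrightarrow> \<omega> x \<in> \<real>\<^sub>\<ge>\<^sub>0}"

definition predual_norm :: "'i opalg \<Rightarrow> ('i opr \<Rightarrow> complex) \<Rightarrow> real" where
  "predual_norm A \<omega> = (SUP x\<in>{x \<in> elems A. op_norm (index A) x \<le> 1}. cmod (\<omega> x))"

text \<open>Composition of a map on \<open>elems B\<close> with \<open>\<alpha> : elems A \<rightarrow> elems B\<close>, put to \<open>0\<close> outside \<open>elems A\<close>.\<close>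

definition comp_on :: "'i opalg \<Rightarrow> ('j opr \<Rightarrow> 'r::zero) \<Rightarrow> ('i opr \<Rightarrow> 'j opr) \<Rightarrow> 'i opr \<Rightarrow> 'r" where
  "comp_on A \<phi> \<alpha> = (\<lambda>x. if x \<in> elems A then \<phi> (\<alpha> x) else 0)"


subsection \<open>Tensor products\<close>

text \<open>\<open>x \<otimes> y\<close> on \<open>\<ell>\<^sup>2(I) \<otimes> \<ell>\<^sup>2(J) = \<ell>\<^sup>2(I \<times> J)\<close>: apply \<open>y\<close> in the second coordinate, then \<open>x\<close> in the
  first.\<close>

definition tensor_op :: "'i set \<Rightarrow> 'j set \<Rightarrow> 'i opr \<Rightarrow> 'j opr \<Rightarrow> ('i \<times> 'j) opr" where
  "tensor_op I J x y = (\<lambda>\<zeta>. if \<zeta> \<in> l2 (I \<times> J)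
     then (\<lambda>(i, j). x (\<lambda>i'. y (\<lambda>j'. \<zeta> (i', j')) j) i) else 0)"

definition vn_tensor :: "'i opalg \<Rightarrow> 'j opalg \<Rightarrow> ('i \<times> 'j) opalg" where
  "vn_tensor A B = (let K = index A \<times> index B in
     OpAlg K (commutant K (commutant K
       {tensor_op (index A) (index B) x y | x y. x \<in> elems A \<and> y \<in> elems B})))"

text \<open>\<open>\<alpha> \<otimes> id\<close> is the normal linear extension of \<open>x \<otimes> y \<mapsto> \<alpha>(x) \<otimes> y\<close>.\<close>

definition tensor_id ::
  "'i opalg \<Rightarrow> 'j opalg \<Rightarrow> 'k opalg \<Rightarrow> ('i opr \<Rightarrow> 'j opr) \<Rightarrow> ('i \<times> 'k) opr \<Rightarrow> ('j \<times> 'k) opr" where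
  "tensor_id A1 A2 B \<alpha> = (THE \<Theta>. (\<forall>z. z \<notin> elems (vn_tensor A1 B) \<longrightarrow> \<Theta> z = 0) \<and>
     normal_map (vn_tensor A1 B) (vn_tensor A2 B) \<Theta> \<and>
     (\<forall>x\<in>elems A1. \<forall>y\<in>elems B. \<Theta> (tensor_op (index A1) (index B) x y)
        = tensor_op (index A2) (index B) (\<alpha> x) y))"


subsection \<open>Matrices over a von Neumann algebra and its predual\<close>

text \<open>Elements of \<open>M\<^sub>n(A)\<close> are operators on the direct sum of \<open>n\<close> copies of \<open>\<ell>\<^sup>2(I)\<close>, which is
  \<open>\<ell>\<^sup>2({..<n} \<times> I)\<close>.\<close>

definition entry :: "nat \<Rightarrow> nat \<Rightarrow> (nat \<times> 'i) opr \<Rightarrow> 'i opr" where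
  "entry i j X = (\<lambda>\<xi> a. X (\<lambda>(k, b). if k = j then \<xi> b else 0) (i, a))"

definition mat_alg :: "nat \<Rightarrow> 'i opalg \<Rightarrow> (nat \<times> 'i) opalg" where
  "mat_alg n A = OpAlg ({..<n} \<times> index A)
     {X \<in> bounded_ops ({..<n} \<times> index A). \<forall>i<n. \<forall>j<n. entry i j X \<in> elems A}"

text \<open>The matrix order: \<open>[\<psi>\<^sub>i\<^sub>j]\<close> acts on \<open>M\<^sub>n(B)\<close> by \<open>[b\<^sub>i\<^sub>j] \<mapsto> \<Sum> \<psi>\<^sub>i\<^sub>j(b\<^sub>j\<^sub>i)\<close>.\<close>

definition trace_pairing ::
  "nat \<Rightarrow> 'i opalg \<Rightarrow> (nat \<Rightarrow> nat \<Rightarrow> 'i opr \<Rightarrow> complex) \<Rightarrow> (nat \<times> 'i) opr \<Rightarrow> complex" where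
  "trace_pairing n B \<psi> = (\<lambda>Y. if Y \<in> elems (mat_alg n B)
     then (\<Sum>i<n. \<Sum>j<n. \<psi> i j (entry j i Y)) else 0)"

definition completely_positive ::
  "'i opalg \<Rightarrow> 'j opalg \<Rightarrow> ('i opr \<Rightarrow> 'j opr \<Rightarrow> complex) \<Rightarrow> bool" where
  "completely_positive A B \<phi> \<longleftrightarrow> (\<forall>n. \<forall>X\<in>elems (mat_alg n A). positive_op (index (mat_alg n A)) X \<longrightarrow>
     trace_pairing n B (\<lambda>i j. \<phi> (entry i j X)) \<in> predual_pos (mat_alg n B))"

definition matrix_norm :: "'k set \<Rightarrow> ('k \<Rightarrow> 'k \<Rightarrow> complex) \<Rightarrow> real" where
  "matrix_norm K a = op_norm K (\<lambda>f r. if r \<in> K then (\<Sum>s\<in>K. a r s * f s) else 0)"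

text \<open>The operator space structure of \<open>A\<^sub>*\<close>: the norm of \<open>[\<psi>\<^sub>i\<^sub>j] \<in> M\<^sub>n(A\<^sub>*)\<close> is the cb-norm of the map
  \<open>x \<mapsto> [\<psi>\<^sub>i\<^sub>j(x)]\<close> from \<open>A\<close> to \<open>M\<^sub>n(\<complex>)\<close>.\<close>

definition predual_matrix_norm ::
  "'i opalg \<Rightarrow> nat \<Rightarrow> (nat \<Rightarrow> nat \<Rightarrow> 'i opr \<Rightarrow> complex) \<Rightarrow> real" where
  "predual_matrix_norm A n \<psi> =
     Sup {matrix_norm ({..<n} \<times> {..<m}) (\<lambda>(i, k) (j, l). \<psi> i j (entry k l Y)) | m Y.
            Y \<in> elems (mat_alg m A) \<and> op_norm (index (mat_alg m A)) Y \<le> 1}"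


subsection \<open>Completely bounded maps from \<open>A\<close> to \<open>B\<^sub>*\<close> and the space \<open>Nor(A, B\<^sub>*)\<close>\<close>

definition cb_values ::
  "'i opalg \<Rightarrow> 'j opalg \<Rightarrow> ('i opr \<Rightarrow> 'j opr \<Rightarrow> complex) \<Rightarrow> real set" where
  "cb_values A B \<phi> = {predual_matrix_norm B n (\<lambda>i j. \<phi> (entry i j X)) | n X.
     X \<in> elems (mat_alg n A) \<and> op_norm (index (mat_alg n A)) X \<le> 1}"

definition cb_norm :: "'i opalg \<Rightarrow> 'j opalg \<Rightarrow> ('i opr \<Rightarrow> 'j opr \<Rightarrow> complex) \<Rightarrow> real" where
  "cb_norm A B \<phi> = Sup (cb_values A B \<phi>)"

definition CB :: "'i opalg \<Rightarrow> 'j opalg \<Rightarrow> ('i opr \<Rightarrow> 'j opr \<Rightarrow> complex) set" where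
  "CB A B = {\<phi>. (\<forall>x. x \<notin> elems A \<longrightarrow> \<phi> x = 0) \<and> (\<forall>x\<in>elems A. \<phi> x \<in> predual B) \<and>
     linear_on (elems A) smul2 smul1 \<phi> \<and> bdd_above (cb_values A B \<phi>)}"

definition elem_tensor ::
  "('i opr \<Rightarrow> complex) \<Rightarrow> ('j opr \<Rightarrow> complex) \<Rightarrow> 'i opr \<Rightarrow> 'j opr \<Rightarrow> complex" where
  "elem_tensor \<mu> \<nu> = (\<lambda>x. smul1 (\<mu> x) \<nu>)"

text \<open>The algebraic tensor product \<open>A\<^sub>* \<odot> B\<^sub>*\<close> maps injectively into the linear maps \<open>A \<rightarrow> B\<^sub>*\<close> and is
  identified with its image there.\<close>

definition alg_tensor :: "'i opalg \<Rightarrow> 'j opalg \<Rightarrow> ('i opr \<Rightarrow> 'j opr \<Rightarrow> complex) set" where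
  "alg_tensor A B = {\<Sum>k<m. elem_tensor (\<mu> k) (\<nu> k) | (m :: nat) \<mu> \<nu>.
     (\<forall>k<m. \<mu> k \<in> predual A \<and> \<nu> k \<in> predual B)}"

text \<open>The operator space projective norm:
  \<open>\<parallel>u\<parallel>\<^sub>\<and> = inf \<parallel>a\<parallel> \<parallel>v\<parallel> \<parallel>w\<parallel> \<parallel>b\<parallel>\<close> over all factorizations \<open>u = a (v \<otimes> w) b\<close> with
  \<open>v \<in> M\<^sub>p(A\<^sub>*)\<close>, \<open>w \<in> M\<^sub>q(B\<^sub>*)\<close>, a row \<open>a\<close> and a column \<open>b\<close> of length \<open>p q\<close>.\<close>

definition proj_norm :: "'i opalg \<Rightarrow> 'j opalg \<Rightarrow> ('i opr \<Rightarrow> 'j opr \<Rightarrow> complex) \<Rightarrow> real" where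
  "proj_norm A B u =
     Inf {norm2 a * predual_matrix_norm A p v * predual_matrix_norm B q w * norm2 b | p q a b v w.
       a \<in> l2 ({..<p} \<times> {..<q}) \<and> b \<in> l2 ({..<p} \<times> {..<q}) \<and>
       (\<forall>i<p. \<forall>k<p. v i k \<in> predual A) \<and> (\<forall>j<q. \<forall>l<q. w j l \<in> predual B) \<and>
       u = (\<Sum>i<p. \<Sum>j<q. \<Sum>k<p. \<Sum>l<q. smul2 (a (i, j) * b (k, l)) (elem_tensor (v i k) (w j l)))}"

text \<open>An element of the completed tensor product is given by a sequence in the algebraic tensor
  product that is Cauchy for the projective norm, and its image in \<open>CB(A, B\<^sub>*)\<close> is the cb-norm limit
  of that sequence.\<close>

definition Nor :: "'i opalg \<Rightarrow> 'j opalg \<Rightarrow> ('i opr \<Rightarrow> 'j opr \<Rightarrow> complex) set" where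
  "Nor A B = {\<phi> \<in> CB A B. \<exists>u :: nat \<Rightarrow> _. (\<forall>k. u k \<in> alg_tensor A B) \<and>
     (\<forall>\<epsilon>>0. \<exists>K. \<forall>k\<ge>K. \<forall>l\<ge>K. proj_norm A B (u k - u l) < \<epsilon>) \<and>
     (\<lambda>k. cb_norm A B (u k - \<phi>)) \<longlonglongrightarrow> 0}"


subsection \<open>Choi--Jamiolkowski type isomorphisms\<close>

definition Nor_topology :: "'i opalg \<Rightarrow> 'j opalg \<Rightarrow> ('i opr \<Rightarrow> 'j opr \<Rightarrow> complex) topology" where
  "Nor_topology A B = Metric_space.mtopology (Nor A B)
     (\<lambda>\<phi> \<psi>. if \<phi> \<in> Nor A B \<and> \<psi> \<in> Nor A B then cb_norm A B (\<phi> - \<psi>) else 0)"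

definition predual_topology :: "'i opalg \<Rightarrow> ('i opr \<Rightarrow> complex) topology" where
  "predual_topology A = Metric_space.mtopology (predual A)
     (\<lambda>\<omega> \<rho>. if \<omega> \<in> predual A \<and> \<rho> \<in> predual A then predual_norm A (\<omega> - \<rho>) else 0)"

definition matches_positivity :: "'i opalg \<Rightarrow> 'j opalg \<Rightarrow>
    (('i opr \<Rightarrow> 'j opr \<Rightarrow> complex) \<Rightarrow> ('i \<times> 'j) opr \<Rightarrow> complex) \<Rightarrow> bool" where
  "matches_positivity A N J \<longleftrightarrow>
     (\<forall>\<phi>\<in>Nor A N. completely_positive A N \<phi> \<longleftrightarrow> J \<phi> \<in> predual_pos (vn_tensor A N))"

definition cj_isomorphism :: "'i opalg \<Rightarrow> 'j opalg \<Rightarrow>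
    (('i opr \<Rightarrow> 'j opr \<Rightarrow> complex) \<Rightarrow> ('i \<times> 'j) opr \<Rightarrow> complex) \<Rightarrow> bool" where
  "cj_isomorphism A N J \<longleftrightarrow> linear_on (Nor A N) smul2 smul1 J \<and>
     homeomorphic_map (Nor_topology A N) (predual_topology (vn_tensor A N)) J \<and>
     matches_positivity A N J"

text \<open>The identity \<open>J\<^bsub>A1\<^esub>(\<phi> \<circ> \<alpha>) = J\<^bsub>A2\<^esub>(\<phi>) \<circ> (\<alpha> \<otimes> id)\<close>.\<close>

definition natural_at :: "'j opalg \<Rightarrow>
    ('u opalg \<Rightarrow> ('u opr \<Rightarrow> 'j opr \<Rightarrow> complex) \<Rightarrow> ('u \<times> 'j) opr \<Rightarrow> complex) \<Rightarrow>
    'u opalg \<Rightarrow> 'u opalg \<Rightarrow> ('u opr \<Rightarrow> 'u opr) \<Rightarrow> bool" where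
  "natural_at N J A1 A2 \<alpha> \<longleftrightarrow> (\<forall>\<phi>\<in>Nor A2 N.
     J A1 (comp_on A1 \<phi> \<alpha>) = comp_on (vn_tensor A1 N) (J A2 \<phi>) (tensor_id A1 A2 N \<alpha>))"

text \<open>The type \<open>'u\<close> is the universe from which the index sets of the Hilbert spaces of the varying
  algebras are taken.\<close>

definition natural_cj_isomorphism :: "'j opalg \<Rightarrow>
    ('u opalg \<Rightarrow> ('u opr \<Rightarrow> 'j opr \<Rightarrow> complex) \<Rightarrow> ('u \<times> 'j) opr \<Rightarrow> complex) \<Rightarrow> bool" where
  "natural_cj_isomorphism N J \<longleftrightarrow>
     (\<forall>A. von_neumann_algebra A \<longrightarrow> cj_isomorphism A N (J A)) \<and>
     (\<forall>A1 A2 \<alpha>. von_neumann_algebra A1 \<and> von_neumann_algebra A2 \<and> normal_star_hom A1 A2 \<alpha> \<longrightarrow>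
        natural_at N J A1 A2 \<alpha>)"


subsection \<open>Corners\<close>

text \<open>An injection \<open>e\<close> of the natural numbers into the universe provides the bases
  \<open>e 0, \<dots>, e (n - 1)\<close> on which \<open>M\<^sub>n(\<complex>)\<close> acts; in particular \<open>\<complex> = M\<^sub>1(\<complex>)\<close>.\<close>

definition Mat :: "(nat \<Rightarrow> 'u) \<Rightarrow> nat \<Rightarrow> 'u opalg" where
  "Mat e n = OpAlg (e ` {..<n}) (bounded_ops (e ` {..<n}))"

text \<open>The map \<open>\<lambda> \<mapsto> \<lambda> p\<close>, where \<open>\<lambda>\<close> is recovered as the only matrix entry of \<open>x \<in> M\<^sub>1(\<complex>)\<close>.\<close>

definition corner :: "(nat \<Rightarrow> 'u) \<Rightarrow> 'u opr \<Rightarrow> 'u opr \<Rightarrow> 'u opr" where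
  "corner e p = (\<lambda>x. smul2 (x (\<lambda>i. if i = e 0 then 1 else 0) (e 0)) p)"

definition compatible_with_corners :: "(nat \<Rightarrow> 'u) \<Rightarrow> 'j opalg \<Rightarrow>
    ('u opalg \<Rightarrow> ('u opr \<Rightarrow> 'j opr \<Rightarrow> complex) \<Rightarrow> ('u \<times> 'j) opr \<Rightarrow> complex) \<Rightarrow> bool" where
  "compatible_with_corners e N J \<longleftrightarrow> (\<forall>n\<ge>1. \<forall>p. projection (index (Mat e n)) p \<longrightarrow>
     natural_at N J (Mat e 1) (Mat e n) (corner e p))"

text \<open>An assignment of normal functionals need be neither linear nor continuous, but every normal
  functional has to be assigned to some \<open>\<phi>\<close>.  This last requirement cannot be dropped: a normal
  conditional expectation of \<open>N\<close> onto a copy of its opposite algebra yields an assignment that is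
  compatible with the corners and matches positivity without being onto.\<close>

definition onto_normal_functionals :: "'i opalg \<Rightarrow> 'j opalg \<Rightarrow>
    (('i opr \<Rightarrow> 'j opr \<Rightarrow> complex) \<Rightarrow> ('i \<times> 'j) opr \<Rightarrow> complex) \<Rightarrow> bool" where
  "onto_normal_functionals A N J \<longleftrightarrow> J ` Nor A N = predual (vn_tensor A N)"

end

theory Submission
  imports Defs
begin

text \<open>
  For \<open>M = \<complex>\<close> an assignment is a map \<open>\<theta>\<close> of \<open>N\<^sub>*\<close> that preserves and reflects positivity and is onto, and
  \<open>R\<close> denotes its adjoint on \<open>N\<close>.  Compatibility with the corners of rank one projections in
  \<open>M\<^sub>2(\<complex>)\<close> makes \<open>\<theta>\<close> additive and forces the functional assigned to \<open>\<phi> : M\<^sub>2(\<complex>) \<rightarrow> N\<^sub>*\<close> to be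
  \<open>e\<^sub>i\<^sub>j \<otimes> y \<mapsto> \<theta>(\<phi>(e\<^sub>i\<^sub>j))(y)\<close>.  The maps \<open>\<phi>(e\<^sub>i\<^sub>j) = \<langle>\<sqdot> f\<^sub>i, f\<^sub>j\<rangle>\<close> are completely positive, because the trace
  pairing transposes; evaluating the assigned functional at \<open>[x\<^sub>i\<^sup>* x\<^sub>j]\<close> shows that \<open>R\<close> is two-positive as a
  map from \<open>N\<close> to its opposite algebra, and the same argument run backwards applies to the inverse of \<open>R\<close>.
  After normalising by \<open>R(1)\<close> the Schwarz inequalities for \<open>R\<close> and for its inverse are equalities, so that
  \<open>R\<close> becomes an anti-automorphism.
\<close>

text \<open>Corner compatibility gives no linearity or continuity of the assignment, and this shapes
  the proof. Homogeneity of \<theta> is extracted from positivity, for nonnegative real scalars on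
  the positive cone, and \<open>T\<close> is the complex linear extension from there. Boundedness of
  the form defining \<open>R\<close> needs a gliding hump, and normality of \<open>R\<close> a tail
  estimate with growing weights. The formula for \<open>e\<^sub>i\<^sub>j\<close> is proved for
  completely positive \<phi>: these send every rank one projection into the cone, where
  \<open>T\<close> and \<theta> agree, and polarization reaches the off-diagonal units. The order is
  reversed because the matrix order pairs the entry (i, j) with (j, i), whereas the functional on
  the tensor product is evaluated at \<open>e\<^sub>i\<^sub>j\<close> \<otimes> y without
  transposition. For the inverse of \<open>R\<close>, being onto is used at
  \<open>M\<^sub>2\<close>: a vector functional on the tensor product is assigned to some \<phi>.
  Finally R(1) is invertible: an upper bound M for the image of 1 under the inverse gives 1 \<le> M
  R(1). Conjugation by the inverse of its square root makes the map unital.\<close>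

text \<open>At function types of order two the simplifier eta-expands the results of the generic rules
  such as \<open>plus_fun_apply\<close>, so these are replaced by instances.\<close>

declare plus_fun_apply [simp del] zero_fun_apply [simp del] minus_apply [simp del] uminus_apply [simp del]

lemma fun_apply1 [simp]:
  fixes f g :: "'a \<Rightarrow> complex"
  shows "(f + g) i = f i + g i" "(f - g) i = f i - g i" "(- f) i = - f i" "0 i = (0 :: complex)"
  by (simp_all add: plus_fun_def fun_diff_def fun_Compl_def zero_fun_def)

lemma fun_apply2 [simp]:
  fixes f g :: "'a \<Rightarrow> 'b \<Rightarrow> complex"
  shows "(f + g) i = f i + g i" "(f - g) i = f i - g i" "(- f) i = - f i" "0 i = (0 :: 'b \<Rightarrow> complex)"
  by (simp_all add: plus_fun_def fun_diff_def fun_Compl_def zero_fun_def)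

section \<open>Scalar multiples of functions\<close>

lemma smul1_apply [simp]: "smul1 c f i = c * f i"
  by (simp add: smul1_def)

lemma smul2_apply [simp]: "smul2 c x f = smul1 c (x f)"
  by (simp add: smul2_def smul1_def)

lemma smul1_simps [simp]: "smul1 c 0 = 0" "smul1 0 f = 0" "smul1 1 f = f"
    "smul1 a (smul1 b f) = smul1 (a * b) f"
  by (auto simp: fun_eq_iff)

lemma smul2_simps [simp]: "smul2 c 0 = 0" "smul2 0 x = 0" "smul2 1 x = x"
    "smul2 a (smul2 b x) = smul2 (a * b) x"
  by (auto simp: fun_eq_iff)

lemma smul1_add: "smul1 c (f + g) = smul1 c f + smul1 c g"
  by (auto simp: fun_eq_iff algebra_simps)

lemma smul1_add_left: "smul1 (a + b) f = smul1 a f + smul1 b f"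
  by (auto simp: fun_eq_iff algebra_simps)

lemma uminus_smul1: "- f = smul1 (-1) f"
  by (auto simp: fun_eq_iff)

lemma smul2_add: "smul2 c (x + y) = smul2 c x + smul2 c y"
  by (auto simp: fun_eq_iff algebra_simps)

lemma uminus_smul2: "- x = smul2 (-1) x"
  by (auto simp: fun_eq_iff)

section \<open>Square summable functions: inner product, norm and finite truncations\<close>

lemma l2_I: "(\<And>i. i \<notin> I \<Longrightarrow> f i = 0) \<Longrightarrow> (\<lambda>i. (cmod (f i))\<^sup>2) summable_on UNIV \<Longrightarrow> f \<in> l2 I"
  by (simp add: l2_def)

lemma l2_zeroD: "f \<in> l2 I \<Longrightarrow> i \<notin> I \<Longrightarrow> f i = 0"
  by (simp add: l2_def)

lemma l2_summable: "f \<in> l2 I \<Longrightarrow> (\<lambda>i. (cmod (f i))\<^sup>2) summable_on UNIV"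
  by (simp add: l2_def)

lemma l2_zero [simp, intro]: "0 \<in> l2 I"
  by (simp add: l2_def)

lemma l2_smul1 [simp, intro]: "f \<in> l2 I \<Longrightarrow> smul1 c f \<in> l2 I"
  by (simp add: l2_def norm_mult power_mult_distrib summable_on_cmult_right)

lemma sum_squares_bound: "(cmod (a + b))\<^sup>2 \<le> 2 * (cmod a)\<^sup>2 + 2 * (cmod b)\<^sup>2"
proof -
  have "(cmod (a + b))\<^sup>2 \<le> (cmod a + cmod b)\<^sup>2"
    by (simp add: norm_triangle_ineq)
  also have "\<dots> \<le> 2 * (cmod a)\<^sup>2 + 2 * (cmod b)\<^sup>2"
    using zero_le_power2[of "cmod a - cmod b"] by (simp add: power2_eq_square algebra_simps)
  finally show ?thesis .
qed

lemma l2_add [simp, intro]: assumes "f \<in> l2 I" "g \<in> l2 I" shows "f + g \<in> l2 I"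
proof (rule l2_I)
  have s: "(\<lambda>i. 2 * (cmod (f i))\<^sup>2 + 2 * (cmod (g i))\<^sup>2) summable_on UNIV"
    using assms by (intro summable_on_add summable_on_cmult_right l2_summable)
  show "(\<lambda>i. (cmod ((f + g) i))\<^sup>2) summable_on UNIV"
    by (rule summable_on_comparison_test[OF s]) (auto intro: sum_squares_bound)
qed (use assms in \<open>auto simp: l2_def\<close>)

lemma l2_uminus [simp, intro]: "f \<in> l2 I \<Longrightarrow> - f \<in> l2 I"
  unfolding uminus_smul1 by (rule l2_smul1)

lemma l2_diff [simp, intro]: "f \<in> l2 I \<Longrightarrow> g \<in> l2 I \<Longrightarrow> f - g \<in> l2 I"
  unfolding diff_conv_add_uminus by (intro l2_add l2_uminus)

lemma l2_sum [intro]: "(\<And>a. a \<in> S \<Longrightarrow> f a \<in> l2 I) \<Longrightarrow> sum f S \<in> l2 I"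
  by (induction S rule: infinite_finite_induct) auto

lemma l2_finite: assumes "finite F" "F \<subseteq> I" "\<And>i. i \<notin> F \<Longrightarrow> f i = 0" shows "f \<in> l2 I"
proof (rule l2_I)
  show "(\<lambda>i. (cmod (f i))\<^sup>2) summable_on UNIV"
    by (rule has_sum_imp_summable, rule has_sum_finite_neutralI[of F]) (use assms in auto)
qed (use assms in auto)

lemma l2_mult_abs_summable:
  assumes "f \<in> l2 I" "g \<in> l2 I" shows "(\<lambda>i. norm (f i * cnj (g i))) summable_on UNIV"
proof -
  have s: "(\<lambda>i. (cmod (f i))\<^sup>2 + (cmod (g i))\<^sup>2) summable_on UNIV"
    using assms by (intro summable_on_add l2_summable)
  show ?thesis
  proof (rule summable_on_comparison_test[OF s])
    fix i
    have "2 * (cmod (f i) * cmod (g i)) \<le> (cmod (f i))\<^sup>2 + (cmod (g i))\<^sup>2"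
      using zero_le_power2[of "cmod (f i) - cmod (g i)"] by (simp add: power2_eq_square algebra_simps)
    moreover have "0 \<le> cmod (f i) * cmod (g i)" by simp
    ultimately show "norm (f i * cnj (g i)) \<le> (cmod (f i))\<^sup>2 + (cmod (g i))\<^sup>2"
      by (simp only: norm_mult complex_mod_cnj)
  qed auto
qed

lemma l2_mult_summable:
  "f \<in> l2 I \<Longrightarrow> g \<in> l2 I \<Longrightarrow> (\<lambda>i. f i * cnj (g i)) summable_on UNIV"
  by (rule abs_summable_summable, rule l2_mult_abs_summable)

lemma inner2_add_left:
  "f \<in> l2 I \<Longrightarrow> g \<in> l2 I \<Longrightarrow> h \<in> l2 I \<Longrightarrow> inner2 (f + g) h = inner2 f h + inner2 g h"
  unfolding inner2_def plus_fun_apply distrib_right by (intro infsum_add l2_mult_summable)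

lemma inner2_smul_left: "inner2 (smul1 c f) h = c * inner2 f h"
  unfolding inner2_def by (simp add: mult.assoc infsum_cmult_right')

lemma inner2_cnj: "cnj (inner2 f g) = inner2 g f"
  unfolding inner2_def by (simp flip: infsum_cnj add: mult.commute)

lemma inner2_add_right:
  "f \<in> l2 I \<Longrightarrow> g \<in> l2 I \<Longrightarrow> h \<in> l2 I \<Longrightarrow> inner2 h (f + g) = inner2 h f + inner2 h g"
  by (metis complex_cnj_add inner2_add_left inner2_cnj)

lemma inner2_smul_right: "inner2 h (smul1 c f) = cnj c * inner2 h f"
  by (metis complex_cnj_mult inner2_smul_left inner2_cnj)

lemma inner2_zero [simp]: "inner2 0 h = 0" "inner2 h 0 = 0"
  by (simp_all add: inner2_def)

lemma inner2_uminus: "inner2 (- f) h = - inner2 f h" "inner2 h (- f) = - inner2 h f"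
  unfolding uminus_smul1 by (simp_all add: inner2_smul_left inner2_smul_right)

lemma inner2_diff_left:
  "f \<in> l2 I \<Longrightarrow> g \<in> l2 I \<Longrightarrow> h \<in> l2 I \<Longrightarrow> inner2 (f - g) h = inner2 f h - inner2 g h"
  unfolding diff_conv_add_uminus inner2_uminus(1)[symmetric] by (intro inner2_add_left[where I=I] l2_uminus)

lemma inner2_diff_right:
  "f \<in> l2 I \<Longrightarrow> g \<in> l2 I \<Longrightarrow> h \<in> l2 I \<Longrightarrow> inner2 h (f - g) = inner2 h f - inner2 h g"
  unfolding diff_conv_add_uminus inner2_uminus(2)[symmetric] by (intro inner2_add_right[where I=I] l2_uminus)

lemmas inner2_simps = inner2_add_left inner2_add_right inner2_diff_left inner2_diff_right

lemmas inner2_scalar_simps = inner2_smul_left inner2_smul_right inner2_uminus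

lemma inner2_sum_left: assumes f: "\<And>a. a \<in> S \<Longrightarrow> f a \<in> l2 I" and h: "h \<in> l2 I"
  shows "inner2 (sum f S) h = (\<Sum>a\<in>S. inner2 (f a) h)"
proof (cases "finite S")
  case True
  have "finite T \<Longrightarrow> T \<subseteq> S \<Longrightarrow> inner2 (sum f T) h = (\<Sum>a\<in>T. inner2 (f a) h)" for T
  proof (induction T rule: finite_induct)
    case (insert a T)
    have "f a \<in> l2 I" "sum f T \<in> l2 I" 
      by (rule f, use insert.prems in blast) (rule l2_sum, rule f, use insert.prems in blast)
    then have "inner2 (f a + sum f T) h = inner2 (f a) h + inner2 (sum f T) h"
      using h by (rule inner2_add_left)
    also have "inner2 (sum f T) h = (\<Sum>a\<in>T. inner2 (f a) h)"
      using insert by blast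
    finally show ?case unfolding sum.insert[OF insert.hyps] .
  qed simp
  then show ?thesis using True by blast
qed simp

lemma inner2_sum_right: assumes "\<And>a. a \<in> S \<Longrightarrow> f a \<in> l2 I" "h \<in> l2 I"
  shows "inner2 h (sum f S) = (\<Sum>a\<in>S. inner2 h (f a))"
proof -
  have "cnj (inner2 (sum f S) h) = (\<Sum>a\<in>S. cnj (inner2 (f a) h))"
    by (subst inner2_sum_left[where I=I]) (use assms in \<open>auto simp: cnj_sum\<close>)
  then show ?thesis by (simp only: inner2_cnj)
qed

lemma norm2_nonneg [simp]: "0 \<le> norm2 f"
  unfolding norm2_def by (intro real_sqrt_ge_zero infsum_nonneg) simp

lemma norm2_square: "(norm2 f)\<^sup>2 = (\<Sum>\<^sub>\<infinity>i. (cmod (f i))\<^sup>2)"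
  unfolding norm2_def by (simp add: infsum_nonneg)

lemma inner2_self: "inner2 f f = complex_of_real ((norm2 f)\<^sup>2)"
proof -
  have "inner2 f f = (\<Sum>\<^sub>\<infinity>i. complex_of_real ((cmod (f i))\<^sup>2))"
    unfolding inner2_def by (simp add: complex_norm_square del: of_real_power)
  also have "\<dots> = complex_of_real (\<Sum>\<^sub>\<infinity>i. (cmod (f i))\<^sup>2)"
  proof (cases "(\<lambda>i. (cmod (f i))\<^sup>2) summable_on UNIV")
    case True
    then show ?thesis by (intro infsumI has_sum_of_real has_sum_infsum)
  next
    \<comment> \<open>Off l2 both infinite sums are 0 by convention; summability of the complex
      family would pass to its real part.\<close>
    case False
    moreover have "\<not> (\<lambda>i. complex_of_real ((cmod (f i))\<^sup>2)) summable_on UNIV"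
      using False summable_on_Re[of "\<lambda>i. complex_of_real ((cmod (f i))\<^sup>2)" UNIV]
      by (auto simp del: of_real_power)
    ultimately have "infsum (\<lambda>i. complex_of_real ((cmod (f i))\<^sup>2)) UNIV = 0"
      "infsum (\<lambda>i. (cmod (f i))\<^sup>2) UNIV = 0"
      by (auto intro!: infsum_not_exists simp del: of_real_power)
    then show ?thesis by (simp only: of_real_0)
  qed
  finally show ?thesis by (simp only: norm2_square)
qed

lemma norm2_smul: "norm2 (smul1 c f) = cmod c * norm2 f"
  unfolding norm2_def
  by (simp add: norm_mult power_mult_distrib infsum_cmult_right' real_sqrt_mult)

lemma norm2_zero [simp]: "norm2 0 = 0"
  by (simp add: norm2_def)

lemma norm2_uminus [simp]: "norm2 (- f) = norm2 f"
  unfolding uminus_smul1 by (simp add: norm2_smul)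

lemma norm2_coord: assumes "f \<in> l2 I" shows "cmod (f i) \<le> norm2 f"
proof -
  have "(\<Sum>i\<in>{i}. (cmod (f i))\<^sup>2) \<le> (\<Sum>\<^sub>\<infinity>i. (cmod (f i))\<^sup>2)"
    by (rule finite_sum_le_infsum) (use assms l2_summable in auto)
  then have "(cmod (f i))\<^sup>2 \<le> (norm2 f)\<^sup>2" by (simp add: norm2_square)
  then show ?thesis by (rule power2_le_imp_le) simp
qed

lemma norm2_eq_0: "f \<in> l2 I \<Longrightarrow> norm2 f = 0 \<longleftrightarrow> f = 0"
  using norm2_coord[of f I] by (metis ext norm2_zero norm_le_zero_iff zero_fun_apply)

text \<open>For \<open>d\<close> > 0 the scalar \<open>- cnj b / d\<close> minimises the expression,
  and its value there is the claim. The lemma is shared by the inner product and by the form of a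
  positive operator.\<close>

lemma cauchy_schwarz_discriminant:
  fixes a d :: real and b :: complex
  assumes "\<And>c. 0 \<le> a + 2 * Re (c * b) + (cmod c)\<^sup>2 * d" "0 \<le> a" "0 \<le> d"
  shows "(cmod b)\<^sup>2 \<le> a * d"
proof (cases "d = 0")
  case True
  have "b = 0"
  proof (rule ccontr)
    assume "b \<noteq> 0"
    \<comment> \<open>This \<open>t\<close> makes the linear term equal to \<open>- (a + 1)\<close>,
      so the expression would take the value - 1.\<close>
    define t where "t = (a + 1) / (2 * (cmod b)\<^sup>2)"
    have "0 \<le> a + 2 * Re ((- complex_of_real t * cnj b) * b)"
      using assms(1)[of "- complex_of_real t * cnj b"] True by simp
    also have "(- complex_of_real t * cnj b) * b = - complex_of_real (t * (cmod b)\<^sup>2)"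
      using complex_norm_square[of b] by (simp add: mult.commute mult.left_commute)
    finally have "2 * (t * (cmod b)\<^sup>2) \<le> a" by simp
    then show False using \<open>b \<noteq> 0\<close> by (simp add: t_def)
  qed
  then show ?thesis using True by simp
next
  case False
  then have d: "d > 0" using assms(3) by simp
  have "0 \<le> a + 2 * Re ((- cnj b / d) * b) + (cmod (- cnj b / d))\<^sup>2 * d"
    by (rule assms(1))
  also have "(- cnj b / d) * b = - complex_of_real ((cmod b)\<^sup>2 / d)"
    using complex_norm_square[of b] by (simp add: mult.commute)
  also have "(cmod (- cnj b / d))\<^sup>2 * d = (cmod b)\<^sup>2 / d"
    using d by (simp add: norm_divide power2_eq_square)
  finally show ?thesis using d by (simp add: field_simps)
qed

lemma norm2_add_square:
  assumes "f \<in> l2 I" "g \<in> l2 I"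
  shows "(norm2 (f + g))\<^sup>2 = (norm2 f)\<^sup>2 + 2 * Re (inner2 f g) + (norm2 g)\<^sup>2"
proof -
  have "complex_of_real ((norm2 (f + g))\<^sup>2) = inner2 f f + (inner2 f g + cnj (inner2 f g)) + inner2 g g"
    unfolding inner2_self[symmetric] inner2_cnj using assms
    by (simp add: inner2_simps[where I=I])
  also have "\<dots> = complex_of_real ((norm2 f)\<^sup>2 + 2 * Re (inner2 f g) + (norm2 g)\<^sup>2)"
    by (simp add: inner2_self complex_add_cnj)
  finally show ?thesis by (simp only: of_real_eq_iff)
qed

lemma inner2_cauchy_schwarz:
  assumes "f \<in> l2 I" "g \<in> l2 I" shows "cmod (inner2 f g) \<le> norm2 f * norm2 g"
proof -
  have "(cmod (cnj (inner2 f g)))\<^sup>2 \<le> (norm2 f)\<^sup>2 * (norm2 g)\<^sup>2"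
  proof (rule cauchy_schwarz_discriminant)
    fix c
    have "0 \<le> (norm2 (f + smul1 c g))\<^sup>2" by simp
    also have "\<dots> = (norm2 f)\<^sup>2 + 2 * Re (c * cnj (inner2 f g)) + (cmod c)\<^sup>2 * (norm2 g)\<^sup>2"
      using assms by (simp add: norm2_add_square[where I=I] inner2_smul_right norm2_smul power_mult_distrib)
    finally show "0 \<le> (norm2 f)\<^sup>2 + 2 * Re (c * cnj (inner2 f g)) + (cmod c)\<^sup>2 * (norm2 g)\<^sup>2" .
  qed auto
  then have "(cmod (inner2 f g))\<^sup>2 \<le> (norm2 f * norm2 g)\<^sup>2"
    by (simp add: power_mult_distrib)
  then show ?thesis by (rule power2_le_imp_le) simp
qed

lemma norm2_triangle:
  assumes "f \<in> l2 I" "g \<in> l2 I" shows "norm2 (f + g) \<le> norm2 f + norm2 g"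
proof -
  have "Re (inner2 f g) \<le> norm2 f * norm2 g"
    using inner2_cauchy_schwarz[OF assms] complex_Re_le_cmod order_trans by blast
  then have "(norm2 (f + g))\<^sup>2 \<le> (norm2 f + norm2 g)\<^sup>2"
    using assms by (simp add: norm2_add_square[where I=I] power2_sum)
  then show ?thesis by (rule power2_le_imp_le) simp
qed

lemma norm2_triangle_sum:
  "(\<And>a. a \<in> S \<Longrightarrow> f a \<in> l2 I) \<Longrightarrow> norm2 (sum f S) \<le> (\<Sum>a\<in>S. norm2 (f a))"
proof (induction S rule: infinite_finite_induct)
  case (insert a S)
  then have "norm2 (f a + sum f S) \<le> norm2 (f a) + norm2 (sum f S)"
    by (intro norm2_triangle[where I=I] l2_sum) auto
  also have "\<dots> \<le> norm2 (f a) + (\<Sum>a\<in>S. norm2 (f a))"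
    using insert by (intro add_left_mono) blast
  finally show ?case unfolding sum.insert[OF insert.hyps] .
qed auto

lemma l2_eqI: assumes "f \<in> l2 I" "g \<in> l2 I" "\<And>h. h \<in> l2 I \<Longrightarrow> inner2 f h = inner2 g h" shows "f = g"
proof -
  have "inner2 (f - g) (f - g) = 0"
    using assms by (simp add: inner2_diff_left[where I=I])
  then have "norm2 (f - g) = 0" unfolding inner2_self by simp
  then show ?thesis using norm2_eq_0[of "f - g" I] assms by auto
qed

definition basis2 :: "'i \<Rightarrow> 'i vec" where
  "basis2 i = (\<lambda>k. if k = i then 1 else 0)"

lemma basis2_l2 [simp, intro]: "i \<in> I \<Longrightarrow> basis2 i \<in> l2 I"
  by (rule l2_finite[of "{i}"]) (auto simp: basis2_def)

lemma inner2_basis2: "inner2 f (basis2 i) = f i"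
proof -
  have "((\<lambda>k. f k * cnj (basis2 i k)) has_sum f i) UNIV"
    by (rule has_sum_finite_neutralI[of "{i}"]) (auto simp: basis2_def)
  then show ?thesis by (simp add: inner2_def infsumI)
qed

lemma inner2_basis2_left: "inner2 (basis2 i) f = cnj (f i)"
  by (metis inner2_basis2 inner2_cnj)

lemma norm2_basis2 [simp]: "norm2 (basis2 i) = 1"
proof -
  have "complex_of_real ((norm2 (basis2 i))\<^sup>2) = 1"
    unfolding inner2_self[symmetric] inner2_basis2 by (simp add: basis2_def)
  then have "(norm2 (basis2 i))\<^sup>2 = 1" by (simp only: of_real_eq_1_iff)
  then show ?thesis using norm2_nonneg[of "basis2 i"] by (simp add: power2_eq_1_iff)
qed

lemma finite_expansion: assumes "finite F" "\<And>i. i \<notin> F \<Longrightarrow> f i = 0"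
  shows "f = (\<Sum>i\<in>F. smul1 (f i) (basis2 i))"
proof
  fix k
  have "(\<Sum>i\<in>F. smul1 (f i) (basis2 i)) k = (\<Sum>i\<in>F. f i * basis2 i k)"
    by (induction F rule: infinite_finite_induct) auto
  also have "\<dots> = (\<Sum>i\<in>F. if i = k then f i else 0)"
    by (rule sum.cong) (auto simp: basis2_def)
  also have "\<dots> = f k" using assms by (simp add: sum.delta)
  finally show "f k = (\<Sum>i\<in>F. smul1 (f i) (basis2 i)) k" by simp
qed

text \<open>The squared norm of the remainder is the total sum minus a finite partial sum. It lets
  an identity on finitely supported vectors pass to all of l2.\<close>

lemma truncation_tendsto:
  assumes "f \<in> l2 I"
  shows "((\<lambda>F. norm2 (f - (\<lambda>i. if i \<in> F then f i else 0))) \<longlongrightarrow> 0) (finite_subsets_at_top UNIV)"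
proof -
  let ?q = "\<lambda>i. (cmod (f i))\<^sup>2"
  have *: "((\<lambda>F. sqrt (infsum ?q UNIV - sum ?q F)) \<longlongrightarrow> sqrt (infsum ?q UNIV - infsum ?q UNIV)) (finite_subsets_at_top UNIV)"
    by (intro tendsto_intros infsum_tendsto l2_summable[OF assms])
  have "norm2 (f - (\<lambda>i. if i \<in> F then f i else 0)) = sqrt (infsum ?q UNIV - sum ?q F)" if "finite F" for F
  proof -
    have s: "?q summable_on - F" "?q summable_on F"
      using l2_summable[OF assms] that by (auto intro: summable_on_subset_banach)
    have "(\<Sum>\<^sub>\<infinity>i. (cmod ((f - (\<lambda>i. if i \<in> F then f i else 0)) i))\<^sup>2) = infsum ?q (- F)"
      by (rule infsum_cong_neutral) auto
    also have "infsum ?q (F \<union> - F) = infsum ?q F + infsum ?q (- F)"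
      by (rule infsum_Un_disjoint) (use s in auto)
    then have "infsum ?q (- F) = infsum ?q UNIV - sum ?q F" using that by simp
    finally show ?thesis by (simp add: norm2_def)
  qed
  then have "\<forall>\<^sub>F F in finite_subsets_at_top UNIV. sqrt (infsum ?q UNIV - sum ?q F) = norm2 (f - (\<lambda>i. if i \<in> F then f i else 0))"
    by (intro eventually_finite_subsets_at_top_weakI) auto
  from Lim_transform_eventually[OF * this] show ?thesis by simp
qed

section \<open>Bounded operators and adjoints\<close>

lemma bounded_opsI:
  assumes "\<And>f. f \<notin> l2 I \<Longrightarrow> x f = 0" "\<And>f. f \<in> l2 I \<Longrightarrow> x f \<in> l2 I"
    "\<And>f g. f \<in> l2 I \<Longrightarrow> g \<in> l2 I \<Longrightarrow> x (f + g) = x f + x g"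
    "\<And>c f. f \<in> l2 I \<Longrightarrow> x (smul1 c f) = smul1 c (x f)"
    "\<And>f. f \<in> l2 I \<Longrightarrow> norm2 (x f) \<le> C * norm2 f"
  shows "x \<in> bounded_ops I"
  unfolding bounded_ops_def linear_on_def mem_Collect_eq
  by (intro conjI ballI allI impI exI[of _ C]) (simp_all add: assms)

lemma bop_outside: "x \<in> bounded_ops I \<Longrightarrow> f \<notin> l2 I \<Longrightarrow> x f = 0"
  by (simp add: bounded_ops_def)

lemma bop_l2 [simp]: "x \<in> bounded_ops I \<Longrightarrow> x f \<in> l2 I"
  by (cases "f \<in> l2 I") (auto simp: bounded_ops_def)

lemma bop_add: "x \<in> bounded_ops I \<Longrightarrow> f \<in> l2 I \<Longrightarrow> g \<in> l2 I \<Longrightarrow> x (f + g) = x f + x g"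
  unfolding bounded_ops_def linear_on_def by blast

lemma bop_smul: "x \<in> bounded_ops I \<Longrightarrow> f \<in> l2 I \<Longrightarrow> x (smul1 c f) = smul1 c (x f)"
  unfolding bounded_ops_def linear_on_def by blast

lemma bop_zero: "x \<in> bounded_ops I \<Longrightarrow> x 0 = 0"
  using bop_smul[of x I 0 0] by simp

lemma bop_uminus: "x \<in> bounded_ops I \<Longrightarrow> f \<in> l2 I \<Longrightarrow> x (- f) = - x f"
  unfolding uminus_smul1 by (rule bop_smul)

lemma bop_diff: "x \<in> bounded_ops I \<Longrightarrow> f \<in> l2 I \<Longrightarrow> g \<in> l2 I \<Longrightarrow> x (f - g) = x f - x g"
  by (simp only: diff_conv_add_uminus bop_add bop_uminus l2_uminus)

lemma bop_sum:
  assumes x: "x \<in> bounded_ops I" and f: "\<And>a. a \<in> S \<Longrightarrow> f a \<in> l2 I"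
  shows "x (sum f S) = (\<Sum>a\<in>S. x (f a))"
proof (cases "finite S")
  case True
  have "finite T \<Longrightarrow> T \<subseteq> S \<Longrightarrow> x (sum f T) = (\<Sum>a\<in>T. x (f a))" for T
  proof (induction T rule: finite_induct)
    case (insert a T)
    have "f a \<in> l2 I" "sum f T \<in> l2 I"
      by (rule f, use insert.prems in blast) (rule l2_sum, rule f, use insert.prems in blast)
    then have "x (f a + sum f T) = x (f a) + x (sum f T)"
      by (rule bop_add[OF x])
    also have "x (sum f T) = (\<Sum>a\<in>T. x (f a))"
      using insert by blast
    finally show ?case unfolding sum.insert[OF insert.hyps] .
  qed (simp_all add: bop_zero[OF x])
  then show ?thesis using True by blast
qed (simp_all add: bop_zero[OF x])

lemma bop_bound:
  assumes "x \<in> bounded_ops I"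
  obtains C where "0 \<le> C" "\<And>f. f \<in> l2 I \<Longrightarrow> norm2 (x f) \<le> C * norm2 f"
proof -
  obtain C where C: "\<And>f. f \<in> l2 I \<Longrightarrow> norm2 (x f) \<le> C * norm2 f"
    using assms unfolding bounded_ops_def by blast
  show ?thesis
  proof (rule that[of "max C 0"])
    fix f assume "f \<in> l2 I"
    have "norm2 (x f) \<le> C * norm2 f" using C \<open>f \<in> l2 I\<close> .
    also have "\<dots> \<le> max C 0 * norm2 f" by (simp add: mult_right_mono)
    finally show "norm2 (x f) \<le> max C 0 * norm2 f" .
  qed simp
qed

lemma op_eqI:
  assumes "x \<in> bounded_ops I" "y \<in> bounded_ops I" "\<And>f. f \<in> l2 I \<Longrightarrow> x f = y f"
  shows "x = y"
proof
  fix f show "x f = y f"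
    using assms bop_outside[of x I f] bop_outside[of y I f] by (cases "f \<in> l2 I") auto
qed

lemma op_eqI_inner:
  assumes "x \<in> bounded_ops I" "y \<in> bounded_ops I"
    "\<And>f g. f \<in> l2 I \<Longrightarrow> g \<in> l2 I \<Longrightarrow> inner2 (x f) g = inner2 (y f) g"
  shows "x = y"
  using assms by (intro op_eqI[of x I] l2_eqI[of _ I]) auto

lemma zero_bop [simp, intro]: "0 \<in> bounded_ops I"
  by (rule bounded_opsI[of _ _ 0]) auto

lemma smul2_bop [simp, intro]: assumes "x \<in> bounded_ops I" shows "smul2 c x \<in> bounded_ops I"
proof -
  obtain C where "0 \<le> C" "\<And>f. f \<in> l2 I \<Longrightarrow> norm2 (x f) \<le> C * norm2 f"
    using bop_bound[OF assms] by blast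
  then show ?thesis
    by (intro bounded_opsI[of _ _ "cmod c * C"])
      (auto simp: bop_outside[OF assms] bop_add[OF assms] bop_smul[OF assms] assms smul1_add norm2_smul mult.assoc mult.commute[of _ c] intro!: mult_left_mono)
qed

lemma add_bop [simp, intro]:
  assumes "x \<in> bounded_ops I" "y \<in> bounded_ops I" shows "x + y \<in> bounded_ops I"
proof -
  obtain C where C: "\<And>f. f \<in> l2 I \<Longrightarrow> norm2 (x f) \<le> C * norm2 f"
    using bop_bound[OF assms(1)] by blast
  obtain D where D: "\<And>f. f \<in> l2 I \<Longrightarrow> norm2 (y f) \<le> D * norm2 f"
    using bop_bound[OF assms(2)] by blast
  show ?thesis
  proof (rule bounded_opsI[of _ _ "C + D"])
    fix f assume f: "f \<in> l2 I"
    have "norm2 (x f + y f) \<le> norm2 (x f) + norm2 (y f)"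
      using assms by (intro norm2_triangle[of _ I]) auto
    then show "norm2 ((x + y) f) \<le> (C + D) * norm2 f"
      using C[OF f] D[OF f] by (simp add: distrib_right)
  qed (auto simp: assms bop_outside[OF assms(1)] bop_outside[OF assms(2)] bop_add[OF assms(1)] bop_add[OF assms(2)] bop_smul[OF assms(1)] bop_smul[OF assms(2)] smul1_add add_ac)
qed

lemma uminus_bop [simp, intro]: "x \<in> bounded_ops I \<Longrightarrow> - x \<in> bounded_ops I"
  unfolding uminus_smul2 by (rule smul2_bop)

lemma diff_bop [simp, intro]: "x \<in> bounded_ops I \<Longrightarrow> y \<in> bounded_ops I \<Longrightarrow> x - y \<in> bounded_ops I"
  unfolding diff_conv_add_uminus by (intro add_bop uminus_bop)

lemma comp_bop [simp, intro]:
  assumes "x \<in> bounded_ops I" "y \<in> bounded_ops I" shows "x \<circ> y \<in> bounded_ops I"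
proof -
  obtain C where C: "0 \<le> C" "\<And>f. f \<in> l2 I \<Longrightarrow> norm2 (x f) \<le> C * norm2 f"
    using bop_bound[OF assms(1)] by blast
  obtain D where D: "\<And>f. f \<in> l2 I \<Longrightarrow> norm2 (y f) \<le> D * norm2 f"
    using bop_bound[OF assms(2)] by blast
  show ?thesis
  proof (rule bounded_opsI[of _ _ "C * D"])
    fix f assume f: "f \<in> l2 I"
    have "norm2 (x (y f)) \<le> C * norm2 (y f)" using C assms by simp
    also have "\<dots> \<le> C * (D * norm2 f)" using C D f by (intro mult_left_mono) auto
    finally show "norm2 ((x \<circ> y) f) \<le> C * D * norm2 f" by (simp add: mult.assoc)
  qed (auto simp: assms bop_outside[OF assms(2)] bop_zero[OF assms(1)] bop_add[OF assms(1)] bop_add[OF assms(2)] bop_smul[OF assms(1)] bop_smul[OF assms(2)])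
qed

lemma id_op_apply [simp]: "f \<in> l2 I \<Longrightarrow> id_op I f = f"
  by (simp add: id_op_def)

lemma id_op_bop [simp, intro]: "id_op I \<in> bounded_ops I"
  by (rule bounded_opsI[of _ _ 1]) (auto simp: id_op_def)

lemma id_op_comp [simp]: "x \<in> bounded_ops I \<Longrightarrow> id_op I \<circ> x = x"
    "x \<in> bounded_ops I \<Longrightarrow> x \<circ> id_op I = x"
  by (auto intro!: op_eqI[of _ I])

lemma comp_add_left: "(x + y :: 'i opr) \<circ> z = (x \<circ> z) + (y \<circ> (z :: 'i opr))"
  by (simp add: fun_eq_iff)

lemma comp_smul_left: "smul2 c x \<circ> z = smul2 c (x \<circ> z)"
  by (simp add: fun_eq_iff)

lemma comp_add_right:
  "x \<in> bounded_ops I \<Longrightarrow> y \<in> bounded_ops I \<Longrightarrow> z \<in> bounded_ops I \<Longrightarrow> x \<circ> (y + z) = (x \<circ> y) + (x \<circ> z)"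
  by (rule op_eqI[of _ I]) (auto simp: bop_add[where x=x and I=I])

lemma comp_smul_right:
  "x \<in> bounded_ops I \<Longrightarrow> y \<in> bounded_ops I \<Longrightarrow> x \<circ> smul2 c y = smul2 c (x \<circ> y)"
  by (rule op_eqI[of _ I]) (auto simp: bop_smul[where x=x and I=I])

text \<open>In \<open>\<ell>\<^sup>2(I)\<close> the operator of a bounded sesquilinear form \<open>B\<close> is given by its coordinates
  \<open>B f (basis2 i)\<close>, so that no completeness argument is needed.\<close>

lemma form_operator:
  fixes B :: "'i vec \<Rightarrow> 'i vec \<Rightarrow> complex"
  assumes add1: "\<And>f g h. f \<in> l2 I \<Longrightarrow> g \<in> l2 I \<Longrightarrow> h \<in> l2 I \<Longrightarrow> B (f + g) h = B f h + B g h"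
    and add2: "\<And>f g h. f \<in> l2 I \<Longrightarrow> g \<in> l2 I \<Longrightarrow> h \<in> l2 I \<Longrightarrow> B h (f + g) = B h f + B h g"
    and smul1: "\<And>c f h. f \<in> l2 I \<Longrightarrow> h \<in> l2 I \<Longrightarrow> B (smul1 c f) h = c * B f h"
    and smul2: "\<And>c f h. f \<in> l2 I \<Longrightarrow> h \<in> l2 I \<Longrightarrow> B h (smul1 c f) = cnj c * B h f"
    and bound: "\<And>f h. f \<in> l2 I \<Longrightarrow> h \<in> l2 I \<Longrightarrow> cmod (B f h) \<le> C * norm2 f * norm2 h"
  obtains x where "x \<in> bounded_ops I" "\<And>f h. f \<in> l2 I \<Longrightarrow> h \<in> l2 I \<Longrightarrow> inner2 (x f) h = B f h"
    "\<And>f. f \<in> l2 I \<Longrightarrow> norm2 (x f) \<le> C * norm2 f"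
proof -
  define x where "x = (\<lambda>f i. if f \<in> l2 I \<and> i \<in> I then B f (basis2 i) else 0)"
  have B0: "B f 0 = 0" if "f \<in> l2 I" for f
    using smul2[of 0 f 0] that by simp
  have Bsum: "B f (\<Sum>i\<in>F. smul1 (u i) (basis2 i)) = (\<Sum>i\<in>F. cnj (u i) * B f (basis2 i))"
    if "f \<in> l2 I" "finite F" "F \<subseteq> I" for f F u
    using that(2,3)
  proof (induction F rule: finite_induct)
    case (insert i F)
    have "(\<Sum>i\<in>F. smul1 (u i) (basis2 i)) \<in> l2 I"
      by (rule l2_sum) (use insert.prems in auto)
    then have "B f (smul1 (u i) (basis2 i) + (\<Sum>i\<in>F. smul1 (u i) (basis2 i)))
        = B f (smul1 (u i) (basis2 i)) + B f (\<Sum>i\<in>F. smul1 (u i) (basis2 i))"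
      using insert.prems that(1) by (intro add2) auto
    also have "\<dots> = cnj (u i) * B f (basis2 i) + (\<Sum>i\<in>F. cnj (u i) * B f (basis2 i))"
    proof (rule arg_cong2[of _ _ _ _ "(+)"])
      show "B f (smul1 (u i) (basis2 i)) = cnj (u i) * B f (basis2 i)"
        using insert.prems that(1) by (intro smul2) auto
      show "B f (\<Sum>i\<in>F. smul1 (u i) (basis2 i)) = (\<Sum>i\<in>F. cnj (u i) * B f (basis2 i))"
        using insert by blast
    qed
    finally show ?case unfolding sum.insert[OF insert.hyps] .
  qed (simp add: B0 that(1))
  \<comment> \<open>Duality: pairing with \<open>g\<close>, the restriction of \<open>x f\<close> to
    a finite set, gives \<open>s \<le> C * norm2 f * sqrt s\<close> for its squared norm
    \<open>s\<close>. All finite partial sums are bounded in this way, which yields square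
    summability.\<close>
  have fin: "(\<Sum>i\<in>F. (cmod (x f i))\<^sup>2) \<le> (C * norm2 f)\<^sup>2" if f: "f \<in> l2 I" and F: "finite F" for f F
  proof -
    define G where "G = F \<inter> I"
    define g where "g = (\<Sum>i\<in>G. smul1 (x f i) (basis2 i))"
    define s where "s = (\<Sum>i\<in>G. (cmod (x f i))\<^sup>2)"
    have G: "finite G" "G \<subseteq> I" using F by (auto simp: G_def)
    have g: "g \<in> l2 I" unfolding g_def by (rule l2_sum) (use G in auto)
    have s0: "0 \<le> s" unfolding s_def by (rule sum_nonneg) simp
    have gi: "g i = (if i \<in> G then x f i else 0)" for i
    proof -
      have "(\<lambda>i. if i \<in> G then x f i else 0) = (\<Sum>i\<in>G. smul1 (if i \<in> G then x f i else 0) (basis2 i))"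
        by (rule finite_expansion) (use G in auto)
      also have "\<dots> = g" unfolding g_def by (rule sum.cong) auto
      finally have e: "(\<lambda>i. if i \<in> G then x f i else 0) = g" .
      show ?thesis using fun_cong[OF e, of i] by simp
    qed
    have "(norm2 g)\<^sup>2 = s"
      unfolding norm2_square s_def gi
      by (rule infsumI, rule has_sum_finite_neutralI[of G]) (use G in auto)
    then have ng: "norm2 g = sqrt s" by (metis norm2_nonneg real_sqrt_unique)
    have "B f g = (\<Sum>i\<in>G. cnj (x f i) * x f i)"
      unfolding g_def using G f by (subst Bsum) (auto simp: x_def intro!: sum.cong)
    also have "\<dots> = complex_of_real s"
      unfolding s_def of_real_sum
      by (rule sum.cong) (auto simp: complex_norm_square mult.commute simp del: of_real_power)
    finally have "s \<le> C * norm2 f * sqrt s"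
      using bound[OF f g] s0 ng by simp
    have "s \<le> (C * norm2 f)\<^sup>2"
    proof (cases "s = 0")
      case False
      then have "sqrt s > 0" using s0 by simp
      have "sqrt s * sqrt s \<le> C * norm2 f * sqrt s"
        using \<open>s \<le> C * norm2 f * sqrt s\<close> s0 by simp
      then have "sqrt s \<le> C * norm2 f" using \<open>sqrt s > 0\<close> by (rule mult_right_le_imp_le)
      then have "(sqrt s)\<^sup>2 \<le> (C * norm2 f)\<^sup>2" using s0 by (intro power_mono) auto
      then show ?thesis using s0 by simp
    qed simp
    moreover have "(\<Sum>i\<in>F. (cmod (x f i))\<^sup>2) = s"
      unfolding s_def G_def using F by (intro sum.mono_neutral_right) (auto simp: x_def)
    ultimately show ?thesis by simp
  qed
  \<comment> \<open>Testing against a unit vector gives the sign; over an empty index set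
    \<open>f\<close> is 0.\<close>
  have Cn: "0 \<le> C * norm2 f" if f: "f \<in> l2 I" for f
  proof (cases "I = {}")
    case True
    then have "f = 0" using f by (auto simp: l2_def fun_eq_iff)
    then show ?thesis by simp
  next
    case False
    then obtain i where "i \<in> I" by auto
    then have "cmod (B f (basis2 i)) \<le> C * norm2 f"
      using bound[OF f basis2_l2[OF \<open>i \<in> I\<close>]] by simp
    then show ?thesis using norm_ge_zero[of "B f (basis2 i)"] by linarith
  qed
  have xs: "(\<lambda>i. (cmod (x f i))\<^sup>2) summable_on UNIV" if "f \<in> l2 I" for f
    by (rule nonneg_bdd_above_summable_on) (use fin[OF that] in \<open>auto simp: bdd_above_def\<close>)
  have xl2: "x f \<in> l2 I" if "f \<in> l2 I" for f
    by (rule l2_I) (use xs[OF that] in \<open>auto simp: x_def\<close>)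
  have xb: "norm2 (x f) \<le> C * norm2 f" if "f \<in> l2 I" for f
  proof -
    have "(norm2 (x f))\<^sup>2 \<le> (C * norm2 f)\<^sup>2"
      unfolding norm2_square by (rule infsum_le_finite_sums) (use xs[OF that] fin[OF that] in auto)
    then show ?thesis using Cn[OF that] by (rule power2_le_imp_le)
  qed
  have x: "x \<in> bounded_ops I"
    by (rule bounded_opsI[of _ _ C]) (use xl2 xb in \<open>auto simp: x_def fun_eq_iff add1 smul1\<close>)
  \<comment> \<open>Both sides agree at the finite truncations \<open>t F\<close> of
    \<open>h\<close>, and each differs there from its value at \<open>h\<close> by at most
    \<open>C * norm2 f * norm2 (h - t F)\<close>.\<close>
  have "inner2 (x f) h = B f h" if f: "f \<in> l2 I" and h: "h \<in> l2 I" for f h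
  proof -
    define t where "t F = (\<lambda>i. if i \<in> F then h i else 0)" for F
    have t: "t F \<in> l2 I" for F
      by (rule l2_I) (use h in \<open>auto simp: t_def l2_def intro: summable_on_comparison_test\<close>)
    have eq: "B f (t F) = inner2 (x f) (t F)" if "finite F" for F
    proof -
      have "t F = (\<Sum>i\<in>F \<inter> I. smul1 (t F i) (basis2 i))"
        by (rule finite_expansion) (use that h in \<open>auto simp: t_def l2_def\<close>)
      then have "B f (t F) = (\<Sum>i\<in>F \<inter> I. cnj (t F i) * B f (basis2 i))"
        using Bsum[of f "F \<inter> I" "t F"] that f by simp
      also have "\<dots> = (\<Sum>i\<in>F \<inter> I. x f i * cnj (t F i))"
        using f by (intro sum.cong) (auto simp: x_def)
      also have "\<dots> = inner2 (x f) (t F)"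
        unfolding inner2_def
        by (rule sym, rule infsumI, rule has_sum_finite_neutralI[of "F \<inter> I"])
          (use that h in \<open>auto simp: t_def l2_def\<close>)
      finally show ?thesis .
    qed
    have "cmod (inner2 (x f) h - B f h) \<le> 2 * (C * norm2 f) * norm2 (h - t F)" if F: "finite F" for F
    proof -
      have m: "h - t F \<in> l2 I" using h t by auto
      have "B f h = B f (h - t F) + B f (t F)"
        using add2[OF m t f, of F] by simp
      then have "inner2 (x f) h - B f h = inner2 (x f) (h - t F) - B f (h - t F)"
        using inner2_diff_right[OF h t xl2[OF f], of F] eq[OF F] by simp
      also have "cmod \<dots> \<le> cmod (inner2 (x f) (h - t F)) + cmod (B f (h - t F))"
        by (rule norm_triangle_ineq4)
      also have "\<dots> \<le> norm2 (x f) * norm2 (h - t F) + C * norm2 f * norm2 (h - t F)"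
        using inner2_cauchy_schwarz[OF xl2[OF f] m] bound[OF f m] by simp
      also have "\<dots> \<le> C * norm2 f * norm2 (h - t F) + C * norm2 f * norm2 (h - t F)"
        by (intro add_mono mult_right_mono xb[OF f] order_refl norm2_nonneg)
      finally show ?thesis by simp
    qed
    then have "\<forall>\<^sub>F F in finite_subsets_at_top UNIV. cmod (inner2 (x f) h - B f h) \<le> 2 * (C * norm2 f) * norm2 (h - t F)"
      by (intro eventually_finite_subsets_at_top_weakI) auto
    moreover have "((\<lambda>F. 2 * (C * norm2 f) * norm2 (h - t F)) \<longlongrightarrow> 2 * (C * norm2 f) * 0) (finite_subsets_at_top UNIV)"
      unfolding t_def by (intro tendsto_mult tendsto_const truncation_tendsto[OF h])
    ultimately have "cmod (inner2 (x f) h - B f h) \<le> 2 * (C * norm2 f) * 0"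
      by (intro tendsto_lowerbound[OF _ _ finite_subsets_at_top_neq_bot])
    then show ?thesis by simp
  qed
  then show ?thesis using that x xb by blast
qed

text \<open>The form \<open>inner2 f (x h)\<close> is sesquilinear and bounded, so
  \<open>form_operator\<close> represents it. Existence and uniqueness together make the definite
  description in \<open>adj\<close> meaningful.\<close>

lemma adj_exists:
  assumes "x \<in> bounded_ops I"
  shows "\<exists>!y. y \<in> bounded_ops I \<and> (\<forall>f\<in>l2 I. \<forall>g\<in>l2 I. inner2 (x f) g = inner2 f (y g))"
proof -
  obtain C where C: "0 \<le> C" "\<And>f. f \<in> l2 I \<Longrightarrow> norm2 (x f) \<le> C * norm2 f"
    using bop_bound[OF assms] by blast
  obtain y where y: "y \<in> bounded_ops I"
    "\<And>f h. f \<in> l2 I \<Longrightarrow> h \<in> l2 I \<Longrightarrow> inner2 (y f) h = inner2 f (x h)"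
  proof (rule form_operator[of I "\<lambda>f h. inner2 f (x h)" C])
    fix f h assume fh: "f \<in> l2 I" "h \<in> l2 I"
    have "cmod (inner2 f (x h)) \<le> norm2 f * norm2 (x h)"
      using assms fh by (intro inner2_cauchy_schwarz[of _ I]) auto
    also have "\<dots> \<le> norm2 f * (C * norm2 h)" using C fh by (intro mult_left_mono) auto
    finally show "cmod (inner2 f (x h)) \<le> C * norm2 f * norm2 h" by (simp add: mult_ac)
  qed (use assms in \<open>auto simp: bop_add[where x=x and I=I] bop_smul[where x=x and I=I] inner2_simps[where I=I] inner2_scalar_simps\<close>)
  show ?thesis
  proof (rule ex1I[of _ y])
    show "y \<in> bounded_ops I \<and> (\<forall>f\<in>l2 I. \<forall>g\<in>l2 I. inner2 (x f) g = inner2 f (y g))"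
      using y by (metis inner2_cnj)
    fix z assume z: "z \<in> bounded_ops I \<and> (\<forall>f\<in>l2 I. \<forall>g\<in>l2 I. inner2 (x f) g = inner2 f (z g))"
    show "z = y"
      by (rule op_eqI_inner[of _ I]) (use y z in \<open>auto, metis inner2_cnj\<close>)
  qed
qed

lemma
  assumes "x \<in> bounded_ops I"
  shows adj_bop [simp, intro]: "adj I x \<in> bounded_ops I"
    and inner2_adj_right: "f \<in> l2 I \<Longrightarrow> g \<in> l2 I \<Longrightarrow> inner2 f (adj I x g) = inner2 (x f) g"
  using theI'[OF adj_exists[OF assms]] unfolding adj_def[symmetric] by (blast, metis)

lemma inner2_adj_left:
  "x \<in> bounded_ops I \<Longrightarrow> f \<in> l2 I \<Longrightarrow> g \<in> l2 I \<Longrightarrow> inner2 (adj I x f) g = inner2 f (x g)"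
  by (metis inner2_adj_right inner2_cnj)

lemma adj_eqI:
  assumes "x \<in> bounded_ops I" "y \<in> bounded_ops I"
    "\<And>f g. f \<in> l2 I \<Longrightarrow> g \<in> l2 I \<Longrightarrow> inner2 (x f) g = inner2 f (y g)"
  shows "adj I x = y"
proof (rule op_eqI_inner[OF adj_bop[OF assms(1)] assms(2)])
  fix f g assume "f \<in> l2 I" "g \<in> l2 I"
  then show "inner2 (adj I x f) g = inner2 (y f) g"
    using assms(1) assms(3)[of g f] by (metis inner2_adj_left inner2_cnj)
qed

lemma adj_adj [simp]: "x \<in> bounded_ops I \<Longrightarrow> adj I (adj I x) = x"
  by (rule adj_eqI) (auto simp: inner2_adj_left)

lemma adj_comp: "x \<in> bounded_ops I \<Longrightarrow> y \<in> bounded_ops I \<Longrightarrow> adj I (x \<circ> y) = adj I y \<circ> adj I x"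
  by (rule adj_eqI) (auto simp: inner2_adj_right[of _ I])

lemma adj_add: "x \<in> bounded_ops I \<Longrightarrow> y \<in> bounded_ops I \<Longrightarrow> adj I (x + y) = adj I x + adj I y"
  by (rule adj_eqI) (auto simp: inner2_adj_right[of _ I] inner2_simps[where I=I])

lemma adj_smul: "x \<in> bounded_ops I \<Longrightarrow> adj I (smul2 c x) = smul2 (cnj c) (adj I x)"
  by (rule adj_eqI) (auto simp: inner2_adj_right[of _ I] inner2_scalar_simps)

lemma adj_diff: "x \<in> bounded_ops I \<Longrightarrow> y \<in> bounded_ops I \<Longrightarrow> adj I (x - y) = adj I x - adj I y"
  by (rule adj_eqI) (auto simp: inner2_adj_right[of _ I] inner2_simps[where I=I])

lemma adj_id [simp]: "adj I (id_op I) = id_op I"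
  by (rule adj_eqI) auto

lemma adj_zero [simp]: "adj I 0 = 0"
  by (rule adj_eqI) auto

lemma polarization:
  assumes x: "x \<in> bounded_ops I" and f: "f \<in> l2 I" and g: "g \<in> l2 I"
  shows "4 * inner2 (x f) g = inner2 (x (f + g)) (f + g) - inner2 (x (f - g)) (f - g)
    + \<i> * inner2 (x (f + smul1 \<i> g)) (f + smul1 \<i> g) - \<i> * inner2 (x (f - smul1 \<i> g)) (f - smul1 \<i> g)"
  using assms
  by (simp add: bop_add[OF x] bop_diff[OF x] bop_smul[OF x] inner2_simps[where I=I] inner2_scalar_simps algebra_simps)

lemma op_eqI_quadratic:
  assumes "x \<in> bounded_ops I" "y \<in> bounded_ops I"
    "\<And>f. f \<in> l2 I \<Longrightarrow> inner2 (x f) f = inner2 (y f) f"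
  shows "x = y"
proof (rule op_eqI_inner[OF assms(1,2)])
  fix f g assume "f \<in> l2 I" "g \<in> l2 I"
  then have "4 * inner2 (x f) g = 4 * inner2 (y f) g"
    using assms by (simp add: polarization[where I=I])
  then show "inner2 (x f) g = inner2 (y f) g" by simp
qed

lemma positive_op_antisym:
  assumes "positive_op I (x - y)" "positive_op I (y - x)" "x \<in> bounded_ops I" "y \<in> bounded_ops I"
  shows "x = y"
proof (rule op_eqI_quadratic[OF assms(3,4)])
  fix f assume f: "f \<in> l2 I"
  have "inner2 (x f) f - inner2 (y f) f \<in> \<real>\<^sub>\<ge>\<^sub>0" "inner2 (y f) f - inner2 (x f) f \<in> \<real>\<^sub>\<ge>\<^sub>0"
    using assms f by (auto simp: positive_op_def inner2_diff_left[where I=I])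
  then show "inner2 (x f) f = inner2 (y f) f"
    by (auto simp: complex_nonneg_Reals_iff complex_eq_iff)
qed

text \<open>The quadratic forms of an operator and of its adjoint are conjugate, and over \<complex>
  the quadratic form determines the operator.\<close>

lemma positive_op_adj: "positive_op I x \<Longrightarrow> adj I x = x"
proof (rule op_eqI_quadratic[of _ I])
  fix f assume *: "positive_op I x" "f \<in> l2 I"
  then have "cnj (inner2 (x f) f) = inner2 (x f) f"
    by (auto simp: positive_op_def complex_nonneg_Reals_iff complex_eq_iff)
  then show "inner2 (adj I x f) f = inner2 (x f) f"
    using * by (simp add: inner2_adj_left[of _ I] positive_op_def inner2_cnj)
qed (auto simp: positive_op_def)

lemma op_norm_le_1D:
  assumes "x \<in> bounded_ops I" "op_norm I x \<le> 1" "f \<in> l2 I"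
  shows "norm2 (x f) \<le> norm2 f"
proof (cases "f = 0")
  case False
  then have n: "norm2 f > 0" using norm2_eq_0[OF assms(3)] norm2_nonneg[of f] by linarith
  obtain C where C: "0 \<le> C" "\<And>f. f \<in> l2 I \<Longrightarrow> norm2 (x f) \<le> C * norm2 f"
    using bop_bound[OF assms(1)] by blast
  define g where "g = smul1 (1 / norm2 f) f"
  have g: "g \<in> l2 I" "norm2 g \<le> 1" using n assms(3) by (auto simp: g_def norm2_smul norm_divide)
  have "norm2 (x g) \<le> op_norm I x"
    unfolding op_norm_def
  proof (rule cSUP_upper)
    show "bdd_above ((\<lambda>f. norm2 (x f)) ` {f \<in> l2 I. norm2 f \<le> 1})"
      using C by (intro bdd_aboveI2[of _ _ C]) (auto intro: order_trans[OF C(2)] mult_left_le)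
  qed (use g in auto)
  then have "norm2 (smul1 (1 / norm2 f) (x f)) \<le> 1"
    using assms by (simp add: g_def bop_smul[OF assms(1)])
  then show ?thesis using n by (simp add: norm2_smul norm_divide field_simps)
qed (simp add: bop_zero[OF assms(1)])

lemma op_norm_leI:
  assumes "\<And>f. f \<in> l2 I \<Longrightarrow> norm2 f \<le> 1 \<Longrightarrow> norm2 (x f) \<le> C"
  shows "op_norm I x \<le> C"
  unfolding op_norm_def by (rule cSUP_least) (use assms in \<open>auto intro: exI[of _ 0]\<close>)

section \<open>Commutants and von Neumann algebras\<close>

lemma commutant_sub: "commutant I S \<subseteq> bounded_ops I"
  by (auto simp: commutant_def)

lemma commutant_iff: "t \<in> commutant I S \<longleftrightarrow> t \<in> bounded_ops I \<and> (\<forall>x\<in>S. t \<circ> x = x \<circ> t)"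
  by (auto simp: commutant_def)

lemma commutant_closed:
  assumes "S \<subseteq> bounded_ops I"
  shows "0 \<in> commutant I S" "id_op I \<in> commutant I S"
    "x \<in> commutant I S \<Longrightarrow> smul2 c x \<in> commutant I S"
    "x \<in> commutant I S \<Longrightarrow> y \<in> commutant I S \<Longrightarrow> x + y \<in> commutant I S"
    "x \<in> commutant I S \<Longrightarrow> y \<in> commutant I S \<Longrightarrow> x \<circ> y \<in> commutant I S"
proof -
  have S: "s \<in> bounded_ops I" if "s \<in> S" for s using assms that by auto
  show "0 \<in> commutant I S"
    unfolding commutant_def
  proof (intro CollectI conjI ballI ext)
    fix s f i assume "s \<in> S"
    then show "(0 \<circ> s) f i = (s \<circ> 0) f i" by (simp add: bop_zero[OF S])
  qed simp
  show "id_op I \<in> commutant I S" using S by (auto simp: commutant_def)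
  show "x \<in> commutant I S \<Longrightarrow> smul2 c x \<in> commutant I S"
    using S by (auto simp: commutant_def comp_smul_left comp_smul_right[of _ I])
  show "x \<in> commutant I S \<Longrightarrow> y \<in> commutant I S \<Longrightarrow> x + y \<in> commutant I S"
    using S by (auto simp: commutant_def comp_add_left comp_add_right[of _ I])
  show "x \<in> commutant I S \<Longrightarrow> y \<in> commutant I S \<Longrightarrow> x \<circ> y \<in> commutant I S"
  proof -
    assume x: "x \<in> commutant I S" and y: "y \<in> commutant I S"
    have "(x \<circ> y) \<circ> s = s \<circ> (x \<circ> y)" if "s \<in> S" for s
    proof -
      have "x \<circ> s = s \<circ> x" "y \<circ> s = s \<circ> y" using x y that by (auto simp: commutant_def)
      then show ?thesis by (metis comp_assoc)
    qed
    then show "x \<circ> y \<in> commutant I S" using x y by (auto simp: commutant_def)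
  qed
qed

lemma double_commutant_sup: "S \<subseteq> bounded_ops I \<Longrightarrow> S \<subseteq> commutant I (commutant I S)"
  by (auto simp: commutant_def)

locale vn_algebra =
  fixes A :: "'i opalg"
  assumes vn: "von_neumann_algebra A"
begin

lemma elems_bop [simp]: "x \<in> elems A \<Longrightarrow> x \<in> bounded_ops (index A)"
  using vn by (auto simp: von_neumann_algebra_def)

lemma elems_adj [simp, intro]: "x \<in> elems A \<Longrightarrow> adj (index A) x \<in> elems A"
  using vn by (auto simp: von_neumann_algebra_def)

text \<open>The bicommutant property as a membership test: operators that arise from forms or as
  limits are placed in the algebra by checking that they commute with its commutant.\<close>

lemma elems_iff: "x \<in> elems A \<longleftrightarrow>
  x \<in> bounded_ops (index A) \<and> (\<forall>t\<in>commutant (index A) (elems A). x \<circ> t = t \<circ> x)"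
proof -
  have "x \<in> elems A \<longleftrightarrow> x \<in> commutant (index A) (commutant (index A) (elems A))"
    using vn unfolding von_neumann_algebra_def by blast
  then show ?thesis unfolding commutant_iff .
qed

lemma elems_closed [simp, intro]:
  "0 \<in> elems A" "id_op (index A) \<in> elems A"
  "x \<in> elems A \<Longrightarrow> smul2 c x \<in> elems A"
  "x \<in> elems A \<Longrightarrow> y \<in> elems A \<Longrightarrow> x + y \<in> elems A"
  "x \<in> elems A \<Longrightarrow> y \<in> elems A \<Longrightarrow> x \<circ> y \<in> elems A"
proof -
  have "commutant (index A) (commutant (index A) (elems A)) = elems A"
    using vn unfolding von_neumann_algebra_def by blast
  note closed = commutant_closed[OF commutant_sub[of "index A" "elems A"], unfolded this]
  show "0 \<in> elems A" "id_op (index A) \<in> elems A"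
    "x \<in> elems A \<Longrightarrow> smul2 c x \<in> elems A"
    "x \<in> elems A \<Longrightarrow> y \<in> elems A \<Longrightarrow> x + y \<in> elems A"
    "x \<in> elems A \<Longrightarrow> y \<in> elems A \<Longrightarrow> x \<circ> y \<in> elems A"
    by (fact closed)+
qed

lemma elems_uminus [simp, intro]: "x \<in> elems A \<Longrightarrow> - x \<in> elems A"
  unfolding uminus_smul2 by (rule elems_closed)

lemma elems_diff [simp, intro]: "x \<in> elems A \<Longrightarrow> y \<in> elems A \<Longrightarrow> x - y \<in> elems A"
  unfolding diff_conv_add_uminus by (intro elems_closed elems_uminus)

end

section \<open>Square summable families of vectors and the functionals they define\<close>

definition l2_family :: "'i set \<Rightarrow> (nat \<Rightarrow> 'i vec) \<Rightarrow> bool" where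
  "l2_family I \<xi> \<longleftrightarrow> range \<xi> \<subseteq> l2 I \<and> summable (\<lambda>k. (norm2 (\<xi> k))\<^sup>2)"

text \<open>These are the functionals that generate the ultraweak topology.\<close>

definition series_functional :: "'i opalg \<Rightarrow> (nat \<Rightarrow> 'i vec) \<Rightarrow> (nat \<Rightarrow> 'i vec) \<Rightarrow> 'i opr \<Rightarrow> complex" where
  "series_functional A \<xi> \<eta> = (\<lambda>x. if x \<in> elems A then \<Sum>k. inner2 (x (\<xi> k)) (\<eta> k) else 0)"

definition vec_functional :: "'i opalg \<Rightarrow> 'i vec \<Rightarrow> 'i vec \<Rightarrow> 'i opr \<Rightarrow> complex" where
  "vec_functional A f g = (\<lambda>x. if x \<in> elems A then inner2 (x f) g else 0)"

text \<open>Presents one vector as a family, so that vector functionals are special series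
  functionals.\<close>

definition single_family :: "'i vec \<Rightarrow> nat \<Rightarrow> 'i vec" where
  "single_family f = (\<lambda>k. if k = 0 then f else 0)"

lemma l2_familyI: "range \<xi> \<subseteq> l2 I \<Longrightarrow> summable (\<lambda>k. (norm2 (\<xi> k))\<^sup>2) \<Longrightarrow> l2_family I \<xi>"
  by (simp add: l2_family_def)

lemma l2_family_l2: "l2_family I \<xi> \<Longrightarrow> \<xi> k \<in> l2 I"
  by (auto simp: l2_family_def)

lemma l2_family_single: "f \<in> l2 I \<Longrightarrow> l2_family I (single_family f)"
  unfolding l2_family_def
  by (auto simp: single_family_def intro!: summable_finite[of "{0}"] split: if_splits)

lemma l2_family_smul: "l2_family I \<xi> \<Longrightarrow> l2_family I (\<lambda>k. smul1 c (\<xi> k))"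
  unfolding l2_family_def by (auto simp: norm2_smul power_mult_distrib intro!: summable_mult)

lemma l2_family_add:
  assumes "l2_family I \<xi>" "l2_family I \<eta>" shows "l2_family I (\<lambda>k. \<xi> k + \<eta> k)"
proof -
  have s: "summable (\<lambda>k. 2 * (norm2 (\<xi> k))\<^sup>2 + 2 * (norm2 (\<eta> k))\<^sup>2)"
    using assms unfolding l2_family_def by (intro summable_add summable_mult) auto
  have "summable (\<lambda>k. (norm2 (\<xi> k + \<eta> k))\<^sup>2)"
  proof (rule summable_comparison_test'[OF s, of 0])
    fix k
    have "norm2 (\<xi> k + \<eta> k) \<le> norm2 (\<xi> k) + norm2 (\<eta> k)"
      using assms by (intro norm2_triangle[of _ I]) (auto simp: l2_family_def)
    then have "(norm2 (\<xi> k + \<eta> k))\<^sup>2 \<le> (norm2 (\<xi> k) + norm2 (\<eta> k))\<^sup>2" by (intro power_mono) auto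
    also have "\<dots> \<le> 2 * (norm2 (\<xi> k))\<^sup>2 + 2 * (norm2 (\<eta> k))\<^sup>2"
      using zero_le_power2[of "norm2 (\<xi> k) - norm2 (\<eta> k)"] by (simp add: power2_eq_square algebra_simps)
    finally show "norm ((norm2 (\<xi> k + \<eta> k))\<^sup>2) \<le> 2 * (norm2 (\<xi> k))\<^sup>2 + 2 * (norm2 (\<eta> k))\<^sup>2" by simp
  qed
  then show ?thesis using assms by (auto simp: l2_family_def)
qed

lemma l2_family_diff:
  assumes "l2_family I \<xi>" "l2_family I \<eta>" shows "l2_family I (\<lambda>k. \<xi> k - \<eta> k)"
  using l2_family_add[OF assms(1) l2_family_smul[OF assms(2), of "-1"]]
  by (simp add: uminus_smul1[symmetric])

lemma series_summable:
  assumes x: "x \<in> bounded_ops I" and "l2_family I \<xi>" "l2_family I \<eta>"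
  shows "summable (\<lambda>k. inner2 (x (\<xi> k)) (\<eta> k))"
proof -
  obtain C where C: "0 \<le> C" "\<And>f. f \<in> l2 I \<Longrightarrow> norm2 (x f) \<le> C * norm2 f"
    using bop_bound[OF x] by blast
  have s: "summable (\<lambda>k. C * ((norm2 (\<xi> k))\<^sup>2 + (norm2 (\<eta> k))\<^sup>2))"
    using assms unfolding l2_family_def by (intro summable_add summable_mult) auto
  show ?thesis
  proof (rule summable_comparison_test'[OF s, of 0])
    fix k
    have m: "\<xi> k \<in> l2 I" "\<eta> k \<in> l2 I" using assms by (auto simp: l2_family_def)
    have "cmod (inner2 (x (\<xi> k)) (\<eta> k)) \<le> norm2 (x (\<xi> k)) * norm2 (\<eta> k)"
      using m x by (intro inner2_cauchy_schwarz[of _ I]) auto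
    also have "\<dots> \<le> (C * norm2 (\<xi> k)) * norm2 (\<eta> k)" using C m by (intro mult_right_mono) auto
    also have "\<dots> = C * (norm2 (\<xi> k) * norm2 (\<eta> k))" by simp
    also have "\<dots> \<le> C * ((norm2 (\<xi> k))\<^sup>2 + (norm2 (\<eta> k))\<^sup>2)"
    proof (rule mult_left_mono[OF _ C(1)])
      have "2 * (norm2 (\<xi> k) * norm2 (\<eta> k)) \<le> (norm2 (\<xi> k))\<^sup>2 + (norm2 (\<eta> k))\<^sup>2"
        using zero_le_power2[of "norm2 (\<xi> k) - norm2 (\<eta> k)"] by (simp add: power2_eq_square algebra_simps)
      moreover have "0 \<le> norm2 (\<xi> k) * norm2 (\<eta> k)" by simp
      ultimately show "norm2 (\<xi> k) * norm2 (\<eta> k) \<le> (norm2 (\<xi> k))\<^sup>2 + (norm2 (\<eta> k))\<^sup>2" by linarith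
    qed
    finally show "norm (inner2 (x (\<xi> k)) (\<eta> k)) \<le> C * ((norm2 (\<xi> k))\<^sup>2 + (norm2 (\<eta> k))\<^sup>2)" .
  qed
qed

lemma series_single:
  assumes x: "x \<in> bounded_ops I"
  shows "(\<Sum>k. inner2 (x (single_family f k)) (single_family g k)) = inner2 (x f) g"
proof -
  have "(\<lambda>k. inner2 (x (single_family f k)) (single_family g k)) sums
      (\<Sum>k\<in>{0}. inner2 (x (single_family f k)) (single_family g k))"
    by (rule sums_finite) (auto simp: single_family_def)
  then show ?thesis by (simp add: sums_iff single_family_def)
qed

section \<open>The ultraweak topology and normal functionals\<close>

text \<open>Only the linear structure is recorded, so that the theory of the predual applies at once
  to von Neumann algebras, to \<open>mat_alg n A\<close> and to
  \<open>vn_tensor A B\<close>.\<close>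

locale op_space =
  fixes A :: "'i opalg"
  assumes sub_bounded: "elems A \<subseteq> bounded_ops (index A)"
    and zero_mem [simp, intro]: "0 \<in> elems A"
    and add_mem [simp, intro]: "x \<in> elems A \<Longrightarrow> y \<in> elems A \<Longrightarrow> x + y \<in> elems A"
    and smul_mem [simp, intro]: "x \<in> elems A \<Longrightarrow> smul2 c x \<in> elems A"
begin

lemma elem_bop [simp]: "x \<in> elems A \<Longrightarrow> x \<in> bounded_ops (index A)"
  using sub_bounded by auto

lemma uminus_mem [simp, intro]: "x \<in> elems A \<Longrightarrow> - x \<in> elems A"
  unfolding uminus_smul2 by (rule smul_mem)

lemma diff_mem [simp, intro]: "x \<in> elems A \<Longrightarrow> y \<in> elems A \<Longrightarrow> x - y \<in> elems A"
  unfolding diff_conv_add_uminus by (intro add_mem uminus_mem)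

lemma topspace_ultraweak [simp]: "topspace (ultraweak A) = elems A"
proof -
  let ?S = "{{x \<in> elems A. (\<Sum>k. inner2 (x (\<xi> k)) (\<eta> k)) \<in> U} | (\<xi> :: nat \<Rightarrow> 'i vec) \<eta> U.
        range \<xi> \<subseteq> l2 (index A) \<and> range \<eta> \<subseteq> l2 (index A) \<and>
        summable (\<lambda>k. (norm2 (\<xi> k))\<^sup>2) \<and> summable (\<lambda>k. (norm2 (\<eta> k))\<^sup>2) \<and> open U}"
  have "elems A \<in> ?S"
    unfolding mem_Collect_eq
    by (rule exI[of _ "\<lambda>k. 0"], rule exI[of _ "\<lambda>k. 0"], rule exI[of _ UNIV]) (simp add: image_subset_iff)
  moreover have "V \<subseteq> elems A" if V_in: "V \<in> ?S" for V
    using V_in unfolding mem_Collect_eq by (elim exE conjE) simp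
  ultimately have "\<Union> ?S = elems A" by (intro antisym Union_upper Union_least)
  then show ?thesis unfolding ultraweak_def topology_generated_by_topspace .
qed

lemma continuous_series:
  assumes "l2_family (index A) \<xi>" "l2_family (index A) \<eta>"
  shows "continuous_map (ultraweak A) euclidean (\<lambda>x. \<Sum>k. inner2 (x (\<xi> k)) (\<eta> k))"
  unfolding continuous_map_def
proof (intro conjI allI impI)
  fix U :: "complex set" assume "openin euclidean U"
  then have "open U" by simp
  then show "openin (ultraweak A) {x \<in> topspace (ultraweak A). (\<Sum>k. inner2 (x (\<xi> k)) (\<eta> k)) \<in> U}"
    unfolding topspace_ultraweak unfolding ultraweak_def
    by (intro topology_generated_by_Basis) (use assms in \<open>auto simp: l2_family_def\<close>)
qed auto

lemma continuous_vec:
  assumes "f \<in> l2 (index A)" "g \<in> l2 (index A)"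
  shows "continuous_map (ultraweak A) euclidean (\<lambda>x. inner2 (x f) g)"
proof (rule continuous_map_eq[OF continuous_series[OF l2_family_single[OF assms(1)] l2_family_single[OF assms(2)]]])
  fix x assume "x \<in> topspace (ultraweak A)"
  then show "(\<Sum>k. inner2 (x (single_family f k)) (single_family g k)) = inner2 (x f) g"
    by (intro series_single[of x "index A"]) auto
qed

text \<open>The ultraweak topology is generated by preimages under series functionals, so continuity
  can be tested on these.\<close>

lemma continuous_into_ultraweak:
  assumes "\<And>x. x \<in> topspace X \<Longrightarrow> F x \<in> elems A"
    "\<And>\<xi> \<eta>. l2_family (index A) \<xi> \<Longrightarrow> l2_family (index A) \<eta> \<Longrightarrow>
      continuous_map X euclidean (\<lambda>x. \<Sum>k. inner2 (F x (\<xi> k)) (\<eta> k))"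
  shows "continuous_map X (ultraweak A) F"
proof -
  let ?S = "{{x \<in> elems A. (\<Sum>k. inner2 (x (\<xi> k)) (\<eta> k)) \<in> U} | (\<xi> :: nat \<Rightarrow> 'i vec) \<eta> U.
        range \<xi> \<subseteq> l2 (index A) \<and> range \<eta> \<subseteq> l2 (index A) \<and>
        summable (\<lambda>k. (norm2 (\<xi> k))\<^sup>2) \<and> summable (\<lambda>k. (norm2 (\<eta> k))\<^sup>2) \<and> open U}"
  have "F ` topspace X \<subseteq> \<Union> ?S"
    using topspace_ultraweak assms(1) unfolding ultraweak_def topology_generated_by_topspace by auto
  moreover have "openin X (F -` V \<inter> topspace X)" if V_in: "V \<in> ?S" for V
  proof -
    obtain \<xi> \<eta> U where V: "V = {x \<in> elems A. (\<Sum>k. inner2 (x (\<xi> k)) (\<eta> k)) \<in> U}"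
      "range \<xi> \<subseteq> l2 (index A)" "range \<eta> \<subseteq> l2 (index A)"
      "summable (\<lambda>k. (norm2 (\<xi> k))\<^sup>2)" "summable (\<lambda>k. (norm2 (\<eta> k))\<^sup>2)" "open U"
      using V_in unfolding mem_Collect_eq by (elim exE conjE) (rule that)
    note * = V(1) l2_familyI[OF V(2,4)] l2_familyI[OF V(3,5)] V(6)
    have "F -` V \<inter> topspace X = {x \<in> topspace X. (\<Sum>k. inner2 (F x (\<xi> k)) (\<eta> k)) \<in> U}"
      using assms(1) by (auto simp: *(1))
    also have "openin X \<dots>"
      using assms(2)[OF *(2,3)] *(4) by (auto simp: continuous_map_def)
    finally show ?thesis .
  qed
  ultimately show ?thesis unfolding ultraweak_def continuous_on_generated_topo_iff by blast
qed

lemma predualI: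
  assumes "\<And>x. x \<notin> elems A \<Longrightarrow> \<omega> x = 0"
    "\<And>x y. x \<in> elems A \<Longrightarrow> y \<in> elems A \<Longrightarrow> \<omega> (x + y) = \<omega> x + \<omega> y"
    "\<And>c x. x \<in> elems A \<Longrightarrow> \<omega> (smul2 c x) = c * \<omega> x"
    "continuous_map (ultraweak A) euclidean \<omega>"
  shows "\<omega> \<in> predual A"
  unfolding predual_def linear_on_def mem_Collect_eq using assms by blast

lemma predual_outside: "\<omega> \<in> predual A \<Longrightarrow> x \<notin> elems A \<Longrightarrow> \<omega> x = 0"
  unfolding predual_def by blast

lemma predual_plus: "\<omega> \<in> predual A \<Longrightarrow> x \<in> elems A \<Longrightarrow> y \<in> elems A \<Longrightarrow> \<omega> (x + y) = \<omega> x + \<omega> y"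
  unfolding predual_def linear_on_def by blast

lemma predual_scale: "\<omega> \<in> predual A \<Longrightarrow> x \<in> elems A \<Longrightarrow> \<omega> (smul2 c x) = c * \<omega> x"
  unfolding predual_def linear_on_def by blast

lemma predual_zero: "\<omega> \<in> predual A \<Longrightarrow> \<omega> 0 = 0"
  using predual_scale[of \<omega> 0 0] by simp

lemma predual_minus: "\<omega> \<in> predual A \<Longrightarrow> x \<in> elems A \<Longrightarrow> y \<in> elems A \<Longrightarrow> \<omega> (x - y) = \<omega> x - \<omega> y"
  using predual_plus[of \<omega> x "smul2 (-1) y"] predual_scale[of \<omega> y "-1"]
  by (simp add: uminus_smul2[symmetric])

lemma predual_continuous: "\<omega> \<in> predual A \<Longrightarrow> continuous_map (ultraweak A) euclidean \<omega>"
  unfolding predual_def by blast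

lemma predual_eqI:
  "\<omega> \<in> predual A \<Longrightarrow> \<rho> \<in> predual A \<Longrightarrow> (\<And>x. x \<in> elems A \<Longrightarrow> \<omega> x = \<rho> x) \<Longrightarrow> \<omega> = \<rho>"
  by (rule ext) (metis predual_outside)

lemma zero_predual [simp, intro]: "0 \<in> predual A"
proof (rule predualI)
  show "continuous_map (ultraweak A) euclidean (0 :: 'i opr \<Rightarrow> complex)"
    unfolding zero_fun_def by simp
qed auto

lemma add_predual [simp, intro]:
  assumes "\<omega> \<in> predual A" "\<rho> \<in> predual A" shows "\<omega> + \<rho> \<in> predual A"
proof (rule predualI)
  show "continuous_map (ultraweak A) euclidean (\<omega> + \<rho>)"
    unfolding plus_fun_def using assms by (intro continuous_map_add predual_continuous)
qed (use assms in \<open>auto simp: predual_outside predual_plus predual_scale algebra_simps\<close>)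

lemma smul_predual [simp, intro]: assumes "\<omega> \<in> predual A" shows "smul1 c \<omega> \<in> predual A"
proof (rule predualI)
  show "continuous_map (ultraweak A) euclidean (smul1 c \<omega>)"
    using continuous_map_compose[OF predual_continuous[OF assms], of euclidean "(*) c"]
    by (simp add: comp_def smul1_def continuous_map_iff_continuous2 continuous_on_mult_left)
qed (use assms in \<open>auto simp: predual_outside predual_plus predual_scale algebra_simps\<close>)

lemma uminus_predual [simp, intro]: "\<omega> \<in> predual A \<Longrightarrow> - \<omega> \<in> predual A"
  unfolding uminus_smul1 by (rule smul_predual)

lemma diff_predual [simp, intro]: "\<omega> \<in> predual A \<Longrightarrow> \<rho> \<in> predual A \<Longrightarrow> \<omega> - \<rho> \<in> predual A"
  unfolding diff_conv_add_uminus by (intro add_predual uminus_predual)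

lemma sum_predual [intro]: "(\<And>a. a \<in> S \<Longrightarrow> \<omega> a \<in> predual A) \<Longrightarrow> sum \<omega> S \<in> predual A"
  by (induction S rule: infinite_finite_induct) auto

lemma series_functional_predual [intro]:
  assumes "l2_family (index A) \<xi>" "l2_family (index A) \<eta>"
  shows "series_functional A \<xi> \<eta> \<in> predual A"
proof (rule predualI)
  show "continuous_map (ultraweak A) euclidean (series_functional A \<xi> \<eta>)"
    by (rule continuous_map_eq[OF continuous_series[OF assms]]) (auto simp: series_functional_def)
next
  fix x y assume xy: "x \<in> elems A" "y \<in> elems A"
  have m: "\<xi> k \<in> l2 (index A)" "\<eta> k \<in> l2 (index A)" for k using assms by (auto simp: l2_family_def)
  have "inner2 ((x + y) (\<xi> k)) (\<eta> k) = inner2 (x (\<xi> k)) (\<eta> k) + inner2 (y (\<xi> k)) (\<eta> k)" for k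
    using xy m by (simp add: inner2_add_left[where I="index A"])
  then show "series_functional A \<xi> \<eta> (x + y) = series_functional A \<xi> \<eta> x + series_functional A \<xi> \<eta> y"
    using xy by (simp add: series_functional_def
      suminf_add[OF series_summable[OF elem_bop[OF xy(1)] assms] series_summable[OF elem_bop[OF xy(2)] assms]])
next
  fix c x assume x: "x \<in> elems A"
  show "series_functional A \<xi> \<eta> (smul2 c x) = c * series_functional A \<xi> \<eta> x"
    using x by (simp add: series_functional_def inner2_smul_left
      suminf_mult[OF series_summable[OF elem_bop[OF x] assms]])
qed (auto simp: series_functional_def)

lemma vec_functional_series:
  "vec_functional A f g = series_functional A (single_family f) (single_family g)"
proof
  fix x show "vec_functional A f g x = series_functional A (single_family f) (single_family g) x"
    using series_single[of x "index A" f g] by (simp add: vec_functional_def series_functional_def)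
qed

lemma vec_functional_predual [simp, intro]:
  "f \<in> l2 (index A) \<Longrightarrow> g \<in> l2 (index A) \<Longrightarrow> vec_functional A f g \<in> predual A"
  unfolding vec_functional_series by (intro series_functional_predual l2_family_single)

text \<open>A generating set restricts one series functional, so if it contains 0 it contains the
  kernel of that functional. In the induction an intersection unites the finite sets of functionals,
  and a union keeps one of them.\<close>

lemma neighbourhood_of_zero:
  assumes "openin (ultraweak A) U" "0 \<in> U"
  shows "\<exists>F. finite F \<and> (\<forall>(\<xi>, \<eta>)\<in>F. l2_family (index A) \<xi> \<and> l2_family (index A) \<eta>) \<and>
    (\<forall>x\<in>elems A. (\<forall>(\<xi>, \<eta>)\<in>F. series_functional A \<xi> \<eta> x = 0) \<longrightarrow> x \<in> U)"
proof -
  let ?S = "{{x \<in> elems A. (\<Sum>k. inner2 (x (\<xi> k)) (\<eta> k)) \<in> U} | (\<xi> :: nat \<Rightarrow> 'i vec) \<eta> U.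
        range \<xi> \<subseteq> l2 (index A) \<and> range \<eta> \<subseteq> l2 (index A) \<and>
        summable (\<lambda>k. (norm2 (\<xi> k))\<^sup>2) \<and> summable (\<lambda>k. (norm2 (\<eta> k))\<^sup>2) \<and> open U}"
  define P where "P F U \<longleftrightarrow> finite F \<and> (\<forall>(\<xi>, \<eta>)\<in>F. l2_family (index A) \<xi> \<and> l2_family (index A) \<eta>) \<and>
    (\<forall>x\<in>elems A. (\<forall>(\<xi>, \<eta>)\<in>F. series_functional A \<xi> \<eta> x = 0) \<longrightarrow> x \<in> U)" for F U
  have "generate_topology_on ?S U"
    using assms(1) unfolding ultraweak_def openin_topology_generated_by_iff .
  then have "0 \<in> U \<longrightarrow> (\<exists>F. P F U)"
  proof (induction rule: generate_topology_on.induct)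
    case (Int a b)
    show ?case
    proof
      assume "0 \<in> a \<inter> b"
      then obtain F G where "P F a" "P G b" using Int by blast
      then have "P (F \<union> G) (a \<inter> b)" unfolding P_def by blast
      then show "\<exists>F. P F (a \<inter> b)" by blast
    qed
  next
    case (UN K)
    show ?case
    proof
      assume "0 \<in> \<Union> K"
      then obtain k F where "k \<in> K" "P F k" using UN by blast
      then have "P F (\<Union> K)" unfolding P_def by blast
      then show "\<exists>F. P F (\<Union> K)" by blast
    qed
  next
    case (Basis s)
    show ?case
    proof
      assume "0 \<in> s"
      obtain \<xi> \<eta> U where V: "s = {x \<in> elems A. (\<Sum>k. inner2 (x (\<xi> k)) (\<eta> k)) \<in> U}"
        "range \<xi> \<subseteq> l2 (index A)" "range \<eta> \<subseteq> l2 (index A)"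
        "summable (\<lambda>k. (norm2 (\<xi> k))\<^sup>2)" "summable (\<lambda>k. (norm2 (\<eta> k))\<^sup>2)"
        using Basis unfolding mem_Collect_eq by (elim exE conjE) (rule that)
      note * = V(1) l2_familyI[OF V(2,4)] l2_familyI[OF V(3,5)]
      have "0 \<in> U" using \<open>0 \<in> s\<close> by (simp add: *(1))
      then have "P {(\<xi>, \<eta>)} s" using *(2,3) by (auto simp: P_def *(1) series_functional_def)
      then show "\<exists>F. P F s" by blast
    qed
  qed auto
  then show ?thesis using assms(2) unfolding P_def by blast
qed

text \<open>If some \<open>x0\<close> is killed by \<open>F\<close> but not by \<open>q\<close>,
  subtracting the multiple of \<open>q\<close> that agrees with \<open>g\<close> at
  \<open>x0\<close> reduces the claim to \<open>F\<close>. Otherwise \<open>q\<close> vanishes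
  wherever \<open>F\<close> does, and the kernel condition already holds for
  \<open>F\<close>.\<close>

lemma kernel_combination:
  assumes "finite F"
  shows "(\<And>p. p \<in> F \<Longrightarrow> linear_on (elems A) smul2 (*) p) \<Longrightarrow> linear_on (elems A) smul2 (*) g \<Longrightarrow>
    (\<And>x. x \<in> elems A \<Longrightarrow> (\<And>p. p \<in> F \<Longrightarrow> p x = 0) \<Longrightarrow> g x = 0) \<Longrightarrow>
    \<exists>c. \<forall>x\<in>elems A. g x = (\<Sum>p\<in>F. c p * p x)"
  using assms
proof (induction F arbitrary: g rule: finite_induct)
  case empty
  then show ?case by auto
next
  case (insert q F)
  have lin: "p (x + y) = p x + p y" "p (smul2 c x) = c * p x"
    if "p = g \<or> p \<in> insert q F" "x \<in> elems A" "y \<in> elems A" for p x y c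
    using insert.prems(1,2) that unfolding linear_on_def by blast+
  show ?case
  proof (cases "\<exists>x0\<in>elems A. (\<forall>p\<in>F. p x0 = 0) \<and> q x0 \<noteq> 0")
    case True
    then obtain x0 where x0: "x0 \<in> elems A" "\<And>p. p \<in> F \<Longrightarrow> p x0 = 0" "q x0 \<noteq> 0" by blast
    define d where "d = g x0 / q x0"
    have "\<exists>c. \<forall>x\<in>elems A. g x - d * q x = (\<Sum>p\<in>F. c p * p x)"
    proof (rule insert.IH[of "\<lambda>x. g x - d * q x"])
      fix x assume x: "x \<in> elems A" and px: "\<And>p. p \<in> F \<Longrightarrow> p x = 0"
      define y where "y = x + smul2 (- q x / q x0) x0"
      have y: "y \<in> elems A" using x x0 by (auto simp: y_def)
      have "g y = 0"
      proof (rule insert.prems(3)[OF y])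
        fix p assume "p \<in> insert q F"
        then have "p y = p x + (- q x / q x0) * p x0"
          using x x0(1) by (simp add: y_def lin)
        then show "p y = 0" using px[of p] x0(2)[of p] x0(3) \<open>p \<in> insert q F\<close> by auto
      qed
      moreover have "g y = g x + (- q x / q x0) * g x0"
        using x x0(1) by (simp add: y_def lin)
      ultimately show "g x - d * q x = 0" by (simp add: d_def)
    next
      show "linear_on (elems A) smul2 (*) (\<lambda>x. g x - d * q x)"
        by (auto simp: linear_on_def lin algebra_simps)
    qed (use insert.prems(1) in blast)
    then obtain c where c: "\<forall>x\<in>elems A. g x - d * q x = (\<Sum>p\<in>F. c p * p x)" by blast
    have "(\<Sum>p\<in>F. (if p = q then d else c p) * p x) = (\<Sum>p\<in>F. c p * p x)" for x
      using insert.hyps by (intro sum.cong) auto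
    then have "\<forall>x\<in>elems A. g x = (\<Sum>p\<in>insert q F. (if p = q then d else c p) * p x)"
      using c insert.hyps by (simp add: algebra_simps)
    then show ?thesis by (rule exI[of _ "\<lambda>p. if p = q then d else c p"])
  next
    case False
    have "\<exists>c. \<forall>x\<in>elems A. g x = (\<Sum>p\<in>F. c p * p x)"
      using insert.prems False by (intro insert.IH) blast+
    then obtain c where c: "\<forall>x\<in>elems A. g x = (\<Sum>p\<in>F. c p * p x)" by blast
    have "(\<Sum>p\<in>F. (if p = q then 0 else c p) * p x) = (\<Sum>p\<in>F. c p * p x)" for x
      using insert.hyps by (intro sum.cong) auto
    then have "\<forall>x\<in>elems A. g x = (\<Sum>p\<in>insert q F. (if p = q then 0 else c p) * p x)"
      using c insert.hyps by simp
    then show ?thesis by (rule exI[of _ "\<lambda>p. if p = q then 0 else c p"])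
  qed
qed

text \<open>The ultraweak topology is a weak topology, so a continuous functional vanishes on the common
  kernel of finitely many of the defining functionals and is a linear combination of them.\<close>

lemma predual_representation:
  assumes \<omega>: "\<omega> \<in> predual A"
  shows "\<exists>F c. finite F \<and> (\<forall>(\<xi>, \<eta>)\<in>F. l2_family (index A) \<xi> \<and> l2_family (index A) \<eta>) \<and>
    \<omega> = (\<Sum>(\<xi>, \<eta>)\<in>F. smul1 (c (\<xi>, \<eta>)) (series_functional A \<xi> \<eta>))"
proof -
  have "openin (ultraweak A) {x \<in> topspace (ultraweak A). \<omega> x \<in> U}" if "open U" for U
    using openin_continuous_map_preimage[OF predual_continuous[OF \<omega>], of U] that by simp
  from this[OF open_ball] have "openin (ultraweak A) {x \<in> topspace (ultraweak A). \<omega> x \<in> ball 0 1}" .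
  moreover have "0 \<in> {x \<in> topspace (ultraweak A). \<omega> x \<in> ball 0 1}"
    using predual_zero[OF \<omega>] by simp
  ultimately have "\<exists>F. finite F \<and> (\<forall>(\<xi>, \<eta>)\<in>F. l2_family (index A) \<xi> \<and> l2_family (index A) \<eta>) \<and>
    (\<forall>x\<in>elems A. (\<forall>(\<xi>, \<eta>)\<in>F. series_functional A \<xi> \<eta> x = 0) \<longrightarrow>
      x \<in> {x \<in> topspace (ultraweak A). \<omega> x \<in> ball 0 1})"
    by (rule neighbourhood_of_zero)
  then obtain F where F: "finite F" "\<forall>(\<xi>, \<eta>)\<in>F. l2_family (index A) \<xi> \<and> l2_family (index A) \<eta>"
    "\<forall>x\<in>elems A. (\<forall>(\<xi>, \<eta>)\<in>F. series_functional A \<xi> \<eta> x = 0) \<longrightarrow>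
      x \<in> {x \<in> topspace (ultraweak A). \<omega> x \<in> ball 0 1}"
    by (elim exE conjE) (rule that)
  define s where "s = (\<lambda>(\<xi>, \<eta>). series_functional A \<xi> \<eta>)"
  have s: "s p \<in> predual A" if "p \<in> F" for p
    using F(2) that by (cases p) (auto simp: s_def intro!: series_functional_predual)
  have "\<exists>c. \<forall>x\<in>elems A. \<omega> x = (\<Sum>p\<in>s ` F. c p * p x)"
  proof (rule kernel_combination)
    fix x assume x: "x \<in> elems A" and z: "\<And>p. p \<in> s ` F \<Longrightarrow> p x = 0"
    \<comment> \<open>The common kernel is closed under scaling, so the values of \<omega> on a
      whole line stay in the unit disc. This forces \<omega> to vanish there.\<close>
    have small: "cmod (\<omega> (smul2 t x)) < 1" for t
    proof -
      have "smul2 t x \<in> {x \<in> topspace (ultraweak A). \<omega> x \<in> ball 0 1}"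
      proof (rule F(3)[rule_format])
        fix p assume "p \<in> F"
        moreover obtain \<xi> \<eta> where p: "p = (\<xi>, \<eta>)" by (cases p)
        ultimately have "(\<xi>, \<eta>) \<in> F" by simp
        then have "series_functional A \<xi> \<eta> x = 0" using z by (auto simp: s_def)
        moreover have "series_functional A \<xi> \<eta> \<in> predual A" using F(2) \<open>(\<xi>, \<eta>) \<in> F\<close> by auto
        ultimately show "case p of (\<xi>, \<eta>) \<Rightarrow> series_functional A \<xi> \<eta> (smul2 t x) = 0"
          using x by (simp add: p predual_scale)
      qed (use x in auto)
      then show ?thesis by simp
    qed
    show "\<omega> x = 0"
    proof (rule ccontr)
      assume "\<omega> x \<noteq> 0"
      then show False using small[of "1 / \<omega> x"] predual_scale[OF \<omega> x] by simp
    qed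
  qed (use F(1) s \<omega> in \<open>auto simp: predual_def\<close>)
  then obtain c where c: "\<forall>x\<in>elems A. \<omega> x = (\<Sum>p\<in>s ` F. c p * p x)" by blast
  \<comment> \<open>Different pairs may give the same functional. On a subset where \<open>s\<close>
    is injective the coefficients can be transported from functionals back to pairs.\<close>
  obtain F' where F': "F' \<subseteq> F" "inj_on s F'" "s ` F' = s ` F"
    by (metis subset_image_inj order_refl)
  define c' where "c' = c \<circ> s"
  have "\<omega> = (\<Sum>p\<in>F'. smul1 (c' p) (s p))"
  proof (rule predual_eqI[OF \<omega>])
    show "(\<Sum>p\<in>F'. smul1 (c' p) (s p)) \<in> predual A"
      by (rule sum_predual) (use s F' in auto)
    fix x assume "x \<in> elems A"
    then have "\<omega> x = (\<Sum>p\<in>s ` F'. c p * p x)" using c F' by simp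
    also have "\<dots> = (\<Sum>p\<in>F'. smul1 (c' p) (s p) x)"
      using F'(2) by (simp add: sum.reindex c'_def)
    also have "\<dots> = (\<Sum>p\<in>F'. smul1 (c' p) (s p)) x"
      by (induction F' rule: infinite_finite_induct) auto
    finally show "\<omega> x = (\<Sum>p\<in>F'. smul1 (c' p) (s p)) x" .
  qed
  also have "\<dots> = (\<Sum>(\<xi>, \<eta>)\<in>F'. smul1 (c' (\<xi>, \<eta>)) (series_functional A \<xi> \<eta>))"
    by (rule sum.cong) (auto simp: s_def)
  finally have "\<omega> = (\<Sum>(\<xi>, \<eta>)\<in>F'. smul1 (c' (\<xi>, \<eta>)) (series_functional A \<xi> \<eta>))" .
  moreover have "finite F'" "\<forall>(\<xi>, \<eta>)\<in>F'. l2_family (index A) \<xi> \<and> l2_family (index A) \<eta>"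
    using F(1,2) F'(1) by (auto intro: finite_subset)
  ultimately show ?thesis by blast
qed

section \<open>Positive normal functionals\<close>

lemma predual_pos_predual [simp]: "\<omega> \<in> predual_pos A \<Longrightarrow> \<omega> \<in> predual A"
  unfolding predual_pos_def by blast

lemma predual_pos_nonneg: "\<omega> \<in> predual_pos A \<Longrightarrow> x \<in> elems A \<Longrightarrow> positive_op (index A) x \<Longrightarrow> \<omega> x \<in> \<real>\<^sub>\<ge>\<^sub>0"
  unfolding predual_pos_def by blast

lemma predual_posI:
  "\<omega> \<in> predual A \<Longrightarrow> (\<And>x. x \<in> elems A \<Longrightarrow> positive_op (index A) x \<Longrightarrow> \<omega> x \<in> \<real>\<^sub>\<ge>\<^sub>0) \<Longrightarrow> \<omega> \<in> predual_pos A"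
  unfolding predual_pos_def by blast

lemma zero_pos [simp, intro]: "0 \<in> predual_pos A"
  by (rule predual_posI) auto

lemma add_pos [simp, intro]: "\<omega> \<in> predual_pos A \<Longrightarrow> \<rho> \<in> predual_pos A \<Longrightarrow> \<omega> + \<rho> \<in> predual_pos A"
  by (rule predual_posI) (auto intro: nonneg_Reals_add_I dest: predual_pos_nonneg)

lemma smul_pos [simp, intro]:
  assumes "\<omega> \<in> predual_pos A" "0 \<le> r" shows "smul1 (complex_of_real r) \<omega> \<in> predual_pos A"
proof (rule predual_posI)
  fix x assume "x \<in> elems A" "positive_op (index A) x"
  then have "\<omega> x \<in> \<real>\<^sub>\<ge>\<^sub>0" by (rule predual_pos_nonneg[OF assms(1)])
  then show "smul1 (complex_of_real r) \<omega> x \<in> \<real>\<^sub>\<ge>\<^sub>0"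
    using assms(2) by (simp add: nonneg_Reals_mult_I)
qed (use assms in auto)

lemma series_functional_pos [intro]:
  assumes "l2_family (index A) \<xi>" shows "series_functional A \<xi> \<xi> \<in> predual_pos A"
proof (rule predual_posI)
  fix x assume x: "x \<in> elems A" "positive_op (index A) x"
  have "inner2 (x (\<xi> k)) (\<xi> k) \<in> \<real>\<^sub>\<ge>\<^sub>0" for k
    using x assms by (auto simp: positive_op_def l2_family_def)
  then have r: "inner2 (x (\<xi> k)) (\<xi> k) = complex_of_real (Re (inner2 (x (\<xi> k)) (\<xi> k)))"
    "0 \<le> Re (inner2 (x (\<xi> k)) (\<xi> k))" for k
    by (auto simp: complex_nonneg_Reals_iff complex_eq_iff)
  have s: "summable (\<lambda>k. inner2 (x (\<xi> k)) (\<xi> k))"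
    using series_summable[OF elem_bop[OF x(1)] assms assms] .
  have sr: "summable (\<lambda>k. Re (inner2 (x (\<xi> k)) (\<xi> k)))"
    using s by (rule summable_Re)
  have "(\<Sum>k. inner2 (x (\<xi> k)) (\<xi> k)) = (\<Sum>k. complex_of_real (Re (inner2 (x (\<xi> k)) (\<xi> k))))"
    by (rule suminf_cong) (rule r(1))
  also have "\<dots> = complex_of_real (\<Sum>k. Re (inner2 (x (\<xi> k)) (\<xi> k)))"
    by (rule suminf_of_real[OF sr, symmetric])
  finally have "(\<Sum>k. inner2 (x (\<xi> k)) (\<xi> k)) = complex_of_real (\<Sum>k. Re (inner2 (x (\<xi> k)) (\<xi> k)))" .
  moreover have "0 \<le> (\<Sum>k. Re (inner2 (x (\<xi> k)) (\<xi> k)))"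
    by (rule suminf_nonneg[OF sr r(2)])
  ultimately show "series_functional A \<xi> \<xi> x \<in> \<real>\<^sub>\<ge>\<^sub>0"
    using x by (simp add: series_functional_def nonneg_Reals_of_real_iff)
qed (use assms in auto)

lemma vec_functional_pos [simp, intro]: "f \<in> l2 (index A) \<Longrightarrow> vec_functional A f f \<in> predual_pos A"
  unfolding vec_functional_series by (intro series_functional_pos l2_family_single)

text \<open>No minimality is asked, so a functional has many decompositions;
  \<open>combine_unique\<close> shows that the extension of \<theta> does not depend on the
  choice.\<close>

definition decomposes :: "('i opr \<Rightarrow> complex) \<Rightarrow> (nat \<Rightarrow> 'i opr \<Rightarrow> complex) \<Rightarrow> bool" where
  "decomposes \<omega> p \<longleftrightarrow> (\<forall>k. p k \<in> predual_pos A) \<and>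
     \<omega> = p 0 - p 1 + smul1 \<i> (p 2) - smul1 \<i> (p 3)"

lemma decomposes_apply: "decomposes \<omega> p \<Longrightarrow> \<omega> x = p 0 x - p 1 x + \<i> * p 2 x - \<i> * p 3 x"
  by (simp add: decomposes_def)

lemma decomposesI:
  "(\<And>k. p k \<in> predual_pos A) \<Longrightarrow> (\<And>x. \<omega> x = p 0 x - p 1 x + \<i> * p 2 x - \<i> * p 3 x) \<Longrightarrow> decomposes \<omega> p"
  unfolding decomposes_def by (intro conjI allI ext) simp_all

lemma decomposes_pos: "decomposes \<omega> p \<Longrightarrow> p k \<in> predual_pos A"
  by (simp add: decomposes_def)

lemma decomposes_add:
  assumes "decomposes \<omega> p" "decomposes \<rho> q" shows "decomposes (\<omega> + \<rho>) (\<lambda>k. p k + q k)"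
proof (rule decomposesI)
  fix x show "(\<omega> + \<rho>) x = (p 0 + q 0) x - (p 1 + q 1) x + \<i> * (p 2 + q 2) x - \<i> * (p 3 + q 3) x"
    unfolding fun_apply1 smul1_apply decomposes_apply[OF assms(1)] decomposes_apply[OF assms(2)] by (simp add: algebra_simps)
qed (use assms decomposes_pos in auto)

lemma decomposes_scale:
  assumes "decomposes \<omega> p" "0 \<le> r"
  shows "decomposes (smul1 (complex_of_real r) \<omega>) (\<lambda>k. smul1 (complex_of_real r) (p k))"
proof (rule decomposesI)
  fix x show "smul1 (complex_of_real r) \<omega> x = smul1 (complex_of_real r) (p 0) x - smul1 (complex_of_real r) (p 1) x
      + \<i> * smul1 (complex_of_real r) (p 2) x - \<i> * smul1 (complex_of_real r) (p 3) x"
    unfolding fun_apply1 smul1_apply decomposes_apply[OF assms(1)] by (simp add: algebra_simps)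
qed (use assms decomposes_pos in auto)

lemma decomposes_i:
  assumes "decomposes \<omega> p"
  shows "decomposes (smul1 \<i> \<omega>) (\<lambda>k. if k = 0 then p 3 else if k = 1 then p 2 else if k = 2 then p 0 else p 1)"
proof (rule decomposesI)
  fix x show "smul1 \<i> \<omega> x = (if (0::nat) = 0 then p 3 else if 0 = (1::nat) then p 2 else if 0 = (2::nat) then p 0 else p 1) x - (if (1::nat) = 0 then p 3 else if 1 = (1::nat) then p 2 else if 1 = (2::nat) then p 0 else p 1) x
      + \<i> * (if (2::nat) = 0 then p 3 else if 2 = (1::nat) then p 2 else if 2 = (2::nat) then p 0 else p 1) x - \<i> * (if (3::nat) = 0 then p 3 else if 3 = (1::nat) then p 2 else if 3 = (2::nat) then p 0 else p 1) x"
    unfolding fun_apply1 smul1_apply decomposes_apply[OF assms] by (simp add: algebra_simps)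
qed (use assms decomposes_pos in auto)

lemma decomposes_minus:
  assumes "decomposes \<omega> p"
  shows "decomposes (- \<omega>) (\<lambda>k. if k = 0 then p 1 else if k = 1 then p 0 else if k = 2 then p 3 else p 2)"
proof (rule decomposesI)
  fix x show "(- \<omega>) x = (if (0::nat) = 0 then p 1 else if 0 = (1::nat) then p 0 else if 0 = (2::nat) then p 3 else p 2) x - (if (1::nat) = 0 then p 1 else if 1 = (1::nat) then p 0 else if 1 = (2::nat) then p 3 else p 2) x
      + \<i> * (if (2::nat) = 0 then p 1 else if 2 = (1::nat) then p 0 else if 2 = (2::nat) then p 3 else p 2) x - \<i> * (if (3::nat) = 0 then p 1 else if 3 = (1::nat) then p 0 else if 3 = (2::nat) then p 3 else p 2) x"
    unfolding fun_apply1 smul1_apply decomposes_apply[OF assms] by (simp add: algebra_simps)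
qed (use assms decomposes_pos in auto)

text \<open>Reduces a complex scalar to nonnegative reals, a sign and the factor \<i>. For each of
  these three operations a decomposition of the result can be written down.\<close>

lemma smul1_decomposed:
  "smul1 c \<omega> = (if 0 \<le> Re c then smul1 (complex_of_real \<bar>Re c\<bar>) \<omega> else - smul1 (complex_of_real \<bar>Re c\<bar>) \<omega>)
     + smul1 \<i> (if 0 \<le> Im c then smul1 (complex_of_real \<bar>Im c\<bar>) \<omega> else - smul1 (complex_of_real \<bar>Im c\<bar>) \<omega>)"
proof
  fix x
  have "c * \<omega> x = complex_of_real (Re c) * \<omega> x + \<i> * (complex_of_real (Im c) * \<omega> x)"
    by (subst complex_eq[of c]) (simp add: algebra_simps)
  then show "smul1 c \<omega> x = ((if 0 \<le> Re c then smul1 (complex_of_real \<bar>Re c\<bar>) \<omega> else - smul1 (complex_of_real \<bar>Re c\<bar>) \<omega>)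
     + smul1 \<i> (if 0 \<le> Im c then smul1 (complex_of_real \<bar>Im c\<bar>) \<omega> else - smul1 (complex_of_real \<bar>Im c\<bar>) \<omega>)) x"
    by auto
qed

lemma decomposes_smul: assumes "\<exists>p. decomposes \<omega> p" shows "\<exists>p. decomposes (smul1 c \<omega>) p"
proof -
  have *: "\<exists>p. decomposes (if 0 \<le> r then smul1 (complex_of_real \<bar>r\<bar>) \<omega> else - smul1 (complex_of_real \<bar>r\<bar>) \<omega>) p" for r
    using assms decomposes_scale[of \<omega> _ "\<bar>r\<bar>"] decomposes_minus by (cases "0 \<le> r") (simp, blast)+
  show ?thesis
    unfolding smul1_decomposed[of c \<omega>] using *[of "Re c"] *[of "Im c"] decomposes_i decomposes_add by blast
qed

lemma series_functional_polarization:
  assumes \<xi>: "l2_family (index A) \<xi>" and \<eta>: "l2_family (index A) \<eta>"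
  shows "decomposes (smul1 4 (series_functional A \<xi> \<eta>))
    (\<lambda>k. if k = 0 then series_functional A (\<lambda>k. \<xi> k + \<eta> k) (\<lambda>k. \<xi> k + \<eta> k)
      else if k = 1 then series_functional A (\<lambda>k. \<xi> k - \<eta> k) (\<lambda>k. \<xi> k - \<eta> k)
      else if k = 2 then series_functional A (\<lambda>k. \<xi> k + smul1 \<i> (\<eta> k)) (\<lambda>k. \<xi> k + smul1 \<i> (\<eta> k))
      else series_functional A (\<lambda>k. \<xi> k - smul1 \<i> (\<eta> k)) (\<lambda>k. \<xi> k - smul1 \<i> (\<eta> k)))"
    (is "decomposes _ (\<lambda>k. if k = 0 then ?s0 else if k = 1 then ?s1 else if k = 2 then ?s2 else ?s3)")
proof -
  note f = l2_family_add[OF \<xi> \<eta>] l2_family_diff[OF \<xi> \<eta>]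
    l2_family_add[OF \<xi> l2_family_smul[OF \<eta>, of \<i>]] l2_family_diff[OF \<xi> l2_family_smul[OF \<eta>, of \<i>]]
  have pos: "?s0 \<in> predual_pos A" "?s1 \<in> predual_pos A" "?s2 \<in> predual_pos A" "?s3 \<in> predual_pos A"
    by (intro series_functional_pos f)+
  have "smul1 4 (series_functional A \<xi> \<eta>) = ?s0 - ?s1 + smul1 \<i> ?s2 - smul1 \<i> ?s3"
  proof
    fix x
    show "smul1 4 (series_functional A \<xi> \<eta>) x = (?s0 - ?s1 + smul1 \<i> ?s2 - smul1 \<i> ?s3) x"
    proof (cases "x \<in> elems A")
      case True
      note s = series_summable[OF elem_bop[OF True] f(1) f(1)] series_summable[OF elem_bop[OF True] f(2) f(2)]
        series_summable[OF elem_bop[OF True] f(3) f(3)] series_summable[OF elem_bop[OF True] f(4) f(4)]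
      have "4 * inner2 (x (\<xi> k)) (\<eta> k) = inner2 (x (\<xi> k + \<eta> k)) (\<xi> k + \<eta> k) - inner2 (x (\<xi> k - \<eta> k)) (\<xi> k - \<eta> k)
        + \<i> * inner2 (x (\<xi> k + smul1 \<i> (\<eta> k))) (\<xi> k + smul1 \<i> (\<eta> k)) - \<i> * inner2 (x (\<xi> k - smul1 \<i> (\<eta> k))) (\<xi> k - smul1 \<i> (\<eta> k))" for k
        by (rule polarization[of x "index A"]) (use True \<xi> \<eta> in \<open>auto simp: l2_family_l2\<close>)
      then have "(\<lambda>k. 4 * inner2 (x (\<xi> k)) (\<eta> k)) sums (?s0 x - ?s1 x + \<i> * ?s2 x - \<i> * ?s3 x)"
        using True sums_diff[OF sums_add[OF sums_diff[OF summable_sums[OF s(1)] summable_sums[OF s(2)]]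
          sums_mult[OF summable_sums[OF s(3)], of \<i>]] sums_mult[OF summable_sums[OF s(4)], of \<i>]]
        by (simp only: series_functional_def if_True)
      moreover have "(\<lambda>k. 4 * inner2 (x (\<xi> k)) (\<eta> k)) sums (4 * series_functional A \<xi> \<eta> x)"
        using True sums_mult[OF summable_sums[OF series_summable[OF elem_bop[OF True] \<xi> \<eta>]], of 4]
        by (simp only: series_functional_def if_True)
      ultimately have "4 * series_functional A \<xi> \<eta> x = ?s0 x - ?s1 x + \<i> * ?s2 x - \<i> * ?s3 x"
        by (rule sums_unique2[rotated])
      then show ?thesis by simp
    qed (simp add: series_functional_def)
  qed
  then show ?thesis using pos by (auto simp: decomposes_def)
qed

text \<open>Four times a series functional is decomposed by polarization, and functionals with a
  decomposition are closed under sums and scalars.\<close>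

lemma predual_decomposes: assumes "\<omega> \<in> predual A" shows "\<exists>p. decomposes \<omega> p"
proof -
  obtain F c where F: "finite F" "\<forall>(\<xi>, \<eta>)\<in>F. l2_family (index A) \<xi> \<and> l2_family (index A) \<eta>"
    "\<omega> = (\<Sum>(\<xi>, \<eta>)\<in>F. smul1 (c (\<xi>, \<eta>)) (series_functional A \<xi> \<eta>))"
    using predual_representation[OF assms] by (elim exE conjE) (rule that)
  have one: "\<exists>p. decomposes (smul1 d (series_functional A \<xi> \<eta>)) p" if "(\<xi>, \<eta>) \<in> F" for \<xi> \<eta> d
  proof -
    have "l2_family (index A) \<xi>" "l2_family (index A) \<eta>" using F(2) that by auto
    then have "\<exists>p. decomposes (smul1 4 (series_functional A \<xi> \<eta>)) p"
      by (intro exI) (rule series_functional_polarization)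
    then have "\<exists>p. decomposes (smul1 (d / 4) (smul1 4 (series_functional A \<xi> \<eta>))) p"
      by (rule decomposes_smul)
    then show ?thesis by simp
  qed
  have "\<exists>p. decomposes 0 p"
    by (rule exI[of _ "\<lambda>k. 0"]) (simp add: decomposes_def)
  have "finite G \<Longrightarrow> G \<subseteq> F \<Longrightarrow> \<exists>p. decomposes (\<Sum>(\<xi>, \<eta>)\<in>G. smul1 (c (\<xi>, \<eta>)) (series_functional A \<xi> \<eta>)) p" for G
  proof (induction G rule: finite_induct)
    case empty
    then show ?case using \<open>\<exists>p. decomposes 0 p\<close> by (simp only: sum.empty)
  next
    case (insert a G)
    obtain \<xi> \<eta> where a: "a = (\<xi>, \<eta>)" by (cases a)
    obtain p where p: "decomposes (smul1 (c (\<xi>, \<eta>)) (series_functional A \<xi> \<eta>)) p"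
      using one insert.prems a by blast
    obtain q where q: "decomposes (\<Sum>(\<xi>, \<eta>)\<in>G. smul1 (c (\<xi>, \<eta>)) (series_functional A \<xi> \<eta>)) q"
      using insert by blast
    show ?case unfolding sum.insert[OF insert.hyps] unfolding a prod.case
      by (rule exI, rule decomposes_add[OF p q[unfolded a]])
  qed
  from this[OF F(1) order_refl] show ?thesis unfolding F(3) .
qed

end

sublocale vn_algebra \<subseteq> op_space A
  by standard auto

text \<open>Additivity and positivity make \<open>f\<close> monotone. Squeezing
  \<open>real n * t\<close> between consecutive integers shows that n times the deviation from
  linearity stays below \<open>f 1\<close> for every n.\<close>

lemma additive_nonneg_linear:
  fixes f :: "real \<Rightarrow> real"
  assumes add: "\<And>s t. 0 \<le> s \<Longrightarrow> 0 \<le> t \<Longrightarrow> f (s + t) = f s + f t" and nonneg: "\<And>t. 0 \<le> t \<Longrightarrow> 0 \<le> f t"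
    and t: "0 \<le> t"
  shows "f t = t * f 1"
proof (rule ccontr)
  assume ne: "f t \<noteq> t * f 1"
  have mult: "f (real n * s) = real n * f s" if "0 \<le> s" for n s
  proof (induction n)
    case 0
    show ?case using add[of 0 0] by simp
  next
    case (Suc n)
    have "f (real (Suc n) * s) = f (real n * s + s)" by (simp add: algebra_simps)
    also have "\<dots> = f (real n * s) + f s" using that by (intro add) auto
    finally show ?case using Suc by (simp add: algebra_simps)
  qed
  have mono: "f s \<le> f u" if "0 \<le> s" "s \<le> u" for s u
    using add[of s "u - s"] nonneg[of "u - s"] that by simp
  have bound: "\<bar>real n * (f t - t * f 1)\<bar> \<le> f 1" for n
  proof -
    define m where "m = nat \<lfloor>real n * t\<rfloor>"
    have m: "real m \<le> real n * t" "real n * t \<le> real m + 1"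
      using t by (auto simp: m_def)
    have "f (real m) \<le> f (real n * t)" "f (real n * t) \<le> f (real (Suc m))"
      using m t by (auto intro!: mono)
    then have a: "real m * f 1 \<le> real n * f t" "real n * f t \<le> real (Suc m) * f 1"
      using mult[of 1 m] mult[of 1 "Suc m"] mult[OF t, of n] by auto
    have b: "real m * f 1 \<le> (real n * t) * f 1" "(real n * t) * f 1 \<le> (real m + 1) * f 1"
      using m nonneg[of 1] by (auto intro!: mult_right_mono)
    show ?thesis using a b by (simp add: algebra_simps abs_le_iff)
  qed
  obtain n :: nat where "f 1 / \<bar>f t - t * f 1\<bar> < real n" using reals_Archimedean2 by blast
  then have "f 1 < real n * \<bar>f t - t * f 1\<bar>" using ne by (simp add: field_simps)
  then show False using bound[of n] by (simp add: abs_mult)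
qed

text \<open>Weights \<open>1 / sqrt t\<^sub>k\<close>, where \<open>t\<^sub>k\<close> is the tail of the series, keep a series summable because
  \<open>(t\<^sub>k - t\<^sub>k\<^sub>+\<^sub>1) / sqrt t\<^sub>k \<le> 2 (sqrt t\<^sub>k - sqrt t\<^sub>k\<^sub>+\<^sub>1)\<close>; adding \<open>2\<^sup>-\<^sup>k\<close> makes the tails positive.\<close>

lemma summable_weights:
  fixes a :: "nat \<Rightarrow> real"
  assumes "summable a" "\<And>k. 0 \<le> a k"
  obtains w where "\<And>k. 0 < w k" "\<And>k l. k \<le> l \<Longrightarrow> w k \<le> w l" "(\<lambda>k. 1 / w k) \<longlonglongrightarrow> 0" "summable (\<lambda>k. w k * a k)"
proof -
  define b where "b k = a k + (1 / 2) ^ k" for k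
  define t where "t m = (\<Sum>k. b (k + m))" for m
  have "summable b" unfolding b_def using assms(1) by (intro summable_add summable_geometric) auto
  moreover have "0 < b k" "a k \<le> b k" for k
    using assms(2)[of k] by (auto simp: b_def intro!: add_nonneg_pos)
  ultimately have b: "summable b" "\<And>k. 0 < b k" "\<And>k. a k \<le> b k" by blast+
  have step: "t m = b m + t (Suc m)" for m
  proof -
    have "summable (\<lambda>k. b (k + m))" using b(1) by (subst summable_iff_shift)
    from suminf_split_head[OF this] show ?thesis by (simp add: t_def)
  qed
  have tpos: "0 < t m" for m
    unfolding t_def by (rule suminf_pos) (use b summable_iff_shift in blast)+
  have tdec: "t l \<le> t k" if "k \<le> l" for k l
    using that
  proof (induction rule: dec_induct)
    case (step n)
    then show ?case using \<open>\<And>m. t m = b m + t (Suc m)\<close>[of n] b(2)[of n] by simp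
  qed simp
  have tlim: "t \<longlonglongrightarrow> 0" unfolding t_def by (rule suminf_exist_split2[OF b(1)])
  define w where "w k = 1 / sqrt (t k)" for k
  have "summable (\<lambda>k. w k * b k)"
  proof (rule bounded_imp_summable)
    show "0 \<le> w k * b k" for k using b(2)[of k] tpos[of k] by (simp add: w_def less_imp_le)
    have one: "w k * b k \<le> 2 * (sqrt (t k) - sqrt (t (Suc k)))" for k
    proof -
      have s: "sqrt (t k) > 0" "sqrt (t (Suc k)) \<le> sqrt (t k)" using tpos tdec[of k "Suc k"] by auto
      have "b k = sqrt (t k) * sqrt (t k) - sqrt (t (Suc k)) * sqrt (t (Suc k))"
        using step[of k] tpos[of k] tpos[of "Suc k"] by simp
      also have "\<dots> = (sqrt (t k) - sqrt (t (Suc k))) * (sqrt (t k) + sqrt (t (Suc k)))"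
        by (simp add: algebra_simps)
      also have "\<dots> \<le> (sqrt (t k) - sqrt (t (Suc k))) * (2 * sqrt (t k))"
        using s by (intro mult_left_mono) auto
      finally have "b k \<le> (2 * (sqrt (t k) - sqrt (t (Suc k)))) * sqrt (t k)" by (simp add: mult_ac)
      then show ?thesis using s by (simp add: w_def divide_le_eq)
    qed
    show "(\<Sum>k\<le>n. w k * b k) \<le> 2 * sqrt (t 0)" for n
    proof -
      have "(\<Sum>k\<le>n. w k * b k) \<le> (\<Sum>k\<le>n. 2 * (sqrt (t k) - sqrt (t (Suc k))))"
        by (rule sum_mono) (rule one)
      also have "\<dots> = 2 * (sqrt (t 0) - sqrt (t (Suc n)))"
        using sum_telescope[of "\<lambda>k. 2 * sqrt (t k)" n] by (simp add: right_diff_distrib)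
      also have "\<dots> \<le> 2 * sqrt (t 0)" using tpos[of "Suc n"] by simp
      finally show ?thesis .
    qed
  qed
  moreover have "w k > 0" for k using tpos[of k] by (simp add: w_def)
  moreover have "w k \<le> w l" if "k \<le> l" for k l
    using tpos tdec[OF that] by (simp add: w_def frac_le)
  moreover have "(\<lambda>k. 1 / w k) \<longlonglongrightarrow> 0"
    using tendsto_real_sqrt[OF tlim] by (simp add: w_def)
  ultimately show ?thesis
  proof (intro that[of w])
    assume s: "summable (\<lambda>k. w k * b k)" and w: "\<And>k. w k > 0"
    show "summable (\<lambda>k. w k * a k)"
      by (rule summable_comparison_test'[OF s, of 0])
        (use assms(2) w b(3) in \<open>auto simp: abs_mult less_imp_le intro!: mult_left_mono\<close>)
  qed auto
qed

section \<open>Order, selfadjoint parts and bounds for positive functionals\<close>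

context vn_algebra
begin

text \<open>The quadratic form of a selfadjoint operator is real and at most \<open>C\<close> times
  the squared norm in absolute value. This supplies the positive elements on which functionals are
  compared.\<close>

lemma selfadjoint_shift:
  assumes x: "x \<in> bounded_ops (index A)" and sa: "adj (index A) x = x"
    and C: "\<And>f. f \<in> l2 (index A) \<Longrightarrow> norm2 (x f) \<le> C * norm2 f"
  shows "positive_op (index A) (smul2 (complex_of_real C) (id_op (index A)) + x)"
    "positive_op (index A) (smul2 (complex_of_real C) (id_op (index A)) - x)"
proof -
  have "inner2 ((smul2 (complex_of_real C) (id_op (index A)) + x) f) f \<in> \<real>\<^sub>\<ge>\<^sub>0 \<and>
      inner2 ((smul2 (complex_of_real C) (id_op (index A)) - x) f) f \<in> \<real>\<^sub>\<ge>\<^sub>0" if f: "f \<in> l2 (index A)" for f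
  proof -
    have "cnj (inner2 (x f) f) = inner2 (x f) f"
      using inner2_adj_right[OF x f f] sa by (simp add: inner2_cnj)
    then have r: "inner2 (x f) f = complex_of_real (Re (inner2 (x f) f))"
      by (metis Reals_cnj_iff of_real_Re)
    have "\<bar>Re (inner2 (x f) f)\<bar> \<le> cmod (inner2 (x f) f)" by (rule abs_Re_le_cmod)
    also have "\<dots> \<le> norm2 (x f) * norm2 f" using x f by (intro inner2_cauchy_schwarz[of _ "index A"]) auto
    also have "\<dots> \<le> C * norm2 f * norm2 f" using C[OF f] by (intro mult_right_mono) auto
    finally have b: "\<bar>Re (inner2 (x f) f)\<bar> \<le> C * (norm2 f)\<^sup>2" by (simp add: power2_eq_square mult.assoc)
    have e: "inner2 ((smul2 (complex_of_real C) (id_op (index A)) + x) f) f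
        = complex_of_real (C * (norm2 f)\<^sup>2 + Re (inner2 (x f) f))"
      "inner2 ((smul2 (complex_of_real C) (id_op (index A)) - x) f) f
        = complex_of_real (C * (norm2 f)\<^sup>2 - Re (inner2 (x f) f))"
      using f x r by (simp_all add: inner2_simps[where I="index A"] inner2_scalar_simps inner2_self)
    show ?thesis unfolding e nonneg_Reals_of_real_iff using b by linarith
  qed
  then show "positive_op (index A) (smul2 (complex_of_real C) (id_op (index A)) + x)"
    "positive_op (index A) (smul2 (complex_of_real C) (id_op (index A)) - x)"
    using x by (auto simp: positive_op_def simp del: fun_apply2)
qed

definition real_part :: "'i opr \<Rightarrow> 'i opr" where
  "real_part x = smul2 (1 / 2) (x + adj (index A) x)"

definition imag_part :: "'i opr \<Rightarrow> 'i opr" where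
  "imag_part x = smul2 (1 / (2 * \<i>)) (x - adj (index A) x)"

lemma real_imag_part:
  assumes "x \<in> elems A"
  shows "real_part x \<in> elems A" "imag_part x \<in> elems A" "adj (index A) (real_part x) = real_part x"
    "adj (index A) (imag_part x) = imag_part x" "x = real_part x + smul2 \<i> (imag_part x)"
    "adj (index A) x = real_part x - smul2 \<i> (imag_part x)"
proof -
  show "real_part x \<in> elems A" "imag_part x \<in> elems A"
    using assms by (auto simp: real_part_def imag_part_def)
  show "adj (index A) (real_part x) = real_part x"
    using assms by (simp add: real_part_def adj_smul adj_add add.commute)
  have "adj (index A) (imag_part x) = smul2 (cnj (1 / (2 * \<i>))) (adj (index A) x - x)"
    using assms unfolding imag_part_def by (subst adj_smul) (simp_all add: adj_diff)
  also have "\<dots> = imag_part x" by (auto simp: imag_part_def fun_eq_iff algebra_simps)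
  finally show "adj (index A) (imag_part x) = imag_part x" .
  show "x = real_part x + smul2 \<i> (imag_part x)" "adj (index A) x = real_part x - smul2 \<i> (imag_part x)"
    by (auto simp: real_part_def imag_part_def fun_eq_iff field_simps)
qed

text \<open>All claims follow from the positivity of c + h and c - h, where c is a large multiple of
  the identity. The constant depends on \<open>h\<close> alone and serves all functionals at
  once.\<close>

lemma positive_selfadjoint:
  assumes h: "h \<in> elems A" "adj (index A) h = h"
  obtains C where "0 \<le> C" "\<And>\<omega>. \<omega> \<in> predual_pos A \<Longrightarrow> \<omega> h = complex_of_real (Re (\<omega> h))"
    "\<And>\<omega>. \<omega> \<in> predual_pos A \<Longrightarrow> \<bar>Re (\<omega> h)\<bar> \<le> C * Re (\<omega> (id_op (index A)))"
    "\<And>\<omega> \<rho>. \<omega> \<in> predual A \<Longrightarrow> \<rho> \<in> predual A \<Longrightarrow>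
      (\<And>b. b \<in> elems A \<Longrightarrow> positive_op (index A) b \<Longrightarrow> \<omega> b = \<rho> b) \<Longrightarrow> \<omega> h = \<rho> h"
proof -
  obtain C where C: "0 \<le> C" "\<And>f. f \<in> l2 (index A) \<Longrightarrow> norm2 (h f) \<le> C * norm2 f"
    using bop_bound[OF elems_bop[OF h(1)]] by blast
  define c where "c = smul2 (complex_of_real C) (id_op (index A))"
  have c: "c \<in> elems A" by (simp add: c_def)
  have pos: "positive_op (index A) (c + h)" "positive_op (index A) (c - h)"
    unfolding c_def by (rule selfadjoint_shift; use h C in auto)+
  have mem: "c + h \<in> elems A" "c - h \<in> elems A" using c h by auto
  have c_val: "\<omega> c = complex_of_real C * \<omega> (id_op (index A))" if "\<omega> \<in> predual A" for \<omega>
    using that by (simp add: c_def predual_scale)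
  have pm: "\<omega> (c + h) = \<omega> c + \<omega> h" "\<omega> (c - h) = \<omega> c - \<omega> h" if "\<omega> \<in> predual A" for \<omega>
    using that c h by (auto simp: predual_plus predual_minus)
  have real: "\<omega> h = complex_of_real (Re (\<omega> h)) \<and> \<bar>Re (\<omega> h)\<bar> \<le> C * Re (\<omega> (id_op (index A)))"
    if w: "\<omega> \<in> predual_pos A" for \<omega>
  proof -
    have "\<omega> c + \<omega> h \<in> \<real>\<^sub>\<ge>\<^sub>0" "\<omega> c - \<omega> h \<in> \<real>\<^sub>\<ge>\<^sub>0"
      using predual_pos_nonneg[OF w mem(1) pos(1)] predual_pos_nonneg[OF w mem(2) pos(2)]
        pm[OF predual_pos_predual[OF w]] by auto
    then show ?thesis using c_val[OF predual_pos_predual[OF w]]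
      by (auto simp: complex_nonneg_Reals_iff complex_eq_iff)
  qed
  have eq: "\<omega> h = \<rho> h" if w: "\<omega> \<in> predual A" "\<rho> \<in> predual A"
    and e: "\<And>b. b \<in> elems A \<Longrightarrow> positive_op (index A) b \<Longrightarrow> \<omega> b = \<rho> b" for \<omega> \<rho>
  proof -
    have "\<omega> (c + h) - \<omega> (c - h) = \<rho> (c + h) - \<rho> (c - h)"
      using e mem pos by simp
    then show ?thesis using pm[OF w(1)] pm[OF w(2)] by simp
  qed
  show ?thesis using that[of C] C(1) real eq by blast
qed

lemma predual_eq_on_positive:
  assumes w: "\<omega> \<in> predual A" "\<rho> \<in> predual A"
    and e: "\<And>b. b \<in> elems A \<Longrightarrow> positive_op (index A) b \<Longrightarrow> \<omega> b = \<rho> b"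
  shows "\<omega> = \<rho>"
proof (rule predual_eqI[OF w])
  fix x assume x: "x \<in> elems A"
  note ri = real_imag_part[OF x]
  have "\<omega> (real_part x) = \<rho> (real_part x)"
    by (rule positive_selfadjoint[OF ri(1,3)]) (use w e in blast)
  moreover have "\<omega> (imag_part x) = \<rho> (imag_part x)"
    by (rule positive_selfadjoint[OF ri(2,4)]) (use w e in blast)
  ultimately show "\<omega> x = \<rho> x"
    using w ri(1,2) by (subst (1 2) ri(5)) (simp add: predual_plus predual_scale)
qed

lemma predual_pos_adj:
  assumes w: "\<omega> \<in> predual_pos A" and x: "x \<in> elems A"
  shows "\<omega> (adj (index A) x) = cnj (\<omega> x)"
proof -
  note ri = real_imag_part[OF x]
  have "cnj (\<omega> (real_part x)) = \<omega> (real_part x)"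
    by (rule positive_selfadjoint[OF ri(1,3)]) (use w in \<open>metis complex_cnj_complex_of_real\<close>)
  moreover have "cnj (\<omega> (imag_part x)) = \<omega> (imag_part x)"
    by (rule positive_selfadjoint[OF ri(2,4)]) (use w in \<open>metis complex_cnj_complex_of_real\<close>)
  ultimately show ?thesis
    using w ri(1,2) by (subst ri(6), subst (3) ri(5)) (simp add: predual_plus predual_minus predual_scale)
qed

text \<open>Splitting into selfadjoint parts reduces this to \<open>positive_selfadjoint\<close>.
  Since \<open>K\<close> does not depend on \<omega>, smallness at the identity gives smallness at
  \<open>x\<close>.\<close>

lemma positive_functional_bound:
  assumes x: "x \<in> elems A"
  obtains K where "0 \<le> K" "\<And>\<omega>. \<omega> \<in> predual_pos A \<Longrightarrow> cmod (\<omega> x) \<le> K * Re (\<omega> (id_op (index A)))"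
proof -
  note ri = real_imag_part[OF x]
  obtain C where C: "0 \<le> C" "\<And>\<omega>. \<omega> \<in> predual_pos A \<Longrightarrow> \<omega> (real_part x) = complex_of_real (Re (\<omega> (real_part x)))"
    "\<And>\<omega>. \<omega> \<in> predual_pos A \<Longrightarrow> \<bar>Re (\<omega> (real_part x))\<bar> \<le> C * Re (\<omega> (id_op (index A)))"
    by (rule positive_selfadjoint[OF ri(1,3)]) blast
  obtain D where D: "0 \<le> D" "\<And>\<omega>. \<omega> \<in> predual_pos A \<Longrightarrow> \<omega> (imag_part x) = complex_of_real (Re (\<omega> (imag_part x)))"
    "\<And>\<omega>. \<omega> \<in> predual_pos A \<Longrightarrow> \<bar>Re (\<omega> (imag_part x))\<bar> \<le> D * Re (\<omega> (id_op (index A)))"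
    by (rule positive_selfadjoint[OF ri(2,4)]) blast
  show ?thesis
  proof (rule that[of "C + D"])
    fix \<omega> assume w: "\<omega> \<in> predual_pos A"
    have "\<omega> x = \<omega> (real_part x) + \<i> * \<omega> (imag_part x)"
      using w ri(1,2) by (subst ri(5)) (simp add: predual_plus predual_scale)
    then have "cmod (\<omega> x) \<le> cmod (\<omega> (real_part x)) + cmod (\<omega> (imag_part x))"
      using norm_triangle_ineq[of "\<omega> (real_part x)" "\<i> * \<omega> (imag_part x)"] by (simp add: norm_mult)
    also have "cmod (\<omega> (real_part x)) = \<bar>Re (\<omega> (real_part x))\<bar>" by (subst C(2)[OF w]) simp
    also have "cmod (\<omega> (imag_part x)) = \<bar>Re (\<omega> (imag_part x))\<bar>" by (subst D(2)[OF w]) simp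
    finally show "cmod (\<omega> x) \<le> (C + D) * Re (\<omega> (id_op (index A)))"
      using C(3)[OF w] D(3)[OF w] by (simp add: algebra_simps)
  qed (use C D in simp)
qed

lemma id_positive: "positive_op (index A) (id_op (index A))"
  by (auto simp: positive_op_def inner2_self nonneg_Reals_of_real_iff simp del: of_real_power)

lemma pos_id_real:
  assumes "\<omega> \<in> predual_pos A"
  shows "0 \<le> Re (\<omega> (id_op (index A)))"
  using predual_pos_nonneg[OF assms _ id_positive] by (auto simp: complex_nonneg_Reals_iff)


end

section \<open>Additive maps of the positive cone\<close>

text \<open>An additive map of the cone of positive normal functionals extends to a complex linear map
  \<open>T\<close> of the predual, whose adjoint \<open>R\<close> acts on the algebra.\<close>

locale cone_map = vn_algebra A for A :: "'i opalg" +
  fixes \<theta> :: "('i opr \<Rightarrow> complex) \<Rightarrow> 'i opr \<Rightarrow> complex"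
  assumes cone: "\<omega> \<in> predual_pos A \<Longrightarrow> \<theta> \<omega> \<in> predual_pos A"
    and additive: "\<omega> \<in> predual_pos A \<Longrightarrow> \<rho> \<in> predual_pos A \<Longrightarrow> \<theta> (\<omega> + \<rho>) = \<theta> \<omega> + \<theta> \<rho>"
begin

lemma theta_zero: "\<theta> 0 = 0"
  using additive[OF zero_pos zero_pos] by simp

text \<open>At a fixed positive \<open>b\<close> the value of the image of t \<omega> is additive
  and nonnegative in t \<ge> 0, hence linear; positive elements determine a normal
  functional.\<close>

lemma theta_scale:
  assumes w: "\<omega> \<in> predual_pos A" and t: "0 \<le> t"
  shows "\<theta> (smul1 (complex_of_real t) \<omega>) = smul1 (complex_of_real t) (\<theta> \<omega>)"
proof (rule predual_eq_on_positive)
  show "\<theta> (smul1 (complex_of_real t) \<omega>) \<in> predual A" "smul1 (complex_of_real t) (\<theta> \<omega>) \<in> predual A"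
    using w t by (auto intro!: predual_pos_predual cone)
  fix b assume b: "b \<in> elems A" "positive_op (index A) b"
  define f where "f s = Re (\<theta> (smul1 (complex_of_real s) \<omega>) b)" for s
  have r: "\<theta> (smul1 (complex_of_real s) \<omega>) b = complex_of_real (f s) \<and> 0 \<le> f s" if "0 \<le> s" for s
    using predual_pos_nonneg[OF cone[OF smul_pos[OF w that]] b]
    by (auto simp: f_def complex_nonneg_Reals_iff complex_eq_iff)
  have "f t = t * f 1"
  proof (rule additive_nonneg_linear[OF _ _ t])
    fix s u :: real assume "0 \<le> s" "0 \<le> u"
    then have "\<theta> (smul1 (complex_of_real s) \<omega> + smul1 (complex_of_real u) \<omega>)
        = \<theta> (smul1 (complex_of_real s) \<omega>) + \<theta> (smul1 (complex_of_real u) \<omega>)"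
      using w by (intro additive smul_pos)
    then show "f (s + u) = f s + f u"
      unfolding f_def of_real_add smul1_add_left by simp
  qed (use r in auto)
  then show "\<theta> (smul1 (complex_of_real t) \<omega>) b = smul1 (complex_of_real t) (\<theta> \<omega>) b"
    using r[OF t] r[of 1] by simp
qed

definition combine :: "(nat \<Rightarrow> 'i opr \<Rightarrow> complex) \<Rightarrow> 'i opr \<Rightarrow> complex" where
  "combine p = \<theta> (p 0) - \<theta> (p 1) + smul1 \<i> (\<theta> (p 2)) - smul1 \<i> (\<theta> (p 3))"

definition T :: "('i opr \<Rightarrow> complex) \<Rightarrow> 'i opr \<Rightarrow> complex" where
  "T \<omega> = combine (SOME p. decomposes \<omega> p)"

text \<open>On positive elements all values are real, so real and imaginary parts separate into
  \<open>p 0 + q 1 = q 0 + p 1\<close> and \<open>p 2 + q 3 = q 2 + p 3\<close>. These are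
  identities in the cone, where \<theta> is additive.\<close>

lemma combine_unique:
  assumes p: "decomposes \<omega> p" and q: "decomposes \<omega> q"
  shows "combine p = combine q"
proof -
  have nonneg: "p k b \<in> \<real>\<^sub>\<ge>\<^sub>0" "q k b \<in> \<real>\<^sub>\<ge>\<^sub>0" if "b \<in> elems A" "positive_op (index A) b" for k b
    using predual_pos_nonneg[OF decomposes_pos[OF p] that] predual_pos_nonneg[OF decomposes_pos[OF q] that] by auto
  have eq: "p 0 b - p 1 b + \<i> * p 2 b - \<i> * p 3 b = q 0 b - q 1 b + \<i> * q 2 b - \<i> * q 3 b" for b
    using decomposes_apply[OF p, of b] decomposes_apply[OF q, of b] by simp
  have "p 0 + q 1 = q 0 + p 1 \<and> p 2 + q 3 = q 2 + p 3"
  proof (intro conjI predual_eq_on_positive)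
    fix b assume b: "b \<in> elems A" "positive_op (index A) b"
    note n = nonneg[OF b]
    have im: "Im (p k b) = 0" "Im (q k b) = 0" for k using n[of k] by (auto simp: complex_nonneg_Reals_iff)
    show "(p 0 + q 1) b = (q 0 + p 1) b" "(p 2 + q 3) b = (q 2 + p 3) b"
      using arg_cong[OF eq[of b], of Re] arg_cong[OF eq[of b], of Im] im by (auto simp: complex_eq_iff)
  qed (use p q decomposes_pos in \<open>auto intro!: predual_pos_predual add_pos\<close>)
  then have "\<theta> (p 0 + q 1) = \<theta> (q 0 + p 1)" "\<theta> (p 2 + q 3) = \<theta> (q 2 + p 3)" by auto
  then have e: "\<theta> (p 0) + \<theta> (q 1) = \<theta> (q 0) + \<theta> (p 1)" "\<theta> (p 2) + \<theta> (q 3) = \<theta> (q 2) + \<theta> (p 3)"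
    using additive[OF decomposes_pos[OF p] decomposes_pos[OF q]] additive[OF decomposes_pos[OF q] decomposes_pos[OF p]]
    by auto
  show ?thesis
  proof
    fix x
    have "\<theta> (p 0) x - \<theta> (p 1) x = \<theta> (q 0) x - \<theta> (q 1) x"
      using fun_cong[OF e(1), of x] by (simp add: algebra_simps)
    moreover have "\<theta> (p 2) x - \<theta> (p 3) x = \<theta> (q 2) x - \<theta> (q 3) x"
      using fun_cong[OF e(2), of x] by (simp add: algebra_simps)
    then have "\<i> * \<theta> (p 2) x - \<i> * \<theta> (p 3) x = \<i> * \<theta> (q 2) x - \<i> * \<theta> (q 3) x"
      by (simp only: right_diff_distrib[symmetric])
    ultimately show "combine p x = combine q x"
      unfolding combine_def fun_apply1 smul1_apply by (metis add_diff_eq)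
  qed
qed

lemma T_eq: "decomposes \<omega> p \<Longrightarrow> T \<omega> = combine p"
  unfolding T_def by (rule combine_unique[OF someI[of "decomposes \<omega>"]])

lemma T_predual [simp, intro]: assumes "\<omega> \<in> predual A" shows "T \<omega> \<in> predual A"
proof -
  obtain p where p: "decomposes \<omega> p" using predual_decomposes[OF assms] by blast
  show ?thesis unfolding T_eq[OF p] combine_def
    by (intro diff_predual add_predual smul_predual predual_pos_predual cone decomposes_pos[OF p])
qed

lemma T_pos: assumes "\<omega> \<in> predual_pos A" shows "T \<omega> = \<theta> \<omega>"
proof -
  have "decomposes \<omega> (\<lambda>k. if k = 0 then \<omega> else 0)"
    by (rule decomposesI) (use assms in auto)
  then have "T \<omega> = combine (\<lambda>k. if k = 0 then \<omega> else 0)" by (rule T_eq)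
  then show ?thesis by (simp add: combine_def theta_zero)
qed

lemma T_add: assumes "\<omega> \<in> predual A" "\<rho> \<in> predual A" shows "T (\<omega> + \<rho>) = T \<omega> + T \<rho>"
proof -
  obtain p q where p: "decomposes \<omega> p" and q: "decomposes \<rho> q"
    using predual_decomposes[OF assms(1)] predual_decomposes[OF assms(2)] by blast
  show ?thesis
    unfolding T_eq[OF p] T_eq[OF q] T_eq[OF decomposes_add[OF p q]] combine_def
      additive[OF decomposes_pos[OF p] decomposes_pos[OF q]] smul1_add
    by (simp add: algebra_simps)
qed

lemma T_smul: assumes w: "\<omega> \<in> predual A" shows "T (smul1 c \<omega>) = smul1 c (T \<omega>)"
proof -
  have scale: "T (smul1 (complex_of_real r) \<omega>) = smul1 (complex_of_real r) (T \<omega>)"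
    if r: "0 \<le> r" and w': "\<omega> \<in> predual A" for r \<omega>
  proof -
    obtain p where p: "decomposes \<omega> p" using predual_decomposes[OF w'] by blast
    show ?thesis
      unfolding T_eq[OF p] T_eq[OF decomposes_scale[OF p r]] combine_def
        theta_scale[OF decomposes_pos[OF p] r]
      by (auto simp: fun_eq_iff algebra_simps)
  qed
  have i: "T (smul1 \<i> \<omega>) = smul1 \<i> (T \<omega>)" if w': "\<omega> \<in> predual A" for \<omega>
  proof -
    obtain p where p: "decomposes \<omega> p" using predual_decomposes[OF w'] by blast
    show ?thesis
      unfolding T_eq[OF p] T_eq[OF decomposes_i[OF p]] combine_def
      by (auto simp: fun_eq_iff algebra_simps)
  qed
  have minus: "T (- \<omega>) = - T \<omega>" if w': "\<omega> \<in> predual A" for \<omega>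
  proof -
    obtain p where p: "decomposes \<omega> p" using predual_decomposes[OF w'] by blast
    show ?thesis
      unfolding T_eq[OF p] T_eq[OF decomposes_minus[OF p]] combine_def
      by (auto simp: fun_eq_iff algebra_simps)
  qed
  have *: "T (if b then smul1 (complex_of_real \<bar>r\<bar>) \<omega> else - smul1 (complex_of_real \<bar>r\<bar>) \<omega>)
      = (if b then smul1 (complex_of_real \<bar>r\<bar>) (T \<omega>) else - smul1 (complex_of_real \<bar>r\<bar>) (T \<omega>))"
    "(if b then smul1 (complex_of_real \<bar>r\<bar>) \<omega> else - smul1 (complex_of_real \<bar>r\<bar>) \<omega>) \<in> predual A" for b r
    using w scale[of "\<bar>r\<bar>" \<omega>] minus[of "smul1 (complex_of_real \<bar>r\<bar>) \<omega>"] by auto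
  show ?thesis
    unfolding smul1_decomposed[of c \<omega>] smul1_decomposed[of c "T \<omega>"]
    by (subst T_add, (intro *(2) smul_predual)+, subst i, rule *(2), subst (1 2) *(1), rule refl)
qed

lemma T_sum:
  assumes "finite F" "\<And>a. a \<in> F \<Longrightarrow> \<omega> a \<in> predual A"
  shows "T (sum \<omega> F) = (\<Sum>a\<in>F. T (\<omega> a))"
  using assms
proof (induction F rule: finite_induct)
  case empty
  show ?case unfolding sum.empty using T_pos[OF zero_pos] theta_zero by (rule trans)
next
  case (insert a F)
  have "T (\<omega> a + sum \<omega> F) = T (\<omega> a) + T (sum \<omega> F)"
    using insert.prems by (intro T_add sum_predual) blast+
  also have "T (sum \<omega> F) = (\<Sum>a\<in>F. T (\<omega> a))" using insert by blast
  finally show ?case unfolding sum.insert[OF insert.hyps] .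
qed

abbreviation "I \<equiv> index A"

lemma series_shift:
  assumes "l2_family I \<xi>"
  shows "series_functional A (\<lambda>k. \<xi> (k + m)) (\<lambda>k. \<xi> (k + m)) =
    vec_functional A (\<xi> m) (\<xi> m) + series_functional A (\<lambda>k. \<xi> (k + Suc m)) (\<lambda>k. \<xi> (k + Suc m))"
proof
  fix x
  show "series_functional A (\<lambda>k. \<xi> (k + m)) (\<lambda>k. \<xi> (k + m)) x =
    (vec_functional A (\<xi> m) (\<xi> m) + series_functional A (\<lambda>k. \<xi> (k + Suc m)) (\<lambda>k. \<xi> (k + Suc m))) x"
  proof (cases "x \<in> elems A")
    case True
    have "summable (\<lambda>k. inner2 (x (\<xi> k)) (\<xi> k))"
      using series_summable[OF elem_bop[OF True] assms assms] .
    then have "summable (\<lambda>k. inner2 (x (\<xi> (k + m))) (\<xi> (k + m)))"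
      by (subst summable_iff_shift[where f="\<lambda>k. inner2 (x (\<xi> k)) (\<xi> k)"])
    from suminf_split_head[OF this] show ?thesis using True
      by (simp add: series_functional_def vec_functional_def)
  qed (simp add: series_functional_def vec_functional_def)
qed

lemma l2_family_shift: "l2_family J \<xi> \<Longrightarrow> l2_family J (\<lambda>k. \<xi> (k + m))"
  unfolding l2_family_def
  by (auto simp: summable_iff_shift[where f="\<lambda>k. (norm2 (\<xi> k))\<^sup>2"])

abbreviation "one \<equiv> id_op I"

text \<open>The value at the identity of the image of the m-th tail. By
  \<open>positive_functional_bound\<close> it controls the image of the tail at every element, which
  stands in for continuity of \<theta>.\<close>

definition tail_mass :: "(nat \<Rightarrow> 'i vec) \<Rightarrow> nat \<Rightarrow> real" where
  "tail_mass \<xi> m = Re (\<theta> (series_functional A (\<lambda>k. \<xi> (k + m)) (\<lambda>k. \<xi> (k + m))) one)"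

lemma tail_pos:
  "l2_family I \<xi> \<Longrightarrow> series_functional A (\<lambda>k. \<xi> (k + m)) (\<lambda>k. \<xi> (k + m)) \<in> predual_pos A"
  by (intro series_functional_pos l2_family_shift)

lemma theta_series_shift:
  assumes "l2_family I \<xi>"
  shows "\<theta> (series_functional A (\<lambda>k. \<xi> (k + m)) (\<lambda>k. \<xi> (k + m))) =
    \<theta> (vec_functional A (\<xi> m) (\<xi> m)) + \<theta> (series_functional A (\<lambda>k. \<xi> (k + Suc m)) (\<lambda>k. \<xi> (k + Suc m)))"
  using assms unfolding series_shift[OF assms, of m]
  by (intro additive vec_functional_pos tail_pos) (auto simp: l2_family_l2)

lemma tail_mass_step:
  assumes "l2_family I \<xi>"
  shows "tail_mass \<xi> m = Re (\<theta> (vec_functional A (\<xi> m) (\<xi> m)) one) + tail_mass \<xi> (Suc m)"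
  unfolding tail_mass_def theta_series_shift[OF assms, of m] by simp

lemma tail_mass_nonneg: "l2_family I \<xi> \<Longrightarrow> 0 \<le> tail_mass \<xi> m"
  unfolding tail_mass_def by (intro pos_id_real cone tail_pos)

lemma theta_vec_nonneg: "f \<in> l2 I \<Longrightarrow> 0 \<le> Re (\<theta> (vec_functional A f f) one)"
  by (intro pos_id_real cone vec_functional_pos)

lemma tail_mass_le: "l2_family I \<xi> \<Longrightarrow> tail_mass \<xi> m \<le> tail_mass \<xi> 0"
proof (induction m)
  case (Suc m)
  then show ?case using tail_mass_step[of \<xi> m] theta_vec_nonneg[OF l2_family_l2[of I \<xi> m]] by simp
qed simp

lemma vec_functional_scale:
  "vec_functional A (smul1 c f) (smul1 c f) = smul1 (complex_of_real ((cmod c)\<^sup>2)) (vec_functional A f f)"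
  if f: "f \<in> l2 I"
proof
  fix x
  have "cnj c * c = complex_of_real ((cmod c)\<^sup>2)" by (simp only: complex_norm_square mult.commute)
  then show "vec_functional A (smul1 c f) (smul1 c f) x = smul1 (complex_of_real ((cmod c)\<^sup>2)) (vec_functional A f f) x"
    using f bop_smul[OF elem_bop, of x f c]
    by (simp add: vec_functional_def inner2_scalar_simps mult.assoc[symmetric] del: of_real_power)
qed

text \<open>Gliding hump: vectors violating the bound more and more would sum up to a normal functional
  whose image has infinite mass.\<close>

lemma theta_bound: "\<exists>C\<ge>0. \<forall>f\<in>l2 I. Re (\<theta> (vec_functional A f f) one) \<le> C * (norm2 f)\<^sup>2"
proof (rule ccontr)
  assume neg: "\<not> ?thesis"
  have "\<exists>f\<in>l2 I. real k * 4 ^ k * (norm2 f)\<^sup>2 < Re (\<theta> (vec_functional A f f) one)" for k :: nat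
  proof (rule ccontr)
    assume "\<not> ?thesis"
    then have "0 \<le> real k * 4 ^ k \<and> (\<forall>f\<in>l2 I. Re (\<theta> (vec_functional A f f) one) \<le> real k * 4 ^ k * (norm2 f)\<^sup>2)"
      by (auto simp: not_less)
    then show False using neg by blast
  qed
  then obtain \<zeta> where \<zeta>: "\<And>k. \<zeta> k \<in> l2 I"
    "\<And>k. real k * 4 ^ k * (norm2 (\<zeta> k))\<^sup>2 < Re (\<theta> (vec_functional A (\<zeta> k) (\<zeta> k)) one)"
    by metis
  have nz: "norm2 (\<zeta> k) \<noteq> 0" for k
  proof
    assume "norm2 (\<zeta> k) = 0"
    then have "\<zeta> k = 0" using norm2_eq_0[OF \<zeta>(1)[of k]] by simp
    moreover have "vec_functional A (0 :: 'i vec) 0 = 0" by (auto simp: vec_functional_def fun_eq_iff)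
    ultimately show False using \<zeta>(2)[of k] theta_zero by simp
  qed
  \<comment> \<open>Normalises the squared norm of \<open>\<xi> k\<close> to
    \<open>(1 / 4) ^ k\<close>, which is summable, while the factor \<open>4 ^ k\<close> in the
    choice of \<open>\<zeta> k\<close> still leaves a mass above k.\<close>
  define c where "c k = 1 / (2 ^ k * norm2 (\<zeta> k))" for k
  define \<xi> where "\<xi> k = smul1 (complex_of_real (c k)) (\<zeta> k)" for k
  have c2: "(c k)\<^sup>2 * (norm2 (\<zeta> k))\<^sup>2 = (1 / 4) ^ k" for k
  proof -
    have "(2 ^ k)\<^sup>2 = (4 :: real) ^ k" by (simp add: power2_eq_square flip: power_mult_distrib)
    then show ?thesis using nz[of k] by (simp add: c_def power_divide power_mult_distrib)
  qed
  have fam: "l2_family I \<xi>"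
  proof (rule l2_familyI)
    have "(\<lambda>k. (norm2 (\<xi> k))\<^sup>2) = (\<lambda>k. (1 / 4 :: real) ^ k)"
      using c2 by (simp add: \<xi>_def norm2_smul power_mult_distrib)
    then show "summable (\<lambda>k. (norm2 (\<xi> k))\<^sup>2)" by simp
  qed (use \<zeta>(1) in \<open>auto simp: \<xi>_def\<close>)
  have large: "real k < Re (\<theta> (vec_functional A (\<xi> k) (\<xi> k)) one)" for k
  proof -
    have "real k = (c k)\<^sup>2 * (real k * 4 ^ k * (norm2 (\<zeta> k))\<^sup>2)"
    proof -
      have "(c k)\<^sup>2 * (real k * 4 ^ k * (norm2 (\<zeta> k))\<^sup>2) = real k * 4 ^ k * ((c k)\<^sup>2 * (norm2 (\<zeta> k))\<^sup>2)"
        by (simp add: mult_ac)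
      then show ?thesis unfolding c2 by (simp add: power_divide)
    qed
    also have "\<dots> < (c k)\<^sup>2 * Re (\<theta> (vec_functional A (\<zeta> k) (\<zeta> k)) one)"
      using \<zeta>(2)[of k] nz[of k] by (intro mult_strict_left_mono) (auto simp: c_def)
    also have "\<dots> = Re (\<theta> (smul1 (complex_of_real ((cmod (complex_of_real (c k)))\<^sup>2)) (vec_functional A (\<zeta> k) (\<zeta> k))) one)"
      using \<zeta>(1)[of k] by (subst theta_scale) (auto simp: Re_complex_of_real simp del: of_real_power)
    also have "\<dots> = Re (\<theta> (vec_functional A (\<xi> k) (\<xi> k)) one)"
      unfolding \<xi>_def vec_functional_scale[OF \<zeta>(1)] ..
    finally show ?thesis .
  qed
  obtain k :: nat where "tail_mass \<xi> 0 < real k" using reals_Archimedean2 by blast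
  moreover have "Re (\<theta> (vec_functional A (\<xi> k) (\<xi> k)) one) \<le> tail_mass \<xi> 0"
    using tail_mass_step[OF fam, of k] tail_mass_nonneg[OF fam, of "Suc k"] tail_mass_le[OF fam, of k] by simp
  ultimately show False using large[of k] by simp
qed

text \<open>The family \<zeta>, which is \<xi> multiplied by square roots of growing weights, is
  still square summable. As the weights increase, the m-th tail of \<zeta> dominates
  \<open>w m\<close> times that of \<xi>, so \<open>tail_mass \<xi> m\<close> is at most
  \<open>tail_mass \<zeta> 0 / w m\<close>.\<close>

lemma tail_mass_tendsto:
  assumes fam: "l2_family I \<xi>"
  shows "tail_mass \<xi> \<longlonglongrightarrow> 0"
proof -
  obtain w where w: "\<And>k. 0 < w k" "\<And>k l. k \<le> l \<Longrightarrow> w k \<le> w l" "(\<lambda>k. 1 / w k) \<longlonglongrightarrow> 0"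
    "summable (\<lambda>k. w k * (norm2 (\<xi> k))\<^sup>2)"
    by (rule summable_weights[of "\<lambda>k. (norm2 (\<xi> k))\<^sup>2"]) (use fam in \<open>auto simp: l2_family_def\<close>)
  define \<zeta> where "\<zeta> k = smul1 (complex_of_real (sqrt (w k))) (\<xi> k)" for k
  have fam': "l2_family I \<zeta>"
    by (rule l2_familyI)
      (use w(1,4) fam in \<open>auto simp: \<zeta>_def norm2_smul power_mult_distrib l2_family_l2 less_imp_le\<close>)
  have le: "w m * tail_mass \<xi> m \<le> tail_mass \<zeta> 0" for m
  proof -
    \<comment> \<open>The excess of the m-th tail of \<zeta> over \<open>w m\<close> times that of
      \<xi>, written as a series of vectors so that it is visibly positive and normal.\<close>
    define \<kappa> where "\<kappa> k = smul1 (complex_of_real (sqrt (w (k + m) - w m))) (\<xi> (k + m))" for k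
    have wm: "0 \<le> w (k + m) - w m" "w (k + m) - w m \<le> w (k + m)" for k
      using w(2)[of m "k + m"] w(1)[of m] by auto
    have "l2_family I \<kappa>"
    proof (rule l2_familyI)
      have s: "summable (\<lambda>k. w (k + m) * (norm2 (\<xi> (k + m)))\<^sup>2)"
        using w(4) by (subst summable_iff_shift[where f="\<lambda>k. w k * (norm2 (\<xi> k))\<^sup>2"])
      show "summable (\<lambda>k. (norm2 (\<kappa> k))\<^sup>2)"
        by (rule summable_comparison_test'[OF s, of 0])
          (use wm in \<open>auto simp: \<kappa>_def norm2_smul power_mult_distrib intro!: mult_right_mono\<close>)
    qed (use fam in \<open>auto simp: \<kappa>_def l2_family_l2\<close>)
    note famk = this
    have eq: "series_functional A (\<lambda>k. \<zeta> (k + m)) (\<lambda>k. \<zeta> (k + m))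
      = smul1 (complex_of_real (w m)) (series_functional A (\<lambda>k. \<xi> (k + m)) (\<lambda>k. \<xi> (k + m))) + series_functional A \<kappa> \<kappa>"
    proof
      fix x
      show "series_functional A (\<lambda>k. \<zeta> (k + m)) (\<lambda>k. \<zeta> (k + m)) x
        = (smul1 (complex_of_real (w m)) (series_functional A (\<lambda>k. \<xi> (k + m)) (\<lambda>k. \<xi> (k + m))) + series_functional A \<kappa> \<kappa>) x"
      proof (cases "x \<in> elems A")
        case True
        have sc: "inner2 (x (smul1 (complex_of_real (sqrt r)) f)) (smul1 (complex_of_real (sqrt r)) f)
            = complex_of_real r * inner2 (x f) f" if "0 \<le> r" "f \<in> l2 I" for r f
        proof -
          have "complex_of_real (sqrt r) * complex_of_real (sqrt r) = complex_of_real r"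
            using that by (simp flip: of_real_mult)
          then show ?thesis using that
            by (simp add: bop_smul[OF elem_bop[OF True]] inner2_scalar_simps mult.assoc[symmetric])
        qed
        have "inner2 (x (\<zeta> (k + m))) (\<zeta> (k + m)) =
            complex_of_real (w m) * inner2 (x (\<xi> (k + m))) (\<xi> (k + m)) + inner2 (x (\<kappa> k)) (\<kappa> k)" for k
          unfolding \<zeta>_def \<kappa>_def using wm[of k] w(1)[of "k + m"] fam
          by (simp add: sc less_imp_le l2_family_l2 algebra_simps)
        moreover have "(\<lambda>k. complex_of_real (w m) * inner2 (x (\<xi> (k + m))) (\<xi> (k + m)) + inner2 (x (\<kappa> k)) (\<kappa> k)) sums
          (complex_of_real (w m) * (\<Sum>k. inner2 (x (\<xi> (k + m))) (\<xi> (k + m))) + (\<Sum>k. inner2 (x (\<kappa> k)) (\<kappa> k)))"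
          by (intro sums_add sums_mult summable_sums series_summable[OF elem_bop[OF True]] l2_family_shift fam famk)
        ultimately show ?thesis using True by (simp add: series_functional_def sums_iff)
      qed (simp add: series_functional_def)
    qed
    have "\<theta> (series_functional A (\<lambda>k. \<zeta> (k + m)) (\<lambda>k. \<zeta> (k + m)))
      = smul1 (complex_of_real (w m)) (\<theta> (series_functional A (\<lambda>k. \<xi> (k + m)) (\<lambda>k. \<xi> (k + m)))) + \<theta> (series_functional A \<kappa> \<kappa>)"
      unfolding eq using w(1)[of m]
      by (subst additive) (auto intro!: smul_pos tail_pos fam famk theta_scale simp: less_imp_le)
    then have "tail_mass \<zeta> m = w m * tail_mass \<xi> m + Re (\<theta> (series_functional A \<kappa> \<kappa>) one)"
      by (simp add: tail_mass_def)
    moreover have "0 \<le> Re (\<theta> (series_functional A \<kappa> \<kappa>) one)"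
      by (intro pos_id_real cone series_functional_pos famk)
    ultimately show ?thesis using tail_mass_le[OF fam', of m] by simp
  qed
  have "(\<lambda>m. tail_mass \<zeta> 0 * (1 / w m)) \<longlonglongrightarrow> tail_mass \<zeta> 0 * 0"
    by (intro tendsto_mult tendsto_const w(3))
  then have lim: "(\<lambda>m. tail_mass \<zeta> 0 * (1 / w m)) \<longlonglongrightarrow> 0" by simp
  have "tail_mass \<xi> m \<le> tail_mass \<zeta> 0 * (1 / w m)" for m
    using le[of m] w(1)[of m] by (simp add: field_simps)
  then show ?thesis
    by (intro tendsto_sandwich[OF _ _ tendsto_const lim] always_eventually allI)
      (auto intro: tail_mass_nonneg[OF fam])
qed

text \<open>Finite additivity leaves the image of a tail, whose value at \<open>x\<close> is at most
  a constant times its tail mass.\<close>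

lemma theta_series_sums:
  assumes fam: "l2_family I \<xi>" and x: "x \<in> elems A"
  shows "(\<lambda>k. \<theta> (vec_functional A (\<xi> k) (\<xi> k)) x) sums \<theta> (series_functional A \<xi> \<xi>) x"
proof -
  obtain K where K: "0 \<le> K" "\<And>\<omega>. \<omega> \<in> predual_pos A \<Longrightarrow> cmod (\<omega> x) \<le> K * Re (\<omega> one)"
    using positive_functional_bound[OF x] by blast
  define r where "r m = \<theta> (series_functional A (\<lambda>k. \<xi> (k + m)) (\<lambda>k. \<xi> (k + m))) x" for m
  have part: "\<theta> (series_functional A \<xi> \<xi>) x = (\<Sum>k<m. \<theta> (vec_functional A (\<xi> k) (\<xi> k)) x) + r m" for m
  proof (induction m)
    case (Suc m)
    have "r m = \<theta> (vec_functional A (\<xi> m) (\<xi> m)) x + r (Suc m)"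
      unfolding r_def theta_series_shift[OF fam, of m] by simp
    then show ?case using Suc by simp
  qed (simp add: r_def)
  have "(\<lambda>m. K * tail_mass \<xi> m) \<longlonglongrightarrow> K * 0"
    by (intro tendsto_mult tendsto_const tail_mass_tendsto fam)
  then have "r \<longlonglongrightarrow> 0"
    by (intro Lim_null_comparison[of r "\<lambda>m. K * tail_mass \<xi> m"] always_eventually allI)
      (auto simp: r_def tail_mass_def intro!: K(2) cone tail_pos fam)
  then have "(\<lambda>m. \<theta> (series_functional A \<xi> \<xi>) x - r m) \<longlonglongrightarrow> \<theta> (series_functional A \<xi> \<xi>) x - 0"
    by (intro tendsto_intros)
  moreover have "(\<lambda>m. \<theta> (series_functional A \<xi> \<xi>) x - r m) = (\<lambda>m. \<Sum>k<m. \<theta> (vec_functional A (\<xi> k) (\<xi> k)) x)"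
    by (rule ext) (use part in \<open>metis add_diff_cancel_right'\<close>)
  ultimately show ?thesis by (simp add: sums_def)
qed

end

lemma vec_functional_add_left:
  "f \<in> l2 (index A) \<Longrightarrow> g \<in> l2 (index A) \<Longrightarrow> h \<in> l2 (index A) \<Longrightarrow> elems A \<subseteq> bounded_ops (index A) \<Longrightarrow>
    vec_functional A (f + g) h = vec_functional A f h + vec_functional A g h"
proof
  fix x assume *: "f \<in> l2 (index A)" "g \<in> l2 (index A)" "h \<in> l2 (index A)" "elems A \<subseteq> bounded_ops (index A)"
  then have "x \<in> bounded_ops (index A)" if "x \<in> elems A" using that by auto
  then show "vec_functional A (f + g) h x = (vec_functional A f h + vec_functional A g h) x"
    using * bop_add[of x "index A" f g] by (simp add: vec_functional_def inner2_add_left[where I="index A"])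
qed

lemma vec_functional_add_right:
  "f \<in> l2 (index A) \<Longrightarrow> g \<in> l2 (index A) \<Longrightarrow> h \<in> l2 (index A) \<Longrightarrow> elems A \<subseteq> bounded_ops (index A) \<Longrightarrow>
    vec_functional A h (f + g) = vec_functional A h f + vec_functional A h g"
  by (rule ext) (auto simp: vec_functional_def inner2_add_right[where I="index A"] subset_iff)

lemma vec_functional_smul_left:
  "f \<in> l2 (index A) \<Longrightarrow> elems A \<subseteq> bounded_ops (index A) \<Longrightarrow>
    vec_functional A (smul1 c f) h = smul1 c (vec_functional A f h)"
proof
  fix x assume *: "f \<in> l2 (index A)" "elems A \<subseteq> bounded_ops (index A)"
  then have "x \<in> bounded_ops (index A)" if "x \<in> elems A" using that by auto
  then show "vec_functional A (smul1 c f) h x = smul1 c (vec_functional A f h) x"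
    using * bop_smul[of x "index A" f c] by (simp add: vec_functional_def inner2_smul_left)
qed

lemma vec_functional_smul_right:
  "vec_functional A h (smul1 c f) = smul1 (cnj c) (vec_functional A h f)"
  by (rule ext) (auto simp: vec_functional_def inner2_smul_right)

lemma (in op_space) vec_functional_polarization:
  assumes f: "f \<in> l2 (index A)" and g: "g \<in> l2 (index A)"
  shows "decomposes (smul1 4 (vec_functional A f g))
    (\<lambda>k. if k = 0 then vec_functional A (f + g) (f + g)
      else if k = 1 then vec_functional A (f - g) (f - g)
      else if k = 2 then vec_functional A (f + smul1 \<i> g) (f + smul1 \<i> g)
      else vec_functional A (f - smul1 \<i> g) (f - smul1 \<i> g))"
proof (rule decomposesI)
  fix x
  show "smul1 4 (vec_functional A f g) x =
    (if (0 :: nat) = 0 then vec_functional A (f + g) (f + g)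
      else if (0 :: nat) = 1 then vec_functional A (f - g) (f - g)
      else if (0 :: nat) = 2 then vec_functional A (f + smul1 \<i> g) (f + smul1 \<i> g)
      else vec_functional A (f - smul1 \<i> g) (f - smul1 \<i> g)) x -
    (if (1 :: nat) = 0 then vec_functional A (f + g) (f + g)
      else if (1 :: nat) = 1 then vec_functional A (f - g) (f - g)
      else if (1 :: nat) = 2 then vec_functional A (f + smul1 \<i> g) (f + smul1 \<i> g)
      else vec_functional A (f - smul1 \<i> g) (f - smul1 \<i> g)) x +
    \<i> * (if (2 :: nat) = 0 then vec_functional A (f + g) (f + g)
      else if (2 :: nat) = 1 then vec_functional A (f - g) (f - g)
      else if (2 :: nat) = 2 then vec_functional A (f + smul1 \<i> g) (f + smul1 \<i> g)
      else vec_functional A (f - smul1 \<i> g) (f - smul1 \<i> g)) x -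
    \<i> * (if (3 :: nat) = 0 then vec_functional A (f + g) (f + g)
      else if (3 :: nat) = 1 then vec_functional A (f - g) (f - g)
      else if (3 :: nat) = 2 then vec_functional A (f + smul1 \<i> g) (f + smul1 \<i> g)
      else vec_functional A (f - smul1 \<i> g) (f - smul1 \<i> g)) x"
    using polarization[OF elem_bop f g, of x] by (simp add: vec_functional_def)
qed (use f g in auto)

context cone_map
begin

text \<open>For unit vectors the four vectors of the polarization identity have norm at most 2, so
  \<open>theta_bound\<close> bounds each diagonal term by \<open>K * (C * 4)\<close>. Dividing their
  sum by 4 gives the constant \<open>4 * K * C\<close>, and general vectors follow by
  scaling.\<close>

lemma T_vec_bound:
  assumes x: "x \<in> elems A"
  obtains D where "0 \<le> D" "\<And>f g. f \<in> l2 I \<Longrightarrow> g \<in> l2 I \<Longrightarrow> cmod (T (vec_functional A f g) x) \<le> D * norm2 f * norm2 g"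
proof -
  obtain K where K: "0 \<le> K" "\<And>\<omega>. \<omega> \<in> predual_pos A \<Longrightarrow> cmod (\<omega> x) \<le> K * Re (\<omega> one)"
    using positive_functional_bound[OF x] by blast
  obtain C where C: "0 \<le> C" "\<forall>f\<in>l2 I. Re (\<theta> (vec_functional A f f) one) \<le> C * (norm2 f)\<^sup>2"
    using theta_bound by blast
  have q: "cmod (\<theta> (vec_functional A h h) x) \<le> K * (C * 4)" if h: "h \<in> l2 I" "norm2 h \<le> 2" for h
  proof -
    have "cmod (\<theta> (vec_functional A h h) x) \<le> K * Re (\<theta> (vec_functional A h h) one)"
      using h by (intro K cone vec_functional_pos)
    also have "\<dots> \<le> K * (C * (norm2 h)\<^sup>2)" using C h K by (intro mult_left_mono) auto
    also have "\<dots> \<le> K * (C * 4)"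
      using K C h power_mono[OF h(2) norm2_nonneg, of 2] by (intro mult_left_mono) auto
    finally show ?thesis .
  qed
  have unit: "cmod (T (vec_functional A f g) x) \<le> 4 * K * C"
    if f: "f \<in> l2 I" "norm2 f = 1" and g: "g \<in> l2 I" "norm2 g = 1" for f g
  proof -
    let ?a = "\<theta> (vec_functional A (f + g) (f + g)) x" and ?b = "\<theta> (vec_functional A (f - g) (f - g)) x"
    let ?c = "\<theta> (vec_functional A (f + smul1 \<i> g) (f + smul1 \<i> g)) x"
    let ?d = "\<theta> (vec_functional A (f - smul1 \<i> g) (f - smul1 \<i> g)) x"
    have n: "norm2 (f + h) \<le> 2" "norm2 (f - h) \<le> 2" if h: "h \<in> l2 I" "norm2 h = 1" for h
      using norm2_triangle[OF f(1) h(1)] norm2_triangle[OF f(1), of "- h"] f h by auto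
    have ig: "smul1 \<i> g \<in> l2 I" "norm2 (smul1 \<i> g) = 1" using g by (auto simp: norm2_smul)
    have "T (smul1 4 (vec_functional A f g)) x = ?a - ?b + \<i> * ?c - \<i> * ?d"
      unfolding T_eq[OF vec_functional_polarization[OF f(1) g(1)]] combine_def by simp
    moreover have "T (smul1 4 (vec_functional A f g)) x = 4 * T (vec_functional A f g) x"
      using f g by (simp add: T_smul)
    ultimately have "4 * cmod (T (vec_functional A f g) x) = cmod (?a - ?b + \<i> * ?c - \<i> * ?d)"
      by (metis norm_mult norm_numeral)
    also have "\<dots> \<le> cmod ?a + cmod ?b + cmod ?c + cmod ?d"
      using norm_triangle_ineq4[of "?a - ?b + \<i> * ?c" "\<i> * ?d"] norm_triangle_ineq[of "?a - ?b" "\<i> * ?c"]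
        norm_triangle_ineq4[of ?a ?b] by (simp add: norm_mult)
    also have "\<dots> \<le> K * (C * 4) + K * (C * 4) + K * (C * 4) + K * (C * 4)"
      using f g ig by (intro add_mono q n) auto
    finally show ?thesis by (simp add: mult_ac)
  qed
  show ?thesis
  proof (rule that[of "4 * K * C"])
    fix f g assume f: "f \<in> l2 I" and g: "g \<in> l2 I"
    show "cmod (T (vec_functional A f g) x) \<le> 4 * K * C * norm2 f * norm2 g"
    proof (cases "f = 0 \<or> g = 0")
      case True
      then have "vec_functional A f g = 0"
      proof (intro ext)
        fix x assume "f = 0 \<or> g = 0"
        then show "vec_functional A f g x = 0 x"
          using bop_zero[OF elem_bop, of x] by (auto simp: vec_functional_def)
      qed
      moreover have "T 0 x = 0" unfolding T_pos[OF zero_pos] theta_zero by simp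
      ultimately have "T (vec_functional A f g) x = 0" by (simp only:)
      then show ?thesis using K C by simp
    next
      case False
      then have n: "norm2 f > 0" "norm2 g > 0"
        using norm2_eq_0[OF f] norm2_eq_0[OF g] norm2_nonneg[of f] norm2_nonneg[of g] by linarith+
      define f' g' where "f' = smul1 (1 / norm2 f) f" and "g' = smul1 (1 / norm2 g) g"
      have u: "f' \<in> l2 I" "norm2 f' = 1" "g' \<in> l2 I" "norm2 g' = 1"
        using f g n by (auto simp: f'_def g'_def norm2_smul norm_divide)
      have fg: "f = smul1 (norm2 f) f'" "g = smul1 (norm2 g) g'" using n by (auto simp: f'_def g'_def)
      have "vec_functional A f g = smul1 (norm2 f) (smul1 (norm2 g) (vec_functional A f' g'))"
        by (subst fg(1), subst vec_functional_smul_left[OF u(1) sub_bounded], subst fg(2), subst vec_functional_smul_right) simp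
      then have "T (vec_functional A f g) x = norm2 f * norm2 g * T (vec_functional A f' g') x"
        using u by (simp add: T_smul)
      then have "cmod (T (vec_functional A f g) x) = norm2 f * norm2 g * cmod (T (vec_functional A f' g') x)"
        using n by (simp add: norm_mult)
      also have "\<dots> \<le> norm2 f * norm2 g * (4 * K * C)" using unit[OF u] n by (intro mult_left_mono) auto
      finally show ?thesis by (simp add: mult_ac)
    qed
  qed (use K C in simp)
qed

lemma R_exists:
  assumes x: "x \<in> elems A"
  shows "\<exists>y. y \<in> bounded_ops I \<and> (\<forall>f\<in>l2 I. \<forall>g\<in>l2 I. inner2 (y f) g = T (vec_functional A f g) x)"
proof -
  obtain D where D: "0 \<le> D" "\<And>f g. f \<in> l2 I \<Longrightarrow> g \<in> l2 I \<Longrightarrow> cmod (T (vec_functional A f g) x) \<le> D * norm2 f * norm2 g"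
    using T_vec_bound[OF x] by blast
  obtain y where "y \<in> bounded_ops I" "\<And>f g. f \<in> l2 I \<Longrightarrow> g \<in> l2 I \<Longrightarrow> inner2 (y f) g = T (vec_functional A f g) x"
    by (rule form_operator[of I "\<lambda>f g. T (vec_functional A f g) x" D])
      (auto simp: vec_functional_add_left vec_functional_add_right vec_functional_smul_left vec_functional_smul_right
         sub_bounded T_add T_smul D)
  then show ?thesis by blast
qed

text \<open>Prescribed on vector functionals alone; \<open>functional_R\<close> shows that it is the
  adjoint of \<open>T\<close> on the whole predual.\<close>

definition R :: "'i opr \<Rightarrow> 'i opr" where
  "R x = (if x \<in> elems A
     then SOME y. y \<in> bounded_ops I \<and> (\<forall>f\<in>l2 I. \<forall>g\<in>l2 I. inner2 (y f) g = T (vec_functional A f g) x) else 0)"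

lemma
  assumes x: "x \<in> elems A"
  shows R_bop: "R x \<in> bounded_ops I"
    and inner2_R: "f \<in> l2 I \<Longrightarrow> g \<in> l2 I \<Longrightarrow> inner2 (R x f) g = T (vec_functional A f g) x"
proof -
  have "R x = (SOME y. y \<in> bounded_ops I \<and> (\<forall>f\<in>l2 I. \<forall>g\<in>l2 I. inner2 (y f) g = T (vec_functional A f g) x))"
    by (simp only: R_def x if_True)
  then have "R x \<in> bounded_ops I \<and> (\<forall>f\<in>l2 I. \<forall>g\<in>l2 I. inner2 (R x f) g = T (vec_functional A f g) x)"
    by (rule ssubst) (rule someI_ex[OF R_exists[OF x]])
  then show "R x \<in> bounded_ops I" "f \<in> l2 I \<Longrightarrow> g \<in> l2 I \<Longrightarrow> inner2 (R x f) g = T (vec_functional A f g) x"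
    by blast+
qed

lemma inner2_R_self: "x \<in> elems A \<Longrightarrow> f \<in> l2 I \<Longrightarrow> inner2 (R x f) f = \<theta> (vec_functional A f f) x"
  by (simp add: inner2_R T_pos)

text \<open>On the algebra the vector functional of (t f, g) equals that of f and the adjoint of t
  applied to g, for t in the commutant. Hence \<open>R x\<close> commutes with the
  commutant.\<close>

lemma R_elems [simp, intro]: assumes x: "x \<in> elems A" shows "R x \<in> elems A"
proof -
  have "R x \<circ> t = t \<circ> R x" if t: "t \<in> commutant I (elems A)" for t
  proof (rule op_eqI_inner)
    have tb: "t \<in> bounded_ops I" using t commutant_sub by auto
    show "R x \<circ> t \<in> bounded_ops I" "t \<circ> R x \<in> bounded_ops I" using R_bop[OF x] tb by auto
    fix f g assume f: "f \<in> l2 I" and g: "g \<in> l2 I"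
    have "vec_functional A (t f) g = vec_functional A f (adj I t g)"
    proof
      fix y
      show "vec_functional A (t f) g y = vec_functional A f (adj I t g) y"
      proof (cases "y \<in> elems A")
        case True
        have "y (t f) = t (y f)" using t True by (metis commutant_iff comp_apply)
        then show ?thesis using True tb f g by (simp add: vec_functional_def inner2_adj_right[OF tb])
      qed (simp add: vec_functional_def)
    qed
    then have "inner2 (R x (t f)) g = inner2 (R x f) (adj I t g)"
      using f g tb x by (simp add: inner2_R)
    then show "inner2 ((R x \<circ> t) f) g = inner2 ((t \<circ> R x) f) g"
      using tb g R_bop[OF x] by (simp add: inner2_adj_right[OF tb])
  qed
  then show ?thesis unfolding elems_iff using R_bop[OF x] by blast
qed

lemma R_add: "x \<in> elems A \<Longrightarrow> y \<in> elems A \<Longrightarrow> R (x + y) = R x + R y"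
  by (rule op_eqI_inner[of _ I])
    (auto simp: inner2_R R_bop inner2_add_left[where I=I] predual_plus[OF T_predual[OF vec_functional_predual]])

lemma R_smul: "x \<in> elems A \<Longrightarrow> R (smul2 c x) = smul2 c (R x)"
  by (rule op_eqI_inner[of _ I])
    (auto simp: inner2_R R_bop inner2_smul_left predual_scale[OF T_predual[OF vec_functional_predual]])

lemma R_positive: "x \<in> elems A \<Longrightarrow> positive_op I x \<Longrightarrow> positive_op I (R x)"
  by (auto simp: positive_op_def[of I "R x"] R_bop inner2_R_self intro!: predual_pos_nonneg[OF cone[OF vec_functional_pos]])

lemma R_adj: assumes x: "x \<in> elems A" shows "R (adj I x) = adj I (R x)"
proof (rule op_eqI_quadratic[of _ I])
  fix f assume f: "f \<in> l2 I"
  have "inner2 (R (adj I x) f) f = cnj (inner2 (R x f) f)"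
    using x f by (simp add: inner2_R_self predual_pos_adj[OF cone[OF vec_functional_pos]])
  then show "inner2 (R (adj I x) f) f = inner2 (adj I (R x) f) f"
    using x f by (simp add: inner2_adj_left[OF R_bop] inner2_cnj)
qed (use x R_bop in auto)

text \<open>The diagonal case is \<open>theta_series_sums\<close>, the countable additivity of
  \<theta>; polarization gives the rest.\<close>

lemma series_functional_R:
  assumes \<xi>: "l2_family I \<xi>" and \<eta>: "l2_family I \<eta>" and x: "x \<in> elems A"
  shows "series_functional A \<xi> \<eta> (R x) = T (series_functional A \<xi> \<eta>) x"
proof -
  have diag: "series_functional A \<zeta> \<zeta> (R x) = \<theta> (series_functional A \<zeta> \<zeta>) x" if z: "l2_family I \<zeta>" for \<zeta>
    using theta_series_sums[OF z x] x
    by (simp add: series_functional_def inner2_R_self l2_family_l2[OF z] sums_iff)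
  note dec = series_functional_polarization[OF \<xi> \<eta>]
  have "4 * series_functional A \<xi> \<eta> (R x) = 4 * T (series_functional A \<xi> \<eta>) x"
    using decomposes_apply[OF dec, of "R x"] T_eq[OF dec] T_smul[OF series_functional_predual[OF \<xi> \<eta>], of 4]
    by (simp add: combine_def fun_eq_iff diag l2_family_add l2_family_diff l2_family_smul \<xi> \<eta>)
  then show ?thesis by simp
qed

lemma functional_R:
  assumes \<omega>: "\<omega> \<in> predual A" and x: "x \<in> elems A"
  shows "\<omega> (R x) = T \<omega> x"
proof -
  obtain F c where F: "finite F" "\<forall>(\<xi>, \<eta>)\<in>F. l2_family I \<xi> \<and> l2_family I \<eta>"
    "\<omega> = (\<Sum>(\<xi>, \<eta>)\<in>F. smul1 (c (\<xi>, \<eta>)) (series_functional A \<xi> \<eta>))"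
    using predual_representation[OF \<omega>] by (elim exE conjE) (rule that)
  define s where "s p = smul1 (c p) (series_functional A (fst p) (snd p))" for p
  have \<omega>_eq: "\<omega> = (\<Sum>p\<in>F. s p)" unfolding F(3) by (rule sum.cong) (auto simp: s_def)
  have s: "s p \<in> predual A" "s p (R x) = T (s p) x" if "p \<in> F" for p
    using F(2) that x by (auto simp: s_def T_smul series_functional_R series_functional_predual)
  have app: "(\<Sum>p\<in>G. t p) z = (\<Sum>p\<in>G. t p z)" for G z and t :: "_ \<Rightarrow> 'i opr \<Rightarrow> complex"
    by (induction G rule: infinite_finite_induct) auto
  have "T \<omega> = (\<Sum>p\<in>F. T (s p))" unfolding \<omega>_eq by (rule T_sum) (use F s in auto)
  then have "T \<omega> x = (\<Sum>p\<in>F. T (s p) x)" by (simp only: app)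
  also have "\<dots> = \<omega> (R x)" unfolding \<omega>_eq app using s(2) by (intro sum.cong) auto
  finally show ?thesis by simp
qed

text \<open>Composing a generating functional with \<open>R\<close> gives \<open>T\<close> of that
  functional, which is again normal.\<close>

lemma R_continuous: "continuous_map (ultraweak A) (ultraweak A) R"
proof (rule continuous_into_ultraweak)
  fix \<xi> \<eta> assume f: "l2_family I \<xi>" "l2_family I \<eta>"
  show "continuous_map (ultraweak A) euclidean (\<lambda>x. \<Sum>k. inner2 (R x (\<xi> k)) (\<eta> k))"
  proof (rule continuous_map_eq[OF predual_continuous[OF T_predual[OF series_functional_predual[OF f]]]])
    fix x assume "x \<in> topspace (ultraweak A)"
    then show "T (series_functional A \<xi> \<eta>) x = (\<Sum>k. inner2 (R x (\<xi> k)) (\<eta> k))"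
      using series_functional_R[OF f, of x] by (simp add: series_functional_def)
  qed
qed auto

end

text \<open>Adjoints reverse the order of composition: the quadratic form of the composite at
  \<open>f\<close> is \<theta>' after \<theta> applied to the vector functional of
  \<open>f\<close>.\<close>

lemma R_inverse:
  assumes "cone_map A \<theta>" "cone_map A \<theta>'" "\<And>\<omega>. \<omega> \<in> predual_pos A \<Longrightarrow> \<theta>' (\<theta> \<omega>) = \<omega>" and x: "x \<in> elems A"
  shows "cone_map.R A \<theta> (cone_map.R A \<theta>' x) = x"
proof -
  interpret a: cone_map A \<theta> by fact
  interpret b: cone_map A \<theta>' by fact
  show ?thesis
  proof (rule op_eqI_quadratic[of _ "index A"])
    fix f assume f: "f \<in> l2 (index A)"
    have "inner2 (a.R (b.R x) f) f = b.T (\<theta> (vec_functional A f f)) x"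
      using f x by (simp add: a.inner2_R_self b.functional_R a.cone)
    also have "\<dots> = \<theta>' (\<theta> (vec_functional A f f)) x"
      using f by (simp add: b.T_pos a.cone)
    also have "\<theta>' (\<theta> (vec_functional A f f)) = vec_functional A f f"
      using f by (intro assms(3) a.vec_functional_pos)
    also have "vec_functional A f f x = inner2 (x f) f" using x by (simp add: vec_functional_def)
    finally show "inner2 (a.R (b.R x) f) f = inner2 (x f) f" .
  qed (use x in auto)
qed

section \<open>Maps that are two-positive into the opposite algebra\<close>

context vn_algebra
begin

abbreviation "J \<equiv> index A"
abbreviation "unit \<equiv> id_op J"

text \<open>In the last clause the image of \<open>adj J x1 \<circ> x2\<close> acts on
  \<open>f1\<close> and is paired with \<open>f2\<close>; for an ordinary two-positive map the two
  vectors would be exchanged. This is two-positivity into the opposite algebra, tested on Gram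
  matrices.\<close>

definition two_antipositive :: "('i opr \<Rightarrow> 'i opr) \<Rightarrow> bool" where
  "two_antipositive R \<longleftrightarrow> (\<forall>x\<in>elems A. R x \<in> elems A) \<and>
     (\<forall>x\<in>elems A. \<forall>y\<in>elems A. R (x + y) = R x + R y) \<and>
     (\<forall>c. \<forall>x\<in>elems A. R (smul2 c x) = smul2 c (R x)) \<and>
     (\<forall>x\<in>elems A. R (adj J x) = adj J (R x)) \<and>
     (\<forall>x\<in>elems A. positive_op J x \<longrightarrow> positive_op J (R x)) \<and>
     (\<forall>x1\<in>elems A. \<forall>x2\<in>elems A. \<forall>f1\<in>l2 J. \<forall>f2\<in>l2 J.
       inner2 (R (adj J x1 \<circ> x1) f1) f1 + inner2 (R (adj J x1 \<circ> x2) f1) f2 +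
       inner2 (R (adj J x2 \<circ> x1) f2) f1 + inner2 (R (adj J x2 \<circ> x2) f2) f2 \<in> \<real>\<^sub>\<ge>\<^sub>0)"

lemma two_antipositiveD:
  assumes "two_antipositive R"
  shows "x \<in> elems A \<Longrightarrow> R x \<in> elems A"
    "x \<in> elems A \<Longrightarrow> y \<in> elems A \<Longrightarrow> R (x + y) = R x + R y"
    "x \<in> elems A \<Longrightarrow> R (smul2 c x) = smul2 c (R x)"
    "x \<in> elems A \<Longrightarrow> R (adj J x) = adj J (R x)"
    "x \<in> elems A \<Longrightarrow> positive_op J x \<Longrightarrow> positive_op J (R x)"
    "x1 \<in> elems A \<Longrightarrow> x2 \<in> elems A \<Longrightarrow> f1 \<in> l2 J \<Longrightarrow> f2 \<in> l2 J \<Longrightarrow>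
       inner2 (R (adj J x1 \<circ> x1) f1) f1 + inner2 (R (adj J x1 \<circ> x2) f1) f2 +
       inner2 (R (adj J x2 \<circ> x1) f2) f1 + inner2 (R (adj J x2 \<circ> x2) f2) f2 \<in> \<real>\<^sub>\<ge>\<^sub>0"
  using assms unfolding two_antipositive_def by blast+

lemma two_antipositive_diff:
  assumes "two_antipositive R" "x \<in> elems A" "y \<in> elems A" shows "R (x - y) = R x - R y"
  using two_antipositiveD(2)[OF assms(1,2), of "smul2 (-1) y"] two_antipositiveD(3)[OF assms(1,3), of "-1"] assms(3)
  by (simp add: uminus_smul2[symmetric])

text \<open>Apply the last clause to the elements \<open>unit\<close> and \<open>x\<close> with the
  vectors - g and f, where g is the adjoint of \<open>R x\<close> applied to f. Three of the four
  terms combine to the negative of the squared norm of g. The factors of the product stand in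
  reversed order because the map goes into the opposite algebra.\<close>

lemma anti_schwarz:
  assumes R: "two_antipositive R" and unital: "R unit = unit" and x: "x \<in> elems A"
  shows "positive_op J (R (adj J x \<circ> x) - (R x \<circ> adj J (R x)))"
proof -
  have m: "R x \<in> elems A" "R (adj J x \<circ> x) \<in> elems A" "adj J x \<circ> x \<in> elems A"
    using two_antipositiveD(1)[OF R] x by auto
  have b: "R x \<in> bounded_ops J" using m(1) by simp
  have sum_cancel: "a + - a + - a + c = c - a" for a c :: complex by simp
  have "inner2 ((R (adj J x \<circ> x) - (R x \<circ> adj J (R x))) f) f \<in> \<real>\<^sub>\<ge>\<^sub>0" if f: "f \<in> l2 J" for f
  proof -
    define g where "g = adj J (R x) f"
    have g: "g \<in> l2 J" using adj_bop[OF b] by (simp add: g_def)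
    have "inner2 (R (adj J unit \<circ> unit) (- g)) (- g) + inner2 (R (adj J unit \<circ> x) (- g)) f +
       inner2 (R (adj J x \<circ> unit) f) (- g) + inner2 (R (adj J x \<circ> x) f) f \<in> \<real>\<^sub>\<ge>\<^sub>0"
      using f g x by (intro two_antipositiveD(6)[OF R]) auto
    also have "R (adj J unit \<circ> unit) = unit" using unital by simp
    also have "R (adj J unit \<circ> x) = R x" using x by simp
    also have "R (adj J x \<circ> unit) = adj J (R x)" using x two_antipositiveD(4)[OF R x] by simp
    also have "inner2 (unit (- g)) (- g) = inner2 g g" using g by (simp add: inner2_uminus)
    also have "inner2 (R x (- g)) f = - inner2 g g"
      using f g b by (simp add: bop_uminus[OF b] inner2_uminus g_def inner2_adj_right[OF b])
    also have "inner2 (adj J (R x) f) (- g) = - inner2 g g" by (simp add: inner2_uminus g_def)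
    also have "inner2 g g + - inner2 g g + - inner2 g g + inner2 (R (adj J x \<circ> x) f) f
        = inner2 (R (adj J x \<circ> x) f) f - inner2 g g" by (rule sum_cancel)
    finally have "inner2 (R (adj J x \<circ> x) f) f - inner2 g g \<in> \<real>\<^sub>\<ge>\<^sub>0" .
    moreover have "inner2 (R x g) f = inner2 g g"
      using f g b by (simp add: g_def inner2_adj_right[OF b])
    ultimately show ?thesis
      using f g m b by (simp add: inner2_diff_left[where I=J] g_def[symmetric])
  qed
  moreover have "R (adj J x \<circ> x) - (R x \<circ> adj J (R x)) \<in> bounded_ops J" using m b by auto
  ultimately show ?thesis by (simp add: positive_op_def)
qed

lemma positive_op_conj:
  assumes x: "positive_op J x" and k: "k \<in> elems A" "adj J k = k"
  shows "positive_op J (k \<circ> x \<circ> k)"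
proof -
  have xb: "x \<in> bounded_ops J" using x by (simp add: positive_op_def)
  have kb: "k \<in> bounded_ops J" using k by simp
  have "inner2 (k (x (k f))) f = inner2 (x (k f)) (k f)" if "f \<in> l2 J" for f
    using inner2_adj_left[OF kb, of "x (k f)" f] that xb k by simp
  then show ?thesis using x xb kb by (auto simp: positive_op_def)
qed

lemma two_antipositive_conj_left:
  assumes R: "two_antipositive R" and k: "k \<in> elems A" "adj J k = k"
  shows "two_antipositive (\<lambda>x. k \<circ> R x \<circ> k)"
proof -
  have kb: "k \<in> bounded_ops J" using k by simp
  note D = two_antipositiveD[OF R]
  have Rb: "R x \<in> bounded_ops J" if "x \<in> elems A" for x using D(1)[OF that] by simp
  have i: "inner2 ((k \<circ> R x \<circ> k) f) g = inner2 (R x (k f)) (k g)" if "x \<in> elems A" "f \<in> l2 J" "g \<in> l2 J" for x f g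
    using inner2_adj_left[OF kb, of "R x (k f)" g] that Rb kb k by simp
  show ?thesis
    unfolding two_antipositive_def
  proof (intro conjI ballI allI impI)
    fix x1 x2 f1 f2 assume *: "x1 \<in> elems A" "x2 \<in> elems A" "f1 \<in> l2 J" "f2 \<in> l2 J"
    then show "inner2 ((k \<circ> R (adj J x1 \<circ> x1) \<circ> k) f1) f1 + inner2 ((k \<circ> R (adj J x1 \<circ> x2) \<circ> k) f1) f2 +
       inner2 ((k \<circ> R (adj J x2 \<circ> x1) \<circ> k) f2) f1 + inner2 ((k \<circ> R (adj J x2 \<circ> x2) \<circ> k) f2) f2 \<in> \<real>\<^sub>\<ge>\<^sub>0"
      using D(6)[of x1 x2 "k f1" "k f2"] kb by (simp only: i elems_adj elems_closed bop_l2)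
  next
    fix x assume x: "x \<in> elems A"
    show "k \<circ> R (adj J x) \<circ> k = adj J (k \<circ> R x \<circ> k)"
      using x k kb Rb[OF x] D(4)[OF x] by (simp add: adj_comp comp_assoc)
    show "k \<circ> R (smul2 c x) \<circ> k = smul2 c (k \<circ> R x \<circ> k)" for c
      using D(3)[OF x] kb Rb[OF x] by (simp add: comp_smul_right[OF kb] comp_smul_left)
    show "k \<circ> R (x + y) \<circ> k = (k \<circ> R x \<circ> k) + (k \<circ> R y \<circ> k)" if "y \<in> elems A" for y
      using D(2)[OF x that] Rb[OF x] Rb[OF that] by (simp add: comp_add_right[OF kb] comp_add_left)
    show "positive_op J (k \<circ> R x \<circ> k)" if "positive_op J x"
      by (rule positive_op_conj[OF D(5)[OF x that] k])
  qed (use D k in auto)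
qed

text \<open>Compressing by a selfadjoint \<open>k\<close> turns the Gram matrix of x1, x2 into the
  Gram matrix of \<open>x1 \<circ> k\<close>, \<open>x2 \<circ> k\<close>.\<close>

lemma two_antipositive_conj_right:
  assumes R: "two_antipositive R" and k: "k \<in> elems A" "adj J k = k"
  shows "two_antipositive (\<lambda>x. R (k \<circ> x \<circ> k))"
proof -
  have kb: "k \<in> bounded_ops J" using k by simp
  note D = two_antipositiveD[OF R]
  have e: "k \<circ> (adj J x \<circ> y) \<circ> k = adj J (x \<circ> k) \<circ> (y \<circ> k)" if "x \<in> elems A" "y \<in> elems A" for x y
    using that k kb by (simp add: adj_comp comp_assoc)
  show ?thesis
    unfolding two_antipositive_def
  proof (intro conjI ballI allI impI)
    fix x1 x2 f1 f2 assume *: "x1 \<in> elems A" "x2 \<in> elems A" "f1 \<in> l2 J" "f2 \<in> l2 J"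
    then show "inner2 (R (k \<circ> (adj J x1 \<circ> x1) \<circ> k) f1) f1 + inner2 (R (k \<circ> (adj J x1 \<circ> x2) \<circ> k) f1) f2 +
       inner2 (R (k \<circ> (adj J x2 \<circ> x1) \<circ> k) f2) f1 + inner2 (R (k \<circ> (adj J x2 \<circ> x2) \<circ> k) f2) f2 \<in> \<real>\<^sub>\<ge>\<^sub>0"
      unfolding e[OF *(1,1)] e[OF *(1,2)] e[OF *(2,1)] e[OF *(2,2)] using k by (intro D(6)) auto
  next
    fix x assume x: "x \<in> elems A"
    have xb: "x \<in> bounded_ops J" using x by simp
    show "R (k \<circ> adj J x \<circ> k) = adj J (R (k \<circ> x \<circ> k))"
      using x k kb D(4)[of "k \<circ> x \<circ> k"] by (simp add: adj_comp comp_assoc)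
    show "R (k \<circ> smul2 c x \<circ> k) = smul2 c (R (k \<circ> x \<circ> k))" for c
      using D(3)[of "k \<circ> x \<circ> k" c] x k kb xb by (simp add: comp_smul_right[OF kb] comp_smul_left)
    show "R (k \<circ> (x + y) \<circ> k) = R (k \<circ> x \<circ> k) + R (k \<circ> y \<circ> k)" if "y \<in> elems A" for y
      using D(2)[of "k \<circ> x \<circ> k" "k \<circ> y \<circ> k"] x k that by (simp add: comp_add_right[OF kb xb] comp_add_left)
    show "positive_op J (R (k \<circ> x \<circ> k))" if "positive_op J x"
      using D(5)[of "k \<circ> x \<circ> k"] positive_op_conj[OF that k] x k by auto
  qed (use D k in auto)
qed

text \<open>The Schwarz inequalities of a map and of its inverse together give equality.\<close>

lemma anti_multiplicative_diag:
  assumes a: "two_antipositive \<alpha>" "\<alpha> unit = unit" and b: "two_antipositive \<beta>" "\<beta> unit = unit"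
    and inv: "\<And>x. x \<in> elems A \<Longrightarrow> \<beta> (\<alpha> x) = x" "\<And>x. x \<in> elems A \<Longrightarrow> \<alpha> (\<beta> x) = x"
    and x: "x \<in> elems A"
  shows "\<alpha> (adj J x \<circ> x) = \<alpha> x \<circ> adj J (\<alpha> x)"
proof (rule positive_op_antisym)
  note Da = two_antipositiveD[OF a(1)] and Db = two_antipositiveD[OF b(1)]
  have m: "\<alpha> x \<in> elems A" "\<alpha> x \<circ> adj J (\<alpha> x) \<in> elems A" "adj J x \<circ> x \<in> elems A" "\<alpha> (adj J x \<circ> x) \<in> elems A"
    using x Da(1) by auto
  show "positive_op J (\<alpha> (adj J x \<circ> x) - (\<alpha> x \<circ> adj J (\<alpha> x)))"
    by (rule anti_schwarz[OF a x])
  \<comment> \<open>The Schwarz inequality for \<beta> is used at the adjoint of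
    \<open>\<alpha> x\<close>. Applying the positive map \<alpha> to it gives the inequality in the
    other direction.\<close>
  have "\<beta> (adj J (\<alpha> x)) = adj J x" using Db(4)[OF m(1)] inv(1)[OF x] by simp
  then have "positive_op J (\<beta> (\<alpha> x \<circ> adj J (\<alpha> x)) - (adj J x \<circ> x))"
    using anti_schwarz[OF b elems_adj[OF m(1)]] m(1) x by (simp only: adj_adj elems_bop)
  moreover have "\<beta> (\<alpha> x \<circ> adj J (\<alpha> x)) \<in> elems A" using Db(1) m by auto
  ultimately have "positive_op J (\<alpha> (\<beta> (\<alpha> x \<circ> adj J (\<alpha> x)) - (adj J x \<circ> x)))"
    using m by (intro Da(5)) auto
  then show "positive_op J ((\<alpha> x \<circ> adj J (\<alpha> x)) - \<alpha> (adj J x \<circ> x))"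
    using \<open>\<beta> (\<alpha> x \<circ> adj J (\<alpha> x)) \<in> elems A\<close> m by (simp add: two_antipositive_diff[OF a(1)] inv)
  show "\<alpha> (adj J x \<circ> x) \<in> bounded_ops J" "\<alpha> x \<circ> adj J (\<alpha> x) \<in> bounded_ops J" using m by auto
qed

text \<open>With z the adjoint of x, expand the diagonal identity at \<open>y + smul2 c z\<close>.
  The choices c = 1 and c = \<i> separate the two mixed terms.\<close>

lemma anti_multiplicative:
  assumes a: "two_antipositive \<alpha>" and diag: "\<And>x. x \<in> elems A \<Longrightarrow> \<alpha> (adj J x \<circ> x) = \<alpha> x \<circ> adj J (\<alpha> x)"
    and x: "x \<in> elems A" and y: "y \<in> elems A"
  shows "\<alpha> (x \<circ> y) = \<alpha> y \<circ> \<alpha> x"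
proof -
  note D = two_antipositiveD[OF a]
  define z where "z = adj J x"
  have z: "z \<in> elems A" and xz: "x = adj J z" using x by (auto simp: z_def)
  have ab: "\<alpha> y \<in> bounded_ops J" "\<alpha> z \<in> bounded_ops J" using D(1) y z by auto
  have zy: "adj J z \<circ> y \<in> elems A" "adj J y \<circ> z \<in> elems A" "adj J y \<circ> y \<in> elems A" "adj J z \<circ> z \<in> elems A"
    using y z by auto
  have key: "smul2 (cnj c) (\<alpha> (adj J z \<circ> y)) + smul2 c (\<alpha> (adj J y \<circ> z)) =
      smul2 (cnj c) (\<alpha> y \<circ> adj J (\<alpha> z)) + smul2 c (\<alpha> z \<circ> adj J (\<alpha> y))" for c
  proof -
    define w where "w = y + smul2 c z"
    have w: "w \<in> elems A" using y z by (simp add: w_def)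
    have "adj J w \<circ> w = (adj J y \<circ> y) + (smul2 c (adj J y \<circ> z) + (smul2 (cnj c) (adj J z \<circ> y) + smul2 (cnj c * c) (adj J z \<circ> z)))"
      using y z unfolding w_def
      by (simp add: adj_add adj_smul comp_add_left comp_add_right[where I=J] comp_smul_left comp_smul_right[where I=J] smul2_add add_ac)
    then have "\<alpha> (adj J w \<circ> w) = \<alpha> (adj J y \<circ> y) + (smul2 c (\<alpha> (adj J y \<circ> z)) + (smul2 (cnj c) (\<alpha> (adj J z \<circ> y)) + smul2 (cnj c * c) (\<alpha> (adj J z \<circ> z))))"
      using zy by (simp add: D(2,3))
    moreover have "\<alpha> w = \<alpha> y + smul2 c (\<alpha> z)" using y z by (simp add: w_def D(2,3))
    then have "\<alpha> w \<circ> adj J (\<alpha> w) = (\<alpha> y \<circ> adj J (\<alpha> y)) + (smul2 c (\<alpha> z \<circ> adj J (\<alpha> y)) + (smul2 (cnj c) (\<alpha> y \<circ> adj J (\<alpha> z)) + smul2 (cnj c * c) (\<alpha> z \<circ> adj J (\<alpha> z))))"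
      using ab by (simp add: adj_add adj_smul comp_add_left comp_add_right[where I=J] comp_smul_left comp_smul_right[where I=J] smul2_add add_ac mult.commute)
    ultimately show ?thesis using diag[OF w] diag[OF y] diag[OF z] by (simp add: add_ac)
  qed
  have "\<alpha> (adj J z \<circ> y) = \<alpha> y \<circ> adj J (\<alpha> z)"
  proof (intro ext)
    fix f i
    let ?p = "\<alpha> (adj J z \<circ> y) f i" and ?q = "\<alpha> (adj J y \<circ> z) f i"
      and ?r = "(\<alpha> y \<circ> adj J (\<alpha> z)) f i" and ?s = "(\<alpha> z \<circ> adj J (\<alpha> y)) f i"
    have "cnj c * ?p + c * ?q = cnj c * ?r + c * ?s" for c
      using fun_cong[OF fun_cong[OF key[of c], of f], of i] by simp
    from this[of 1] this[of \<i>] have "?p + ?q = ?r + ?s" "\<i> * (?q - ?p) = \<i> * (?s - ?r)"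
      by (simp_all add: algebra_simps)
    then have "?p + ?q = ?r + ?s" "?q - ?p = ?s - ?r" by simp_all
    then have "2 * ?p = 2 * ?r" by algebra
    then show "?p = ?r" by simp
  qed
  then show ?thesis using D(4)[OF z] by (simp add: xz)
qed

text \<open>The limit is taken weakly, as the operator of the limiting sesquilinear form, and it
  inherits commutation with the commutant. The geometric bound on the steps then gives the stated
  norm estimate.\<close>

lemma contraction_limit:
  assumes y: "\<And>n. y n \<in> elems A" and r: "0 \<le> r" "r < 1" and C: "0 \<le> C"
    and step: "\<And>n f. f \<in> l2 J \<Longrightarrow> norm2 (y (Suc n) f - y n f) \<le> C * r ^ n * norm2 f"
  obtains z where "z \<in> elems A"
    "\<And>n f. f \<in> l2 J \<Longrightarrow> norm2 (z f - y n f) \<le> C / (1 - r) * r ^ n * norm2 f"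
proof -
  have yb: "y n \<in> bounded_ops J" for n using y by simp
  have far: "norm2 (y (n + k) f - y n f) \<le> C * r ^ n * (\<Sum>j<k. r ^ j) * norm2 f" if f: "f \<in> l2 J" for n k f
  proof (induction k)
    case (Suc k)
    have "y (n + Suc k) f - y n f = (y (Suc (n + k)) f - y (n + k) f) + (y (n + k) f - y n f)" by simp
    then have "norm2 (y (n + Suc k) f - y n f) \<le> norm2 (y (Suc (n + k)) f - y (n + k) f) + norm2 (y (n + k) f - y n f)"
      using yb by (metis norm2_triangle l2_diff bop_l2)
    also have "\<dots> \<le> C * r ^ (n + k) * norm2 f + C * r ^ n * (\<Sum>j<k. r ^ j) * norm2 f"
      using step[OF f] Suc by (intro add_mono)
    also have "\<dots> = C * r ^ n * (\<Sum>j<Suc k. r ^ j) * norm2 f" by (simp add: algebra_simps power_add)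
    finally show ?case .
  qed (simp only: add_0_right diff_self norm2_zero lessThan_0 sum.empty mult_zero_right mult_zero_left order_refl)
  have geo: "(\<Sum>j<k. r ^ j) \<le> 1 / (1 - r)" for k
    using sum_le_suminf[OF summable_geometric, of r "{..<k}"] suminf_geometric[of r] r by auto
  have far': "norm2 (y (n + k) f - y n f) \<le> C / (1 - r) * r ^ n * norm2 f" if f: "f \<in> l2 J" for n k f
  proof -
    have "C * r ^ n * (\<Sum>j<k. r ^ j) * norm2 f \<le> C * r ^ n * (1 / (1 - r)) * norm2 f"
      using C r geo by (intro mult_right_mono mult_left_mono) auto
    then show ?thesis using far[OF f, of n k] by simp
  qed
  define D where "D = C / (1 - r)"
  have D: "0 \<le> D" using C r by (simp add: D_def)
  have weak: "cmod (inner2 (y (n + k) f) g - inner2 (y n f) g) \<le> D * r ^ n * norm2 f * norm2 g"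
    if f: "f \<in> l2 J" and g: "g \<in> l2 J" for n k f g
  proof -
    have "inner2 (y (n + k) f) g - inner2 (y n f) g = inner2 (y (n + k) f - y n f) g"
      using yb g by (simp add: inner2_diff_left[where I=J])
    then have "cmod (inner2 (y (n + k) f) g - inner2 (y n f) g) \<le> norm2 (y (n + k) f - y n f) * norm2 g"
      using yb g inner2_cauchy_schwarz[of "y (n + k) f - y n f" J g] by simp
    also have "\<dots> \<le> D * r ^ n * norm2 f * norm2 g"
      using far'[OF f, of n k] by (intro mult_right_mono) (auto simp: D_def)
    finally show ?thesis .
  qed
  have conv: "convergent (\<lambda>n. inner2 (y n f) g)" if f: "f \<in> l2 J" and g: "g \<in> l2 J" for f g
    unfolding Cauchy_convergent_iff[symmetric]
  proof (rule metric_CauchyI)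
    fix e :: real assume e: "0 < e"
    have "(\<lambda>n. 2 * (D * r ^ n * norm2 f * norm2 g)) \<longlonglongrightarrow> 2 * (D * 0 * norm2 f * norm2 g)"
      using r by (intro tendsto_mult tendsto_const LIMSEQ_realpow_zero)
    then have "\<forall>\<^sub>F n in sequentially. 2 * (D * r ^ n * norm2 f * norm2 g) < e"
      using e by (intro order_tendstoD) auto
    then obtain N where N: "2 * (D * r ^ N * norm2 f * norm2 g) < e" by (auto simp: eventually_sequentially)
    have near: "cmod (inner2 (y m f) g - inner2 (y N f) g) \<le> D * r ^ N * norm2 f * norm2 g" if "N \<le> m" for m
      using weak[OF f g, of N "m - N"] that by simp
    show "\<exists>N. \<forall>m\<ge>N. \<forall>n\<ge>N. dist (inner2 (y m f) g) (inner2 (y n f) g) < e"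
    proof (intro exI[of _ N] allI impI)
      fix m n assume "N \<le> m" "N \<le> n"
      then show "dist (inner2 (y m f) g) (inner2 (y n f) g) < e"
        using near[of m] near[of n] N dist_triangle2[of "inner2 (y m f) g" "inner2 (y n f) g" "inner2 (y N f) g"]
        by (simp add: dist_norm)
    qed
  qed
  define B where "B f g = lim (\<lambda>n. inner2 (y n f) g)" for f g
  have B: "(\<lambda>n. inner2 (y n f) g) \<longlonglongrightarrow> B f g" if "f \<in> l2 J" "g \<in> l2 J" for f g
    unfolding B_def using conv[OF that] by (rule convergent_LIMSEQ_iff[THEN iffD1])
  have Bn: "cmod (B f g - inner2 (y n f) g) \<le> D * r ^ n * norm2 f * norm2 g"
    if f: "f \<in> l2 J" and g: "g \<in> l2 J" for n f g
  proof (rule tendsto_upperbound)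
    show "(\<lambda>k. cmod (inner2 (y (k + n) f) g - inner2 (y n f) g)) \<longlonglongrightarrow> cmod (B f g - inner2 (y n f) g)"
      by (intro tendsto_intros LIMSEQ_ignore_initial_segment B f g)
    show "\<forall>\<^sub>F k in sequentially. cmod (inner2 (y (k + n) f) g - inner2 (y n f) g) \<le> D * r ^ n * norm2 f * norm2 g"
      using weak[OF f g, of n] by (simp add: add.commute)
  qed simp
  obtain C0 where C0: "0 \<le> C0" "\<And>f. f \<in> l2 J \<Longrightarrow> norm2 (y 0 f) \<le> C0 * norm2 f"
    using bop_bound[OF yb] by blast
  obtain z where z: "z \<in> bounded_ops J" "\<And>f g. f \<in> l2 J \<Longrightarrow> g \<in> l2 J \<Longrightarrow> inner2 (z f) g = B f g"
  proof (rule form_operator[of J B "C0 + D"])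
    fix f g h assume fgh: "f \<in> l2 J" "g \<in> l2 J" "h \<in> l2 J"
    have e: "inner2 (y n (f + g)) h = inner2 (y n f) h + inner2 (y n g) h"
      "inner2 (y n h) (f + g) = inner2 (y n h) f + inner2 (y n h) g" for n
      using fgh yb by (auto simp: bop_add[OF yb] inner2_simps[where I=J])
    show "B (f + g) h = B f h + B g h"
      by (rule LIMSEQ_unique[OF B[OF l2_add[OF fgh(1,2)] fgh(3)]]) (unfold e, intro tendsto_add B fgh)
    show "B h (f + g) = B h f + B h g"
      by (rule LIMSEQ_unique[OF B[OF fgh(3) l2_add[OF fgh(1,2)]]]) (unfold e, intro tendsto_add B fgh)
  next
    fix c f h assume fh: "f \<in> l2 J" "h \<in> l2 J"
    have e: "inner2 (y n (smul1 c f)) h = c * inner2 (y n f) h" "inner2 (y n h) (smul1 c f) = cnj c * inner2 (y n h) f" for n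
      using fh by (auto simp: bop_smul[OF yb] inner2_scalar_simps)
    show "B (smul1 c f) h = c * B f h"
      by (rule LIMSEQ_unique[OF B[OF l2_smul1[OF fh(1)] fh(2)]]) (unfold e, intro tendsto_mult tendsto_const B fh)
    show "B h (smul1 c f) = cnj c * B h f"
      by (rule LIMSEQ_unique[OF B[OF fh(2) l2_smul1[OF fh(1)]]]) (unfold e, intro tendsto_mult tendsto_const B fh)
  next
    fix f h assume fh: "f \<in> l2 J" "h \<in> l2 J"
    have "cmod (B f h) \<le> cmod (B f h - inner2 (y 0 f) h) + cmod (inner2 (y 0 f) h)"
      using norm_triangle_ineq[of "B f h - inner2 (y 0 f) h" "inner2 (y 0 f) h"] by simp
    also have "\<dots> \<le> D * norm2 f * norm2 h + norm2 (y 0 f) * norm2 h"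
      using Bn[OF fh, of 0] inner2_cauchy_schwarz[of "y 0 f" J h] yb fh by (intro add_mono) auto
    also have "\<dots> \<le> D * norm2 f * norm2 h + C0 * norm2 f * norm2 h"
      using C0(2)[OF fh(1)] by (intro add_mono mult_right_mono) auto
    finally show "cmod (B f h) \<le> (C0 + D) * norm2 f * norm2 h" by (simp add: algebra_simps)
  qed blast
  have "z \<circ> t = t \<circ> z" if t: "t \<in> commutant J (elems A)" for t
  proof (rule op_eqI_inner)
    have tb: "t \<in> bounded_ops J" using t commutant_sub by auto
    show "z \<circ> t \<in> bounded_ops J" "t \<circ> z \<in> bounded_ops J" using z tb by auto
    fix f g assume f: "f \<in> l2 J" and g: "g \<in> l2 J"
    have "inner2 (y n (t f)) g = inner2 (y n f) (adj J t g)" for n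
    proof -
      have "y n (t f) = t (y n f)" using t y by (metis commutant_iff comp_apply)
      then show ?thesis using yb g tb by (simp add: inner2_adj_right[OF tb])
    qed
    then have "B (t f) g = B f (adj J t g)" by (simp add: B_def)
    then show "inner2 ((z \<circ> t) f) g = inner2 ((t \<circ> z) f) g"
      using f g tb z(1) by (simp add: z(2) flip: inner2_adj_right[OF tb])
  qed
  then have "z \<in> elems A" unfolding elems_iff using z(1) by blast
  moreover have "norm2 (z f - y n f) \<le> C / (1 - r) * r ^ n * norm2 f" if f: "f \<in> l2 J" for n f
  proof -
    \<comment> \<open>Testing the weak estimate against the difference itself turns it into a norm
      estimate.\<close>
    define g where "g = z f - y n f"
    have g: "g \<in> l2 J" using z yb by (simp add: g_def)
    have "inner2 g g = B f g - inner2 (y n f) g"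
      using f g z yb by (subst (1) g_def) (simp add: inner2_diff_left[where I=J])
    then have "(norm2 g)\<^sup>2 = cmod (B f g - inner2 (y n f) g)"
      using inner2_self[of g] by (metis norm_of_real abs_power2)
    also have "\<dots> \<le> D * r ^ n * norm2 f * norm2 g" by (rule Bn[OF f g])
    finally have "norm2 g * norm2 g \<le> (D * r ^ n * norm2 f) * norm2 g" by (simp add: power2_eq_square)
    then have "norm2 g \<le> D * r ^ n * norm2 f"
      using D r norm2_nonneg[of g] by (cases "norm2 g = 0") (auto simp: mult_le_cancel_right)
    then show ?thesis by (simp add: g_def D_def)
  qed
  ultimately show ?thesis using that by blast
qed

end

section \<open>Inverses and square roots inside the algebra, and the resulting
  anti-automorphism\<close>

context vn_algebra
begin

lemma norm_le_of_weak:
  assumes x: "x \<in> bounded_ops J" and h: "f \<in> l2 J" "0 \<le> C"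
    and w: "\<And>g. g \<in> l2 J \<Longrightarrow> cmod (inner2 (x f) g) \<le> C * norm2 f * norm2 g"
  shows "norm2 (x f) \<le> C * norm2 f"
proof (cases "norm2 (x f) = 0")
  case False
  have "(norm2 (x f))\<^sup>2 = cmod (inner2 (x f) (x f))"
    using inner2_self[of "x f"] by (metis norm_of_real abs_power2)
  also have "\<dots> \<le> C * norm2 f * norm2 (x f)" using x by (intro w) auto
  finally have "norm2 (x f) * norm2 (x f) \<le> (C * norm2 f) * norm2 (x f)" by (simp add: power2_eq_square)
  then show ?thesis using False norm2_nonneg[of "x f"] by (simp add: mult_le_cancel_right)
qed (use h in simp)

text \<open>Cauchy-Schwarz for the semi-inner product \<open>inner2 (c f) g\<close> bounds it by the
  two diagonal values, and these are controlled by \<open>q\<close>.\<close>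

lemma positive_op_norm:
  assumes c: "positive_op J c" and q: "0 \<le> q"
    and le: "\<And>f. f \<in> l2 J \<Longrightarrow> Re (inner2 (c f) f) \<le> q * (norm2 f)\<^sup>2"
    and f: "f \<in> l2 J"
  shows "norm2 (c f) \<le> q * norm2 f"
proof (rule norm_le_of_weak[OF _ f q])
  show cb: "c \<in> bounded_ops J" using c by (simp add: positive_op_def)
  fix g assume g: "g \<in> l2 J"
  have real: "inner2 (c h) h = complex_of_real (Re (inner2 (c h) h))" "0 \<le> Re (inner2 (c h) h)" if "h \<in> l2 J" for h
    using c that by (auto simp: positive_op_def complex_nonneg_Reals_iff complex_eq_iff)
  have herm: "inner2 (c g) f = cnj (inner2 (c f) g)"
    using inner2_adj_left[OF cb g f] positive_op_adj[OF c] by (simp add: inner2_cnj)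
  have "(cmod (cnj (inner2 (c f) g)))\<^sup>2 \<le> Re (inner2 (c f) f) * Re (inner2 (c g) g)"
  proof (rule cauchy_schwarz_discriminant)
    fix t
    have "inner2 (c (f + smul1 t g)) (f + smul1 t g)
        = inner2 (c f) f + (t * inner2 (c g) f + cnj (t * inner2 (c g) f)) + (t * cnj t) * inner2 (c g) g"
      using cb f g by (simp add: bop_add[OF cb] bop_smul[OF cb] inner2_simps[where I=J] inner2_scalar_simps herm algebra_simps)
    also have "\<dots> = inner2 (c f) f + complex_of_real (2 * Re (t * inner2 (c g) f)) + complex_of_real ((cmod t)\<^sup>2) * inner2 (c g) g"
      by (simp only: complex_add_cnj complex_norm_square)
    finally have "Re (inner2 (c (f + smul1 t g)) (f + smul1 t g))
        = Re (inner2 (c f) f) + 2 * Re (t * inner2 (c g) f) + (cmod t)\<^sup>2 * Re (inner2 (c g) g)"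
      by (simp del: of_real_power)
    then show "0 \<le> Re (inner2 (c f) f) + 2 * Re (t * cnj (inner2 (c f) g)) + (cmod t)\<^sup>2 * Re (inner2 (c g) g)"
      using real(2)[of "f + smul1 t g"] f g by (simp add: herm)
  qed (use real f g in auto)
  then have "(cmod (inner2 (c f) g))\<^sup>2 \<le> Re (inner2 (c f) f) * Re (inner2 (c g) g)" by simp
  also have "\<dots> \<le> (q * (norm2 f)\<^sup>2) * (q * (norm2 g)\<^sup>2)"
    using le f g real q by (intro mult_mono) auto
  also have "\<dots> = (q * norm2 f * norm2 g)\<^sup>2" by (simp add: power2_eq_square mult_ac)
  finally show "cmod (inner2 (c f) g) \<le> q * norm2 f * norm2 g"
    by (rule power2_le_imp_le) (use q in simp)
qed

lemma geometric_small:
  assumes "0 \<le> r" "r < 1" "\<And>n. a \<le> D * r ^ n" shows "(a :: real) \<le> 0"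
proof -
  have "(\<lambda>n. D * r ^ n) \<longlonglongrightarrow> D * 0"
    using assms(1,2) by (intro tendsto_mult tendsto_const LIMSEQ_realpow_zero) auto
  then have "(\<lambda>n. D * r ^ n) \<longlonglongrightarrow> 0" by simp
  then show ?thesis by (rule tendsto_lowerbound) (use assms(3) in auto)
qed

text \<open>The square root of \<open>1 - c\<close> is \<open>1 - z\<close>, where \<open>z\<close> is the fixed point of the contraction
  \<open>z \<mapsto> (c + z\<^sup>2) / 2\<close> on the ball of radius \<open>1 - sqrt (1 - q)\<close>.\<close>

lemma sqrt_fixed_point:
  assumes c: "c \<in> elems A" "adj J c = c" and q: "0 \<le> q" "q < 1"
    and cq: "\<And>f. f \<in> l2 J \<Longrightarrow> norm2 (c f) \<le> q * norm2 f"
  obtains z r where "z \<in> elems A" "adj J z = z" "z = smul2 (1 / 2) (c + (z \<circ> z))" "0 \<le> r" "r < 1"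
    "\<And>f. f \<in> l2 J \<Longrightarrow> norm2 (z f) \<le> r * norm2 f"
proof -
  define r where "r = 1 - sqrt (1 - q)"
  have r: "0 \<le> r" "r < 1" using q by (auto simp: r_def)
  have "sqrt (1 - q) * sqrt (1 - q) = 1 - q" using q by simp
  moreover have "r * r = 1 - 2 * sqrt (1 - q) + sqrt (1 - q) * sqrt (1 - q)" by (simp add: r_def algebra_simps)
  ultimately have "r * r = 2 - 2 * sqrt (1 - q) - q" by linarith
  \<comment> \<open>\<open>r\<close> is fixed by the scalar map sending r to (q + r r) / 2. Hence
    the iteration preserves the bound \<open>r\<close>, and on operators with this bound it
    contracts distances by the factor \<open>r\<close>.\<close>
  then have rq: "(q + r * r) / 2 = r" by (simp add: r_def diff_divide_distrib)
  define y where "y n = ((\<lambda>z. smul2 (1 / 2) (c + (z \<circ> z))) ^^ n) 0" for n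
  have y0: "y 0 = 0" and yS: "y (Suc n) = smul2 (1 / 2) (c + (y n \<circ> y n))" for n
    by (simp_all only: y_def funpow.simps id_apply comp_apply)
  have ye: "y n \<in> elems A" for n
    by (induction n) (simp_all only: y0 yS elems_closed c)
  have yb: "y n \<in> bounded_ops J" for n using ye by simp
  have yn: "norm2 (y n f) \<le> r * norm2 f" if f: "f \<in> l2 J" for n f
    using f
  proof (induction n arbitrary: f)
    case 0
    have "norm2 (y 0 f) = 0" by (simp only: y0 fun_apply2 norm2_zero)
    then show ?case using r by simp
  next
    case (Suc n)
    have "norm2 (c f + y n (y n f)) \<le> norm2 (c f) + norm2 (y n (y n f))"
      using c yb by (intro norm2_triangle[of _ J]) auto
    also have "norm2 (y n (y n f)) \<le> r * norm2 (y n f)" using yb by (intro Suc.IH) auto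
    also have "r * norm2 (y n f) \<le> r * (r * norm2 f)" using r Suc by (intro mult_left_mono) auto
    finally have "norm2 (c f + y n (y n f)) \<le> q * norm2 f + r * (r * norm2 f)" using cq[OF Suc.prems] by linarith
    then have "norm2 (y (Suc n) f) \<le> (q + r * r) / 2 * norm2 f"
      by (simp add: yS norm2_smul algebra_simps)
    then show ?case by (simp only: rq)
  qed
  have sq: "norm2 (y m (y m f) - y n (y n f)) \<le> r * D * norm2 f + D * (r * norm2 f)"
    if f: "f \<in> l2 J" and d: "\<And>f. f \<in> l2 J \<Longrightarrow> norm2 (y m f - y n f) \<le> D * norm2 f" and D: "0 \<le> D" for m n f D
  proof -
    \<comment> \<open>A difference of squares, factored without commuting the two operators.\<close>
    have "y m (y m f) - y n (y n f) = y m (y m f - y n f) + (y m (y n f) - y n (y n f))"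
      using yb by (simp add: bop_diff[OF yb])
    then have "norm2 (y m (y m f) - y n (y n f)) \<le> norm2 (y m (y m f - y n f)) + norm2 (y m (y n f) - y n (y n f))"
      using yb by (metis norm2_triangle l2_diff bop_l2)
    also have "norm2 (y m (y m f - y n f)) \<le> r * norm2 (y m f - y n f)" using yb by (intro yn) auto
    also have "r * norm2 (y m f - y n f) \<le> r * (D * norm2 f)" using r d[OF f] by (intro mult_left_mono)
    also have "norm2 (y m (y n f) - y n (y n f)) \<le> D * norm2 (y n f)" using yb by (intro d) auto
    also have "D * norm2 (y n f) \<le> D * (r * norm2 f)" using D yn[OF f] by (intro mult_left_mono)
    finally show ?thesis by simp
  qed
  have step: "norm2 (y (Suc n) f - y n f) \<le> q * r ^ n * norm2 f" if f: "f \<in> l2 J" for n f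
    using f
  proof (induction n arbitrary: f)
    case 0
    have "y (Suc 0) f - y 0 f = smul1 (1 / 2) (c f)"
    proof
      fix i
      have "(0 :: 'i vec) i = 0" by simp
      then show "(y (Suc 0) f - y 0 f) i = smul1 (1 / 2) (c f) i"
        unfolding yS y0 smul2_apply fun_apply2 fun_apply1 smul1_apply comp_apply by simp
    qed
    then have "norm2 (y (Suc 0) f - y 0 f) = norm2 (c f) / 2" by (simp only: norm2_smul) simp
    also have "\<dots> \<le> q * norm2 f" using cq[OF 0] norm2_nonneg[of "c f"] by linarith
    finally show ?case by (simp only: power_0 mult_1_right)
  next
    case (Suc n)
    have "norm2 (y (Suc n) (y (Suc n) f) - y n (y n f)) \<le> r * (q * r ^ n) * norm2 f + q * r ^ n * (r * norm2 f)"
    proof (rule sq[OF Suc.prems Suc.IH])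
      show "0 \<le> q * r ^ n" using q r by simp
    qed
    moreover have "r * (q * r ^ n) * norm2 f + q * r ^ n * (r * norm2 f) = 2 * (q * r ^ Suc n * norm2 f)" by simp
    ultimately have b: "1 / 2 * norm2 (y (Suc n) (y (Suc n) f) - y n (y n f)) \<le> q * r ^ Suc n * norm2 f"
      by linarith
    have e: "y (Suc (Suc n)) f - y (Suc n) f = smul1 (1 / 2) (y (Suc n) (y (Suc n) f) - y n (y n f))"
    proof
      fix i show "(y (Suc (Suc n)) f - y (Suc n) f) i = smul1 (1 / 2) (y (Suc n) (y (Suc n) f) - y n (y n f)) i"
        unfolding fun_apply1 yS[of "Suc n"] by (subst (2) yS) (simp add: field_simps)
    qed
    have half: "cmod (1 / 2) = 1 / 2" by simp
    show ?case unfolding e norm2_smul half by (rule b)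
  qed
  obtain z where z: "z \<in> elems A" "\<And>n f. f \<in> l2 J \<Longrightarrow> norm2 (z f - y n f) \<le> q / (1 - r) * r ^ n * norm2 f"
    by (rule contraction_limit[OF ye r q(1) step]) auto
  define D where "D = q / (1 - r)"
  have D: "0 \<le> D" using q r by (simp add: D_def)
  have zb: "z \<in> bounded_ops J" using z by simp
  have zn: "norm2 (z f) \<le> r * norm2 f" if f: "f \<in> l2 J" for f
  proof -
    have "norm2 (z f) - r * norm2 f \<le> (D * norm2 f) * r ^ n" for n
    proof -
      have "norm2 (z f) \<le> norm2 (z f - y n f) + norm2 (y n f)"
        using norm2_triangle[of "z f - y n f" J "y n f"] zb yb by simp
      then show ?thesis using z(2)[OF f, of n] yn[OF f, of n] by (simp add: D_def mult_ac)
    qed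
    from geometric_small[OF r this] show ?thesis by simp
  qed
  have fix_z: "z = smul2 (1 / 2) (c + (z \<circ> z))"
  proof (rule op_eqI)
    show "z \<in> bounded_ops J" "smul2 (1 / 2) (c + (z \<circ> z)) \<in> bounded_ops J" using zb c by auto
    fix f assume f: "f \<in> l2 J"
    define g where "g = z f - smul1 (1 / 2) (c f + z (z f))"
    have g: "g \<in> l2 J" using zb c by (simp add: g_def)
    have "norm2 g \<le> (D * norm2 f + r * D * norm2 f) * r ^ n" for n
    proof -
      \<comment> \<open>The defect of the fixed point equation is expressed by the errors of two
        consecutive iterates. It is at most a constant times \<open>r ^ n\<close> for every n, hence
        0.\<close>
      have e: "g = (z f - y (Suc n) f) + smul1 (1 / 2) ((y n (y n f) - z (y n f)) + z (y n f - z f))"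
        unfolding g_def yS using zb yb c f by (simp add: bop_diff[OF zb]) (simp add: fun_eq_iff algebra_simps)
      have t1: "norm2 g \<le> norm2 (z f - y (Suc n) f) + norm2 (smul1 (1 / 2) ((y n (y n f) - z (y n f)) + z (y n f - z f)))"
        by (subst e, rule norm2_triangle[of _ J]) (use zb yb in auto)
      have t2: "norm2 (smul1 (1 / 2) ((y n (y n f) - z (y n f)) + z (y n f - z f))) \<le> (norm2 (y n (y n f) - z (y n f)) + norm2 (z (y n f - z f))) / 2"
      proof -
        have "norm2 ((y n (y n f) - z (y n f)) + z (y n f - z f)) \<le> norm2 (y n (y n f) - z (y n f)) + norm2 (z (y n f - z f))"
          using zb yb by (intro norm2_triangle[of _ J]) auto
        moreover have "N \<le> P + Q \<Longrightarrow> cmod (1 / 2) * N \<le> (P + Q) / 2" for N P Q :: real by simp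
        ultimately show ?thesis unfolding norm2_smul by blast
      qed
      define U where "U = D * r ^ n * norm2 f"
      have "norm2 (y n (y n f) - z (y n f)) = norm2 (z (y n f) - y n (y n f))"
        using norm2_uminus[of "y n (y n f) - z (y n f)"] by (simp only: minus_diff_eq)
      also have "\<dots> \<le> D * r ^ n * norm2 (y n f)" unfolding D_def using yb by (intro z(2)) auto
      also have "\<dots> \<le> D * r ^ n * (r * norm2 f)" using D r yn[OF f] by (intro mult_left_mono) auto
      also have "\<dots> = r * U" by (simp add: U_def)
      finally have t3: "norm2 (y n (y n f) - z (y n f)) \<le> r * U" .
      have "norm2 (z (y n f - z f)) \<le> r * norm2 (y n f - z f)" using yb zb by (intro zn) auto
      also have "norm2 (y n f - z f) = norm2 (z f - y n f)"
        using norm2_uminus[of "y n f - z f"] by (simp only: minus_diff_eq)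
      also have "r * norm2 (z f - y n f) \<le> r * U"
        using r z(2)[OF f, of n] by (intro mult_left_mono) (auto simp: D_def U_def)
      finally have t4: "norm2 (z (y n f - z f)) \<le> r * U" .
      have "norm2 (z f - y (Suc n) f) \<le> D * r ^ Suc n * norm2 f" using z(2)[OF f, of "Suc n"] unfolding D_def .
      also have "\<dots> \<le> U"
        unfolding U_def using D r by (intro mult_right_mono mult_left_mono) (auto simp: mult_left_le_one_le)
      finally have t5: "norm2 (z f - y (Suc n) f) \<le> U" .
      have "norm2 g \<le> U + r * U"
      proof -
        have "G \<le> a + b \<Longrightarrow> b \<le> (c + d) / 2 \<Longrightarrow> c \<le> t \<Longrightarrow> d \<le> t \<Longrightarrow> a \<le> u \<Longrightarrow> G \<le> u + t"
          for G a b c d t u :: real by simp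
        from this[OF t1 t2 t3 t4 t5] show ?thesis .
      qed
      also have "\<dots> = (D * norm2 f + r * D * norm2 f) * r ^ n" by (simp add: U_def algebra_simps)
      finally show ?thesis .
    qed
    then have "norm2 g \<le> 0" by (rule geometric_small[OF r])
    then have "g = 0" using norm2_eq_0[OF g] norm2_nonneg[of g] by linarith
    then show "z f = smul2 (1 / 2) (c + (z \<circ> z)) f" by (simp add: g_def)
  qed
  have ysa: "adj J (y n) = y n" for n
  proof (induction n)
    case 0
    show ?case unfolding y0 by (rule adj_zero)
  next
    case (Suc n)
    then show ?case using c yb by (simp only: yS adj_smul adj_add adj_comp comp_bop add_bop elems_bop) simp
  qed
  have "adj J z = z"
  proof (rule adj_eqI[OF zb zb])
    fix f g assume f: "f \<in> l2 J" and g: "g \<in> l2 J"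
    have "cmod (inner2 (z f) g - inner2 f (z g)) \<le> (2 * D * norm2 f * norm2 g) * r ^ n" for n
    proof -
      have "inner2 (y n f) g = inner2 f (y n g)" using inner2_adj_right[OF yb f g, of n] ysa by simp
      then have "inner2 (z f) g - inner2 f (z g) = inner2 (z f - y n f) g - inner2 f (z g - y n g)"
        using zb yb f g by (simp add: inner2_simps[where I=J])
      then have "cmod (inner2 (z f) g - inner2 f (z g)) \<le> cmod (inner2 (z f - y n f) g) + cmod (inner2 f (z g - y n g))"
        by (simp only: norm_triangle_ineq4)
      also have "\<dots> \<le> norm2 (z f - y n f) * norm2 g + norm2 f * norm2 (z g - y n g)"
        using zb yb f g by (intro add_mono inner2_cauchy_schwarz[of _ J]) auto
      also have "\<dots> \<le> (D * r ^ n * norm2 f) * norm2 g + norm2 f * (D * r ^ n * norm2 g)"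
        unfolding D_def using f g by (intro add_mono mult_right_mono mult_left_mono z(2)) auto
      finally show ?thesis by (simp add: mult_ac)
    qed
    from geometric_small[OF r this] show "inner2 (z f) g = inner2 f (z g)" by simp
  qed
  then show ?thesis using that[OF z(1) _ fix_z r zn] by blast
qed

text \<open>Iterating w to 1 + z w produces the partial sums of the geometric series, and the limit
  is a right inverse of 1 - z. Since 1 - z is selfadjoint, the adjoint of w is a left inverse, so
  the two coincide.\<close>

lemma neumann_inverse:
  assumes z: "z \<in> elems A" "adj J z = z" and r: "0 \<le> r" "r < 1"
    and zn: "\<And>f. f \<in> l2 J \<Longrightarrow> norm2 (z f) \<le> r * norm2 f"
  obtains w where "w \<in> elems A" "adj J w = w" "(unit - z) \<circ> w = unit" "w \<circ> (unit - z) = unit"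
proof -
  define y where "y n = ((\<lambda>w. unit + (z \<circ> w)) ^^ n) 0" for n
  have y0: "y 0 = 0" and yS: "y (Suc n) = unit + (z \<circ> y n)" for n
    by (simp_all only: y_def funpow.simps id_apply comp_apply)
  have zb: "z \<in> bounded_ops J" using z by simp
  have ye: "y n \<in> elems A" for n
    by (induction n) (simp_all only: y0 yS elems_closed z)
  have yb: "y n \<in> bounded_ops J" for n using ye by simp
  have step: "norm2 (y (Suc n) f - y n f) \<le> 1 * r ^ n * norm2 f" if f: "f \<in> l2 J" for n f
  proof (induction n)
    case 0
    have "y (Suc 0) f - y 0 f = f"
      using f unfolding yS y0 fun_apply2 comp_apply bop_zero[OF zb] by simp
    then show ?case by (simp only: power_0 mult_1_right mult_1 order_refl)
  next
    case (Suc n)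
    have "y (Suc (Suc n)) f - y (Suc n) f = z (y (Suc n) f - y n f)"
      unfolding yS[of "Suc n"] by (subst (2) yS) (simp add: bop_diff[OF zb] yb)
    then have "norm2 (y (Suc (Suc n)) f - y (Suc n) f) \<le> r * norm2 (y (Suc n) f - y n f)"
      using zn[of "y (Suc n) f - y n f"] yb by simp
    also have "\<dots> \<le> r * (1 * r ^ n * norm2 f)" using r Suc by (intro mult_left_mono)
    also have "\<dots> = 1 * r ^ Suc n * norm2 f" by simp
    finally show ?case .
  qed
  obtain w where w: "w \<in> elems A" "\<And>n f. f \<in> l2 J \<Longrightarrow> norm2 (w f - y n f) \<le> 1 / (1 - r) * r ^ n * norm2 f"
    by (rule contraction_limit[OF ye r _ step]) auto
  have wb: "w \<in> bounded_ops J" using w by simp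
  have w_eq: "w f = f + z (w f)" if f: "f \<in> l2 J" for f
  proof -
    define g where "g = w f - (f + z (w f))"
    have g: "g \<in> l2 J" using wb zb f by (simp add: g_def)
    have "norm2 g \<le> (2 * (1 / (1 - r)) * norm2 f) * r ^ n" for n
    proof -
      have e: "g = (w f - y (Suc n) f) + z (y n f - w f)"
        unfolding g_def yS using zb wb yb f by (simp add: bop_diff[OF zb]) 
      have t1: "norm2 g \<le> norm2 (w f - y (Suc n) f) + norm2 (z (y n f - w f))"
        by (subst e, rule norm2_triangle[of _ J]) (use zb yb wb in auto)
      define V where "V = 1 / (1 - r) * r ^ n * norm2 f"
      have "norm2 (z (y n f - w f)) \<le> r * norm2 (y n f - w f)" using yb wb by (intro zn) auto
      also have "\<dots> \<le> 1 * norm2 (y n f - w f)" using r by (intro mult_right_mono) auto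
      also have "\<dots> = norm2 (w f - y n f)"
        using norm2_uminus[of "y n f - w f"] by (simp only: minus_diff_eq mult_1)
      also have "\<dots> \<le> V" unfolding V_def by (rule w(2)[OF f])
      finally have t2: "norm2 (z (y n f - w f)) \<le> V" .
      have "norm2 (w f - y (Suc n) f) \<le> 1 / (1 - r) * r ^ Suc n * norm2 f" by (rule w(2)[OF f])
      also have "\<dots> \<le> V"
        unfolding V_def using r by (intro mult_right_mono mult_left_mono) (auto simp: mult_left_le_one_le)
      finally have t3: "norm2 (w f - y (Suc n) f) \<le> V" .
      have "norm2 g \<le> 2 * V"
      proof -
        have "G \<le> a + b \<Longrightarrow> b \<le> v \<Longrightarrow> a \<le> v \<Longrightarrow> G \<le> 2 * v" for G a b v :: real by linarith
        from this[OF t1 t2 t3] show ?thesis .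
      qed
      also have "\<dots> = (2 * (1 / (1 - r)) * norm2 f) * r ^ n" by (simp add: V_def)
      finally show ?thesis .
    qed
    then have "norm2 g \<le> 0" by (rule geometric_small[OF r])
    then have "g = 0" using norm2_eq_0[OF g] norm2_nonneg[of g] by linarith
    then show ?thesis by (simp add: g_def)
  qed
  define s where "s = unit - z"
  have s: "s \<in> elems A" "adj J s = s" using z by (auto simp: s_def adj_diff)
  have sb: "s \<in> bounded_ops J" using s by simp
  have sw: "s \<circ> w = unit"
  proof (rule op_eqI[of _ J])
    fix f assume f: "f \<in> l2 J"
    have "(s \<circ> w) f = w f - z (w f)" using wb by (simp add: s_def)
    also have "\<dots> = f" using w_eq[OF f] by (simp only: diff_eq_eq)
    finally show "(s \<circ> w) f = unit f" using f by simp
  qed (use sb wb in auto)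
  have ws: "adj J w \<circ> s = unit"
    using arg_cong[OF sw, of "adj J"] s sb wb by (simp only: adj_comp adj_id)
  have "adj J w = adj J w \<circ> (s \<circ> w)" using wb by (simp add: sw)
  also have "\<dots> = (adj J w \<circ> s) \<circ> w" by (simp only: comp_assoc)
  also have "\<dots> = w" using wb by (simp add: ws)
  finally have "adj J w = w" .
  then show ?thesis using that[OF w(1)] sw ws by (simp only: s_def)
qed

text \<open>Put c = 1 - h / M. The fixed point z satisfies 2 z = c + z z, so the square of 1 - z is
  1 - c = h / M. The root is 1 - z scaled by \<open>sqrt M\<close>, and
  \<open>neumann_inverse\<close> inverts it.\<close>

lemma positive_square_root:
  assumes h: "h \<in> elems A" "adj J h = h" and \<delta>: "0 < \<delta>"
    and low: "\<And>f. f \<in> l2 J \<Longrightarrow> \<delta> * (norm2 f)\<^sup>2 \<le> Re (inner2 (h f) f)"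
  obtains k l where "k \<in> elems A" "adj J k = k" "l \<in> elems A" "adj J l = l" "k \<circ> k = h" "k \<circ> l = unit" "l \<circ> k = unit"
proof -
  have hb: "h \<in> bounded_ops J" using h by simp
  obtain C where C: "0 \<le> C" "\<And>f. f \<in> l2 J \<Longrightarrow> norm2 (h f) \<le> C * norm2 f"
    using bop_bound[OF hb] by blast
  \<comment> \<open>Larger than \<delta> and than the norm bound \<open>C\<close>, so that
    \<open>c\<close> is positive and \<open>q = 1 - \<delta> / M\<close> lies in [0, 1).\<close>
  define M where "M = C + \<delta> + 1"
  have M: "0 < M" "\<delta> < M" using C \<delta> by (auto simp: M_def)
  have up: "Re (inner2 (h f) f) \<le> M * (norm2 f)\<^sup>2" if f: "f \<in> l2 J" for f
  proof -
    have "Re (inner2 (h f) f) \<le> cmod (inner2 (h f) f)" by (rule complex_Re_le_cmod)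
    also have "\<dots> \<le> norm2 (h f) * norm2 f" using hb f by (intro inner2_cauchy_schwarz[of _ J]) auto
    also have "\<dots> \<le> C * norm2 f * norm2 f" using C(2)[OF f] by (intro mult_right_mono) auto
    also have "\<dots> \<le> M * norm2 f * norm2 f" using \<delta> by (intro mult_right_mono) (auto simp: M_def)
    finally show ?thesis by (simp add: power2_eq_square mult.assoc)
  qed
  have hreal: "inner2 (h f) f = complex_of_real (Re (inner2 (h f) f))" if f: "f \<in> l2 J" for f
    using inner2_adj_left[OF hb f f] h(2) by (metis Reals_cnj_iff inner2_cnj of_real_Re)
  define c where "c = unit - smul2 (complex_of_real (1 / M)) h"
  have c: "c \<in> elems A" "adj J c = c" using h hb by (auto simp: c_def adj_diff adj_smul)
  have cf: "inner2 (c f) f = complex_of_real ((norm2 f)\<^sup>2 - Re (inner2 (h f) f) / M)" if f: "f \<in> l2 J" for f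
    using f hb unfolding c_def
    by (simp add: inner2_diff_left[where I=J] inner2_smul_left inner2_self) (subst hreal[OF f], simp)
  define q where "q = 1 - \<delta> / M"
  have q: "0 \<le> q" "q < 1" using M \<delta> by (auto simp: q_def)
  have cpos: "positive_op J c"
    unfolding positive_op_def
  proof (intro conjI ballI)
    fix f assume f: "f \<in> l2 J"
    show "inner2 (c f) f \<in> \<real>\<^sub>\<ge>\<^sub>0"
      unfolding cf[OF f] nonneg_Reals_of_real_iff using up[OF f] M by (simp add: field_simps)
  qed (use c in simp)
  have cq: "norm2 (c f) \<le> q * norm2 f" if f: "f \<in> l2 J" for f
  proof (rule positive_op_norm[OF cpos q(1) _ f])
    fix g assume g: "g \<in> l2 J"
    show "Re (inner2 (c g) g) \<le> q * (norm2 g)\<^sup>2"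
      unfolding cf[OF g] using low[OF g] M by (simp add: q_def field_simps)
  qed
  obtain z r where z: "z \<in> elems A" "adj J z = z" "z = smul2 (1 / 2) (c + (z \<circ> z))" "0 \<le> r" "r < 1"
    "\<And>f. f \<in> l2 J \<Longrightarrow> norm2 (z f) \<le> r * norm2 f"
    by (rule sqrt_fixed_point[OF c q cq]) auto
  obtain w where w: "w \<in> elems A" "adj J w = w" "(unit - z) \<circ> w = unit" "w \<circ> (unit - z) = unit"
    by (rule neumann_inverse[OF z(1,2,4,5,6)]) auto
  define s where "s = unit - z"
  have zb: "z \<in> bounded_ops J" using z by simp
  have s: "s \<in> elems A" "adj J s = s" using z zb by (auto simp: s_def adj_diff)
  have sb: "s \<in> bounded_ops J" and wb: "w \<in> bounded_ops J" using s w by auto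
  have ss: "smul2 (complex_of_real M) (s \<circ> s) = h"
  proof (rule op_eqI[of _ J])
    fix f assume f: "f \<in> l2 J"
    have z2: "z f = smul1 (1 / 2) (c f + z (z f))" using z(3) by (metis smul2_apply fun_apply2(1) comp_apply)
    have "(s \<circ> s) f = f - z f - (z f - z (z f))"
      using f zb by (simp add: s_def bop_diff[OF zb])
    also have "\<dots> = smul1 (1 / M) (h f)"
    proof
      fix i
      have "z f i = (c f i + z (z f) i) / 2" using fun_cong[OF z2, of i] by simp
      moreover have "c f i = f i - h f i / M" using f by (simp add: c_def)
      ultimately show "(f - z f - (z f - z (z f))) i = smul1 (1 / M) (h f) i" by (simp add: field_simps)
    qed
    finally show "smul2 (complex_of_real M) (s \<circ> s) f = h f" using M by simp
  qed (use sb hb in auto)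
  define m where "m = complex_of_real (sqrt M)"
  have m: "m * m = complex_of_real M" "m \<noteq> 0" "cnj m = m"
    using M by (auto simp: m_def simp flip: of_real_mult)
  show ?thesis
  proof (rule that[of "smul2 m s" "smul2 (1 / m) w"])
    show "smul2 m s \<in> elems A" "smul2 (1 / m) w \<in> elems A" using s w by auto
    show "adj J (smul2 m s) = smul2 m s" "adj J (smul2 (1 / m) w) = smul2 (1 / m) w"
      using s w sb wb m by (auto simp: adj_smul)
    show "smul2 m s \<circ> smul2 m s = h"
      using ss sb m by (simp add: comp_smul_left comp_smul_right[OF sb])
    show "smul2 m s \<circ> smul2 (1 / m) w = unit"
      using w sb wb m unfolding s_def[symmetric] by (simp add: comp_smul_left comp_smul_right[OF sb])
    show "smul2 (1 / m) w \<circ> smul2 m s = unit"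
      using w sb wb m unfolding s_def[symmetric] by (simp add: comp_smul_left comp_smul_right[OF wb])
  qed
qed

lemma l2_family_bop:
  assumes k: "k \<in> bounded_ops J" and f: "l2_family J \<xi>" shows "l2_family J (\<lambda>n. k (\<xi> n))"
proof (rule l2_familyI)
  obtain C where C: "0 \<le> C" "\<And>f. f \<in> l2 J \<Longrightarrow> norm2 (k f) \<le> C * norm2 f"
    using bop_bound[OF k] by blast
  have s: "summable (\<lambda>n. C\<^sup>2 * (norm2 (\<xi> n))\<^sup>2)" using f unfolding l2_family_def by (intro summable_mult) auto
  show "summable (\<lambda>n. (norm2 (k (\<xi> n)))\<^sup>2)"
  proof (rule summable_comparison_test'[OF s, of 0])
    fix n
    have "(norm2 (k (\<xi> n)))\<^sup>2 \<le> (C * norm2 (\<xi> n))\<^sup>2" using C(2)[OF l2_family_l2[OF f]] by (intro power_mono) auto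
    then show "norm ((norm2 (k (\<xi> n)))\<^sup>2) \<le> C\<^sup>2 * (norm2 (\<xi> n))\<^sup>2" by (simp add: power_mult_distrib)
  qed
qed (use k in auto)

text \<open>Once \<open>h = R unit\<close> has an invertible square root k with inverse l,
  conjugating \<open>R\<close> by l gives a unital map whose inverse is \<open>R'\<close>
  precomposed with conjugation by k. Both are two-antipositive, so the Schwarz inequalities apply to
  both.\<close>

theorem anti_isomorphic_of_two_antipositive:
  assumes R: "two_antipositive R" and R': "two_antipositive R'"
    and inv: "\<And>x. x \<in> elems A \<Longrightarrow> R (R' x) = x" "\<And>x. x \<in> elems A \<Longrightarrow> R' (R x) = x"
    and cont: "continuous_map (ultraweak A) (ultraweak A) R"
  shows "anti_isomorphic_to_itself A"
proof -
  note D = two_antipositiveD[OF R] and D' = two_antipositiveD[OF R']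
  define h where "h = R unit"
  have h: "h \<in> elems A" "adj J h = h" using D(1)[of unit] D(4)[of unit] by (auto simp: h_def)
  have hb: "h \<in> bounded_ops J" using h by simp
  have h': "R' unit \<in> elems A" "adj J (R' unit) = R' unit" using D'(1)[of unit] D'(4)[of unit] by auto
  obtain C where C: "0 \<le> C" "\<And>f. f \<in> l2 J \<Longrightarrow> norm2 (R' unit f) \<le> C * norm2 f"
    using bop_bound[OF elems_bop[OF h'(1)]] by blast
  define M where "M = C + 1"
  have M: "0 < M" and CM: "\<And>f. f \<in> l2 J \<Longrightarrow> norm2 (R' unit f) \<le> M * norm2 f"
    using C by (auto simp: M_def algebra_simps intro: order_trans[OF C(2)])
  \<comment> \<open>Since \<open>R (R' unit) = unit\<close>, positivity of \<open>R\<close> carries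
    the upper bound \<open>M\<close> for \<open>R' unit\<close> to the lower bound 1 / M for
    \<open>h\<close>.\<close>
  have "positive_op J (R (smul2 (complex_of_real M) unit - R' unit))"
    using h' by (intro D(5) selfadjoint_shift(2) CM) auto
  then have pos: "positive_op J (smul2 (complex_of_real M) h - unit)"
    using h' inv(1)[of unit] by (simp add: two_antipositive_diff[OF R] D(3) h_def)
  have low: "1 / M * (norm2 f)\<^sup>2 \<le> Re (inner2 (h f) f)" if f: "f \<in> l2 J" for f
  proof -
    have "inner2 ((smul2 (complex_of_real M) h - unit) f) f = complex_of_real M * inner2 (h f) f - complex_of_real ((norm2 f)\<^sup>2)"
      using f hb by (simp add: inner2_diff_left[where I=J] inner2_smul_left inner2_self)
    then have "complex_of_real M * inner2 (h f) f - complex_of_real ((norm2 f)\<^sup>2) \<in> \<real>\<^sub>\<ge>\<^sub>0"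
      using pos f unfolding positive_op_def by metis
    then have "(norm2 f)\<^sup>2 \<le> M * Re (inner2 (h f) f)"
      by (auto simp: complex_nonneg_Reals_iff simp del: of_real_power)
    then show ?thesis using M by (simp add: field_simps)
  qed
  obtain k l where k: "k \<in> elems A" "adj J k = k" and l: "l \<in> elems A" "adj J l = l"
    and kl: "k \<circ> k = h" "k \<circ> l = unit" "l \<circ> k = unit"
    by (rule positive_square_root[OF h _ low]) (use M in auto)
  have kb: "k \<in> bounded_ops J" and lb: "l \<in> bounded_ops J" using k l by auto
  define \<alpha> \<beta> where "\<alpha> = (\<lambda>x. l \<circ> R x \<circ> l)" and "\<beta> = (\<lambda>y. R' (k \<circ> y \<circ> k))"
  have a: "two_antipositive \<alpha>" unfolding \<alpha>_def by (rule two_antipositive_conj_left[OF R l])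
  have b: "two_antipositive \<beta>" unfolding \<beta>_def by (rule two_antipositive_conj_right[OF R' k])
  note Da = two_antipositiveD[OF a] and Db = two_antipositiveD[OF b]
  have lhl: "l \<circ> (k \<circ> y \<circ> k) \<circ> l = y" "k \<circ> (l \<circ> y \<circ> l) \<circ> k = y" if "y \<in> elems A" for y
  proof -
    have "l \<circ> (k \<circ> y \<circ> k) \<circ> l = (l \<circ> k) \<circ> y \<circ> (k \<circ> l)" "k \<circ> (l \<circ> y \<circ> l) \<circ> k = (k \<circ> l) \<circ> y \<circ> (l \<circ> k)"
      by (simp_all only: comp_assoc)
    then show "l \<circ> (k \<circ> y \<circ> k) \<circ> l = y" "k \<circ> (l \<circ> y \<circ> l) \<circ> k = y" using that by (simp_all add: kl)
  qed
  have a1: "\<alpha> unit = unit"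
    using lhl(1)[of unit] kb by (simp add: \<alpha>_def h_def[symmetric] kl(1))
  have b1: "\<beta> unit = unit"
    using kb inv(2)[of unit] by (simp add: \<beta>_def kl(1) h_def)
  have ba: "\<beta> (\<alpha> x) = x" "\<alpha> (\<beta> x) = x" if x: "x \<in> elems A" for x
    using lhl(2)[OF D(1)[OF x]] inv(2)[OF x] lhl(1)[OF x] inv(1)[of "k \<circ> x \<circ> k"] x k by (auto simp: \<alpha>_def \<beta>_def)
  have diag: "\<alpha> (adj J x \<circ> x) = \<alpha> x \<circ> adj J (\<alpha> x)" if x: "x \<in> elems A" for x
    by (rule anti_multiplicative_diag[OF a a1 b b1 _ _ x]) (use ba in auto)
  have "\<alpha> (x \<circ> y) = \<alpha> y \<circ> \<alpha> x" if xy: "x \<in> elems A" "y \<in> elems A" for x y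
    by (rule anti_multiplicative[OF a _ xy]) (rule diag)
  moreover have "bij_betw \<alpha> (elems A) (elems A)"
    by (rule bij_betw_byWitness[of _ \<beta>]) (use ba Da(1) Db(1) in auto)
  moreover have "continuous_map (ultraweak A) (ultraweak A) \<alpha>"
  proof (rule continuous_into_ultraweak)
    fix \<xi> \<eta> assume f: "l2_family J \<xi>" "l2_family J \<eta>"
    note fl = l2_family_bop[OF lb f(1)] l2_family_bop[OF lb f(2)]
    have "continuous_map (ultraweak A) euclidean (\<lambda>x. \<Sum>n. inner2 (R x (l (\<xi> n))) (l (\<eta> n)))"
      using continuous_map_compose[OF cont continuous_series[OF fl]] by (simp add: comp_def)
    then show "continuous_map (ultraweak A) euclidean (\<lambda>x. \<Sum>n. inner2 (\<alpha> x (\<xi> n)) (\<eta> n))"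
    proof (rule continuous_map_eq)
      fix x assume "x \<in> topspace (ultraweak A)"
      then have "R x \<in> bounded_ops J" using D(1) by simp
      then have "inner2 (\<alpha> x (\<xi> n)) (\<eta> n) = inner2 (R x (l (\<xi> n))) (l (\<eta> n))" for n
        using inner2_adj_left[OF lb, of "R x (l (\<xi> n))" "\<eta> n"] l(2) l2_family_l2[OF f(2)] by (simp add: \<alpha>_def)
      then show "(\<Sum>n. inner2 (R x (l (\<xi> n))) (l (\<eta> n))) = (\<Sum>n. inner2 (\<alpha> x (\<xi> n)) (\<eta> n))" by simp
    qed
  qed (use Da(1) in simp)
  ultimately show ?thesis
    unfolding anti_isomorphic_to_itself_def normal_map_def linear_on_def
    using Da(2,3,4) by (intro exI[of _ \<alpha>] conjI ballI allI)
qed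

end

section \<open>Block operators\<close>

definition emb :: "'e \<Rightarrow> 'i vec \<Rightarrow> ('e \<times> 'i) vec" where
  "emb j \<xi> = (\<lambda>(k, b). if k = j then \<xi> b else 0)"

definition slice :: "'e \<Rightarrow> ('e \<times> 'i) vec \<Rightarrow> 'i vec" where
  "slice i \<zeta> = (\<lambda>b. \<zeta> (i, b))"

text \<open>Matrix entries over an arbitrary index type. Blocks indexed by numbers, as in
  \<open>mat_alg\<close>, and blocks indexed by basis labels from the universe, as in
  \<open>vn_tensor\<close>, then share one calculus.\<close>

definition ent :: "'e \<Rightarrow> 'e \<Rightarrow> ('e \<times> 'i) opr \<Rightarrow> 'i opr" where
  "ent i j X = (\<lambda>\<xi>. slice i (X (emb j \<xi>)))"

lemma entry_eq_ent: "entry i j X = ent i j X"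
  by (simp add: entry_def ent_def emb_def slice_def fun_eq_iff)

lemma slice_simps [simp]:
  "slice i (\<zeta> + \<zeta>') = slice i \<zeta> + slice i \<zeta>'" "slice i (smul1 c \<zeta>) = smul1 c (slice i \<zeta>)"
  "slice i 0 = 0" "slice i (emb j \<xi>) = (if i = j then \<xi> else 0)"
  by (auto simp: slice_def emb_def fun_eq_iff)

lemma emb_simps:
  "emb i (\<xi> + \<eta>) = emb i \<xi> + emb i \<eta>" "emb i (smul1 c \<xi>) = smul1 c (emb i \<xi>)" "emb i 0 = 0"
  by (auto simp: emb_def fun_eq_iff)

lemma slice_sum: "slice i (sum F S) = (\<Sum>a\<in>S. slice i (F a))"
  by (induction S rule: infinite_finite_induct) (simp_all only: sum.infinite sum.empty sum.insert slice_simps not_False_eq_True)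

lemma emb_l2 [simp, intro]:
  assumes j: "j \<in> E" and \<xi>: "\<xi> \<in> l2 I" shows "emb j \<xi> \<in> l2 (E \<times> I)"
proof (rule l2_I)
  have "(\<lambda>k. (cmod (emb j \<xi> k))\<^sup>2) summable_on range (Pair j)"
    by (subst summable_on_reindex) (use l2_summable[OF \<xi>] in \<open>auto simp: inj_on_def emb_def comp_def\<close>)
  then show "(\<lambda>k. (cmod (emb j \<xi> k))\<^sup>2) summable_on UNIV"
    by (rule summable_on_cong_neutral[THEN iffD1, rotated -1]) (auto simp: emb_def)
next
  fix i assume "i \<notin> E \<times> I"
  then show "emb j \<xi> i = 0" using j l2_zeroD[OF \<xi>] by (cases i) (auto simp: emb_def)
qed

lemma slice_l2 [simp, intro]:
  assumes \<zeta>: "\<zeta> \<in> l2 (E \<times> I)" shows "slice i \<zeta> \<in> l2 I"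
proof (rule l2_I)
  have "(\<lambda>k. (cmod (\<zeta> k))\<^sup>2) summable_on range (Pair i)"
    by (rule summable_on_subset_banach[OF l2_summable[OF \<zeta>]]) auto
  then show "(\<lambda>b. (cmod (slice i \<zeta> b))\<^sup>2) summable_on UNIV"
    by (subst (asm) summable_on_reindex) (auto simp: inj_on_def slice_def comp_def)
qed (use l2_zeroD[OF \<zeta>] in \<open>auto simp: slice_def\<close>)

lemma slice_outside: "\<zeta> \<in> l2 (E \<times> I) \<Longrightarrow> i \<notin> E \<Longrightarrow> slice i \<zeta> = 0"
  by (auto simp: slice_def fun_eq_iff l2_zeroD)

lemma emb_l2_iff: "j \<in> E \<Longrightarrow> emb j \<xi> \<in> l2 (E \<times> I) \<longleftrightarrow> \<xi> \<in> l2 I"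
  using slice_l2[of "emb j \<xi>" E I j] by auto

lemma inner2_emb: "inner2 (emb i \<xi>) (emb j \<eta>) = (if i = j then inner2 \<xi> \<eta> else 0)"
proof (cases "i = j")
  case True
  have "inner2 (emb i \<xi>) (emb i \<eta>) = infsum (\<lambda>k. emb i \<xi> k * cnj (emb i \<eta> k)) (range (Pair i))"
    unfolding inner2_def by (rule infsum_cong_neutral) (auto simp: emb_def)
  also have "\<dots> = inner2 \<xi> \<eta>"
    by (subst infsum_reindex) (auto simp: inj_on_def emb_def inner2_def comp_def)
  finally show ?thesis using True by simp
next
  case False
  then have "(\<lambda>k. emb i \<xi> k * cnj (emb j \<eta> k)) = (\<lambda>k. 0)" by (auto simp: emb_def fun_eq_iff)
  then show ?thesis using False by (simp add: inner2_def)
qed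

lemma norm2_emb [simp]: "norm2 (emb i \<xi>) = norm2 \<xi>"
proof -
  have "complex_of_real ((norm2 (emb i \<xi>))\<^sup>2) = complex_of_real ((norm2 \<xi>)\<^sup>2)"
    using inner2_emb[of i \<xi> i \<xi>] unfolding inner2_self by simp
  then have "(norm2 (emb i \<xi>))\<^sup>2 = (norm2 \<xi>)\<^sup>2" by (simp only: of_real_eq_iff)
  then show ?thesis by (simp only: power2_eq_iff_nonneg[OF norm2_nonneg norm2_nonneg])
qed

lemma emb_decomposition:
  fixes \<zeta> :: "('e \<times> 'i) vec"
  assumes \<zeta>: "\<zeta> \<in> l2 (E \<times> I)" and E: "finite E"
  shows "\<zeta> = (\<Sum>i\<in>E. emb i (slice i \<zeta>))"
proof
  fix k :: "'e \<times> 'i"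
  obtain j b where k: "k = (j, b)" by (cases k)
  have "(\<Sum>i\<in>E. emb i (slice i \<zeta>)) k = (\<Sum>i\<in>E. emb i (slice i \<zeta>) k)"
    by (induction E rule: infinite_finite_induct) auto
  also have "\<dots> = (\<Sum>i\<in>E. if i = j then \<zeta> (j, b) else 0)"
    by (rule sum.cong) (auto simp: k emb_def slice_def)
  also have "\<dots> = \<zeta> k" using E \<zeta> by (simp add: sum.delta k l2_zeroD)
  finally show "\<zeta> k = (\<Sum>i\<in>E. emb i (slice i \<zeta>)) k" by simp
qed

lemma inner2_slices:
  assumes \<zeta>: "\<zeta> \<in> l2 (E \<times> I)" "\<zeta>' \<in> l2 (E \<times> I)" and E: "finite E"
  shows "inner2 \<zeta> \<zeta>' = (\<Sum>i\<in>E. inner2 (slice i \<zeta>) (slice i \<zeta>'))"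
proof -
  have "inner2 \<zeta> \<zeta>' = (\<Sum>i\<in>E. inner2 (emb i (slice i \<zeta>)) \<zeta>')"
    by (subst emb_decomposition[OF \<zeta>(1) E], rule inner2_sum_left[of _ _ "E \<times> I"]) (use \<zeta> in auto)
  also have "\<dots> = (\<Sum>i\<in>E. inner2 (slice i \<zeta>) (slice i \<zeta>'))"
  proof (rule sum.cong[OF refl])
    fix i assume i: "i \<in> E"
    have "inner2 (emb i (slice i \<zeta>)) \<zeta>' = (\<Sum>j\<in>E. inner2 (emb i (slice i \<zeta>)) (emb j (slice j \<zeta>')))"
      by (subst emb_decomposition[OF \<zeta>(2) E], rule inner2_sum_right[of _ _ "E \<times> I"]) (use \<zeta> i in auto)
    also have "\<dots> = inner2 (slice i \<zeta>) (slice i \<zeta>')"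
      using E i by (simp add: inner2_emb sum.delta)
    finally show "inner2 (emb i (slice i \<zeta>)) \<zeta>' = inner2 (slice i \<zeta>) (slice i \<zeta>')" .
  qed
  finally show ?thesis .
qed

lemma norm2_slices:
  assumes \<zeta>: "\<zeta> \<in> l2 (E \<times> I)" and E: "finite E"
  shows "(norm2 \<zeta>)\<^sup>2 = (\<Sum>i\<in>E. (norm2 (slice i \<zeta>))\<^sup>2)"
proof -
  have "complex_of_real ((norm2 \<zeta>)\<^sup>2) = complex_of_real (\<Sum>i\<in>E. (norm2 (slice i \<zeta>))\<^sup>2)"
    unfolding of_real_sum inner2_self[symmetric] by (rule inner2_slices[OF \<zeta> \<zeta> E])
  then show ?thesis by (simp only: of_real_eq_iff)
qed

lemma norm2_slice_le:
  assumes \<zeta>: "\<zeta> \<in> l2 (E \<times> I)" and E: "finite E"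
  shows "norm2 (slice i \<zeta>) \<le> norm2 \<zeta>"
proof (cases "i \<in> E")
  case True
  have "(norm2 (slice i \<zeta>))\<^sup>2 \<le> (norm2 \<zeta>)\<^sup>2"
    unfolding norm2_slices[OF \<zeta> E] using True E by (intro member_le_sum) auto
  then show ?thesis by (rule power2_le_imp_le) simp
qed (simp add: slice_outside[OF \<zeta>])

lemma ent_bop [simp, intro]:
  assumes X: "X \<in> bounded_ops (E \<times> I)" and E: "finite E" and j: "j \<in> E"
  shows "ent i j X \<in> bounded_ops I"
proof -
  obtain C where C: "0 \<le> C" "\<And>f. f \<in> l2 (E \<times> I) \<Longrightarrow> norm2 (X f) \<le> C * norm2 f"
    using bop_bound[OF X] by blast
  show ?thesis
  proof (rule bounded_opsI[of _ _ C])
    fix f assume f: "f \<notin> l2 I"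
    then have "X (emb j f) = 0" using emb_l2_iff[OF j] by (intro bop_outside[OF X]) blast
    then show "ent i j X f = 0" unfolding ent_def by (simp only: slice_simps)
  next
    fix f assume f: "f \<in> l2 I"
    have "norm2 (slice i (X (emb j f))) \<le> norm2 (X (emb j f))"
      by (rule norm2_slice_le[OF bop_l2[OF X] E])
    also have "\<dots> \<le> C * norm2 f" using C(2)[OF emb_l2[OF j f]] by simp
    finally show "norm2 (ent i j X f) \<le> C * norm2 f" by (simp only: ent_def)
    show "ent i j X f \<in> l2 I" unfolding ent_def by (rule slice_l2[OF bop_l2[OF X]])
    show "ent i j X (f + g) = ent i j X f + ent i j X g" if "g \<in> l2 I" for g
      unfolding ent_def emb_simps bop_add[OF X emb_l2[OF j f] emb_l2[OF j that]] by (rule slice_simps)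
    show "ent i j X (smul1 c f) = smul1 c (ent i j X f)" for c
      unfolding ent_def emb_simps bop_smul[OF X emb_l2[OF j f]] by (rule slice_simps)
  qed
qed

lemma ent_linear: "ent i j (X + Y) = ent i j X + ent i j Y" "ent i j (smul2 c X) = smul2 c (ent i j X)" "ent i j 0 = 0"
  by (auto simp: ent_def slice_def fun_eq_iff)

lemma inner2_entries:
  assumes X: "X \<in> bounded_ops (E \<times> I)" and E: "finite E" and \<zeta>: "\<zeta> \<in> l2 (E \<times> I)" "\<zeta>' \<in> l2 (E \<times> I)"
  shows "inner2 (X \<zeta>) \<zeta>' = (\<Sum>i\<in>E. \<Sum>j\<in>E. inner2 (ent i j X (slice j \<zeta>)) (slice i \<zeta>'))"
proof -
  have "X \<zeta> = (\<Sum>j\<in>E. X (emb j (slice j \<zeta>)))"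
    by (subst emb_decomposition[OF \<zeta>(1) E], rule bop_sum[OF X]) (use \<zeta> in auto)
  then have s: "slice i (X \<zeta>) = (\<Sum>j\<in>E. ent i j X (slice j \<zeta>))" for i
    by (simp only: slice_sum ent_def)
  have "inner2 (X \<zeta>) \<zeta>' = (\<Sum>i\<in>E. inner2 (slice i (X \<zeta>)) (slice i \<zeta>'))"
    using X \<zeta> by (intro inner2_slices[OF _ _ E]) auto
  also have "\<dots> = (\<Sum>i\<in>E. \<Sum>j\<in>E. inner2 (ent i j X (slice j \<zeta>)) (slice i \<zeta>'))"
    unfolding s by (intro sum.cong refl inner2_sum_left[of _ _ I]) (use X E \<zeta> in auto)
  finally show ?thesis .
qed

definition block :: "'e set \<Rightarrow> 'i set \<Rightarrow> ('e \<Rightarrow> 'e \<Rightarrow> 'i opr) \<Rightarrow> ('e \<times> 'i) opr" where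
  "block E I x = (\<lambda>\<zeta>. if \<zeta> \<in> l2 (E \<times> I) then \<Sum>i\<in>E. \<Sum>j\<in>E. emb i (x i j (slice j \<zeta>)) else 0)"

lemma block_bop [simp, intro]:
  assumes E: "finite E" and x: "\<And>i j. i \<in> E \<Longrightarrow> j \<in> E \<Longrightarrow> x i j \<in> bounded_ops I"
  shows "block E I x \<in> bounded_ops (E \<times> I)"
proof -
  define C where "C i j = (SOME C. 0 \<le> C \<and> (\<forall>f\<in>l2 I. norm2 (x i j f) \<le> C * norm2 f))" for i j
  have "0 \<le> C i j \<and> (\<forall>f\<in>l2 I. norm2 (x i j f) \<le> C i j * norm2 f)" if ij: "i \<in> E" "j \<in> E" for i j
  proof -
    have "\<exists>C. 0 \<le> C \<and> (\<forall>f\<in>l2 I. norm2 (x i j f) \<le> C * norm2 f)"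
    proof (rule bop_bound[OF x[OF ij]])
      fix C assume "0 \<le> C" "\<And>f. f \<in> l2 I \<Longrightarrow> norm2 (x i j f) \<le> C * norm2 f"
      then show "\<exists>C. 0 \<le> C \<and> (\<forall>f\<in>l2 I. norm2 (x i j f) \<le> C * norm2 f)"
        by (intro exI[of _ C] conjI ballI)
    qed
    then show ?thesis unfolding C_def by (rule someI_ex)
  qed
  note Cb = this
  have C1: "0 \<le> C i j" if "i \<in> E" "j \<in> E" for i j using Cb[OF that] by (rule conjunct1)
  have C2: "norm2 (x i j f) \<le> C i j * norm2 f" if "i \<in> E" "j \<in> E" "f \<in> l2 I" for i j f
    using bspec[OF conjunct2[OF Cb[OF that(1,2)]] that(3)] .
  have mem: "emb i (x i j (slice j \<zeta>)) \<in> l2 (E \<times> I)" if "i \<in> E" "j \<in> E" for i j \<zeta>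
    by (rule emb_l2[OF that(1) bop_l2[OF x[OF that]]])
  show ?thesis
  proof (rule bounded_opsI[of _ _ "\<Sum>i\<in>E. \<Sum>j\<in>E. C i j"])
    fix f assume f: "f \<in> l2 (E \<times> I)"
    have b: "block E I x f = (\<Sum>i\<in>E. \<Sum>j\<in>E. emb i (x i j (slice j f)))" if "f \<in> l2 (E \<times> I)" for f
      using that by (simp only: block_def if_True)
    show "block E I x f \<in> l2 (E \<times> I)" unfolding b[OF f] by (intro l2_sum mem)
    have "norm2 (block E I x f) \<le> (\<Sum>i\<in>E. \<Sum>j\<in>E. norm2 (emb i (x i j (slice j f))))"
    proof -
      have "norm2 (block E I x f) \<le> (\<Sum>i\<in>E. norm2 (\<Sum>j\<in>E. emb i (x i j (slice j f))))"
        unfolding b[OF f] by (rule norm2_triangle_sum[of _ _ "E \<times> I"]) (intro l2_sum mem)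
      also have "\<dots> \<le> (\<Sum>i\<in>E. \<Sum>j\<in>E. norm2 (emb i (x i j (slice j f))))"
        by (intro sum_mono norm2_triangle_sum[of _ _ "E \<times> I"] mem)
      finally show ?thesis .
    qed
    also have "\<dots> \<le> (\<Sum>i\<in>E. \<Sum>j\<in>E. C i j * norm2 f)"
    proof (intro sum_mono)
      fix i j assume ij: "i \<in> E" "j \<in> E"
      have "norm2 (x i j (slice j f)) \<le> C i j * norm2 (slice j f)" by (rule C2[OF ij slice_l2[OF f]])
      also have "\<dots> \<le> C i j * norm2 f" using C1[OF ij] norm2_slice_le[OF f E] by (intro mult_left_mono)
      finally show "norm2 (emb i (x i j (slice j f))) \<le> C i j * norm2 f" by (simp only: norm2_emb)
    qed
    finally show "norm2 (block E I x f) \<le> (\<Sum>i\<in>E. \<Sum>j\<in>E. C i j) * norm2 f"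
      by (simp only: sum_distrib_right)
    show "block E I x (f + g) = block E I x f + block E I x g" if g: "g \<in> l2 (E \<times> I)" for g
    proof -
      have "emb i (x i j (slice j (f + g))) = emb i (x i j (slice j f)) + emb i (x i j (slice j g))" if "i \<in> E" "j \<in> E" for i j
        unfolding slice_simps bop_add[OF x[OF that] slice_l2[OF f] slice_l2[OF g]] by (rule emb_simps)
      then show ?thesis unfolding b[OF f] b[OF g] b[OF l2_add[OF f g]] sum.distrib[symmetric]
        by (intro sum.cong refl)
    qed
    show "block E I x (smul1 c f) = smul1 c (block E I x f)" for c
    proof -
      have sm: "smul1 c (sum F S) = (\<Sum>a\<in>S. smul1 c (F a))" for F :: "'a \<Rightarrow> ('a \<times> 'b) vec" and S
        by (induction S rule: infinite_finite_induct) (simp_all only: sum.infinite sum.empty sum.insert smul1_simps smul1_add not_False_eq_True)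
      have "emb i (x i j (slice j (smul1 c f))) = smul1 c (emb i (x i j (slice j f)))" if "i \<in> E" "j \<in> E" for i j
        unfolding slice_simps bop_smul[OF x[OF that] slice_l2[OF f]] by (rule emb_simps)
      then show ?thesis unfolding b[OF f] b[OF l2_smul1[OF f]] sm
        by (intro sum.cong refl)
    qed
  qed (simp only: block_def if_False)
qed

lemma ent_block:
  assumes E: "finite E" and ij: "i \<in> E" "j \<in> E" and x: "\<And>i j. i \<in> E \<Longrightarrow> j \<in> E \<Longrightarrow> x i j \<in> bounded_ops I"
  shows "ent i j (block E I x) = x i j"
proof (rule op_eqI[of _ I])
  show "ent i j (block E I x) \<in> bounded_ops I" "x i j \<in> bounded_ops I"
    using E ij x by auto
  fix f assume f: "f \<in> l2 I"
  have "ent i j (block E I x) f = (\<Sum>i'\<in>E. \<Sum>j'\<in>E. slice i (emb i' (x i' j' (slice j' (emb j f)))))"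
    using f ij by (simp only: ent_def block_def emb_l2 if_True slice_sum)
  also have "\<dots> = (\<Sum>i'\<in>E. \<Sum>j'\<in>E. if j' = j then (if i' = i then x i j f else 0) else 0)"
  proof (intro sum.cong refl)
    fix i' j' assume "i' \<in> E" "j' \<in> E"
    then show "slice i (emb i' (x i' j' (slice j' (emb j f)))) = (if j' = j then (if i' = i then x i j f else 0) else 0)"
      using bop_zero[OF x] by auto
  qed
  also have "\<dots> = (\<Sum>i'\<in>E. if i' = i then x i j f else 0)"
    using E ij by (simp only: sum.delta if_True)
  also have "\<dots> = x i j f" using E ij by (simp only: sum.delta if_True)
  finally show "ent i j (block E I x) f = x i j f" .
qed

lemma block_eqI:
  assumes E: "finite E" and X: "X \<in> bounded_ops (E \<times> I)" "Y \<in> bounded_ops (E \<times> I)"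
    and e: "\<And>i j. i \<in> E \<Longrightarrow> j \<in> E \<Longrightarrow> ent i j X = ent i j Y"
  shows "X = Y"
proof (rule op_eqI_inner[OF X])
  fix f g assume "f \<in> l2 (E \<times> I)" "g \<in> l2 (E \<times> I)"
  then show "inner2 (X f) g = inner2 (Y f) g"
    by (simp add: inner2_entries[OF X(1) E] inner2_entries[OF X(2) E] e)
qed

section \<open>Finite tensors of normal functionals lie in Nor\<close>

text \<open>An operator norm bound in terms of finite sums, so that no supremum has to be shown
  finite before bounds are added, scaled or tensored.\<close>

definition matrix_bound :: "nat \<Rightarrow> (nat \<Rightarrow> nat \<Rightarrow> complex) \<Rightarrow> real \<Rightarrow> bool" where
  "matrix_bound n a C \<longleftrightarrow> 0 \<le> C \<and> (\<forall>f. (\<Sum>i<n. (cmod (\<Sum>j<n. a i j * f j))\<^sup>2) \<le> C\<^sup>2 * (\<Sum>j<n. (cmod (f j))\<^sup>2))"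

lemma norm2_finite:
  assumes "finite K" "\<And>k. k \<notin> K \<Longrightarrow> f k = 0"
  shows "(norm2 f)\<^sup>2 = (\<Sum>k\<in>K. (cmod (f k))\<^sup>2)"
  unfolding norm2_square by (rule infsumI, rule has_sum_finite_neutralI[OF assms(1)]) (use assms in auto)

text \<open>The Kronecker product is applied in two stages: \<open>b\<close> in the second
  coordinate for each fixed first one, which gives \<open>g\<close>, then \<open>a\<close> in the
  first coordinate.\<close>

lemma matrix_bound_kronecker:
  assumes a: "matrix_bound n a C" and b: "matrix_bound m b D"
  shows "matrix_norm ({..<n} \<times> {..<m}) (\<lambda>(i, k) (j, l). a i j * b k l) \<le> C * D"
    and "f \<in> l2 ({..<n} \<times> {..<m}) \<Longrightarrow>
      norm2 (\<lambda>r. if r \<in> {..<n} \<times> {..<m} then \<Sum>s\<in>{..<n} \<times> {..<m}. (case r of (i, k) \<Rightarrow> \<lambda>(j, l). a i j * b k l) s * f s else 0)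
        \<le> C * D * norm2 f"
proof -
  let ?K = "{..<n} \<times> {..<m}"
  let ?F = "\<lambda>f r. if r \<in> ?K then \<Sum>s\<in>?K. (case r of (i, k) \<Rightarrow> \<lambda>(j, l). a i j * b k l) s * f s else 0"
  have CD: "0 \<le> C" "0 \<le> D" using a b by (auto simp: matrix_bound_def)
  have main: "norm2 (?F f) \<le> C * D * norm2 f" if f: "f \<in> l2 ?K" for f
  proof -
    define g where "g j k = (\<Sum>l<m. b k l * f (j, l))" for j k
    have val: "?F f (i, k) = (\<Sum>j<n. a i j * g j k)" if "i < n" "k < m" for i k
    proof -
      have "?F f (i, k) = (\<Sum>s\<in>?K. case s of (j, l) \<Rightarrow> a i j * b k l * f (j, l))"
        using that by (auto intro!: sum.cong)
      also have "\<dots> = (\<Sum>j<n. \<Sum>l<m. a i j * b k l * f (j, l))"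
        by (rule sum.cartesian_product[symmetric])
      finally show ?thesis by (simp add: g_def sum_distrib_left mult.assoc)
    qed
    have "(norm2 (?F f))\<^sup>2 = (\<Sum>r\<in>?K. (cmod (?F f r))\<^sup>2)"
      by (rule norm2_finite) auto
    also have "\<dots> = (\<Sum>i<n. \<Sum>k<m. (cmod (?F f (i, k)))\<^sup>2)"
      unfolding sum.cartesian_product by (rule sum.cong) auto
    also have "\<dots> = (\<Sum>i<n. \<Sum>k<m. (cmod (\<Sum>j<n. a i j * g j k))\<^sup>2)"
      by (intro sum.cong refl) (simp only: val lessThan_iff)
    also have "\<dots> = (\<Sum>k<m. \<Sum>i<n. (cmod (\<Sum>j<n. a i j * g j k))\<^sup>2)" by (rule sum.swap)
    also have "\<dots> \<le> (\<Sum>k<m. C\<^sup>2 * (\<Sum>j<n. (cmod (g j k))\<^sup>2))"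
    proof (rule sum_mono)
      fix k show "(\<Sum>i<n. (cmod (\<Sum>j<n. a i j * g j k))\<^sup>2) \<le> C\<^sup>2 * (\<Sum>j<n. (cmod (g j k))\<^sup>2)"
        using a[unfolded matrix_bound_def, THEN conjunct2, THEN spec[of _ "\<lambda>j. g j k"]] .
    qed
    also have "\<dots> = C\<^sup>2 * (\<Sum>j<n. \<Sum>k<m. (cmod (g j k))\<^sup>2)"
      unfolding sum_distrib_left[symmetric] by (subst sum.swap) (rule refl)
    also have "\<dots> \<le> C\<^sup>2 * (\<Sum>j<n. D\<^sup>2 * (\<Sum>l<m. (cmod (f (j, l)))\<^sup>2))"
    proof (intro mult_left_mono sum_mono)
      fix j show "(\<Sum>k<m. (cmod (g j k))\<^sup>2) \<le> D\<^sup>2 * (\<Sum>l<m. (cmod (f (j, l)))\<^sup>2)"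
        unfolding g_def using b[unfolded matrix_bound_def, THEN conjunct2, THEN spec[of _ "\<lambda>l. f (j, l)"]] .
    qed simp
    also have "\<dots> = (C * D)\<^sup>2 * (\<Sum>j<n. \<Sum>l<m. (cmod (f (j, l)))\<^sup>2)"
      by (simp add: power_mult_distrib sum_distrib_left mult.assoc)
    also have "(\<Sum>j<n. \<Sum>l<m. (cmod (f (j, l)))\<^sup>2) = (\<Sum>s\<in>?K. (cmod (f s))\<^sup>2)"
      unfolding sum.cartesian_product by (rule sum.cong) auto
    also have "\<dots> = (norm2 f)\<^sup>2"
      by (rule norm2_finite[symmetric]) (use l2_zeroD[OF f] in auto)
    finally have "(norm2 (?F f))\<^sup>2 \<le> (C * D * norm2 f)\<^sup>2" by (simp add: power_mult_distrib)
    then show ?thesis by (rule power2_le_imp_le) (use CD in simp)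
  qed
  show "f \<in> l2 ?K \<Longrightarrow> norm2 (?F f) \<le> C * D * norm2 f" by (rule main)
  show "matrix_norm ?K (\<lambda>(i, k) (j, l). a i j * b k l) \<le> C * D"
    unfolding matrix_norm_def
  proof (rule op_norm_leI)
    fix f assume f: "f \<in> l2 ?K" "norm2 f \<le> 1"
    have "norm2 (?F f) \<le> C * D * norm2 f" by (rule main[OF f(1)])
    also have "\<dots> \<le> C * D * 1" using CD f by (intro mult_left_mono) auto
    finally show "norm2 (?F f) \<le> C * D" by simp
  qed
qed


lemma sum_apply: "(\<Sum>a\<in>S. F a) x = (\<Sum>a\<in>S. F a x)" for F :: "'a \<Rightarrow> 'b \<Rightarrow> complex"
  by (induction S rule: infinite_finite_induct) auto

lemma sum_apply2: "(\<Sum>a\<in>S. F a) x = (\<Sum>a\<in>S. F a x)" for F :: "'a \<Rightarrow> 'b \<Rightarrow> 'c \<Rightarrow> complex"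
proof
  fix y
  have "(\<Sum>a\<in>S. F a) x y = (\<Sum>a\<in>S. F a x y)"
    by (induction S rule: infinite_finite_induct) auto
  then show "(\<Sum>a\<in>S. F a) x y = (\<Sum>a\<in>S. F a x) y" by (simp only: sum_apply)
qed

lemma matrix_bound_add:
  assumes a: "matrix_bound n a C" and b: "matrix_bound n b D"
  shows "matrix_bound n (\<lambda>i j. a i j + b i j) (C + D)"
proof -
  have CD: "0 \<le> C" "0 \<le> D" using a b by (auto simp: matrix_bound_def)
  have "(\<Sum>i<n. (cmod (\<Sum>j<n. (a i j + b i j) * f j))\<^sup>2) \<le> (C + D)\<^sup>2 * (\<Sum>j<n. (cmod (f j))\<^sup>2)" for f
  proof -
    let ?s = "\<lambda>c. L2_set (\<lambda>i. cmod (\<Sum>j<n. c i j * f j)) {..<n}" and ?f = "L2_set (\<lambda>j. cmod (f j)) {..<n}"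
    have root: "?s c \<le> K * ?f" if "(\<Sum>i<n. (cmod (\<Sum>j<n. c i j * f j))\<^sup>2) \<le> K\<^sup>2 * (\<Sum>j<n. (cmod (f j))\<^sup>2)" "0 \<le> K" for c K
      unfolding L2_set_def using real_sqrt_le_mono[OF that(1)] that(2) by (simp add: real_sqrt_mult)
    have "?s (\<lambda>i j. a i j + b i j) \<le> L2_set (\<lambda>i. cmod (\<Sum>j<n. a i j * f j) + cmod (\<Sum>j<n. b i j * f j)) {..<n}"
      by (rule L2_set_mono) (simp_all add: distrib_right sum.distrib norm_triangle_ineq)
    also have "\<dots> \<le> ?s a + ?s b" by (rule L2_set_triangle_ineq)
    also have "\<dots> \<le> C * ?f + D * ?f"
      using a b unfolding matrix_bound_def by (intro add_mono root) auto
    finally have "?s (\<lambda>i j. a i j + b i j) \<le> (C + D) * ?f" by (simp add: distrib_right)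
    then have "(?s (\<lambda>i j. a i j + b i j))\<^sup>2 \<le> ((C + D) * ?f)\<^sup>2" by (intro power_mono) (auto simp: L2_set_nonneg)
    then show ?thesis by (simp add: L2_set_def power_mult_distrib sum_nonneg)
  qed
  then show ?thesis using CD by (simp add: matrix_bound_def)
qed

lemma matrix_bound_scale: "matrix_bound n a C \<Longrightarrow> matrix_bound n (\<lambda>i j. c * a i j) (cmod c * C)"
  unfolding matrix_bound_def
  by (auto simp: mult.assoc sum_distrib_left[symmetric] norm_mult power_mult_distrib mult_left_mono)

lemma matrix_bound_zero: "matrix_bound n (\<lambda>i j. 0) 0"
  by (simp add: matrix_bound_def)

lemma matrix_bound_sum:
  "finite S \<Longrightarrow> (\<And>t. t \<in> S \<Longrightarrow> matrix_bound n (a t) (C t)) \<Longrightarrow> matrix_bound n (\<lambda>i j. \<Sum>t\<in>S. a t i j) (\<Sum>t\<in>S. C t)"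
  by (induction S rule: finite_induct) (auto simp: matrix_bound_zero intro!: matrix_bound_add)

lemma matrix_bound_unit: "matrix_bound n (\<lambda>i j. if i = a \<and> j = b then 1 else 0) 1"
proof -
  have "(\<Sum>i<n. (cmod (\<Sum>j<n. (if i = a \<and> j = b then 1 else 0) * f j))\<^sup>2) \<le> 1\<^sup>2 * (\<Sum>j<n. (cmod (f j))\<^sup>2)" for f :: "nat \<Rightarrow> complex"
  proof -
    have "(\<Sum>j<n. (if i = a \<and> j = b then 1 else 0) * f j) = (if i = a then if b < n then f b else 0 else 0)" for i
    proof -
      have "(\<Sum>j<n. (if i = a \<and> j = b then 1 else 0) * f j) = (\<Sum>j<n. if j = b then if i = a then f b else 0 else 0)"
        by (rule sum.cong) auto
      then show ?thesis by (simp add: sum.delta)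
    qed
    then have "(\<Sum>i<n. (cmod (\<Sum>j<n. (if i = a \<and> j = b then 1 else 0) * f j))\<^sup>2)
        = (\<Sum>i<n. if i = a then (cmod (if b < n then f b else 0))\<^sup>2 else 0)"
      by (intro sum.cong) auto
    also have "\<dots> \<le> (cmod (if b < n then f b else 0))\<^sup>2" by (simp add: sum.delta)
    also have "\<dots> \<le> (\<Sum>j<n. (cmod (f j))\<^sup>2)"
      by (cases "b < n") (auto intro!: member_le_sum[of b "{..<n}" "\<lambda>j. (cmod (f j))\<^sup>2"] sum_nonneg)
    finally show ?thesis by simp
  qed
  then show ?thesis by (simp add: matrix_bound_def)
qed

text \<open>Test the form against the image of \<open>f\<close> itself and cancel one factor of its
  norm.\<close>

lemma matrix_boundI:
  assumes C: "0 \<le> C" and B: "\<And>f g. cmod (\<Sum>i<n. \<Sum>j<n. a i j * f j * cnj (g i)) \<le>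
      C * sqrt (\<Sum>j<n. (cmod (f j))\<^sup>2) * sqrt (\<Sum>i<n. (cmod (g i))\<^sup>2)"
  shows "matrix_bound n a C"
proof -
  have "(\<Sum>i<n. (cmod (\<Sum>j<n. a i j * f j))\<^sup>2) \<le> C\<^sup>2 * (\<Sum>j<n. (cmod (f j))\<^sup>2)" for f
  proof -
    define g where "g i = (\<Sum>j<n. a i j * f j)" for i
    define s where "s = (\<Sum>i<n. (cmod (g i))\<^sup>2)"
    define u where "u = C * sqrt (\<Sum>j<n. (cmod (f j))\<^sup>2)"
    have s: "0 \<le> s" unfolding s_def by (rule sum_nonneg) simp
    have u: "0 \<le> u" using C by (simp add: u_def sum_nonneg)
    have "(\<Sum>i<n. \<Sum>j<n. a i j * f j * cnj (g i)) = (\<Sum>i<n. g i * cnj (g i))"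
      by (simp add: g_def sum_distrib_right)
    also have "\<dots> = complex_of_real s" by (simp add: s_def complex_norm_square del: of_real_power)
    finally have "cmod (complex_of_real s) \<le> u * sqrt s" using B[of f g] by (simp only: s_def[symmetric] u_def)
    then have "s \<le> u * sqrt s" using s by simp
    then have "sqrt s * sqrt s \<le> u * sqrt s" using s by simp
    moreover have "a \<le> b" if "a * a \<le> b * a" "0 \<le> a" "0 \<le> b" for a b :: real
      using that by (cases "a = 0") auto
    ultimately have "sqrt s \<le> u" using real_sqrt_ge_zero[OF s] u by blast
    then have "(sqrt s)\<^sup>2 \<le> u\<^sup>2" using s by (intro power_mono) auto
    then show ?thesis using s by (simp add: s_def g_def u_def power_mult_distrib sum_nonneg)
  qed
  then show ?thesis using C by (simp add: matrix_bound_def)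
qed

text \<open>The elementary tensor of the scalar vector \<open>f\<close> with \<xi>. Applying a
  vector functional to the entries of \<open>X\<close> gives a scalar matrix whose form is that of
  \<open>X\<close> at such tensors.\<close>

definition tens :: "nat \<Rightarrow> (nat \<Rightarrow> complex) \<Rightarrow> 'i vec \<Rightarrow> (nat \<times> 'i) vec" where
  "tens n f \<xi> = (\<Sum>j<n. emb j (smul1 (f j) \<xi>))"

lemma tens_l2 [intro]: "\<xi> \<in> l2 I \<Longrightarrow> tens n f \<xi> \<in> l2 ({..<n} \<times> I)"
  unfolding tens_def by (intro l2_sum emb_l2 l2_smul1)

lemma slice_tens: "j < n \<Longrightarrow> slice j (tens n f \<xi>) = smul1 (f j) \<xi>"
proof
  fix b assume j: "j < n"
  have "slice j (tens n f \<xi>) b = (\<Sum>i<n. (if i = j then f j * \<xi> b else 0))"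
    unfolding tens_def slice_sum sum_apply by (rule sum.cong) auto
  then show "slice j (tens n f \<xi>) b = smul1 (f j) \<xi> b" using j by (simp add: sum.delta)
qed

lemma norm2_tens: assumes "\<xi> \<in> l2 I" shows "norm2 (tens n f \<xi>) = sqrt (\<Sum>j<n. (cmod (f j))\<^sup>2) * norm2 \<xi>"
proof -
  have "(norm2 (tens n f \<xi>))\<^sup>2 = (\<Sum>j<n. (norm2 (smul1 (f j) \<xi>))\<^sup>2)"
    unfolding norm2_slices[OF tens_l2[OF assms] finite_lessThan] by (intro sum.cong) (auto simp: slice_tens)
  also have "\<dots> = (sqrt (\<Sum>j<n. (cmod (f j))\<^sup>2) * norm2 \<xi>)\<^sup>2"
    by (simp add: norm2_smul power_mult_distrib sum_distrib_right sum_nonneg)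
  finally show ?thesis by (rule power2_eq_imp_eq) (auto simp: sum_nonneg)
qed

context op_space
begin

lemma mat_alg_bop: "X \<in> elems (mat_alg n A) \<Longrightarrow> X \<in> bounded_ops ({..<n} \<times> index A)"
  by (simp add: mat_alg_def)

lemma mat_alg_entry: "X \<in> elems (mat_alg n A) \<Longrightarrow> i < n \<Longrightarrow> j < n \<Longrightarrow> entry i j X \<in> elems A"
  by (simp add: mat_alg_def)

lemma index_mat_alg [simp]: "index (mat_alg n A) = {..<n} \<times> index A"
  by (simp add: mat_alg_def)

lemma mat_alg_op_space: "op_space (mat_alg n A)"
  by unfold_locales (auto simp: mat_alg_def entry_eq_ent ent_linear)

text \<open>Complete boundedness of a normal functional. The form of the scalar matrix is a sum over
  k of values of \<open>X\<close> at elementary tensors, bounded by the sum of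
  \<open>norm2 (\<xi> k) * norm2 (\<eta> k)\<close>, which does not depend on n.\<close>

lemma series_matrix_bound:
  assumes \<xi>: "l2_family (index A) \<xi>" and \<eta>: "l2_family (index A) \<eta>"
  shows "\<exists>C. \<forall>n. \<forall>X\<in>elems (mat_alg n A). op_norm (index (mat_alg n A)) X \<le> 1 \<longrightarrow>
    matrix_bound n (\<lambda>i j. series_functional A \<xi> \<eta> (entry i j X)) C"
proof -
  define C where "C = (\<Sum>k. norm2 (\<xi> k) * norm2 (\<eta> k))"
  have summ: "summable (\<lambda>k. norm2 (\<xi> k) * norm2 (\<eta> k))"
  proof (rule summable_comparison_test'[of "\<lambda>k. (norm2 (\<xi> k))\<^sup>2 + (norm2 (\<eta> k))\<^sup>2" 0])
    show "summable (\<lambda>k. (norm2 (\<xi> k))\<^sup>2 + (norm2 (\<eta> k))\<^sup>2)"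
      using \<xi> \<eta> unfolding l2_family_def by (intro summable_add) auto
    fix k
    have "2 * (a * b) \<le> a\<^sup>2 + b\<^sup>2" for a b :: real
      using zero_le_power2[of "a - b"] by (simp add: power2_eq_square algebra_simps)
    from this[of "norm2 (\<xi> k)" "norm2 (\<eta> k)"]
    show "norm (norm2 (\<xi> k) * norm2 (\<eta> k)) \<le> (norm2 (\<xi> k))\<^sup>2 + (norm2 (\<eta> k))\<^sup>2"
      using mult_nonneg_nonneg[OF norm2_nonneg[of "\<xi> k"] norm2_nonneg[of "\<eta> k"]]
      unfolding real_norm_def abs_of_nonneg[OF mult_nonneg_nonneg[OF norm2_nonneg norm2_nonneg]] by linarith
  qed
  have C: "0 \<le> C" unfolding C_def by (rule suminf_nonneg[OF summ]) simp
  have "matrix_bound n (\<lambda>i j. series_functional A \<xi> \<eta> (entry i j X)) C"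
    if X: "X \<in> elems (mat_alg n A)" and X1: "op_norm (index (mat_alg n A)) X \<le> 1" for n X
  proof (rule matrix_boundI[OF C])
    fix f g :: "nat \<Rightarrow> complex"
    let ?f = "sqrt (\<Sum>j<n. (cmod (f j))\<^sup>2)" and ?g = "sqrt (\<Sum>i<n. (cmod (g i))\<^sup>2)"
    have Xb: "X \<in> bounded_ops ({..<n} \<times> index A)" by (rule mat_alg_bop[OF X])
    have e: "entry i j X \<in> elems A" if "i < n" "j < n" for i j by (rule mat_alg_entry[OF X that])
    have s: "summable (\<lambda>k. inner2 (entry i j X (\<xi> k)) (\<eta> k))" if "i < n" "j < n" for i j
      by (rule series_summable[OF elem_bop[OF e[OF that]] \<xi> \<eta>])
    have m: "\<xi> k \<in> l2 (index A)" "\<eta> k \<in> l2 (index A)" for k using \<xi> \<eta> by (auto simp: l2_family_l2)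
    have term_k: "(\<Sum>i<n. \<Sum>j<n. inner2 (entry i j X (\<xi> k)) (\<eta> k) * f j * cnj (g i)) = inner2 (X (tens n f (\<xi> k))) (tens n g (\<eta> k))" for k
    proof -
      have "inner2 (X (tens n f (\<xi> k))) (tens n g (\<eta> k)) =
          (\<Sum>i<n. \<Sum>j<n. inner2 (ent i j X (slice j (tens n f (\<xi> k)))) (slice i (tens n g (\<eta> k))))"
        by (rule inner2_entries[OF Xb _ tens_l2[OF m(1)] tens_l2[OF m(2)]]) simp
      also have "\<dots> = (\<Sum>i<n. \<Sum>j<n. inner2 (entry i j X (\<xi> k)) (\<eta> k) * f j * cnj (g i))"
      proof (intro sum.cong refl)
        fix i j assume ij: "i \<in> {..<n}" "j \<in> {..<n}"
        have "ent i j X \<in> bounded_ops (index A)" using e[of i j] ij by (simp add: entry_eq_ent)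
        from bop_smul[OF this m(1)] show "inner2 (ent i j X (slice j (tens n f (\<xi> k)))) (slice i (tens n g (\<eta> k)))
            = inner2 (entry i j X (\<xi> k)) (\<eta> k) * f j * cnj (g i)"
          using ij by (simp only: slice_tens lessThan_iff entry_eq_ent inner2_smul_left inner2_smul_right mult_ac)
      qed
      finally show ?thesis by simp
    qed
    have bd: "cmod (inner2 (X (tens n f (\<xi> k))) (tens n g (\<eta> k))) \<le> ?f * ?g * (norm2 (\<xi> k) * norm2 (\<eta> k))" for k
    proof -
      have "cmod (inner2 (X (tens n f (\<xi> k))) (tens n g (\<eta> k))) \<le> norm2 (X (tens n f (\<xi> k))) * norm2 (tens n g (\<eta> k))"
        by (rule inner2_cauchy_schwarz[OF bop_l2[OF Xb] tens_l2[OF m(2)]])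
      also have "\<dots> \<le> norm2 (tens n f (\<xi> k)) * norm2 (tens n g (\<eta> k))"
        using op_norm_le_1D[OF Xb _ tens_l2[OF m(1)]] X1 by (intro mult_right_mono) auto
      also have "\<dots> = ?f * ?g * (norm2 (\<xi> k) * norm2 (\<eta> k))"
        unfolding norm2_tens[OF m(1)] norm2_tens[OF m(2)] by (simp add: mult_ac)
      finally show ?thesis .
    qed
    have "(\<Sum>i<n. \<Sum>j<n. series_functional A \<xi> \<eta> (entry i j X) * f j * cnj (g i))
      = (\<Sum>i<n. \<Sum>j<n. (\<Sum>k. inner2 (entry i j X (\<xi> k)) (\<eta> k) * f j * cnj (g i)))"
    proof (intro sum.cong refl)
      fix i j assume ij: "i \<in> {..<n}" "j \<in> {..<n}"
      then have ij': "i < n" "j < n" by auto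
      have "(\<Sum>k. inner2 (entry i j X (\<xi> k)) (\<eta> k) * (f j * cnj (g i))) = (\<Sum>k. inner2 (entry i j X (\<xi> k)) (\<eta> k)) * (f j * cnj (g i))"
        by (rule suminf_mult2[OF s[OF ij'], symmetric])
      then show "series_functional A \<xi> \<eta> (entry i j X) * f j * cnj (g i) = (\<Sum>k. inner2 (entry i j X (\<xi> k)) (\<eta> k) * f j * cnj (g i))"
        using e[OF ij'] by (simp add: series_functional_def mult.assoc)
    qed
    also have "\<dots> = (\<Sum>k. \<Sum>i<n. \<Sum>j<n. inner2 (entry i j X (\<xi> k)) (\<eta> k) * f j * cnj (g i))"
    proof -
      have s': "summable (\<lambda>k. inner2 (entry i j X (\<xi> k)) (\<eta> k) * f j * cnj (g i))" if "i < n" "j < n" for i j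
        by (intro summable_mult2 s that)
      have "(\<Sum>i<n. \<Sum>j<n. (\<Sum>k. inner2 (entry i j X (\<xi> k)) (\<eta> k) * f j * cnj (g i)))
          = (\<Sum>i<n. (\<Sum>k. \<Sum>j<n. inner2 (entry i j X (\<xi> k)) (\<eta> k) * f j * cnj (g i)))"
        using s' by (intro sum.cong refl suminf_sum[symmetric]) auto
      also have "\<dots> = (\<Sum>k. \<Sum>i<n. \<Sum>j<n. inner2 (entry i j X (\<xi> k)) (\<eta> k) * f j * cnj (g i))"
        using s' by (intro suminf_sum[symmetric] summable_sum) auto
      finally show ?thesis .
    qed
    also have "cmod \<dots> \<le> (\<Sum>k. ?f * ?g * (norm2 (\<xi> k) * norm2 (\<eta> k)))"
      unfolding term_k by (rule norm_suminf_le[OF bd summable_mult[OF summ]])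
    also have "\<dots> = ?f * ?g * C" unfolding C_def by (rule suminf_mult[OF summ])
    finally show "cmod (\<Sum>i<n. \<Sum>j<n. series_functional A \<xi> \<eta> (entry i j X) * f j * cnj (g i)) \<le> C * ?f * ?g"
      by (simp add: mult_ac)
  qed
  then show ?thesis by blast
qed

lemma predual_matrix_bound:
  assumes \<omega>: "\<omega> \<in> predual A"
  shows "\<exists>C. \<forall>n. \<forall>X\<in>elems (mat_alg n A). op_norm (index (mat_alg n A)) X \<le> 1 \<longrightarrow>
    matrix_bound n (\<lambda>i j. \<omega> (entry i j X)) C"
proof -
  obtain F c where F: "finite F" "\<forall>(\<xi>, \<eta>)\<in>F. l2_family (index A) \<xi> \<and> l2_family (index A) \<eta>"
    "\<omega> = (\<Sum>(\<xi>, \<eta>)\<in>F. smul1 (c (\<xi>, \<eta>)) (series_functional A \<xi> \<eta>))"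
    using predual_representation[OF \<omega>] by (elim exE conjE) (rule that)
  define B where "B p C \<longleftrightarrow> (\<forall>n. \<forall>X\<in>elems (mat_alg n A). op_norm (index (mat_alg n A)) X \<le> 1 \<longrightarrow>
    matrix_bound n (\<lambda>i j. series_functional A (fst p) (snd p) (entry i j X)) C)" for p C
  define C where "C p = (SOME C. B p C)" for p
  have C: "B p (C p)" if p: "p \<in> F" for p
  proof -
    have "\<exists>C. B p C" unfolding B_def by (rule series_matrix_bound) (use F(2) p in auto)
    then show ?thesis unfolding C_def by (rule someI_ex)
  qed
  have app: "\<omega> x = (\<Sum>p\<in>F. c p * series_functional A (fst p) (snd p) x)" for x
    unfolding F(3) sum_apply by (rule sum.cong) auto
  have "matrix_bound n (\<lambda>i j. \<omega> (entry i j X)) (\<Sum>p\<in>F. cmod (c p) * C p)"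
    if "X \<in> elems (mat_alg n A)" "op_norm (index (mat_alg n A)) X \<le> 1" for n X
    unfolding app using C that unfolding B_def by (intro matrix_bound_sum F(1) matrix_bound_scale) blast
  then show ?thesis by blast
qed

lemma zero_mat_alg: "0 \<in> elems (mat_alg n A)" "op_norm (index (mat_alg n A)) 0 \<le> 1"
proof -
  interpret M: op_space "mat_alg n A" by (rule mat_alg_op_space)
  show "0 \<in> elems (mat_alg n A)" by simp
  show "op_norm (index (mat_alg n A)) 0 \<le> 1" by (rule op_norm_leI) simp
qed

lemma predual_matrix_norm_le:
  assumes "\<And>m Y. Y \<in> elems (mat_alg m A) \<Longrightarrow> op_norm (index (mat_alg m A)) Y \<le> 1 \<Longrightarrow>
    matrix_norm ({..<n} \<times> {..<m}) (\<lambda>(i, k) (j, l). \<psi> i j (entry k l Y)) \<le> C"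
  shows "predual_matrix_norm A n \<psi> \<le> C"
  unfolding predual_matrix_norm_def
proof (rule cSup_least)
  show "{matrix_norm ({..<n} \<times> {..<m}) (\<lambda>(i, k) (j, l). \<psi> i j (entry k l Y)) | m Y.
            Y \<in> elems (mat_alg m A) \<and> op_norm (index (mat_alg m A)) Y \<le> 1} \<noteq> {}"
    using zero_mat_alg by blast
qed (use assms in blast)


end

lemma matrix_norm_sum_kronecker:
  assumes S: "finite S" and a: "\<And>t. t \<in> S \<Longrightarrow> matrix_bound n (a t) (C t)" and b: "\<And>t. t \<in> S \<Longrightarrow> matrix_bound m (b t) (D t)"
  shows "matrix_norm ({..<n} \<times> {..<m}) (\<lambda>(i, k) (j, l). \<Sum>t\<in>S. a t i j * b t k l) \<le> (\<Sum>t\<in>S. C t * D t)"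
  unfolding matrix_norm_def
proof (rule op_norm_leI)
  let ?K = "{..<n} \<times> {..<m}"
  let ?F = "\<lambda>t f r. if r \<in> ?K then \<Sum>s\<in>?K. (case r of (i, k) \<Rightarrow> \<lambda>(j, l). a t i j * b t k l) s * f s else 0"
  fix f assume f: "f \<in> l2 ?K" "norm2 f \<le> 1"
  have "(\<lambda>r. if r \<in> ?K then \<Sum>s\<in>?K. (case r of (i, k) \<Rightarrow> \<lambda>(j, l). \<Sum>t\<in>S. a t i j * b t k l) s * f s else 0)
      = (\<Sum>t\<in>S. ?F t f)"
  proof
    fix r :: "nat \<times> nat"
    obtain i k where r: "r = (i, k)" by (cases r)
    have "(\<Sum>s\<in>?K. (case s of (j, l) \<Rightarrow> \<Sum>t\<in>S. a t i j * b t k l) * f s)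
        = (\<Sum>s\<in>?K. \<Sum>t\<in>S. (case s of (j, l) \<Rightarrow> a t i j * b t k l) * f s)"
      by (rule sum.cong) (auto simp: sum_distrib_right)
    also have "\<dots> = (\<Sum>t\<in>S. \<Sum>s\<in>?K. (case s of (j, l) \<Rightarrow> a t i j * b t k l) * f s)" by (rule sum.swap)
    finally show "(if r \<in> ?K then \<Sum>s\<in>?K. (case r of (i, k) \<Rightarrow> \<lambda>(j, l). \<Sum>t\<in>S. a t i j * b t k l) s * f s else 0)
      = (\<Sum>t\<in>S. ?F t f) r"
      unfolding sum_apply by (auto simp: r)
  qed
  moreover have "norm2 (\<Sum>t\<in>S. ?F t f) \<le> (\<Sum>t\<in>S. norm2 (?F t f))"
    by (rule norm2_triangle_sum[of _ _ ?K]) (rule l2_finite[of ?K], auto)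
  moreover have "(\<Sum>t\<in>S. norm2 (?F t f)) \<le> (\<Sum>t\<in>S. C t * D t)"
  proof (rule sum_mono)
    fix t assume t: "t \<in> S"
    have "norm2 (?F t f) \<le> C t * D t * norm2 f" by (rule matrix_bound_kronecker(2)[OF a[OF t] b[OF t] f(1)])
    also have "\<dots> \<le> C t * D t * 1" using a[OF t] b[OF t] f(2) by (intro mult_left_mono) (auto simp: matrix_bound_def)
    finally show "norm2 (?F t f) \<le> C t * D t" by simp
  qed
  ultimately show "norm2 (\<lambda>r. if r \<in> ?K then \<Sum>s\<in>?K. (case r of (i, k) \<Rightarrow> \<lambda>(j, l). \<Sum>t\<in>S. a t i j * b t k l) s * f s else 0)
      \<le> (\<Sum>t\<in>S. C t * D t)" by (simp only:)
qed

lemma matrix_norm_empty: "matrix_norm {} a = 0"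
proof -
  have "(\<lambda>f. norm2 ((\<lambda>f r. if r \<in> {} then (\<Sum>s\<in>{}. a r s * f s) else 0) f)) = (\<lambda>f. 0)"
    by (auto simp: norm2_def)
  moreover have ne: "{f \<in> l2 {}. norm2 f \<le> 1} \<noteq> {}" by (auto intro!: exI[of _ 0])
  ultimately show ?thesis unfolding matrix_norm_def op_norm_def by (simp only: cSUP_const[OF ne])
qed

context op_space
begin

text \<open>The content is that the defining set is bounded above: the matrix is a sum of Kronecker
  products of matrix units with the matrices of the single entries, each bounded by
  \<open>predual_matrix_bound\<close>.\<close>

lemma predual_matrix_norm_upper:
  assumes v: "\<And>i j. i < n \<Longrightarrow> j < n \<Longrightarrow> \<psi> i j \<in> predual A"
    and Y: "Y \<in> elems (mat_alg m A)" "op_norm (index (mat_alg m A)) Y \<le> 1"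
  shows "matrix_norm ({..<n} \<times> {..<m}) (\<lambda>(i, k) (j, l). \<psi> i j (entry k l Y)) \<le> predual_matrix_norm A n \<psi>"
proof -
  let ?S = "{matrix_norm ({..<n} \<times> {..<m}) (\<lambda>(i, k) (j, l). \<psi> i j (entry k l Y)) | m Y.
            Y \<in> elems (mat_alg m A) \<and> op_norm (index (mat_alg m A)) Y \<le> 1}"
  define B where "B p C \<longleftrightarrow> (\<forall>m. \<forall>X\<in>elems (mat_alg m A). op_norm (index (mat_alg m A)) X \<le> 1 \<longrightarrow>
    matrix_bound m (\<lambda>k l. \<psi> (fst p) (snd p) (entry k l X)) C)" for p C
  define C where "C p = (SOME C. B p C)" for p
  let ?T = "{..<n} \<times> {..<n}"
  have C: "B p (C p)" if p: "p \<in> ?T" for p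
  proof -
    have "\<exists>C. B p C" unfolding B_def by (rule predual_matrix_bound) (use v p in auto)
    then show ?thesis unfolding C_def by (rule someI_ex)
  qed
  have le: "matrix_norm ({..<n} \<times> {..<m}) (\<lambda>(i, k) (j, l). \<psi> i j (entry k l Y)) \<le> (\<Sum>p\<in>?T. 1 * C p)"
    if Y: "Y \<in> elems (mat_alg m A)" "op_norm (index (mat_alg m A)) Y \<le> 1" for m Y
  proof -
    let ?g = "\<lambda>i j k l. \<Sum>p\<in>?T. (if i = fst p \<and> j = snd p then 1 else 0) * \<psi> (fst p) (snd p) (entry k l Y)"
    have e: "\<psi> i j (entry k l Y) = ?g i j k l" if "i < n" "j < n" for i j k l
    proof -
      have "?g i j k l = (\<Sum>p\<in>?T. if p = (i, j) then \<psi> i j (entry k l Y) else 0)"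
        by (rule sum.cong) auto
      also have "\<dots> = \<psi> i j (entry k l Y)" using that by (simp add: sum.delta)
      finally show ?thesis by simp
    qed
    have "matrix_norm ({..<n} \<times> {..<m}) (\<lambda>(i, k) (j, l). \<psi> i j (entry k l Y))
        = matrix_norm ({..<n} \<times> {..<m}) (\<lambda>(i, k) (j, l). ?g i j k l)"
      unfolding matrix_norm_def
      by (intro arg_cong2[of _ _ _ _ op_norm] refl ext if_cong sum.cong arg_cong2[of _ _ _ _ "(*)"]) (use e in auto)
    also have "\<dots> \<le> (\<Sum>p\<in>?T. 1 * C p)"
      by (rule matrix_norm_sum_kronecker) (use C Y in \<open>auto simp: B_def intro: matrix_bound_unit\<close>)
    finally show ?thesis .
  qed
  have "bdd_above ?S" using le by (intro bdd_aboveI[of _ "\<Sum>p\<in>?T. 1 * C p"]) blast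
  then show ?thesis unfolding predual_matrix_norm_def by (rule cSup_upper[rotated]) (use Y in blast)
qed

text \<open>Matrices of size 0 contribute the value 0 to the supremum.\<close>

lemma predual_matrix_norm_nonneg:
  assumes v: "\<And>i j. i < n \<Longrightarrow> j < n \<Longrightarrow> \<psi> i j \<in> predual A"
  shows "0 \<le> predual_matrix_norm A n \<psi>"
proof -
  have "matrix_norm ({..<n} \<times> {..<0}) (\<lambda>(i, k) (j, l). \<psi> i j (entry k l 0)) = 0"
    unfolding lessThan_0 Times_empty[THEN iffD2, OF disjI2, OF refl] by (rule matrix_norm_empty)
  moreover have "matrix_norm ({..<n} \<times> {..<0}) (\<lambda>(i, k) (j, l). \<psi> i j (entry k l 0)) \<le> predual_matrix_norm A n \<psi>"
    by (rule predual_matrix_norm_upper[OF _ zero_mat_alg]) (rule v)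
  ultimately show ?thesis by (simp only:)
qed

end

text \<open>The constant sequence \<open>u\<close> serves as approximating sequence. What has to be
  shown is that finite sums of elementary tensors are completely bounded and that both norms behave
  at 0.\<close>

lemma alg_tensor_Nor:
  assumes "op_space A" "op_space B" and u: "u \<in> alg_tensor A B"
  shows "u \<in> Nor A B"
proof -
  interpret A: op_space A by fact
  interpret B: op_space B by fact
  obtain m :: nat and \<mu> \<nu> where u_eq: "u = (\<Sum>k<m. elem_tensor (\<mu> k) (\<nu> k))"
    and mem: "\<And>k. k < m \<Longrightarrow> \<mu> k \<in> predual A" "\<And>k. k < m \<Longrightarrow> \<nu> k \<in> predual B"
    using u unfolding alg_tensor_def by blast
  have app: "u x = (\<Sum>k<m. smul1 (\<mu> k x) (\<nu> k))" for x
    unfolding u_eq sum_apply2 elem_tensor_def ..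
  have app2: "u x y = (\<Sum>k<m. \<mu> k x * \<nu> k y)" for x y
    unfolding app sum_apply smul1_apply ..
  have \<mu>_out: "\<mu> k x = 0" if "k < m" "x \<notin> elems A" for k x by (rule A.predual_outside[OF mem(1)[OF that(1)] that(2)])
  have \<mu>_add: "\<mu> k (x + y) = \<mu> k x + \<mu> k y" if "k < m" "x \<in> elems A" "y \<in> elems A" for k x y
    by (rule A.predual_plus[OF mem(1)[OF that(1)] that(2,3)])
  have \<mu>_smul: "\<mu> k (smul2 c x) = c * \<mu> k x" if "k < m" "x \<in> elems A" for k x c
    by (rule A.predual_scale[OF mem(1)[OF that(1)] that(2)])
  define P where "P k C \<longleftrightarrow> (\<forall>n. \<forall>X\<in>elems (mat_alg n A). op_norm (index (mat_alg n A)) X \<le> 1 \<longrightarrow>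
    matrix_bound n (\<lambda>i j. \<mu> k (entry i j X)) C)" for k C
  define Q where "Q k C \<longleftrightarrow> (\<forall>n. \<forall>X\<in>elems (mat_alg n B). op_norm (index (mat_alg n B)) X \<le> 1 \<longrightarrow>
    matrix_bound n (\<lambda>i j. \<nu> k (entry i j X)) C)" for k C
  define C D where "C k = (SOME c. P k c)" and "D k = (SOME c. Q k c)" for k
  have C: "P k (C k)" if "k < m" for k
  proof -
    have "\<exists>c. P k c" unfolding P_def by (rule A.predual_matrix_bound[OF mem(1)[OF that]])
    then show ?thesis unfolding C_def by (rule someI_ex)
  qed
  have D: "Q k (D k)" if "k < m" for k
  proof -
    have "\<exists>c. Q k c" unfolding Q_def by (rule B.predual_matrix_bound[OF mem(2)[OF that]])
    then show ?thesis unfolding D_def by (rule someI_ex)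
  qed
  have bound: "predual_matrix_norm B n (\<lambda>i j. u (entry i j X)) \<le> (\<Sum>k<m. C k * D k)"
    if X: "X \<in> elems (mat_alg n A)" "op_norm (index (mat_alg n A)) X \<le> 1" for n X
  proof (rule B.predual_matrix_norm_le)
    fix l Y assume Y: "Y \<in> elems (mat_alg l B)" "op_norm (index (mat_alg l B)) Y \<le> 1"
    show "matrix_norm ({..<n} \<times> {..<l}) (\<lambda>(i, k) (j, l). u (entry i j X) (entry k l Y)) \<le> (\<Sum>k<m. C k * D k)"
      unfolding app2
      by (rule matrix_norm_sum_kronecker) (use C D X Y in \<open>auto simp: P_def Q_def\<close>)
  qed
  have CB: "u \<in> CB A B"
    unfolding CB_def mem_Collect_eq
  proof (intro conjI allI ballI impI)
    fix x assume "x \<notin> elems A"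
    then show "u x = 0" by (intro ext) (simp add: app2 \<mu>_out)
  next
    fix x show "u x \<in> predual B" unfolding app by (intro B.sum_predual B.smul_predual mem) auto
  next
    show "linear_on (elems A) smul2 smul1 u"
      unfolding linear_on_def
    proof (intro conjI allI ballI)
      fix x y assume xy: "x \<in> elems A" "y \<in> elems A"
      show "u (x + y) = u x + u y"
        by (intro ext) (simp add: app2 \<mu>_add xy distrib_right sum.distrib)
    next
      fix c x assume x: "x \<in> elems A"
      show "u (smul2 c x) = smul1 c (u x)"
        by (intro ext) (simp add: app2 \<mu>_smul x sum_distrib_left mult.assoc)
    qed
    show "bdd_above (cb_values A B u)"
      unfolding cb_values_def using bound by (intro bdd_aboveI[of _ "\<Sum>k<m. C k * D k"]) blast
  qed
  \<comment> \<open>The empty factorization p = q = 0 represents 0 with value 0. Nonnegativity of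
    the factors bounds the set from below, so that its infimum is at most this value.\<close>
  have pn0: "proj_norm A B 0 \<le> 0"
    unfolding proj_norm_def
  proof (rule cInf_lower)
    let ?S = "{norm2 a * predual_matrix_norm A p v * predual_matrix_norm B q w * norm2 b | p q a b v w.
       a \<in> l2 ({..<p} \<times> {..<q}) \<and> b \<in> l2 ({..<p} \<times> {..<q}) \<and>
       (\<forall>i<p. \<forall>k<p. v i k \<in> predual A) \<and> (\<forall>j<q. \<forall>l<q. w j l \<in> predual B) \<and>
       0 = (\<Sum>i<p. \<Sum>j<q. \<Sum>k<p. \<Sum>l<q. smul2 (a (i, j) * b (k, l)) (elem_tensor (v i k) (w j l)))}"
    show "0 \<in> ?S"
      unfolding mem_Collect_eq
      by (rule exI[of _ 0], rule exI[of _ 0], rule exI[of _ 0], rule exI[of _ 0], rule exI[of _ "\<lambda>_ _. 0"], rule exI[of _ "\<lambda>_ _. 0"])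
        (simp only: norm2_zero mult_zero_left lessThan_0 sum.empty l2_zero not_less0, simp)
    show "bdd_below ?S"
    proof (rule bdd_belowI[of _ 0])
      fix s assume "s \<in> ?S"
      then show "0 \<le> s"
        unfolding mem_Collect_eq
      proof (elim exE conjE)
        fix p q a b v w
        assume s: "s = norm2 a * predual_matrix_norm A p v * predual_matrix_norm B q w * norm2 b"
          and vw: "\<forall>i<p. \<forall>k<p. v i k \<in> predual A" "\<forall>j<q. \<forall>l<q. w j l \<in> predual B"
        have "0 \<le> predual_matrix_norm A p v" "0 \<le> predual_matrix_norm B q w"
          using vw by (auto intro!: A.predual_matrix_norm_nonneg B.predual_matrix_norm_nonneg)
        then show "0 \<le> s" unfolding s by (intro mult_nonneg_nonneg norm2_nonneg)
      qed
    qed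
  qed
  have pm0: "predual_matrix_norm B n (\<lambda>i j. (0 :: 'a opr \<Rightarrow> 'b opr \<Rightarrow> complex) (entry i j X)) = 0" for n X
  proof (rule antisym)
    show "predual_matrix_norm B n (\<lambda>i j. (0 :: 'a opr \<Rightarrow> 'b opr \<Rightarrow> complex) (entry i j X)) \<le> 0"
    proof (rule B.predual_matrix_norm_le)
      fix l Y
      have "(\<lambda>f r. if r \<in> {..<n} \<times> {..<l} then \<Sum>s\<in>{..<n} \<times> {..<l}. (case r of (i, k) \<Rightarrow> \<lambda>(j, l). (0 :: 'a opr \<Rightarrow> 'b opr \<Rightarrow> complex) (entry i j X) (entry k l Y)) s * f s else 0)
        = (\<lambda>f r. 0 :: complex)" by (auto simp: fun_eq_iff intro!: sum.neutral)
      then show "matrix_norm ({..<n} \<times> {..<l}) (\<lambda>(i, k) (j, l). (0 :: 'a opr \<Rightarrow> 'b opr \<Rightarrow> complex) (entry i j X) (entry k l Y)) \<le> 0"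
        unfolding matrix_norm_def by (simp only:) (rule op_norm_leI, simp add: norm2_def)
    qed
    show "0 \<le> predual_matrix_norm B n (\<lambda>i j. (0 :: 'a opr \<Rightarrow> 'b opr \<Rightarrow> complex) (entry i j X))"
      by (rule B.predual_matrix_norm_nonneg) (simp only: fun_apply2 B.zero_predual)
  qed
  have "cb_values A B 0 = {0}"
    unfolding cb_values_def pm0 using A.zero_mat_alg by blast
  then have cb0: "cb_norm A B 0 = 0" unfolding cb_norm_def by simp
  show ?thesis
    unfolding Nor_def mem_Collect_eq
  proof (intro conjI CB exI[of _ "\<lambda>_. u"] allI impI)
    show "u \<in> alg_tensor A B" by fact
    fix e :: real assume "0 < e"
    then have "proj_norm A B 0 < e" using pn0 by simp
    then show "\<exists>K :: nat. \<forall>k\<ge>K. \<forall>l\<ge>K. proj_norm A B (u - u) < e"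
      unfolding diff_self by (intro exI allI impI)
  next
    show "(\<lambda>k. cb_norm A B (u - u)) \<longlonglongrightarrow> 0" unfolding diff_self cb0 by simp
  qed
qed

section \<open>Full matrix algebras and positive scalar matrices\<close>

lemma full_algebra_vn: "von_neumann_algebra (OpAlg K (bounded_ops K))"
proof -
  have "commutant K (commutant K (bounded_ops K)) = bounded_ops K"
    using double_commutant_sup[of "bounded_ops K" K] commutant_sub[of K] by blast
  then show ?thesis unfolding von_neumann_algebra_def opalg.sel by auto
qed

lemma full_algebra: "vn_algebra (OpAlg K (bounded_ops K))"
  by (rule vn_algebra.intro) (rule full_algebra_vn)

lemma nonneg_Reals_sum: "(\<And>t. t \<in> S \<Longrightarrow> f t \<in> \<real>\<^sub>\<ge>\<^sub>0) \<Longrightarrow> sum f S \<in> (\<real>\<^sub>\<ge>\<^sub>0 :: complex set)"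
  by (induction S rule: infinite_finite_induct) (auto intro: nonneg_Reals_add_I)

text \<open>The imaginary part is affine in \<epsilon> and vanishes at 1 and 2, hence at 0; a
  negative real part would persist for small \<epsilon>.\<close>

lemma nonneg_limit:
  assumes "\<And>\<epsilon> :: real. 0 < \<epsilon> \<Longrightarrow> a + complex_of_real \<epsilon> * b \<in> \<real>\<^sub>\<ge>\<^sub>0" shows "a \<in> \<real>\<^sub>\<ge>\<^sub>0"
proof -
  have re: "0 \<le> Re a + \<epsilon> * Re b" and im: "Im a + \<epsilon> * Im b = 0" if "0 < \<epsilon>" for \<epsilon>
    using assms[OF that] by (auto simp: complex_nonneg_Reals_iff)
  have "Im a = 0" using im[of 1] im[of 2] by simp
  moreover have "0 \<le> Re a"
  proof (rule ccontr)
    assume n: "\<not> 0 \<le> Re a"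
    define \<epsilon> where "\<epsilon> = - Re a / (2 * (\<bar>Re b\<bar> + 1))"
    have e: "0 < \<epsilon>" unfolding \<epsilon>_def using n by (intro divide_pos_pos) auto
    have "\<epsilon> * Re b \<le> \<epsilon> * (\<bar>Re b\<bar> + 1)" using e by (intro mult_left_mono) auto
    also have "\<dots> = - Re a / 2" by (simp add: \<epsilon>_def field_simps)
    finally show False using re[OF e] n by simp
  qed
  ultimately show ?thesis by (simp add: complex_nonneg_Reals_iff)
qed

text \<open>A positive matrix plus \<open>\<epsilon>\<close> has an invertible square root, hence is a sum of positive
  matrices of rank one.\<close>

lemma positive_matrix_pairing:
  assumes K: "finite K" and X: "positive_op K X"
    and m: "\<And>v. (\<Sum>r\<in>K. \<Sum>s\<in>K. v r * cnj (v s) * m r s) \<in> \<real>\<^sub>\<ge>\<^sub>0"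
  shows "(\<Sum>r\<in>K. \<Sum>s\<in>K. X (basis2 s) r * m r s) \<in> \<real>\<^sub>\<ge>\<^sub>0"
proof (rule nonneg_limit)
  interpret vn_algebra "OpAlg K (bounded_ops K)" by (rule full_algebra)
  have Xb: "X \<in> bounded_ops K" using X by (simp add: positive_op_def)
  fix \<epsilon> :: real assume e: "0 < \<epsilon>"
  define h where "h = X + smul2 (complex_of_real \<epsilon>) (id_op K)"
  have h: "h \<in> bounded_ops K" "adj K h = h"
    using Xb positive_op_adj[OF X] by (auto simp: h_def adj_add adj_smul)
  have low: "\<epsilon> * (norm2 f)\<^sup>2 \<le> Re (inner2 (h f) f)" if f: "f \<in> l2 K" for f
  proof -
    have "inner2 (h f) f = inner2 (X f) f + complex_of_real (\<epsilon> * (norm2 f)\<^sup>2)"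
      using f Xb by (simp add: h_def inner2_add_left[where I=K] inner2_smul_left inner2_self)
    moreover have "0 \<le> Re (inner2 (X f) f)" using X f by (auto simp: positive_op_def complex_nonneg_Reals_iff)
    ultimately show ?thesis by (simp del: of_real_power of_real_mult)
  qed
  obtain k l where k: "k \<in> bounded_ops K" "adj K k = k" "k \<circ> k = h"
    by (rule positive_square_root[of h \<epsilon>]) (use h low e in auto)
  \<comment> \<open>As \<open>h\<close> is the square of the selfadjoint \<open>k\<close>, its
    entries are sums over t of rank one matrices, and the assumption \<open>m\<close> applies to
    each t.\<close>
  have entry_h: "h (basis2 s) r = (\<Sum>t\<in>K. cnj (k (basis2 r) t) * cnj (cnj (k (basis2 s) t)))" if "r \<in> K" "s \<in> K" for r s
  proof -
    have "h (basis2 s) r = inner2 (k (k (basis2 s))) (basis2 r)"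
      unfolding inner2_basis2 using k(3) by (metis comp_apply)
    also have "\<dots> = inner2 (k (basis2 s)) (k (basis2 r))"
      using inner2_adj_left[OF k(1), of "k (basis2 s)" "basis2 r"] k that by simp
    also have "\<dots> = (\<Sum>t\<in>K. k (basis2 s) t * cnj (k (basis2 r) t))"
      unfolding inner2_def
      by (rule infsumI, rule has_sum_finite_neutralI[OF K]) (use l2_zeroD[OF bop_l2[OF k(1)]] in auto)
    finally show ?thesis by (simp add: mult.commute)
  qed
  have "(\<Sum>r\<in>K. \<Sum>s\<in>K. h (basis2 s) r * m r s) =
      (\<Sum>r\<in>K. \<Sum>s\<in>K. \<Sum>t\<in>K. cnj (k (basis2 r) t) * cnj (cnj (k (basis2 s) t)) * m r s)"
    by (intro sum.cong refl) (simp only: entry_h sum_distrib_right)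
  also have "\<dots> = (\<Sum>r\<in>K. \<Sum>t\<in>K. \<Sum>s\<in>K. cnj (k (basis2 r) t) * cnj (cnj (k (basis2 s) t)) * m r s)"
    by (intro sum.cong refl sum.swap)
  also have "\<dots> = (\<Sum>t\<in>K. \<Sum>r\<in>K. \<Sum>s\<in>K. cnj (k (basis2 r) t) * cnj (cnj (k (basis2 s) t)) * m r s)"
    by (rule sum.swap)
  also have "\<dots> \<in> \<real>\<^sub>\<ge>\<^sub>0"
  proof (rule nonneg_Reals_sum)
    fix t show "(\<Sum>r\<in>K. \<Sum>s\<in>K. cnj (k (basis2 r) t) * cnj (cnj (k (basis2 s) t)) * m r s) \<in> \<real>\<^sub>\<ge>\<^sub>0"
      using m[of "\<lambda>r. cnj (k (basis2 r) t)"] .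
  qed
  finally have "(\<Sum>r\<in>K. \<Sum>s\<in>K. h (basis2 s) r * m r s) \<in> \<real>\<^sub>\<ge>\<^sub>0" .
  also have "(\<Sum>r\<in>K. \<Sum>s\<in>K. h (basis2 s) r * m r s) =
      (\<Sum>r\<in>K. \<Sum>s\<in>K. X (basis2 s) r * m r s + complex_of_real \<epsilon> * (basis2 s r * m r s))"
    by (intro sum.cong refl) (simp add: h_def algebra_simps)
  also have "\<dots> = (\<Sum>r\<in>K. \<Sum>s\<in>K. X (basis2 s) r * m r s) + complex_of_real \<epsilon> * (\<Sum>r\<in>K. \<Sum>s\<in>K. basis2 s r * m r s)"
    by (simp add: sum.distrib sum_distrib_left)
  finally show "(\<Sum>r\<in>K. \<Sum>s\<in>K. X (basis2 s) r * m r s) + complex_of_real \<epsilon> * (\<Sum>r\<in>K. \<Sum>s\<in>K. basis2 s r * m r s) \<in> \<real>\<^sub>\<ge>\<^sub>0" .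
qed

section \<open>Maps from a full matrix algebra\<close>

abbreviation full :: "'e set \<Rightarrow> 'e opalg" where
  "full E \<equiv> OpAlg E (bounded_ops E)"

text \<open>\<open>X (basis2 b) a\<close> is the matrix entry (a, b), so the map sends the matrix
  unit at (a, b) to \<open>\<psi> a b\<close>.\<close>

definition mat_map :: "'e set \<Rightarrow> ('e \<Rightarrow> 'e \<Rightarrow> 'j opr \<Rightarrow> complex) \<Rightarrow> 'e opr \<Rightarrow> 'j opr \<Rightarrow> complex" where
  "mat_map E \<psi> X = (if X \<in> bounded_ops E then \<Sum>p\<in>E \<times> E. smul1 (X (basis2 (snd p)) (fst p)) (\<psi> (fst p) (snd p)) else 0)"

definition mat_unit :: "'e set \<Rightarrow> 'e \<Rightarrow> 'e \<Rightarrow> 'e opr" where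
  "mat_unit E a b = (\<lambda>f. if f \<in> l2 E then smul1 (f b) (basis2 a) else 0)"

lemma mat_unit_bop [simp, intro]: assumes "a \<in> E" "b \<in> E" shows "mat_unit E a b \<in> bounded_ops E"
proof (rule bounded_opsI[of _ _ 1])
  fix f assume f: "f \<in> l2 E"
  show "norm2 (mat_unit E a b f) \<le> 1 * norm2 f" using f norm2_coord[OF f] by (simp add: mat_unit_def norm2_smul)
qed (use assms in \<open>auto simp: mat_unit_def smul1_add_left\<close>)

lemma mat_unit_entry: "b \<in> E \<Longrightarrow> d \<in> E \<Longrightarrow> mat_unit E a b (basis2 d) c = (if c = a \<and> d = b then 1 else 0)"
proof -
  assume "d \<in> E"
  then have "mat_unit E a b (basis2 d) c = basis2 d b * basis2 a c"
    using basis2_l2[of d E] by (simp add: mat_unit_def)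
  then show ?thesis by (simp add: basis2_def)
qed

context vn_algebra
begin

text \<open>Matrix entries are vector functionals, so the map is a finite sum of elementary tensors.
  The pairs of indices are enumerated because \<open>alg_tensor\<close> sums over initial
  segments.\<close>

lemma mat_map_Nor:
  assumes E: "finite E" and \<psi>: "\<And>a b. a \<in> E \<Longrightarrow> b \<in> E \<Longrightarrow> \<psi> a b \<in> predual A"
  shows "mat_map E \<psi> \<in> Nor (full E) A"
proof (rule alg_tensor_Nor)
  interpret F: vn_algebra "full E" by (rule full_algebra)
  show "op_space (full E)" "op_space A" by unfold_locales
  obtain h where h: "bij_betw h {..<card (E \<times> E)} (E \<times> E)"
    using ex_bij_betw_nat_finite[of "E \<times> E"] E by (auto simp: atLeast0LessThan)
  define \<mu> \<nu> where "\<mu> k = vec_functional (full E) (basis2 (snd (h k))) (basis2 (fst (h k)))"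
    and "\<nu> k = \<psi> (fst (h k)) (snd (h k))" for k
  have hm: "fst (h k) \<in> E" "snd (h k) \<in> E" if "k < card (E \<times> E)" for k
  proof -
    have "h k \<in> E \<times> E" using bij_betwE[OF h] that by auto
    then show "fst (h k) \<in> E" "snd (h k) \<in> E" by (auto simp: mem_Times_iff)
  qed
  have "mat_map E \<psi> = (\<Sum>k<card (E \<times> E). elem_tensor (\<mu> k) (\<nu> k))"
  proof
    fix X
    have v: "\<mu> k X = (if X \<in> bounded_ops E then X (basis2 (snd (h k))) (fst (h k)) else 0)" for k
      by (simp add: \<mu>_def vec_functional_def inner2_basis2)
    show "mat_map E \<psi> X = (\<Sum>k<card (E \<times> E). elem_tensor (\<mu> k) (\<nu> k)) X"
    proof (cases "X \<in> bounded_ops E")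
      case True
      have "mat_map E \<psi> X = (\<Sum>p\<in>E \<times> E. smul1 (X (basis2 (snd p)) (fst p)) (\<psi> (fst p) (snd p)))"
        using True by (simp only: mat_map_def if_True)
      also have "\<dots> = (\<Sum>k<card (E \<times> E). smul1 (X (basis2 (snd (h k))) (fst (h k))) (\<psi> (fst (h k)) (snd (h k))))"
        by (rule sum.reindex_bij_betw[OF h, symmetric])
      also have "\<dots> = (\<Sum>k<card (E \<times> E). elem_tensor (\<mu> k) (\<nu> k) X)"
        using True by (simp only: elem_tensor_def v \<nu>_def if_True)
      finally show ?thesis by (simp only: sum_apply2)
    next
      case False
      then show ?thesis by (simp only: mat_map_def if_False sum_apply2 elem_tensor_def v smul1_simps sum.neutral_const)
    qed
  qed
  then show "mat_map E \<psi> \<in> alg_tensor (full E) A"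
    unfolding alg_tensor_def mem_Collect_eq
    by (intro exI[of _ "card (E \<times> E)"] exI[of _ \<mu>] exI[of _ \<nu>] conjI allI impI)
      (auto simp: \<mu>_def \<nu>_def intro!: F.vec_functional_predual \<psi> hm)
qed

lemma mat_map_apply:
  "X \<in> bounded_ops E \<Longrightarrow> mat_map E \<psi> X y = (\<Sum>p\<in>E \<times> E. X (basis2 (snd p)) (fst p) * \<psi> (fst p) (snd p) y)"
  by (simp only: mat_map_def if_True sum_apply smul1_apply)

lemma mat_map_unit:
  assumes "finite E" "a \<in> E" "b \<in> E" shows "mat_map E \<psi> (mat_unit E a b) = \<psi> a b"
proof
  fix y
  have "mat_map E \<psi> (mat_unit E a b) y = (\<Sum>p\<in>E \<times> E. if p = (a, b) then \<psi> a b y else 0)"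
    unfolding mat_map_apply[OF mat_unit_bop[OF assms(2,3)]]
    by (rule sum.cong) (use assms in \<open>auto simp: mat_unit_entry split: if_splits\<close>)
  then show "mat_map E \<psi> (mat_unit E a b) y = \<psi> a b y" using assms by (simp add: sum.delta)
qed

lemma emb_family: "l2_family J \<xi> \<Longrightarrow> j < n \<Longrightarrow> l2_family ({..<n} \<times> J) (\<lambda>k. emb j (\<xi> k))"
  unfolding l2_family_def by auto

text \<open>A vector functional of the (j, i) entry of \<open>Y\<close> is a vector functional of
  \<open>Y\<close> at embedded vectors, so taking entries is ultraweakly continuous.\<close>

lemma trace_pairing_predual:
  assumes \<psi>: "\<And>i j. i < n \<Longrightarrow> j < n \<Longrightarrow> \<psi> i j \<in> predual A"
  shows "trace_pairing n A \<psi> \<in> predual (mat_alg n A)"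
proof -
  interpret M: op_space "mat_alg n A" by (rule mat_alg_op_space)
  have cont: "continuous_map (ultraweak (mat_alg n A)) (ultraweak A) (entry j i)" if ij: "i < n" "j < n" for i j
  proof (rule continuous_into_ultraweak)
    show "entry j i Y \<in> elems A" if "Y \<in> topspace (ultraweak (mat_alg n A))" for Y
      using that ij by (auto intro: mat_alg_entry)
    fix \<xi> \<eta> assume f: "l2_family J \<xi>" "l2_family J \<eta>"
    have "l2_family (index (mat_alg n A)) (\<lambda>k. emb i (\<xi> k))" "l2_family (index (mat_alg n A)) (\<lambda>k. emb j (\<eta> k))"
      using emb_family[OF f(1) ij(1)] emb_family[OF f(2) ij(2)] by auto
    from M.continuous_series[OF this]
    show "continuous_map (ultraweak (mat_alg n A)) euclidean (\<lambda>Y. \<Sum>k. inner2 (entry j i Y (\<xi> k)) (\<eta> k))"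
    proof (rule continuous_map_eq)
      fix Y assume "Y \<in> topspace (ultraweak (mat_alg n A))"
      then have Y: "Y \<in> bounded_ops ({..<n} \<times> J)" by (auto intro: mat_alg_bop)
      have "inner2 (Y (emb i (\<xi> k))) (emb j (\<eta> k)) = inner2 (entry j i Y (\<xi> k)) (\<eta> k)" for k
      proof -
        have m: "\<eta> k \<in> l2 J" "\<xi> k \<in> l2 J" using f by (auto simp: l2_family_l2)
        have "inner2 (Y (emb i (\<xi> k))) (emb j (\<eta> k)) = (\<Sum>p<n. inner2 (slice p (Y (emb i (\<xi> k)))) (slice p (emb j (\<eta> k))))"
          using m ij by (intro inner2_slices[of _ "{..<n}" J] bop_l2[OF Y]) auto
        also have "\<dots> = (\<Sum>p<n. if p = j then inner2 (entry j i Y (\<xi> k)) (\<eta> k) else 0)"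
          by (rule sum.cong) (auto simp: entry_eq_ent ent_def)
        finally show ?thesis using ij by (simp add: sum.delta)
      qed
      then show "(\<Sum>k. inner2 (Y (emb i (\<xi> k))) (emb j (\<eta> k))) = (\<Sum>k. inner2 (entry j i Y (\<xi> k)) (\<eta> k))" by simp
    qed
  qed
  have one: "(\<lambda>Y. if Y \<in> elems (mat_alg n A) then \<psi> i j (entry j i Y) else 0) \<in> predual (mat_alg n A)"
    if ij: "i < n" "j < n" for i j
  proof (rule M.predualI)
    show "continuous_map (ultraweak (mat_alg n A)) euclidean (\<lambda>Y. if Y \<in> elems (mat_alg n A) then \<psi> i j (entry j i Y) else 0)"
      using continuous_map_compose[OF cont[OF ij] predual_continuous[OF \<psi>[OF ij]]]
      by (rule continuous_map_eq) auto
    have e: "entry j i Y \<in> elems A" if "Y \<in> elems (mat_alg n A)" for Y using mat_alg_entry[OF that] ij by auto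
    have lin: "entry j i (Y + Z) = entry j i Y + entry j i Z" "entry j i (smul2 c Y) = smul2 c (entry j i Y)" for Y Z c
      by (simp_all only: entry_eq_ent ent_linear)
    show "(if Y + Z \<in> elems (mat_alg n A) then \<psi> i j (entry j i (Y + Z)) else 0) =
      (if Y \<in> elems (mat_alg n A) then \<psi> i j (entry j i Y) else 0) + (if Z \<in> elems (mat_alg n A) then \<psi> i j (entry j i Z) else 0)"
      if YZ: "Y \<in> elems (mat_alg n A)" "Z \<in> elems (mat_alg n A)" for Y Z
      using YZ e[OF YZ(1)] e[OF YZ(2)] M.add_mem[OF YZ] by (simp only: if_True lin predual_plus[OF \<psi>[OF ij]])
    show "(if smul2 c Y \<in> elems (mat_alg n A) then \<psi> i j (entry j i (smul2 c Y)) else 0) =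
      c * (if Y \<in> elems (mat_alg n A) then \<psi> i j (entry j i Y) else 0)" if Y: "Y \<in> elems (mat_alg n A)" for Y c
      using Y e[OF Y] M.smul_mem[OF Y] by (simp only: if_True lin predual_scale[OF \<psi>[OF ij]])
  qed auto
  have "trace_pairing n A \<psi> = (\<Sum>i<n. \<Sum>j<n. (\<lambda>Y. if Y \<in> elems (mat_alg n A) then \<psi> i j (entry j i Y) else 0))"
    by (rule ext) (simp add: trace_pairing_def sum_apply)
  also have "\<dots> \<in> predual (mat_alg n A)" by (intro M.sum_predual one) auto
  finally show ?thesis .
qed

text \<open>For fixed \<open>Y\<close> the pairing is linear in the scalar matrix \<open>X\<close>,
  and \<open>positive_matrix_pairing\<close> reduces positivity to rank one matrices; this is the
  hypothesis \<open>pos\<close>. The entries of \<open>Y\<close> occur transposed.\<close>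

lemma mat_map_completely_positive:
  assumes E: "finite E" and \<psi>: "\<And>a b. a \<in> E \<Longrightarrow> b \<in> E \<Longrightarrow> \<psi> a b \<in> predual A"
    and pos: "\<And>n Y v. Y \<in> elems (mat_alg n A) \<Longrightarrow> positive_op ({..<n} \<times> J) Y \<Longrightarrow>
      (\<Sum>r\<in>{..<n} \<times> E. \<Sum>s\<in>{..<n} \<times> E. v r * cnj (v s) * \<psi> (snd r) (snd s) (entry (fst s) (fst r) Y)) \<in> \<real>\<^sub>\<ge>\<^sub>0"
  shows "completely_positive (full E) A (mat_map E \<psi>)"
  unfolding completely_positive_def
proof (intro allI ballI impI)
  fix n and X assume X: "X \<in> elems (mat_alg n (full E))" "positive_op (index (mat_alg n (full E))) X"
  interpret F: vn_algebra "full E" by (rule full_algebra)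
  interpret M: op_space "mat_alg n A" by (rule mat_alg_op_space)
  have Xb: "X \<in> bounded_ops ({..<n} \<times> E)" and Xp: "positive_op ({..<n} \<times> E) X"
    using F.mat_alg_bop[OF X(1)] X(2) by auto
  have eX: "entry i j X \<in> bounded_ops E" if "i < n" "j < n" for i j using F.mat_alg_entry[OF X(1) that] by simp
  have mm: "mat_map E \<psi> (entry i j X) \<in> predual A" if "i < n" "j < n" for i j
    unfolding mat_map_def using eX[OF that] by (simp only: if_True) (intro sum_predual smul_predual \<psi>, auto)
  show "trace_pairing n A (\<lambda>i j. mat_map E \<psi> (entry i j X)) \<in> predual_pos (mat_alg n A)"
  proof (rule M.predual_posI)
    show "trace_pairing n A (\<lambda>i j. mat_map E \<psi> (entry i j X)) \<in> predual (mat_alg n A)"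
      by (rule trace_pairing_predual) (rule mm)
    fix Y assume Y: "Y \<in> elems (mat_alg n A)" "positive_op (index (mat_alg n A)) Y"
    let ?K = "{..<n} \<times> E"
    have "(\<Sum>r\<in>?K. \<Sum>s\<in>?K. X (basis2 s) r * \<psi> (snd r) (snd s) (entry (fst s) (fst r) Y)) \<in> \<real>\<^sub>\<ge>\<^sub>0"
      by (rule positive_matrix_pairing[OF _ Xp]) (use E pos Y in auto)
    also have "(\<Sum>r\<in>?K. \<Sum>s\<in>?K. X (basis2 s) r * \<psi> (snd r) (snd s) (entry (fst s) (fst r) Y))
        = (\<Sum>i<n. \<Sum>a\<in>E. \<Sum>j<n. \<Sum>b\<in>E. X (basis2 (j, b)) (i, a) * \<psi> a b (entry j i Y))"
      by (simp add: sum.cartesian_product' )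
    also have "\<dots> = (\<Sum>i<n. \<Sum>j<n. \<Sum>a\<in>E. \<Sum>b\<in>E. X (basis2 (j, b)) (i, a) * \<psi> a b (entry j i Y))"
      by (intro sum.cong refl sum.swap)
    also have "\<dots> = (\<Sum>i<n. \<Sum>j<n. mat_map E \<psi> (entry i j X) (entry j i Y))"
    proof (intro sum.cong refl)
      fix i j assume ij: "i \<in> {..<n}" "j \<in> {..<n}"
      have "entry i j X (basis2 b) a = X (basis2 (j, b)) (i, a)" for a b
      proof -
        have "emb j (basis2 b) = basis2 (j, b)" by (auto simp: emb_def basis2_def fun_eq_iff)
        then show ?thesis by (simp add: entry_eq_ent ent_def slice_def)
      qed
      then have "mat_map E \<psi> (entry i j X) (entry j i Y) = (\<Sum>p\<in>E \<times> E. X (basis2 (j, snd p)) (i, fst p) * \<psi> (fst p) (snd p) (entry j i Y))"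
        using ij eX[of i j] by (simp add: mat_map_apply)
      then show "(\<Sum>a\<in>E. \<Sum>b\<in>E. X (basis2 (j, b)) (i, a) * \<psi> a b (entry j i Y)) = mat_map E \<psi> (entry i j X) (entry j i Y)"
        by (simp add: sum.cartesian_product')
    qed
    also have "\<dots> = trace_pairing n A (\<lambda>i j. mat_map E \<psi> (entry i j X)) Y"
      using Y by (simp add: trace_pairing_def)
    finally show "trace_pairing n A (\<lambda>i j. mat_map E \<psi> (entry i j X)) Y \<in> \<real>\<^sub>\<ge>\<^sub>0" .
  qed
qed

text \<open>The transposition in the pairing turns the sum into the quadratic form of
  \<open>Y\<close> at one vector, whose i-th slice is the combination \<open>F i\<close> of the
  given vectors with coefficients \<open>v (i, a)\<close>.\<close>

lemma vec_mat_map_completely_positive: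
  assumes E: "finite E" and \<xi>: "\<And>a. a \<in> E \<Longrightarrow> \<xi> a \<in> l2 J"
  shows "completely_positive (full E) A (mat_map E (\<lambda>a b. vec_functional A (\<xi> a) (\<xi> b)))"
proof (rule mat_map_completely_positive[OF E])
  fix n Y and v :: "nat \<times> 'a \<Rightarrow> complex"
  assume Y: "Y \<in> elems (mat_alg n A)" "positive_op ({..<n} \<times> J) Y"
  have Yb: "Y \<in> bounded_ops ({..<n} \<times> J)" by (rule mat_alg_bop[OF Y(1)])
  define F where "F i = (\<Sum>a\<in>E. smul1 (v (i, a)) (\<xi> a))" for i
  have F: "F i \<in> l2 J" for i unfolding F_def by (intro l2_sum l2_smul1 \<xi>)
  define \<zeta> where "\<zeta> = (\<Sum>i<n. emb i (F i))"
  have \<zeta>: "\<zeta> \<in> l2 ({..<n} \<times> J)" unfolding \<zeta>_def by (intro l2_sum emb_l2 F)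
  have sl: "slice i \<zeta> = F i" if "i < n" for i
  proof
    fix b
    have "slice i \<zeta> b = (\<Sum>i'<n. if i' = i then F i b else 0)"
      unfolding \<zeta>_def slice_sum sum_apply by (rule sum.cong) auto
    then show "slice i \<zeta> b = F i b" using that by (simp add: sum.delta)
  qed
  have "inner2 (Y \<zeta>) \<zeta> = (\<Sum>j<n. \<Sum>i<n. inner2 (entry j i Y (F i)) (F j))"
    unfolding inner2_entries[OF Yb finite_lessThan \<zeta> \<zeta>] entry_eq_ent by (intro sum.cong refl) (simp only: sl lessThan_iff)
  also have "\<dots> = (\<Sum>i<n. \<Sum>j<n. inner2 (entry j i Y (F i)) (F j))" by (rule sum.swap)
  also have "\<dots> = (\<Sum>i<n. \<Sum>j<n. \<Sum>a\<in>E. \<Sum>b\<in>E. v (i, a) * cnj (v (j, b)) * vec_functional A (\<xi> a) (\<xi> b) (entry j i Y))"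
  proof (intro sum.cong refl)
    fix i j assume ij: "i \<in> {..<n}" "j \<in> {..<n}"
    define y where "y = entry j i Y"
    have y: "y \<in> elems A" using mat_alg_entry[OF Y(1)] ij by (auto simp: y_def)
    note yb = elem_bop[OF y]
    have "y (F i) = (\<Sum>a\<in>E. y (smul1 (v (i, a)) (\<xi> a)))"
      unfolding F_def by (rule bop_sum[OF yb]) (rule l2_smul1[OF \<xi>])
    also have "\<dots> = (\<Sum>a\<in>E. smul1 (v (i, a)) (y (\<xi> a)))"
      by (intro sum.cong refl bop_smul[OF yb] \<xi>)
    finally have yF: "y (F i) = (\<Sum>a\<in>E. smul1 (v (i, a)) (y (\<xi> a)))" .
    have "inner2 (y (F i)) (F j) = (\<Sum>a\<in>E. inner2 (smul1 (v (i, a)) (y (\<xi> a))) (F j))"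
      unfolding yF by (rule inner2_sum_left[of _ _ J]) (rule l2_smul1[OF bop_l2[OF yb]], rule F)
    also have "\<dots> = (\<Sum>a\<in>E. \<Sum>b\<in>E. inner2 (smul1 (v (i, a)) (y (\<xi> a))) (smul1 (v (j, b)) (\<xi> b)))"
      unfolding F_def
      by (intro sum.cong refl inner2_sum_right[of _ _ J]) (rule l2_smul1[OF \<xi>], assumption, rule l2_smul1[OF bop_l2[OF yb]])
    also have "\<dots> = (\<Sum>a\<in>E. \<Sum>b\<in>E. v (i, a) * cnj (v (j, b)) * vec_functional A (\<xi> a) (\<xi> b) y)"
      using y by (simp add: vec_functional_def inner2_scalar_simps mult_ac)
    finally show "inner2 (entry j i Y (F i)) (F j) = (\<Sum>a\<in>E. \<Sum>b\<in>E. v (i, a) * cnj (v (j, b)) * vec_functional A (\<xi> a) (\<xi> b) (entry j i Y))"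
      by (simp only: y_def)
  qed
  also have "\<dots> = (\<Sum>i<n. \<Sum>a\<in>E. \<Sum>j<n. \<Sum>b\<in>E. v (i, a) * cnj (v (j, b)) * vec_functional A (\<xi> a) (\<xi> b) (entry j i Y))"
    by (intro sum.cong refl sum.swap)
  also have "\<dots> = (\<Sum>r\<in>{..<n} \<times> E. \<Sum>s\<in>{..<n} \<times> E. v r * cnj (v s) * vec_functional A (\<xi> (snd r)) (\<xi> (snd s)) (entry (fst s) (fst r) Y))"
    by (simp add: sum.cartesian_product')
  finally have e: "inner2 (Y \<zeta>) \<zeta> = (\<Sum>r\<in>{..<n} \<times> E. \<Sum>s\<in>{..<n} \<times> E. v r * cnj (v s) * vec_functional A (\<xi> (snd r)) (\<xi> (snd s)) (entry (fst s) (fst r) Y))" .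
  have "inner2 (Y \<zeta>) \<zeta> \<in> \<real>\<^sub>\<ge>\<^sub>0" using Y(2) \<zeta> unfolding positive_op_def by blast
  then show "(\<Sum>r\<in>{..<n} \<times> E. \<Sum>s\<in>{..<n} \<times> E. v r * cnj (v s) * vec_functional A (\<xi> (snd r)) (\<xi> (snd s)) (entry (fst s) (fst r) Y)) \<in> \<real>\<^sub>\<ge>\<^sub>0"
    unfolding e .
qed (use \<xi> in auto)

text \<open>The sum is the value of \<omega> at \<open>b\<close>, a compression of \<open>Y\<close>:
  its quadratic form at f is that of \<open>Y\<close> at the elementary tensor of v and f.\<close>

lemma scalar_mat_map_completely_positive:
  assumes \<omega>: "\<omega> \<in> predual_pos A"
  shows "completely_positive (full {a}) A (mat_map {a} (\<lambda>_ _. \<omega>))"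
proof (rule mat_map_completely_positive)
  fix n Y and v :: "nat \<times> 'a \<Rightarrow> complex"
  assume Y: "Y \<in> elems (mat_alg n A)" "positive_op ({..<n} \<times> J) Y"
  have Yb: "Y \<in> bounded_ops ({..<n} \<times> J)" by (rule mat_alg_bop[OF Y(1)])
  have e: "entry j i Y \<in> elems A" if "i < n" "j < n" for i j using mat_alg_entry[OF Y(1)] that by auto
  define b where "b = (\<Sum>i<n. \<Sum>j<n. smul2 (v (i, a) * cnj (v (j, a))) (entry j i Y))"
  have esum: "(\<And>t. t \<in> S \<Longrightarrow> x t \<in> elems A) \<Longrightarrow> sum x S \<in> elems A \<and> \<omega> (sum x S) = (\<Sum>t\<in>S. \<omega> (x t))" if "finite S" for x and S :: "nat set"
    using that
  proof (induction S rule: finite_induct)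
    case empty
    show ?case using predual_zero[OF predual_pos_predual[OF \<omega>]] by (simp only: sum.empty zero_mem)
  next
    case (insert t S)
    have IH: "sum x S \<in> elems A" "\<omega> (sum x S) = (\<Sum>t\<in>S. \<omega> (x t))" using insert by blast+
    have xt: "x t \<in> elems A" using insert.prems by blast
    show ?case unfolding sum.insert[OF insert.hyps]
      by (intro conjI) (rule add_mem[OF xt IH(1)], simp only: predual_plus[OF predual_pos_predual[OF \<omega>] xt IH(1)] IH(2))
  qed
  have inner_mem: "(\<Sum>j<n. smul2 (v (i, a) * cnj (v (j, a))) (entry j i Y)) \<in> elems A \<and>
      \<omega> (\<Sum>j<n. smul2 (v (i, a) * cnj (v (j, a))) (entry j i Y)) = (\<Sum>j<n. v (i, a) * cnj (v (j, a)) * \<omega> (entry j i Y))" if "i < n" for i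
    using esum[of "{..<n}" "\<lambda>j. smul2 (v (i, a) * cnj (v (j, a))) (entry j i Y)"] e that
    by (simp add: predual_scale[OF predual_pos_predual[OF \<omega>]])
  have b: "b \<in> elems A" and \<omega>b: "\<omega> b = (\<Sum>i<n. \<Sum>j<n. v (i, a) * cnj (v (j, a)) * \<omega> (entry j i Y))"
    using esum[of "{..<n}" "\<lambda>i. \<Sum>j<n. smul2 (v (i, a) * cnj (v (j, a))) (entry j i Y)"] inner_mem
    unfolding b_def by auto
  have "positive_op J b"
    unfolding positive_op_def
  proof (intro conjI ballI)
    show "b \<in> bounded_ops J" using b by simp
    fix f assume f: "f \<in> l2 J"
    let ?t = "tens n (\<lambda>i. v (i, a)) f"
    have t: "?t \<in> l2 ({..<n} \<times> J)" using f by (rule tens_l2)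
    have "inner2 (Y ?t) ?t = (\<Sum>j<n. \<Sum>i<n. inner2 (entry j i Y (smul1 (v (i, a)) f)) (smul1 (v (j, a)) f))"
      unfolding inner2_entries[OF Yb finite_lessThan t t] entry_eq_ent
      by (intro sum.cong refl) (simp only: slice_tens lessThan_iff)
    also have "\<dots> = (\<Sum>j<n. \<Sum>i<n. v (i, a) * cnj (v (j, a)) * inner2 (entry j i Y f) f)"
    proof (intro sum.cong refl)
      fix i j assume ij: "i \<in> {..<n}" "j \<in> {..<n}"
      show "inner2 (entry j i Y (smul1 (v (i, a)) f)) (smul1 (v (j, a)) f) = v (i, a) * cnj (v (j, a)) * inner2 (entry j i Y f) f"
        using e[of i j] ij f by (simp add: bop_smul[OF elem_bop, of "entry j i Y" f] inner2_scalar_simps)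
    qed
    also have "\<dots> = (\<Sum>i<n. \<Sum>j<n. v (i, a) * cnj (v (j, a)) * inner2 (entry j i Y f) f)" by (rule sum.swap)
    also have "\<dots> = inner2 (b f) f"
    proof -
      have "b f = (\<Sum>i<n. \<Sum>j<n. smul1 (v (i, a) * cnj (v (j, a))) (entry j i Y f))"
        unfolding b_def sum_apply2 smul2_apply ..
      moreover have m: "smul1 (v (i, a) * cnj (v (j, a))) (entry j i Y f) \<in> l2 J" if "i < n" "j < n" for i j
        by (rule l2_smul1[OF bop_l2[OF elem_bop[OF e[OF that]]]])
      ultimately have "inner2 (b f) f = (\<Sum>i<n. inner2 (\<Sum>j<n. smul1 (v (i, a) * cnj (v (j, a))) (entry j i Y f)) f)"
        using f by (simp only:) (intro inner2_sum_left[of _ _ J] l2_sum, auto)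
      also have "\<dots> = (\<Sum>i<n. \<Sum>j<n. inner2 (smul1 (v (i, a) * cnj (v (j, a))) (entry j i Y f)) f)"
        using m f by (intro sum.cong refl inner2_sum_left[of _ _ J]) auto
      finally show ?thesis by (simp only: inner2_smul_left)
    qed
    finally show "inner2 (b f) f \<in> \<real>\<^sub>\<ge>\<^sub>0" using Y(2) t by (auto simp: positive_op_def)
  qed
  then have "\<omega> b \<in> \<real>\<^sub>\<ge>\<^sub>0" by (rule predual_pos_nonneg[OF \<omega> b])
  then show "(\<Sum>r\<in>{..<n} \<times> {a}. \<Sum>s\<in>{..<n} \<times> {a}. v r * cnj (v s) * \<omega> (entry (fst s) (fst r) Y)) \<in> \<real>\<^sub>\<ge>\<^sub>0"
    unfolding \<omega>b by (simp add: sum.cartesian_product')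
qed (use \<omega> in auto)

end

lemma vn_tensor_op_space: "op_space (vn_tensor A B)"
  unfolding op_space_def vn_tensor_def Let_def opalg.sel
  using commutant_sub commutant_closed[OF commutant_sub] by blast

section \<open>Tensor products with a full matrix algebra\<close>

lemma ent_sum: "ent i j (sum X S) = (\<Sum>a\<in>S. ent i j (X a))"
  by (induction S rule: infinite_finite_induct)
    (simp_all only: sum.infinite sum.empty sum.insert ent_linear not_False_eq_True)

text \<open>The quadratic form at \<zeta> is the squared norm of the sum of the \<open>x j\<close>
  applied to the slices of \<zeta>.\<close>

lemma gram_block_positive:
  assumes E: "finite E" and x: "\<And>i. i \<in> E \<Longrightarrow> x i \<in> bounded_ops J"
  shows "positive_op (E \<times> J) (block E J (\<lambda>i j. adj J (x i) \<circ> x j))"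
  unfolding positive_op_def
proof (intro conjI ballI)
  have b: "adj J (x i) \<circ> x j \<in> bounded_ops J" if "i \<in> E" "j \<in> E" for i j using x that by auto
  show B: "block E J (\<lambda>i j. adj J (x i) \<circ> x j) \<in> bounded_ops (E \<times> J)" by (rule block_bop[OF E b])
  fix \<zeta> assume \<zeta>: "\<zeta> \<in> l2 (E \<times> J)"
  define g where "g = (\<Sum>j\<in>E. x j (slice j \<zeta>))"
  have m: "x j (slice j \<zeta>) \<in> l2 J" if "j \<in> E" for j by (rule bop_l2[OF x[OF that]])
  have g: "g \<in> l2 J" unfolding g_def by (rule l2_sum) (rule m)
  have "inner2 (block E J (\<lambda>i j. adj J (x i) \<circ> x j) \<zeta>) \<zeta> = (\<Sum>i\<in>E. \<Sum>j\<in>E. inner2 ((adj J (x i) \<circ> x j) (slice j \<zeta>)) (slice i \<zeta>))"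
    unfolding inner2_entries[OF B E \<zeta> \<zeta>]
    by (intro sum.cong refl) (simp only: ent_block[OF E _ _ b])
  also have "\<dots> = (\<Sum>i\<in>E. \<Sum>j\<in>E. inner2 (x j (slice j \<zeta>)) (x i (slice i \<zeta>)))"
    by (intro sum.cong refl) (simp only: comp_apply inner2_adj_left[OF x bop_l2[OF x] slice_l2[OF \<zeta>]])
  also have "\<dots> = (\<Sum>i\<in>E. inner2 g (x i (slice i \<zeta>)))"
    unfolding g_def by (intro sum.cong refl inner2_sum_left[of _ _ J, symmetric] m)
  also have "\<dots> = inner2 g g"
    by (subst (3) g_def) (intro inner2_sum_right[of _ _ J, symmetric] m g)
  finally show "inner2 (block E J (\<lambda>i j. adj J (x i) \<circ> x j) \<zeta>) \<zeta> \<in> \<real>\<^sub>\<ge>\<^sub>0"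
    by (simp only: inner2_self nonneg_Reals_of_real_iff zero_le_power2)
qed

text \<open>Over a finite index set the coordinatewise tensor product becomes the block matrix whose
  entries are scalar multiples of \<open>y\<close>, so that the calculus of entries applies.\<close>

lemma tensor_op_block:
  fixes x :: "'e opr" and y :: "'j opr"
  assumes E: "finite E" and x: "x \<in> bounded_ops E" and y: "y \<in> bounded_ops J"
  shows "tensor_op E J x y = block E J (\<lambda>i j. smul2 (x (basis2 j) i) y)"
proof (intro ext)
  fix \<zeta> :: "('e \<times> 'j) vec" and k :: "'e \<times> 'j"
  obtain i b where k: "k = (i, b)" by (cases k)
  show "tensor_op E J x y \<zeta> k = block E J (\<lambda>i j. smul2 (x (basis2 j) i) y) \<zeta> k"
  proof (cases "\<zeta> \<in> l2 (E \<times> J)")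
    case True
    define u where "u i' = y (slice i' \<zeta>) b" for i'
    have u0: "u i' = 0" if "i' \<notin> E" for i'
      unfolding u_def slice_outside[OF True that] bop_zero[OF y] by simp
    have "x u = x (\<Sum>j\<in>E. smul1 (u j) (basis2 j))"
      by (rule arg_cong[of _ _ x]) (rule finite_expansion[OF E u0])
    also have "\<dots> = (\<Sum>j\<in>E. x (smul1 (u j) (basis2 j)))" by (rule bop_sum[OF x]) auto
    also have "\<dots> = (\<Sum>j\<in>E. smul1 (u j) (x (basis2 j)))" by (intro sum.cong refl bop_smul[OF x] basis2_l2)
    finally have xu: "x u i = (\<Sum>j\<in>E. u j * x (basis2 j) i)" by (simp only: sum_apply smul1_apply)
    have "tensor_op E J x y \<zeta> k = x u i"
      using True unfolding tensor_op_def k u_def slice_def by simp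
    moreover have "block E J (\<lambda>i j. smul2 (x (basis2 j) i) y) \<zeta> k
        = (\<Sum>i'\<in>E. \<Sum>j\<in>E. emb i' (smul2 (x (basis2 j) i') y (slice j \<zeta>)) (i, b))"
      using True by (simp only: block_def if_True sum_apply k)
    moreover have "\<dots> = (\<Sum>i'\<in>E. if i' = i then \<Sum>j\<in>E. u j * x (basis2 j) i else 0)"
      by (rule sum.cong) (auto simp: emb_def u_def mult.commute)
    moreover have "\<dots> = (if i \<in> E then \<Sum>j\<in>E. u j * x (basis2 j) i else 0)" using E by (simp add: sum.delta)
    moreover have "x (basis2 j) i = 0" if "i \<notin> E" for j using l2_zeroD[OF bop_l2[OF x] that] .
    ultimately show ?thesis using xu by auto
  qed (simp add: tensor_op_def block_def)
qed

lemma tensor_op_bop [simp, intro]: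
  assumes "finite E" "x \<in> bounded_ops E" "y \<in> bounded_ops J" shows "tensor_op E J x y \<in> bounded_ops (E \<times> J)"
  unfolding tensor_op_block[OF assms] using assms by (intro block_bop) auto

lemma ent_tensor:
  assumes "finite E" "x \<in> bounded_ops E" "y \<in> bounded_ops J" "i \<in> E" "j \<in> E"
  shows "ent i j (tensor_op E J x y) = smul2 (x (basis2 j) i) y"
  unfolding tensor_op_block[OF assms(1-3)] using assms by (intro ent_block) auto

lemma ent_comp_single:
  assumes X: "X \<in> bounded_ops ({a} \<times> J)" and Y: "Y \<in> bounded_ops ({a} \<times> J)"
  shows "ent a a (X \<circ> Y) = ent a a X \<circ> ent a a Y"
proof
  fix f
  have "Y (emb a f) = (\<Sum>i\<in>{a}. emb i (slice i (Y (emb a f))))"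
    by (rule emb_decomposition[OF bop_l2[OF Y]]) simp
  then have "Y (emb a f) = emb a (slice a (Y (emb a f)))" by (simp only: sum.insert finite.emptyI empty_iff not_False_eq_True sum.empty add_0_right)
  then show "ent a a (X \<circ> Y) f = (ent a a X \<circ> ent a a Y) f" unfolding ent_def comp_apply by metis
qed

context vn_algebra
begin

abbreviation "tensor E \<equiv> vn_tensor (full E) A"

lemma index_tensor [simp]: "index (tensor E) = E \<times> J"
  by (simp add: vn_tensor_def Let_def)

lemma elems_tensor: "elems (tensor E) = commutant (E \<times> J) (commutant (E \<times> J)
    {tensor_op E J x y | x y. x \<in> bounded_ops E \<and> y \<in> elems A})"
  by (simp add: vn_tensor_def Let_def)

lemma tensor_op_space: "op_space (tensor E)"
  by (rule vn_tensor_op_space)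

lemma tensor_mem: assumes "finite E" "x \<in> bounded_ops E" "y \<in> elems A" shows "tensor_op E J x y \<in> elems (tensor E)"
proof -
  have "{tensor_op E J x y | x y. x \<in> bounded_ops E \<and> y \<in> elems A} \<subseteq> bounded_ops (E \<times> J)"
    using assms(1) by auto
  from subsetD[OF double_commutant_sup[OF this]] show ?thesis unfolding elems_tensor using assms by blast
qed

text \<open>Identifies \<complex> \<otimes> A with A. For t in the commutant of A the amplification
  of t commutes with all generators, hence with \<open>z\<close> in their bicommutant; so the entry
  of \<open>z\<close> commutes with t.\<close>

lemma tensor_single:
  assumes z: "z \<in> elems (tensor {a})"
  shows "ent a a z \<in> elems A" "z = tensor_op {a} J (id_op {a}) (ent a a z)"
proof -
  interpret M: op_space "tensor {a}" by (rule tensor_op_space)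
  have zb: "z \<in> bounded_ops ({a} \<times> J)" using M.elem_bop[OF z] by simp
  have eb: "ent a a X \<in> bounded_ops J" if "X \<in> bounded_ops ({a} \<times> J)" for X using that by auto
  have one: "basis2 a \<in> l2 {a}" by auto
  have id1: "id_op {a} (basis2 a) a = 1" unfolding id_op_def if_P[OF one] by (simp add: basis2_def)
  have comm: "ent a a z \<circ> t = t \<circ> ent a a z" if t: "t \<in> commutant J (elems A)" for t
  proof -
    define t' where "t' = tensor_op {a} J (id_op {a}) t"
    have tb: "t \<in> bounded_ops J" using t commutant_sub by auto
    have t'b: "t' \<in> bounded_ops ({a} \<times> J)" unfolding t'_def using tb by auto
    have et: "ent a a t' = t" unfolding t'_def
      by (subst ent_tensor) (use tb in \<open>simp_all only: id1 smul2_simps id_op_bop finite.emptyI finite.insertI insertI1\<close>)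
    have "t' \<in> commutant ({a} \<times> J) {tensor_op {a} J x y | x y. x \<in> bounded_ops {a} \<and> y \<in> elems A}"
      unfolding commutant_iff
    proof (intro conjI t'b ballI)
      fix s assume "s \<in> {tensor_op {a} J x y | x y. x \<in> bounded_ops {a} \<and> y \<in> elems A}"
      then obtain x y where s: "s = tensor_op {a} J x y" "x \<in> bounded_ops {a}" "y \<in> elems A" by blast
      have sb: "s \<in> bounded_ops ({a} \<times> J)" unfolding s(1) using s by auto
      have es: "ent a a s = smul2 (x (basis2 a) a) y" unfolding s(1) using s by (subst ent_tensor) auto
      have ty: "t \<circ> y = y \<circ> t" using t s(3) by (simp add: commutant_iff)
      show "t' \<circ> s = s \<circ> t'"
      proof (rule block_eqI[of "{a}" _ J])
        fix i j assume "i \<in> {a}" "j \<in> {a}"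
        then have ij: "i = a" "j = a" by auto
        show "ent i j (t' \<circ> s) = ent i j (s \<circ> t')"
          unfolding ij ent_comp_single[OF t'b sb] ent_comp_single[OF sb t'b] et es
            comp_smul_right[OF tb elem_bop[OF s(3)]] comp_smul_left ty ..
      qed (use t'b sb in auto)
    qed
    then have "z \<circ> t' = t' \<circ> z" using z unfolding elems_tensor commutant_iff[of z] by blast
    then have "ent a a (z \<circ> t') = ent a a (t' \<circ> z)" by (rule arg_cong)
    then show ?thesis unfolding ent_comp_single[OF zb t'b] ent_comp_single[OF t'b zb] et .
  qed
  show mem: "ent a a z \<in> elems A" unfolding elems_iff using eb[OF zb] comm by blast
  show "z = tensor_op {a} J (id_op {a}) (ent a a z)"
  proof (rule block_eqI[of "{a}" _ J])
    fix i j assume "i \<in> {a}" "j \<in> {a}"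
    then have ij: "i = a" "j = a" by auto
    show "ent i j z = ent i j (tensor_op {a} J (id_op {a}) (ent a a z))"
      unfolding ij by (subst ent_tensor) (use eb[OF zb] in \<open>simp_all only: id1 smul2_simps id_op_bop finite.emptyI finite.insertI insertI1\<close>)
  qed (use zb eb[OF zb] in auto)
qed

lemma tensor_op_linear:
  assumes E: "finite E" and x: "x \<in> bounded_ops E" and x': "x' \<in> bounded_ops E" and y: "y \<in> bounded_ops J" and y': "y' \<in> bounded_ops J"
  shows "tensor_op E J x (y + y') = tensor_op E J x y + tensor_op E J x y'"
    "tensor_op E J x (smul2 c y) = smul2 c (tensor_op E J x y)"
    "tensor_op E J (x + x') y = tensor_op E J x y + tensor_op E J x' y"
    "tensor_op E J (smul2 c x) y = smul2 c (tensor_op E J x y)"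
  by (rule block_eqI[OF E, where I=J]; use assms in \<open>force simp: ent_linear ent_tensor smul2_add fun_eq_iff algebra_simps\<close>)+

text \<open>Evaluated on families of vectors, the tensor product is a finite combination of series
  functionals of \<open>y\<close> on their slices, with the entries of \<open>p\<close> as
  coefficients.\<close>

lemma continuous_tensor_op:
  assumes E: "finite E" and p: "p \<in> bounded_ops E"
  shows "continuous_map (ultraweak A) (ultraweak (tensor E)) (tensor_op E J p)"
proof -
  interpret M: op_space "tensor E" by (rule tensor_op_space)
  show ?thesis
  proof (rule M.continuous_into_ultraweak)
    show "tensor_op E J p y \<in> elems (tensor E)" if "y \<in> topspace (ultraweak A)" for y
      using that E p by (auto intro: tensor_mem)
    fix \<xi> \<eta> assume f: "l2_family (index (tensor E)) \<xi>" "l2_family (index (tensor E)) \<eta>"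
    have m: "\<xi> k \<in> l2 (E \<times> J)" "\<eta> k \<in> l2 (E \<times> J)" for k using l2_family_l2[OF f(1)] l2_family_l2[OF f(2)] by auto
    have sl: "l2_family J (\<lambda>k. slice i (\<zeta> k))" if "l2_family (index (tensor E)) \<zeta>" for i \<zeta>
    proof (rule l2_familyI)
      have mz: "\<zeta> k \<in> l2 (E \<times> J)" for k using l2_family_l2[OF that] by auto
      show "range (\<lambda>k. slice i (\<zeta> k)) \<subseteq> l2 J" using slice_l2[OF mz] by auto
      have s: "summable (\<lambda>k. (norm2 (\<zeta> k))\<^sup>2)" using that by (simp add: l2_family_def)
      show "summable (\<lambda>k. (norm2 (slice i (\<zeta> k)))\<^sup>2)"
        by (rule summable_comparison_test'[OF s, of 0]) (use norm2_slice_le[OF mz E] in \<open>auto intro!: power_mono\<close>)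
    qed
    have c: "continuous_map (ultraweak A) euclidean
      (\<lambda>y. \<Sum>i\<in>E. \<Sum>j\<in>E. p (basis2 j) i * (\<Sum>k. inner2 (y (slice j (\<xi> k))) (slice i (\<eta> k))))"
    proof (intro continuous_map_sum E)
      fix i j
      show "continuous_map (ultraweak A) euclidean (\<lambda>y. p (basis2 j) i * (\<Sum>k. inner2 (y (slice j (\<xi> k))) (slice i (\<eta> k))))"
        using continuous_map_compose[OF continuous_series[OF sl[OF f(1), of j] sl[OF f(2), of i]], of euclidean "(*) (p (basis2 j) i)"]
        by (simp add: comp_def continuous_map_iff_continuous2 continuous_on_mult_left)
    qed
    show "continuous_map (ultraweak A) euclidean (\<lambda>y. \<Sum>k. inner2 (tensor_op E J p y (\<xi> k)) (\<eta> k))"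
    proof (rule continuous_map_eq[OF c])
      fix y assume "y \<in> topspace (ultraweak A)"
      then have y: "y \<in> elems A" by simp
      have "inner2 (tensor_op E J p y (\<xi> k)) (\<eta> k) = (\<Sum>i\<in>E. \<Sum>j\<in>E. p (basis2 j) i * inner2 (y (slice j (\<xi> k))) (slice i (\<eta> k)))" for k
        unfolding inner2_entries[OF tensor_op_bop[OF E p elem_bop[OF y]] E m]
        by (intro sum.cong refl) (simp only: ent_tensor[OF E p elem_bop[OF y]] smul2_apply inner2_smul_left)
      moreover have "(\<lambda>k. \<Sum>i\<in>E. \<Sum>j\<in>E. p (basis2 j) i * inner2 (y (slice j (\<xi> k))) (slice i (\<eta> k))) sums
        (\<Sum>i\<in>E. \<Sum>j\<in>E. p (basis2 j) i * (\<Sum>k. inner2 (y (slice j (\<xi> k))) (slice i (\<eta> k))))"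
        by (intro sums_sum sums_mult summable_sums series_summable[OF elem_bop[OF y]] sl f)
      ultimately show "(\<Sum>i\<in>E. \<Sum>j\<in>E. p (basis2 j) i * (\<Sum>k. inner2 (y (slice j (\<xi> k))) (slice i (\<eta> k))))
        = (\<Sum>k. inner2 (tensor_op E J p y (\<xi> k)) (\<eta> k))"
        by (simp add: sums_iff)
    qed
  qed
qed

lemma continuous_ent_single:
  "continuous_map (ultraweak (tensor {a})) (ultraweak A) (ent a a)"
proof -
  interpret M: op_space "tensor {a}" by (rule tensor_op_space)
  show ?thesis
  proof (rule continuous_into_ultraweak)
    show "ent a a z \<in> elems A" if "z \<in> topspace (ultraweak (tensor {a}))" for z using tensor_single(1) that by auto
    fix \<xi> \<eta> assume f: "l2_family J \<xi>" "l2_family J \<eta>"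
    have fe: "l2_family (index (tensor {a})) (\<lambda>k. emb a (\<xi> k))" "l2_family (index (tensor {a})) (\<lambda>k. emb a (\<eta> k))"
      using f unfolding l2_family_def by auto
    show "continuous_map (ultraweak (tensor {a})) euclidean (\<lambda>z. \<Sum>k. inner2 (ent a a z (\<xi> k)) (\<eta> k))"
    proof (rule continuous_map_eq[OF M.continuous_series[OF fe]])
      fix z assume "z \<in> topspace (ultraweak (tensor {a}))"
      then have z: "z \<in> bounded_ops ({a} \<times> J)" using M.elem_bop by auto
      have "inner2 (z (emb a (\<xi> k))) (emb a (\<eta> k)) = inner2 (ent a a z (\<xi> k)) (\<eta> k)" for k
      proof -
        have "inner2 (z (emb a (\<xi> k))) (emb a (\<eta> k)) = (\<Sum>p\<in>{a}. inner2 (slice p (z (emb a (\<xi> k)))) (slice p (emb a (\<eta> k))))"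
          using l2_family_l2[OF f(2)] by (intro inner2_slices[of _ "{a}" J] bop_l2[OF z]) auto
        then show ?thesis by (simp add: ent_def)
      qed
      then show "(\<Sum>k. inner2 (z (emb a (\<xi> k))) (emb a (\<eta> k))) = (\<Sum>k. inner2 (ent a a z (\<xi> k)) (\<eta> k))" by simp
    qed
  qed
qed

text \<open>\<open>tensor_id\<close> is a definite description, so existence and uniqueness are both
  required. The candidate \<open>Th\<close> takes the single entry of z and tensors it with
  \<open>p\<close>; it is the only choice because by \<open>tensor_single\<close> every element is
  an elementary tensor 1 \<otimes> y.\<close>

lemma tensor_id_corner:
  assumes E: "finite E" and p: "p \<in> bounded_ops E" and y: "y \<in> elems A"
  shows "tensor_id (full {e 0}) (full E) A (corner e p) (tensor_op {e 0} J (id_op {e 0}) y) = tensor_op E J p y"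
proof -
  let ?a = "e 0"
  interpret M: op_space "tensor {?a}" by (rule tensor_op_space)
  interpret M2: op_space "tensor E" by (rule tensor_op_space)
  have corner: "corner e p x = smul2 (x (basis2 ?a) ?a) p" for x by (simp add: corner_def basis2_def)
  have one: "basis2 ?a \<in> l2 {?a}" by auto
  have id1: "id_op {?a} (basis2 ?a) ?a = 1" unfolding id_op_def if_P[OF one] by (simp add: basis2_def)
  define Th where "Th z = (if z \<in> elems (tensor {?a}) then tensor_op E J p (ent ?a ?a z) else 0)" for z
  define Q where "Q \<Theta> \<longleftrightarrow> (\<forall>z. z \<notin> elems (tensor {?a}) \<longrightarrow> \<Theta> z = 0) \<and> normal_map (tensor {?a}) (tensor E) \<Theta> \<and>
    (\<forall>x\<in>elems (full {?a}). \<forall>y\<in>elems A. \<Theta> (tensor_op (index (full {?a})) J x y) = tensor_op (index (full E)) J (corner e p x) y)" for \<Theta>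
  have "Q Th"
    unfolding Q_def
  proof (intro conjI allI impI ballI)
    show "Th z = 0" if "z \<notin> elems (tensor {?a})" for z using that by (simp only: Th_def if_False)
    show "Th (tensor_op (index (full {?a})) J x y) = tensor_op (index (full E)) J (corner e p x) y"
      if x: "x \<in> elems (full {?a})" and y: "y \<in> elems A" for x y
    proof -
      have xb: "x \<in> bounded_ops {?a}" and yb: "y \<in> bounded_ops J" using x y by auto
      have "Th (tensor_op {?a} J x y) = tensor_op E J p (ent ?a ?a (tensor_op {?a} J x y))"
        using tensor_mem[OF _ xb y] by (simp only: Th_def if_True finite.emptyI finite.insertI)
      also have "ent ?a ?a (tensor_op {?a} J x y) = smul2 (x (basis2 ?a) ?a) y" using xb yb by (intro ent_tensor) auto
      also have "tensor_op E J p (smul2 (x (basis2 ?a) ?a) y) = tensor_op E J (corner e p x) y"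
        unfolding corner tensor_op_linear[OF E p p yb yb] ..
      finally show ?thesis by (simp only: opalg.sel)
    qed
    show "normal_map (tensor {?a}) (tensor E) Th"
      unfolding normal_map_def linear_on_def
    proof (intro conjI ballI allI)
      have eb: "ent ?a ?a z \<in> bounded_ops J" if "z \<in> elems (tensor {?a})" for z
        using elem_bop[OF tensor_single(1)[OF that]] .
      show "Th (z + w) = Th z + Th w" if "z \<in> elems (tensor {?a})" "w \<in> elems (tensor {?a})" for z w
        using that M.add_mem[OF that] by (simp only: Th_def if_True ent_linear tensor_op_linear[OF E p p eb[OF that(1)] eb[OF that(2)]])
      show "Th (smul2 c z) = smul2 c (Th z)" if "z \<in> elems (tensor {?a})" for c z
        using that M.smul_mem[OF that] by (simp only: Th_def if_True ent_linear tensor_op_linear[OF E p p eb[OF that] eb[OF that]])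
      show "continuous_map (ultraweak (tensor {?a})) (ultraweak (tensor E)) Th"
        by (rule continuous_map_eq[OF continuous_map_compose[OF continuous_ent_single continuous_tensor_op[OF E p]]])
          (simp only: Th_def comp_apply M.topspace_ultraweak if_True)
    qed
  qed
  moreover have "\<Theta> = Th" if Q: "Q \<Theta>" for \<Theta>
  proof
    fix z
    show "\<Theta> z = Th z"
    proof (cases "z \<in> elems (tensor {?a})")
      case True
      note s = tensor_single[OF True]
      have "\<Theta> (tensor_op (index (full {?a})) J (id_op {?a}) (ent ?a ?a z)) = tensor_op (index (full E)) J (corner e p (id_op {?a})) (ent ?a ?a z)"
        using Q s(1) unfolding Q_def by simp
      then have "\<Theta> (tensor_op {?a} J (id_op {?a}) (ent ?a ?a z)) = tensor_op E J p (ent ?a ?a z)"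
        unfolding corner id1 opalg.sel smul2_simps .
      then show ?thesis using True s(2) by (simp only: Th_def if_True)
    next
      case False
      moreover have "\<Theta> z = 0" using Q False unfolding Q_def by blast
      ultimately show ?thesis by (simp only: Th_def if_False)
    qed
  qed
  ultimately have "(THE \<Theta>. Q \<Theta>) = Th" by (intro the_equality)
  then have "tensor_id (full {?a}) (full E) A (corner e p) = Th"
    unfolding tensor_id_def Q_def .
  then have "tensor_id (full {?a}) (full E) A (corner e p) (tensor_op {?a} J (id_op {?a}) y) = Th (tensor_op {?a} J (id_op {?a}) y)" by simp
  also have "\<dots> = tensor_op E J p (ent ?a ?a (tensor_op {?a} J (id_op {?a}) y))"
    using tensor_mem[OF _ id_op_bop y, of "{?a}"] by (simp only: Th_def if_True finite.emptyI finite.insertI)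
  also have "ent ?a ?a (tensor_op {?a} J (id_op {?a}) y) = y"
    by (subst ent_tensor) (use elem_bop[OF y] in \<open>simp_all only: id1 smul2_simps id_op_bop finite.emptyI finite.insertI insertI1\<close>)
  finally show ?thesis .
qed

lemma Nor_predual: "\<phi> \<in> Nor B A \<Longrightarrow> x \<in> elems B \<Longrightarrow> \<phi> x \<in> predual A"
  unfolding Nor_def CB_def by blast

lemma Nor_add: "\<phi> \<in> Nor B A \<Longrightarrow> x \<in> elems B \<Longrightarrow> y \<in> elems B \<Longrightarrow> \<phi> (x + y) = \<phi> x + \<phi> y"
  unfolding Nor_def CB_def linear_on_def by blast

lemma Nor_smul: "\<phi> \<in> Nor B A \<Longrightarrow> x \<in> elems B \<Longrightarrow> \<phi> (smul2 c x) = smul1 c (\<phi> x)"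
  unfolding Nor_def CB_def linear_on_def by blast

lemma Nor_outside: "\<phi> \<in> Nor B A \<Longrightarrow> x \<notin> elems B \<Longrightarrow> \<phi> x = 0"
  unfolding Nor_def CB_def by blast

lemma block_mat_alg:
  assumes "\<And>i j. i < n \<Longrightarrow> j < n \<Longrightarrow> x i j \<in> elems A"
  shows "block {..<n} J x \<in> elems (mat_alg n A)"
    "i < n \<Longrightarrow> j < n \<Longrightarrow> entry i j (block {..<n} J x) = x i j"
proof -
  have b: "x i j \<in> bounded_ops J" if "i \<in> {..<n}" "j \<in> {..<n}" for i j using assms[of i j] that by auto
  show e: "entry i j (block {..<n} J x) = x i j" if "i < n" "j < n" for i j
    unfolding entry_eq_ent by (rule ent_block[OF finite_lessThan]) (use that b in auto)
  show "block {..<n} J x \<in> elems (mat_alg n A)"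
    unfolding mat_alg_def opalg.sel mem_Collect_eq using block_bop[OF finite_lessThan b] e assms by auto
qed

text \<open>Complete positivity read through a positive block matrix on either side; the order
  \<open>y j i\<close> comes from the trace pairing.\<close>

lemma cp_pairing:
  fixes n :: nat
  assumes cp: "completely_positive (full E) A \<phi>" and E: "finite E"
    and x: "\<And>i j. i < n \<Longrightarrow> j < n \<Longrightarrow> x i j \<in> bounded_ops E" "positive_op ({..<n} \<times> E) (block {..<n} E x)"
    and y: "\<And>i j. i < n \<Longrightarrow> j < n \<Longrightarrow> y i j \<in> elems A" "positive_op ({..<n} \<times> J) (block {..<n} J y)"
  shows "(\<Sum>i<n. \<Sum>j<n. \<phi> (x i j) (y j i)) \<in> \<real>\<^sub>\<ge>\<^sub>0"
proof -
  interpret F: vn_algebra "full E" by (rule full_algebra)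
  interpret M: op_space "mat_alg n A" by (rule mat_alg_op_space)
  have X: "block {..<n} E x \<in> elems (mat_alg n (full E))" "\<And>i j. i < n \<Longrightarrow> j < n \<Longrightarrow> entry i j (block {..<n} E x) = x i j"
    using F.block_mat_alg[of n x] x(1) by auto
  note Y = block_mat_alg[of n y, OF y(1)]
  have "trace_pairing n A (\<lambda>i j. \<phi> (entry i j (block {..<n} E x))) \<in> predual_pos (mat_alg n A)"
    using cp X(1) x(2) unfolding completely_positive_def by (simp add: F.index_mat_alg)
  then have "trace_pairing n A (\<lambda>i j. \<phi> (entry i j (block {..<n} E x))) (block {..<n} J y) \<in> \<real>\<^sub>\<ge>\<^sub>0"
    by (rule M.predual_pos_nonneg) (use Y(1) y(2) in auto)
  then show ?thesis using Y X(2) by (simp add: trace_pairing_def)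
qed

lemma cp_positive:
  assumes cp: "completely_positive (full E) A \<phi>" and E: "finite E" and \<phi>: "\<phi> \<in> Nor (full E) A"
    and x: "positive_op E x"
  shows "\<phi> x \<in> predual_pos A"
proof (rule predual_posI)
  have xb: "x \<in> bounded_ops E" using x by (simp add: positive_op_def)
  show "\<phi> x \<in> predual A" by (rule Nor_predual[OF \<phi>]) (use xb in simp)
  have one: "positive_op ({..<1 :: nat} \<times> I) (block {..<1} I (\<lambda>i j. b))" if "positive_op I b" for b and I :: "'b set"
  proof -
    have bb: "b \<in> bounded_ops I" using that by (simp add: positive_op_def)
    have B: "block {..<1} I (\<lambda>i j. b) \<in> bounded_ops ({..<1::nat} \<times> I)" by (rule block_bop) (use bb in auto)
    have "inner2 (block {..<1} I (\<lambda>i j. b) \<zeta>) \<zeta> = inner2 (b (slice 0 \<zeta>)) (slice 0 \<zeta>)" if \<zeta>: "\<zeta> \<in> l2 ({..<1::nat} \<times> I)" for \<zeta>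
    proof -
      have "inner2 (block {..<1} I (\<lambda>i j. b) \<zeta>) \<zeta> = (\<Sum>i\<in>{..<1}. \<Sum>j\<in>{..<1}. inner2 (b (slice j \<zeta>)) (slice i \<zeta>))"
        unfolding inner2_entries[OF B finite_lessThan \<zeta> \<zeta>]
        by (intro sum.cong refl) (simp only: ent_block[OF finite_lessThan _ _ bb])
      then show ?thesis by simp
    qed
    moreover have "slice (0 :: nat) \<zeta> \<in> l2 I" if "\<zeta> \<in> l2 ({..<1::nat} \<times> I)" for \<zeta> :: "(nat \<times> 'b) vec" using that by (rule slice_l2)
    ultimately show ?thesis
      using that B unfolding positive_op_def by (intro conjI ballI) (assumption | simp only:)+
  qed
  fix y assume y: "y \<in> elems A" "positive_op J y"
  have "(\<Sum>i<1::nat. \<Sum>j<1::nat. \<phi> x y) \<in> \<real>\<^sub>\<ge>\<^sub>0"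
    using cp_pairing[OF cp E, of 1 "\<lambda>_ _. x" "\<lambda>_ _. y", OF xb one[OF x] y(1) one[OF y(2)]] .
  then show "\<phi> x y \<in> \<real>\<^sub>\<ge>\<^sub>0" by simp
qed

text \<open>The matrix of matrix units is positive because its form is the squared modulus of the
  sum of the coordinates \<open>slice j \<zeta> (s j)\<close>. The other matrix is a Gram matrix,
  which the pairing transposes.\<close>

lemma cp_gram:
  fixes n :: nat and s :: "nat \<Rightarrow> 'e"
  assumes cp: "completely_positive (full E) A \<phi>" and E: "finite E" and s: "\<And>i. i < n \<Longrightarrow> s i \<in> E"
    and x: "\<And>i. i < n \<Longrightarrow> x i \<in> elems A"
  shows "(\<Sum>i<n. \<Sum>j<n. \<phi> (mat_unit E (s i) (s j)) (adj J (x j) \<circ> x i)) \<in> \<real>\<^sub>\<ge>\<^sub>0"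
proof (rule cp_pairing[OF cp E])
  show "adj J (x i) \<circ> x j \<in> elems A" if "i < n" "j < n" for i j using x that by auto
  show "positive_op ({..<n} \<times> J) (block {..<n} J (\<lambda>i j. adj J (x i) \<circ> x j))"
    by (rule gram_block_positive) (use x in auto)
  show "mat_unit E (s i) (s j) \<in> bounded_ops E" if "i < n" "j < n" for i j using s that by auto
  then have B: "block {..<n} E (\<lambda>i j. mat_unit E (s i) (s j)) \<in> bounded_ops ({..<n} \<times> E)"
    by (intro block_bop) auto
  show "positive_op ({..<n} \<times> E) (block {..<n} E (\<lambda>i j. mat_unit E (s i) (s j)))"
    unfolding positive_op_def
  proof (intro conjI B ballI)
    fix \<zeta> assume \<zeta>: "\<zeta> \<in> l2 ({..<n} \<times> E)"
    define c where "c = (\<Sum>j<n. slice j \<zeta> (s j))"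
    have "inner2 (block {..<n} E (\<lambda>i j. mat_unit E (s i) (s j)) \<zeta>) \<zeta> =
        (\<Sum>i<n. \<Sum>j<n. inner2 (mat_unit E (s i) (s j) (slice j \<zeta>)) (slice i \<zeta>))"
      unfolding inner2_entries[OF B finite_lessThan \<zeta> \<zeta>]
      by (intro sum.cong refl, subst ent_block) (use s in auto)
    also have "\<dots> = (\<Sum>i<n. \<Sum>j<n. slice j \<zeta> (s j) * cnj (slice i \<zeta> (s i)))"
      by (intro sum.cong refl) (simp only: mat_unit_def slice_l2[OF \<zeta>] if_True inner2_smul_left inner2_basis2_left)
    also have "\<dots> = (\<Sum>j<n. \<Sum>i<n. slice j \<zeta> (s j) * cnj (slice i \<zeta> (s i)))" by (rule sum.swap)
    also have "\<dots> = c * cnj c" by (simp only: c_def cnj_sum sum_product)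
    also have "\<dots> = complex_of_real ((cmod c)\<^sup>2)" by (simp only: complex_norm_square)
    finally show "inner2 (block {..<n} E (\<lambda>i j. mat_unit E (s i) (s j)) \<zeta>) \<zeta> \<in> \<real>\<^sub>\<ge>\<^sub>0"
      by (simp only: nonneg_Reals_of_real_iff zero_le_power2)
  qed
qed

end

section \<open>The norms of Nor and of the predual\<close>

definition mat_vec :: "'k set \<Rightarrow> ('k \<Rightarrow> 'k \<Rightarrow> complex) \<Rightarrow> 'k vec \<Rightarrow> 'k vec" where
  "mat_vec K a = (\<lambda>f r. if r \<in> K then (\<Sum>s\<in>K. a r s * f s) else 0)"

lemma mat_vec_l2: "finite K \<Longrightarrow> mat_vec K a f \<in> l2 K"
  by (rule l2_finite[of K]) (auto simp: mat_vec_def)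

lemma mat_vec_combine:
  "mat_vec K (\<lambda>r s. a r s - b r s) f = mat_vec K a f - mat_vec K b f"
  by (rule ext) (simp add: mat_vec_def sum_subtractf left_diff_distrib)

lemma matrix_norm_upper:
  assumes K: "finite K" and f: "f \<in> l2 K" "norm2 f \<le> 1"
  shows "norm2 (mat_vec K a f) \<le> matrix_norm K a"
proof -
  have le: "norm2 (mat_vec K a f) \<le> (\<Sum>r\<in>K. \<Sum>s\<in>K. cmod (a r s))" if f: "f \<in> l2 K" "norm2 f \<le> 1" for f
  proof -
    let ?g = "mat_vec K a f"
    have "?g = (\<Sum>r\<in>K. smul1 (?g r) (basis2 r))" by (rule finite_expansion[OF K]) (simp add: mat_vec_def)
    then have "norm2 ?g = norm2 (\<Sum>r\<in>K. smul1 (?g r) (basis2 r))" by (rule arg_cong)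
    also have "\<dots> \<le> (\<Sum>r\<in>K. norm2 (smul1 (?g r) (basis2 r)))" by (rule norm2_triangle_sum[of _ _ K]) auto
    also have "\<dots> \<le> (\<Sum>r\<in>K. \<Sum>s\<in>K. cmod (a r s))"
    proof (rule sum_mono)
      fix r assume r: "r \<in> K"
      have "norm2 (smul1 (?g r) (basis2 r)) = cmod (\<Sum>s\<in>K. a r s * f s)" using r by (simp add: norm2_smul mat_vec_def)
      also have "\<dots> \<le> (\<Sum>s\<in>K. cmod (a r s * f s))" by (rule norm_sum)
      also have "\<dots> \<le> (\<Sum>s\<in>K. cmod (a r s))"
      proof (rule sum_mono)
        fix s
        have "cmod (f s) \<le> 1" using norm2_coord[OF f(1), of s] f(2) by simp
        then show "cmod (a r s * f s) \<le> cmod (a r s)" by (simp add: norm_mult mult_left_le)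
      qed
      finally show "norm2 (smul1 (?g r) (basis2 r)) \<le> (\<Sum>s\<in>K. cmod (a r s))" .
    qed
    finally show ?thesis .
  qed
  have "bdd_above ((\<lambda>f. norm2 (mat_vec K a f)) ` {f \<in> l2 K. norm2 f \<le> 1})"
    using le by (intro bdd_aboveI2) blast
  then have "norm2 (mat_vec K a f) \<le> (SUP f\<in>{f \<in> l2 K. norm2 f \<le> 1}. norm2 (mat_vec K a f))"
    by (rule cSUP_upper[rotated]) (use f in blast)
  then show ?thesis unfolding matrix_norm_def op_norm_def mat_vec_def .
qed

context op_space
begin

text \<open>Regards a contraction as a matrix of size one, so that estimates over all matrix sizes
  can be specialised to single elements.\<close>

lemma single_matrix:
  assumes x: "x \<in> elems A" "\<And>f. f \<in> l2 (index A) \<Longrightarrow> norm2 (x f) \<le> norm2 f"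
  obtains X where "X \<in> elems (mat_alg 1 A)" "op_norm (index (mat_alg 1 A)) X \<le> 1" "entry 0 0 X = x"
proof (rule that)
  let ?X = "block {..<1 :: nat} (index A) (\<lambda>_ _. x)"
  have xb: "x \<in> bounded_ops (index A)" using x by simp
  show e: "entry 0 0 ?X = x" unfolding entry_eq_ent by (rule ent_block) (use xb in auto)
  have "?X \<in> bounded_ops ({..<1} \<times> index A)" by (rule block_bop) (use xb in auto)
  then show "?X \<in> elems (mat_alg 1 A)"
    unfolding mat_alg_def opalg.sel mem_Collect_eq using e x(1) less_one by metis
  show "op_norm (index (mat_alg 1 A)) ?X \<le> 1"
    unfolding index_mat_alg
  proof (rule op_norm_leI)
    fix \<zeta> assume z: "\<zeta> \<in> l2 ({..<1 :: nat} \<times> index A)" "norm2 \<zeta> \<le> 1"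
    have one: "{..<1 :: nat} = {0}" by auto
    have "?X \<zeta> = emb 0 (x (slice 0 \<zeta>))"
      using z(1) unfolding block_def one by simp
    then have "norm2 (?X \<zeta>) = norm2 (x (slice 0 \<zeta>))" by simp
    also have "\<dots> \<le> norm2 (slice 0 \<zeta>)" by (rule x(2)[OF slice_l2[OF z(1)]])
    also have "\<dots> \<le> norm2 \<zeta>" by (rule norm2_slice_le[OF z(1)]) simp
    finally show "norm2 (?X \<zeta>) \<le> 1" using z(2) by simp
  qed
qed

lemma scale_to_contraction:
  assumes x: "x \<in> elems A"
  obtains c where "c \<noteq> 0" "\<And>f. f \<in> l2 (index A) \<Longrightarrow> norm2 (smul2 c x f) \<le> norm2 f"
proof (rule bop_bound[OF elem_bop[OF x]])
  fix C assume C: "0 \<le> C" "\<And>f. f \<in> l2 (index A) \<Longrightarrow> norm2 (x f) \<le> C * norm2 f"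
  show ?thesis
  proof (rule that[of "complex_of_real (1 / (C + 1))"])
    have "1 / (C + 1) \<noteq> 0" using C(1) by simp
    then show "complex_of_real (1 / (C + 1)) \<noteq> 0" by (simp only: of_real_eq_0_iff not_False_eq_True)
    fix f assume f: "f \<in> l2 (index A)"
    have "norm2 (x f) \<le> (C + 1) * norm2 f" by (rule order_trans[OF C(2)[OF f]]) (simp add: mult_right_mono)
    then have "norm2 (x f) / (C + 1) \<le> norm2 f" using C(1) by (simp add: field_simps)
    then show "norm2 (smul2 (complex_of_real (1 / (C + 1))) x f) \<le> norm2 f"
      using C(1) by (simp add: norm2_smul norm_divide del: of_real_divide)
  qed
qed

lemma predual_norm_upper:
  assumes \<omega>: "\<omega> \<in> predual A" and x: "x \<in> elems A" "op_norm (index A) x \<le> 1"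
  shows "cmod (\<omega> x) \<le> predual_norm A \<omega>"
proof -
  obtain C where C: "\<forall>n. \<forall>X\<in>elems (mat_alg n A). op_norm (index (mat_alg n A)) X \<le> 1 \<longrightarrow>
      matrix_bound n (\<lambda>i j. \<omega> (entry i j X)) C"
    using predual_matrix_bound[OF \<omega>] by blast
  have "cmod (\<omega> y) \<le> C" if y: "y \<in> elems A" "op_norm (index A) y \<le> 1" for y
  proof (rule single_matrix[OF y(1)])
    show "norm2 (y f) \<le> norm2 f" if "f \<in> l2 (index A)" for f by (rule op_norm_le_1D[OF elem_bop[OF y(1)] y(2) that])
    fix X assume X: "X \<in> elems (mat_alg 1 A)" "op_norm (index (mat_alg 1 A)) X \<le> 1" "entry 0 0 X = y"
    have b: "matrix_bound 1 (\<lambda>i j. \<omega> (entry i j X)) C" using C X by blast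
    then have "0 \<le> C" unfolding matrix_bound_def by blast
    moreover have "(cmod (\<omega> y))\<^sup>2 \<le> C\<^sup>2"
      using b[unfolded matrix_bound_def, THEN conjunct2, THEN spec[of _ "\<lambda>_. 1"]] X(3) by simp
    ultimately show "cmod (\<omega> y) \<le> C" using power2_le_imp_le by blast
  qed
  then have "bdd_above ((\<lambda>x. cmod (\<omega> x)) ` {x \<in> elems A. op_norm (index A) x \<le> 1})"
    by (intro bdd_aboveI2) blast
  then show ?thesis unfolding predual_norm_def by (rule cSUP_upper[rotated]) (use x in blast)
qed

lemma zero_contraction: "op_norm (index A) 0 \<le> 1"
  by (rule op_norm_leI) simp

lemma predual_norm_leI:
  assumes "\<And>x. x \<in> elems A \<Longrightarrow> op_norm (index A) x \<le> 1 \<Longrightarrow> cmod (\<omega> x) \<le> C"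
  shows "predual_norm A \<omega> \<le> C"
  unfolding predual_norm_def by (rule cSUP_least) (use assms zero_contraction zero_mem in blast)+

text \<open>The carrier of \<open>mtopology\<close> is the given set once the metric axioms hold;
  definiteness uses that every element has a nonzero multiple that is a contraction. Together with
  the same fact for \<open>Nor_topology\<close> it makes a homeomorphism onto the normal
  functionals.\<close>

lemma topspace_predual_topology: "topspace (predual_topology A) = predual A"
  unfolding predual_topology_def
proof (rule Metric_space.topspace_mtopology, rule Metric_space.intro)
  let ?d = "\<lambda>\<omega> \<rho>. if \<omega> \<in> predual A \<and> \<rho> \<in> predual A then predual_norm A (\<omega> - \<rho>) else 0"
  have nonneg: "0 \<le> predual_norm A \<omega>" if "\<omega> \<in> predual A" for \<omega>
    using predual_norm_upper[OF that zero_mem zero_contraction] norm_ge_zero order_trans by blast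
  have sym: "predual_norm A (\<omega> - \<rho>) \<le> predual_norm A (\<rho> - \<omega>)" if "\<omega> \<in> predual A" "\<rho> \<in> predual A" for \<omega> \<rho>
  proof (rule predual_norm_leI)
    fix x assume x: "x \<in> elems A" "op_norm (index A) x \<le> 1"
    show "cmod ((\<omega> - \<rho>) x) \<le> predual_norm A (\<rho> - \<omega>)"
      using predual_norm_upper[OF diff_predual[OF that(2,1)] x] by (simp add: norm_minus_commute)
  qed
  fix \<omega> \<rho> \<sigma>
  show "0 \<le> ?d \<omega> \<rho>" using nonneg by auto
  show "?d \<omega> \<rho> = ?d \<rho> \<omega>" using sym by (auto intro: antisym)
  show "(?d \<omega> \<rho> = 0) = (\<omega> = \<rho>)" if m: "\<omega> \<in> predual A" "\<rho> \<in> predual A"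
  proof
    assume "?d \<omega> \<rho> = 0"
    then have z: "predual_norm A (\<omega> - \<rho>) = 0" using m by simp
    show "\<omega> = \<rho>"
    proof (rule predual_eqI[OF m])
      fix x assume x: "x \<in> elems A"
      obtain c where c: "c \<noteq> 0" "\<And>f. f \<in> l2 (index A) \<Longrightarrow> norm2 (smul2 c x f) \<le> norm2 f"
        using scale_to_contraction[OF x] by blast
      have "op_norm (index A) (smul2 c x) \<le> 1" by (rule op_norm_leI) (use c(2) order_trans in blast)
      then have "cmod ((\<omega> - \<rho>) (smul2 c x)) \<le> 0"
        using predual_norm_upper[OF diff_predual[OF m] smul_mem[OF x]] z by metis
      then have "(\<omega> - \<rho>) (smul2 c x) = 0" by simp
      then have "c * (\<omega> - \<rho>) x = 0" unfolding predual_scale[OF diff_predual[OF m] x] .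
      then show "\<omega> x = \<rho> x" using c(1) by simp
    qed
  next
    assume e: "\<omega> = \<rho>"
    have "predual_norm A (\<rho> - \<rho>) \<le> 0" by (rule predual_norm_leI) simp
    then show "?d \<omega> \<rho> = 0" using nonneg[OF diff_predual[OF m(2) m(2)]] m unfolding e by simp
  qed
  show "?d \<omega> \<sigma> \<le> ?d \<omega> \<rho> + ?d \<rho> \<sigma>" if m: "\<omega> \<in> predual A" "\<rho> \<in> predual A" "\<sigma> \<in> predual A"
  proof -
    have "predual_norm A (\<omega> - \<sigma>) \<le> predual_norm A (\<omega> - \<rho>) + predual_norm A (\<rho> - \<sigma>)"
    proof (rule predual_norm_leI)
      fix x assume x: "x \<in> elems A" "op_norm (index A) x \<le> 1"
      have "(\<omega> - \<sigma>) x = (\<omega> - \<rho>) x + (\<rho> - \<sigma>) x" by simp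
      then have "cmod ((\<omega> - \<sigma>) x) \<le> cmod ((\<omega> - \<rho>) x) + cmod ((\<rho> - \<sigma>) x)" using norm_triangle_ineq by metis
      also have "\<dots> \<le> predual_norm A (\<omega> - \<rho>) + predual_norm A (\<rho> - \<sigma>)"
        using m x by (intro add_mono predual_norm_upper diff_predual)
      finally show "cmod ((\<omega> - \<sigma>) x) \<le> predual_norm A (\<omega> - \<rho>) + predual_norm A (\<rho> - \<sigma>)" .
    qed
    then show ?thesis using m by simp
  qed
qed

end

definition cb_mat :: "('i opr \<Rightarrow> 'j opr \<Rightarrow> complex) \<Rightarrow> (nat \<times> 'i) opr \<Rightarrow> (nat \<times> 'j) opr \<Rightarrow> nat \<times> nat \<Rightarrow> nat \<times> nat \<Rightarrow> complex" where
  "cb_mat \<phi> X Y = (\<lambda>r s. \<phi> (entry (fst r) (fst s) X) (entry (snd r) (snd s) Y))"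

lemma cb_mat_eq: "(\<lambda>(i, k) (j, l). \<phi> (entry i j X) (entry k l Y)) = cb_mat \<phi> X Y"
  by (simp add: cb_mat_def fun_eq_iff split_beta)

locale op_space_pair = A: op_space A + B: op_space B
  for A :: "'i opalg" and B :: "'j opalg"
begin

text \<open>Bundles contractions on both sides with a vector of the unit ball, so that the nested
  suprema in the cb-norm can be handled as one.\<close>

definition test :: "nat \<Rightarrow> nat \<Rightarrow> (nat \<times> 'i) opr \<Rightarrow> (nat \<times> 'j) opr \<Rightarrow> (nat \<times> nat) vec \<Rightarrow> bool" where
  "test n m X Y f \<longleftrightarrow> X \<in> elems (mat_alg n A) \<and> op_norm (index (mat_alg n A)) X \<le> 1 \<and>
    Y \<in> elems (mat_alg m B) \<and> op_norm (index (mat_alg m B)) Y \<le> 1 \<and> f \<in> l2 ({..<n} \<times> {..<m}) \<and> norm2 f \<le> 1"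

lemma cb_values_le:
  assumes C: "\<And>n m X Y f. test n m X Y f \<Longrightarrow> norm2 (mat_vec ({..<n} \<times> {..<m}) (cb_mat \<phi> X Y) f) \<le> C"
    and v: "v \<in> cb_values A B \<phi>"
  shows "v \<le> C"
proof -
  obtain n X where v: "v = predual_matrix_norm B n (\<lambda>i j. \<phi> (entry i j X))"
    and X: "X \<in> elems (mat_alg n A)" "op_norm (index (mat_alg n A)) X \<le> 1"
    using v unfolding cb_values_def by blast
  show "v \<le> C" unfolding v
  proof (rule B.predual_matrix_norm_le)
    fix m Y assume Y: "Y \<in> elems (mat_alg m B)" "op_norm (index (mat_alg m B)) Y \<le> 1"
    show "matrix_norm ({..<n} \<times> {..<m}) (\<lambda>(i, k) (j, l). \<phi> (entry i j X) (entry k l Y)) \<le> C"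
      unfolding cb_mat_eq matrix_norm_def mat_vec_def[symmetric]
      by (rule op_norm_leI) (use C X Y in \<open>auto simp: test_def\<close>)
  qed
qed

lemma cb_norm_leI:
  assumes "\<And>n m X Y f. test n m X Y f \<Longrightarrow> norm2 (mat_vec ({..<n} \<times> {..<m}) (cb_mat \<phi> X Y) f) \<le> C"
  shows "cb_norm A B \<phi> \<le> C"
  unfolding cb_norm_def
proof (rule cSup_least)
  show "cb_values A B \<phi> \<noteq> {}" unfolding cb_values_def using A.zero_mat_alg by blast
qed (rule cb_values_le[OF assms])

lemma cb_norm_upper:
  assumes \<phi>: "\<phi> \<in> CB A B" and t: "test n m X Y f"
  shows "norm2 (mat_vec ({..<n} \<times> {..<m}) (cb_mat \<phi> X Y) f) \<le> cb_norm A B \<phi>"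
proof -
  have p: "\<phi> (entry i j X) \<in> predual B" if "i < n" "j < n" for i j
    using \<phi> t A.mat_alg_entry[of X n i j] that unfolding CB_def test_def by blast
  have bdd: "bdd_above (cb_values A B \<phi>)" using \<phi> unfolding CB_def mem_Collect_eq by (elim conjE)
  have "norm2 (mat_vec ({..<n} \<times> {..<m}) (cb_mat \<phi> X Y) f) \<le> matrix_norm ({..<n} \<times> {..<m}) (cb_mat \<phi> X Y)"
    using t unfolding test_def by (intro matrix_norm_upper) auto
  also have "\<dots> \<le> predual_matrix_norm B n (\<lambda>i j. \<phi> (entry i j X))"
    unfolding cb_mat_eq[symmetric] using t unfolding test_def by (intro B.predual_matrix_norm_upper p) auto
  also have "\<dots> \<le> cb_norm A B \<phi>"
    unfolding cb_norm_def using t bdd unfolding test_def cb_values_def by (intro cSup_upper) blast+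
  finally show ?thesis .
qed

lemma mat_vec_diff:
  "mat_vec K (cb_mat (\<phi> - \<psi>) X Y) f = mat_vec K (cb_mat \<phi> X Y) f - mat_vec K (cb_mat \<psi> X Y) f"
  unfolding mat_vec_combine[symmetric] by (simp add: cb_mat_def)

lemma norm2_diff_le: "f \<in> l2 K \<Longrightarrow> g \<in> l2 K \<Longrightarrow> norm2 (f - g) \<le> norm2 f + norm2 g"
  using norm2_triangle[of f K "- g"] by simp

lemma CB_diff:
  assumes \<phi>: "\<phi> \<in> CB A B" and \<psi>: "\<psi> \<in> CB A B" shows "\<phi> - \<psi> \<in> CB A B"
proof -
  have "norm2 (mat_vec ({..<n} \<times> {..<m}) (cb_mat (\<phi> - \<psi>) X Y) f) \<le> cb_norm A B \<phi> + cb_norm A B \<psi>"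
    if t: "test n m X Y f" for n m X Y f
    unfolding mat_vec_diff
    by (rule order_trans[OF norm2_diff_le[OF mat_vec_l2 mat_vec_l2] add_mono[OF cb_norm_upper[OF \<phi> t] cb_norm_upper[OF \<psi> t]]]) auto
  from cb_values_le[OF this] have "bdd_above (cb_values A B (\<phi> - \<psi>))"
    by (intro bdd_aboveI[of _ "cb_norm A B \<phi> + cb_norm A B \<psi>"]) blast
  moreover have "(\<phi> - \<psi>) x = 0" if "x \<notin> elems A" for x
    using that \<phi> \<psi> unfolding CB_def by simp
  moreover have "(\<phi> - \<psi>) x \<in> predual B" if "x \<in> elems A" for x
    using that \<phi> \<psi> unfolding CB_def fun_apply2 by blast
  moreover have "linear_on (elems A) smul2 smul1 (\<phi> - \<psi>)"
  proof -
    have l: "linear_on (elems A) smul2 smul1 \<phi>" "linear_on (elems A) smul2 smul1 \<psi>" using \<phi> \<psi> unfolding CB_def by blast+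
    have a: "\<phi> (x + y) = \<phi> x + \<phi> y" "\<psi> (x + y) = \<psi> x + \<psi> y" if "x \<in> elems A" "y \<in> elems A" for x y
      using l that unfolding linear_on_def by blast+
    have s: "\<phi> (smul2 c x) = smul1 c (\<phi> x)" "\<psi> (smul2 c x) = smul1 c (\<psi> x)" if "x \<in> elems A" for c x
      using l that unfolding linear_on_def by blast+
    show ?thesis unfolding linear_on_def
    proof (intro conjI ballI allI)
      fix x y assume "x \<in> elems A" "y \<in> elems A"
      then show "(\<phi> - \<psi>) (x + y) = (\<phi> - \<psi>) x + (\<phi> - \<psi>) y" unfolding fun_apply2(2)[of \<phi> \<psi>] by (simp only: a add_diff_add)
    next
      fix c x assume x: "x \<in> elems A"
      show "(\<phi> - \<psi>) (smul2 c x) = smul1 c ((\<phi> - \<psi>) x)"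
        unfolding fun_apply2(2)[of \<phi> \<psi>] s[OF x] by (rule ext) (simp add: right_diff_distrib)
    qed
  qed
  ultimately show ?thesis unfolding CB_def mem_Collect_eq by (intro conjI allI ballI impI)
qed

lemma cb_norm_nonneg: assumes "\<phi> \<in> CB A B" shows "0 \<le> cb_norm A B \<phi>"
proof -
  have "test 0 0 0 0 0" unfolding test_def by (intro conjI A.zero_mat_alg B.zero_mat_alg l2_zero) simp
  from cb_norm_upper[OF assms this] show ?thesis using norm2_nonneg order_trans by blast
qed

lemma cb_norm_zero:
  assumes \<phi>: "\<phi> \<in> CB A B" and z: "cb_norm A B \<phi> = 0" shows "\<phi> = 0"
proof (intro ext)
  fix x y
  have lin: "\<phi> (smul2 c x) = smul1 c (\<phi> x)" if "x \<in> elems A" for c using \<phi> that unfolding CB_def linear_on_def by blast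
  have pr: "\<phi> x \<in> predual B" if "x \<in> elems A" for x using \<phi> that unfolding CB_def by blast
  have "\<phi> x y = 0"
  proof (cases "x \<in> elems A \<and> y \<in> elems B")
    case True
    then have x: "x \<in> elems A" and y: "y \<in> elems B" by auto
    obtain c where c: "c \<noteq> 0" "\<And>f. f \<in> l2 (index A) \<Longrightarrow> norm2 (smul2 c x f) \<le> norm2 f"
      using A.scale_to_contraction[OF x] by blast
    obtain d where d: "d \<noteq> 0" "\<And>f. f \<in> l2 (index B) \<Longrightarrow> norm2 (smul2 d y f) \<le> norm2 f"
      using B.scale_to_contraction[OF y] by blast
    obtain X where X: "X \<in> elems (mat_alg 1 A)" "op_norm (index (mat_alg 1 A)) X \<le> 1" "entry 0 0 X = smul2 c x"
      by (rule A.single_matrix[OF A.smul_mem[OF x] c(2)])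
    obtain Y where Y: "Y \<in> elems (mat_alg 1 B)" "op_norm (index (mat_alg 1 B)) Y \<le> 1" "entry 0 0 Y = smul2 d y"
      by (rule B.single_matrix[OF B.smul_mem[OF y] d(2)])
    let ?K = "{..<1 :: nat} \<times> {..<1 :: nat}"
    have K: "?K = {(0, 0)}" by auto
    have b: "basis2 (0, 0) \<in> l2 ?K" by (rule basis2_l2) simp
    have "test 1 1 X Y (basis2 (0, 0))" unfolding test_def using X Y b by (simp only: norm2_basis2 order_refl)
    from cb_norm_upper[OF \<phi> this] have n: "norm2 (mat_vec ?K (cb_mat \<phi> X Y) (basis2 (0, 0))) \<le> 0" using z by simp
    have "cmod (mat_vec ?K (cb_mat \<phi> X Y) (basis2 (0, 0)) (0, 0)) \<le> 0"
      by (rule order_trans[OF norm2_coord[OF mat_vec_l2[of ?K]] n]) simp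
    moreover have "mat_vec ?K (cb_mat \<phi> X Y) (basis2 (0, 0)) (0, 0) = \<phi> (smul2 c x) (smul2 d y)"
      unfolding mat_vec_def K by (simp add: cb_mat_def basis2_def X(3) Y(3))
    ultimately have "\<phi> (smul2 c x) (smul2 d y) = 0" by simp
    then have "c * (d * \<phi> x y) = 0"
      unfolding lin[OF x] smul1_apply B.predual_scale[OF pr[OF x] y] .
    then show ?thesis using c(1) d(1) by simp
  next
    case False
    then show ?thesis
    proof (cases "x \<in> elems A")
      case True
      then show ?thesis using B.predual_outside[OF pr] False by blast
    next
      case False
      then have "\<phi> x = 0" using \<phi> unfolding CB_def by blast
      then show ?thesis by simp
    qed
  qed
  then show "\<phi> x y = 0 x y" by simp
qed

text \<open>The cb-norm distance is a metric on \<open>Nor A B\<close>: its axioms are checked on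
  test data, and definiteness is \<open>cb_norm_zero\<close>.\<close>

lemma topspace_Nor_topology: "topspace (Nor_topology A B) = Nor A B"
  unfolding Nor_topology_def
proof (rule Metric_space.topspace_mtopology, rule Metric_space.intro)
  let ?d = "\<lambda>\<phi> \<psi>. if \<phi> \<in> Nor A B \<and> \<psi> \<in> Nor A B then cb_norm A B (\<phi> - \<psi>) else 0"
  have cb: "\<phi> \<in> CB A B" if "\<phi> \<in> Nor A B" for \<phi> using that unfolding Nor_def by blast
  have df: "\<phi> - \<psi> \<in> CB A B" if "\<phi> \<in> Nor A B" "\<psi> \<in> Nor A B" for \<phi> \<psi> by (rule CB_diff[OF cb[OF that(1)] cb[OF that(2)]])
  have sym: "cb_norm A B (\<phi> - \<psi>) \<le> cb_norm A B (\<psi> - \<phi>)" if m: "\<phi> \<in> Nor A B" "\<psi> \<in> Nor A B" for \<phi> \<psi>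
  proof (rule cb_norm_leI)
    fix n m X Y f assume t: "test n m X Y f"
    have "mat_vec ({..<n} \<times> {..<m}) (cb_mat (\<phi> - \<psi>) X Y) f = - mat_vec ({..<n} \<times> {..<m}) (cb_mat (\<psi> - \<phi>) X Y) f"
      unfolding mat_vec_diff by simp
    then show "norm2 (mat_vec ({..<n} \<times> {..<m}) (cb_mat (\<phi> - \<psi>) X Y) f) \<le> cb_norm A B (\<psi> - \<phi>)"
      using cb_norm_upper[OF df[OF m(2,1)] t] by (simp only: norm2_uminus)
  qed
  fix \<phi> \<psi> \<sigma>
  show "0 \<le> ?d \<phi> \<psi>" using cb_norm_nonneg df by auto
  show "?d \<phi> \<psi> = ?d \<psi> \<phi>" using sym by (auto intro: antisym)
  show "(?d \<phi> \<psi> = 0) = (\<phi> = \<psi>)" if m: "\<phi> \<in> Nor A B" "\<psi> \<in> Nor A B"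
  proof
    assume "?d \<phi> \<psi> = 0"
    then have "cb_norm A B (\<phi> - \<psi>) = 0" using m by simp
    from cb_norm_zero[OF df[OF m] this] show "\<phi> = \<psi>" by (simp only: right_minus_eq)
  next
    assume e: "\<phi> = \<psi>"
    have "cb_norm A B (\<phi> - \<phi>) \<le> 0"
    proof (rule cb_norm_leI)
      fix n m X Y f
      show "norm2 (mat_vec ({..<n} \<times> {..<m}) (cb_mat (\<phi> - \<phi>) X Y) f) \<le> 0" unfolding mat_vec_diff by simp
    qed
    then show "?d \<phi> \<psi> = 0" using cb_norm_nonneg[OF df[OF m(1) m(1)]] m e by simp
  qed
  show "?d \<phi> \<sigma> \<le> ?d \<phi> \<psi> + ?d \<psi> \<sigma>" if m: "\<phi> \<in> Nor A B" "\<psi> \<in> Nor A B" "\<sigma> \<in> Nor A B"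
  proof -
    have "cb_norm A B (\<phi> - \<sigma>) \<le> cb_norm A B (\<phi> - \<psi>) + cb_norm A B (\<psi> - \<sigma>)"
    proof (rule cb_norm_leI)
      fix n m X Y f assume t: "test n m X Y f"
      have eq: "mat_vec ({..<n} \<times> {..<m}) (cb_mat (\<phi> - \<sigma>) X Y) f =
        mat_vec ({..<n} \<times> {..<m}) (cb_mat (\<phi> - \<psi>) X Y) f + mat_vec ({..<n} \<times> {..<m}) (cb_mat (\<psi> - \<sigma>) X Y) f"
        unfolding mat_vec_diff by (simp only: diff_add_cancel add_diff_eq)
      show "norm2 (mat_vec ({..<n} \<times> {..<m}) (cb_mat (\<phi> - \<sigma>) X Y) f) \<le> cb_norm A B (\<phi> - \<psi>) + cb_norm A B (\<psi> - \<sigma>)"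
        unfolding eq
        by (rule order_trans[OF norm2_triangle[OF mat_vec_l2 mat_vec_l2]
            add_mono[OF cb_norm_upper[OF df[OF m(1,2)] t] cb_norm_upper[OF df[OF m(2,3)] t]]]) auto
    qed
    then show ?thesis using m by simp
  qed
qed

end

lemma (in op_space) sum_mem: "(\<And>a. a \<in> S \<Longrightarrow> z a \<in> elems A) \<Longrightarrow> sum z S \<in> elems A"
  by (induction S rule: infinite_finite_induct) (simp_all only: sum.infinite sum.empty zero_mem sum.insert add_mem insertI1 insertI2 simp_thms)

lemma (in op_space) predual_sum:
  assumes \<omega>: "\<omega> \<in> predual A" and S: "finite S" and z: "\<And>a. a \<in> S \<Longrightarrow> z a \<in> elems A"
  shows "\<omega> (sum z S) = (\<Sum>a\<in>S. \<omega> (z a))"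
  using S z
proof (induction S rule: finite_induct)
  case empty
  show ?case by (simp only: sum.empty predual_zero[OF \<omega>])
next
  case (insert a S)
  have "z a \<in> elems A" "sum z S \<in> elems A"
    by (rule insert.prems, simp) (rule sum_mem, rule insert.prems, simp)
  then show ?case
    unfolding sum.insert[OF insert.hyps] using predual_plus[OF \<omega>] insert.IH insert.prems by (metis insertI2)
qed

section \<open>The anti-automorphism obtained from the corners\<close>

definition outer :: "'e set \<Rightarrow> 'e vec \<Rightarrow> 'e vec \<Rightarrow> 'e opr" where
  "outer E v w = (\<lambda>f. if f \<in> l2 E then smul1 (inner2 f w) v else 0)"

lemma outer_bop [simp, intro]:
  assumes v: "v \<in> l2 E" and w: "w \<in> l2 E" shows "outer E v w \<in> bounded_ops E"
proof (rule bounded_opsI[of _ _ "norm2 w * norm2 v"])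
  fix f assume f: "f \<in> l2 E"
  have "cmod (inner2 f w) * norm2 v \<le> norm2 f * norm2 w * norm2 v"
    by (intro mult_right_mono inner2_cauchy_schwarz[OF f w]) simp
  then show "norm2 (outer E v w f) \<le> norm2 w * norm2 v * norm2 f"
    using f by (simp add: outer_def norm2_smul mult_ac)
qed (use v w in \<open>auto simp: outer_def inner2_add_left[where I=E] inner2_smul_left smul1_add_left\<close>)

lemma outer_projection:
  assumes v: "v \<in> l2 E" and n: "inner2 v v = 1" shows "projection E (outer E v v)"
  unfolding projection_def
proof (intro conjI outer_bop v)
  show "outer E v v \<circ> outer E v v = outer E v v"
    using v n by (auto simp: outer_def inner2_smul_left intro!: ext)
  show "adj E (outer E v v) = outer E v v"
    by (rule adj_eqI[OF outer_bop[OF v v] outer_bop[OF v v]]) (use v in \<open>auto simp: outer_def inner2_smul_left inner2_smul_right inner2_cnj\<close>)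
qed

lemma outer_positive: assumes v: "v \<in> l2 E" shows "positive_op E (outer E v v)"
  unfolding positive_op_def
proof (intro conjI outer_bop v ballI)
  fix f assume f: "f \<in> l2 E"
  have "inner2 (outer E v v f) f = inner2 f v * cnj (inner2 f v)"
    using f by (simp add: outer_def inner2_smul_left inner2_cnj)
  also have "\<dots> = complex_of_real ((cmod (inner2 f v))\<^sup>2)" by (simp only: complex_norm_square)
  finally show "inner2 (outer E v v f) f \<in> \<real>\<^sub>\<ge>\<^sub>0" by (simp only: nonneg_Reals_of_real_iff zero_le_power2)
qed

lemma mat_unit_outer: "mat_unit E a b = outer E (basis2 a) (basis2 b)"
  unfolding mat_unit_def outer_def inner2_basis2 ..

text \<open>Compatibility is known only at projections. Scaling extends the vanishing from unit
  vectors to all diagonal rank one operators, and polarization to the mixed ones, among them the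
  matrix units.\<close>

lemma outer_vanishes:
  fixes G :: "'e opr \<Rightarrow> complex"
  assumes add: "\<And>X Y. X \<in> bounded_ops E \<Longrightarrow> Y \<in> bounded_ops E \<Longrightarrow> G (X + Y) = G X + G Y"
    and smul: "\<And>c X. X \<in> bounded_ops E \<Longrightarrow> G (smul2 c X) = c * G X"
    and unit: "\<And>v. v \<in> l2 E \<Longrightarrow> inner2 v v = 1 \<Longrightarrow> G (outer E v v) = 0"
    and v: "v \<in> l2 E" and w: "w \<in> l2 E"
  shows "G (outer E v w) = 0"
proof -
  have sq: "G (outer E v v) = 0" if v: "v \<in> l2 E" for v
  proof (cases "v = 0")
    case True
    have "outer E v v = smul2 0 (outer E v v)" unfolding True by (rule ext) (simp add: outer_def)
    then show ?thesis using smul[OF outer_bop[OF v v], of 0] by (metis mult_zero_left)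
  next
    case False
    then have n: "0 < norm2 v" using norm2_eq_0[OF v] norm2_nonneg[of v] by linarith
    define u where "u = smul1 (complex_of_real (1 / norm2 v)) v"
    have u: "u \<in> l2 E" using v by (simp add: u_def)
    have "norm2 u = 1" using n by (simp add: u_def norm2_smul norm_divide)
    then have "inner2 u u = 1" by (simp add: inner2_self)
    then have "G (outer E u u) = 0" by (rule unit[OF u])
    moreover have "outer E v v = smul2 (complex_of_real ((norm2 v)\<^sup>2)) (outer E u u)"
      using n by (intro ext) (simp add: outer_def u_def inner2_smul_right power2_eq_square)
    ultimately show ?thesis using smul[OF outer_bop[OF u u]] by simp
  qed
  let ?o = "\<lambda>z. outer E z z"
  have iw: "smul1 \<i> w \<in> l2 E" using w by simp
  have m: "?o (v + w) \<in> bounded_ops E" "?o (v - w) \<in> bounded_ops E"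
    "?o (v + smul1 \<i> w) \<in> bounded_ops E" "?o (v - smul1 \<i> w) \<in> bounded_ops E" using v w iw by auto
  have "smul2 4 (outer E v w) = (?o (v + w) + smul2 (- 1) (?o (v - w))) +
      (smul2 \<i> (?o (v + smul1 \<i> w)) + smul2 (- \<i>) (?o (v - smul1 \<i> w)))"
  proof (rule ext)
    fix f
    show "smul2 4 (outer E v w) f = ((?o (v + w) + smul2 (- 1) (?o (v - w))) +
      (smul2 \<i> (?o (v + smul1 \<i> w)) + smul2 (- \<i>) (?o (v - smul1 \<i> w)))) f"
    proof (cases "f \<in> l2 E")
      case True
      then show ?thesis
        using v w iw by (intro ext) (simp add: outer_def inner2_add_right[where I=E] inner2_diff_right[where I=E] inner2_smul_right algebra_simps)
    qed (simp add: outer_def)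
  qed
  then have "G (smul2 4 (outer E v w)) = G ((?o (v + w) + smul2 (- 1) (?o (v - w))) +
      (smul2 \<i> (?o (v + smul1 \<i> w)) + smul2 (- \<i>) (?o (v - smul1 \<i> w))))" by (rule arg_cong)
  also have "\<dots> = 0"
    using m sq v w iw by (simp only: add smul add_bop smul2_bop l2_add l2_diff mult_zero_right add_0_right)
  finally show ?thesis using smul[OF outer_bop[OF v w], of 4] by simp
qed

lemma single_expand: assumes X: "X \<in> bounded_ops {a}" shows "X = smul2 (X (basis2 a) a) (id_op {a})"
proof (rule op_eqI[OF X])
  have ex: "f = smul1 (f a) (basis2 a)" if "f \<in> l2 {a}" for f :: "'a vec"
    using finite_expansion[of "{a}" f] l2_zeroD[OF that] by simp
  fix f :: "'a vec" assume f: "f \<in> l2 {a}"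
  have b: "basis2 a \<in> l2 {a}" by simp
  have "X f = X (smul1 (f a) (basis2 a))" by (rule arg_cong[OF ex[OF f]])
  also have "\<dots> = smul1 (f a) (X (basis2 a))" by (rule bop_smul[OF X b])
  also have "X (basis2 a) = smul1 (X (basis2 a) a) (basis2 a)" by (rule ex[OF bop_l2[OF X]])
  also have "smul1 (f a) (smul1 (X (basis2 a) a) (basis2 a)) = smul1 (X (basis2 a) a) (smul1 (f a) (basis2 a))"
    by (simp only: smul1_simps mult.commute)
  also have "\<dots> = smul1 (X (basis2 a) a) f" unfolding ex[OF f, symmetric] ..
  finally show "X f = smul2 (X (basis2 a) a) (id_op {a}) f" using f by (simp only: smul2_apply id_op_apply)
qed simp

context vn_algebra
begin

lemma ent_amplification:
  assumes y: "y \<in> bounded_ops J" shows "ent a a (tensor_op {a} J (id_op {a}) y) = y"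
proof -
  have one: "basis2 a \<in> l2 {a}" by auto
  have id1: "id_op {a} (basis2 a) a = 1" unfolding id_op_def if_P[OF one] by (simp add: basis2_def)
  show ?thesis by (subst ent_tensor) (use y in \<open>simp_all only: id1 smul2_simps id_op_bop finite.emptyI finite.insertI insertI1\<close>)
qed

lemma inner2_ent_single:
  assumes z: "z \<in> bounded_ops ({a} \<times> J)" and \<zeta>: "\<zeta> \<in> l2 ({a} \<times> J)"
  shows "inner2 (z \<zeta>) \<zeta> = inner2 (ent a a z (slice a \<zeta>)) (slice a \<zeta>)"
  using inner2_entries[OF z _ \<zeta> \<zeta>] by simp

lemma amplification_positive:
  assumes y: "positive_op J y" shows "positive_op ({a} \<times> J) (tensor_op {a} J (id_op {a}) y)"
proof -
  have yb: "y \<in> bounded_ops J" using y by (simp add: positive_op_def)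
  have b: "tensor_op {a} J (id_op {a}) y \<in> bounded_ops ({a} \<times> J)" using yb by auto
  show ?thesis unfolding positive_op_def
  proof (intro conjI b ballI)
    fix \<zeta> assume z: "\<zeta> \<in> l2 ({a} \<times> J)"
    show "inner2 (tensor_op {a} J (id_op {a}) y \<zeta>) \<zeta> \<in> \<real>\<^sub>\<ge>\<^sub>0"
      unfolding inner2_ent_single[OF b z] ent_amplification[OF yb]
      using y slice_l2[OF z] unfolding positive_op_def by blast
  qed
qed

lemma ent_positive:
  assumes z: "positive_op ({a} \<times> J) z" shows "positive_op J (ent a a z)"
proof -
  have zb: "z \<in> bounded_ops ({a} \<times> J)" using z by (simp add: positive_op_def)
  show ?thesis unfolding positive_op_def
  proof (intro conjI ballI)
    show "ent a a z \<in> bounded_ops J" using zb by auto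
    fix f assume f: "f \<in> l2 J"
    have m: "emb a f \<in> l2 ({a} \<times> J)" using f by auto
    have "inner2 (z (emb a f)) (emb a f) = inner2 (ent a a z f) f" using inner2_ent_single[OF zb m] by simp
    moreover have "inner2 (z (emb a f)) (emb a f) \<in> \<real>\<^sub>\<ge>\<^sub>0" using z m unfolding positive_op_def by blast
    ultimately show "inner2 (ent a a z f) f \<in> \<real>\<^sub>\<ge>\<^sub>0" by (simp only:)
  qed
qed

lemma predual_tensor_op:
  assumes \<omega>: "\<omega> \<in> predual (tensor E)" and E: "finite E" and p: "p \<in> bounded_ops E"
  shows "(\<lambda>y. if y \<in> elems A then \<omega> (tensor_op E J p y) else 0) \<in> predual A"
proof -
  interpret M: op_space "tensor E" by (rule tensor_op_space)
  note lin = tensor_op_linear[OF E p p]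
  show ?thesis
  proof (rule predualI)
    show "(if x + y \<in> elems A then \<omega> (tensor_op E J p (x + y)) else 0) =
      (if x \<in> elems A then \<omega> (tensor_op E J p x) else 0) + (if y \<in> elems A then \<omega> (tensor_op E J p y) else 0)"
      if xy: "x \<in> elems A" "y \<in> elems A" for x y
      using xy add_mem[OF xy] by (simp only: if_True lin(1)[OF elem_bop elem_bop] M.predual_plus[OF \<omega> tensor_mem[OF E p] tensor_mem[OF E p]])
    show "(if smul2 c x \<in> elems A then \<omega> (tensor_op E J p (smul2 c x)) else 0) =
      c * (if x \<in> elems A then \<omega> (tensor_op E J p x) else 0)" if x: "x \<in> elems A" for c x
      using x smul_mem[OF x] by (simp only: if_True lin(2)[OF elem_bop elem_bop] M.predual_scale[OF \<omega> tensor_mem[OF E p]])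
    show "continuous_map (ultraweak A) euclidean (\<lambda>y. if y \<in> elems A then \<omega> (tensor_op E J p y) else 0)"
      by (rule continuous_map_eq[OF continuous_map_compose[OF continuous_tensor_op[OF E p] M.predual_continuous[OF \<omega>]]]) simp
  qed simp
qed

text \<open>With \<open>predual_tensor_op\<close> this passes between the preduals of \<complex>
  \<otimes> A and of A.\<close>

lemma predual_ent:
  assumes \<rho>: "\<rho> \<in> predual A"
  shows "(\<lambda>z. if z \<in> elems (tensor {a}) then \<rho> (ent a a z) else 0) \<in> predual (tensor {a})"
proof -
  interpret M: op_space "tensor {a}" by (rule tensor_op_space)
  show ?thesis
  proof (rule M.predualI)
    show "(if x + y \<in> elems (tensor {a}) then \<rho> (ent a a (x + y)) else 0) =
      (if x \<in> elems (tensor {a}) then \<rho> (ent a a x) else 0) + (if y \<in> elems (tensor {a}) then \<rho> (ent a a y) else 0)"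
      if xy: "x \<in> elems (tensor {a})" "y \<in> elems (tensor {a})" for x y
      using xy M.add_mem[OF xy] by (simp only: if_True ent_linear predual_plus[OF \<rho> tensor_single(1) tensor_single(1)])
    show "(if smul2 c x \<in> elems (tensor {a}) then \<rho> (ent a a (smul2 c x)) else 0) =
      c * (if x \<in> elems (tensor {a}) then \<rho> (ent a a x) else 0)" if x: "x \<in> elems (tensor {a})" for c x
      using x M.smul_mem[OF x] by (simp only: if_True ent_linear predual_scale[OF \<rho> tensor_single(1)])
    show "continuous_map (ultraweak (tensor {a})) euclidean (\<lambda>z. if z \<in> elems (tensor {a}) then \<rho> (ent a a z) else 0)"
      by (rule continuous_map_eq[OF continuous_map_compose[OF continuous_ent_single predual_continuous[OF \<rho>]]]) simp
  qed simp
qed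

lemma Nor_full_single:
  assumes \<phi>: "\<phi> \<in> Nor (full {a}) A" shows "\<phi> = mat_map {a} (\<lambda>_ _. \<phi> (id_op {a}))"
proof (rule ext)
  fix X
  show "\<phi> X = mat_map {a} (\<lambda>_ _. \<phi> (id_op {a})) X"
  proof (cases "X \<in> bounded_ops {a}")
    case True
    have "\<phi> X = \<phi> (smul2 (X (basis2 a) a) (id_op {a}))" by (rule arg_cong[OF single_expand[OF True]])
    also have "\<dots> = smul1 (X (basis2 a) a) (\<phi> (id_op {a}))" by (rule Nor_smul[OF \<phi>]) simp
    also have "\<dots> = mat_map {a} (\<lambda>_ _. \<phi> (id_op {a})) X" unfolding mat_map_def using True by simp
    finally show ?thesis .
  next
    case False
    then show ?thesis using Nor_outside[OF \<phi>, of X] by (simp only: mat_map_def if_False opalg.sel not_False_eq_True)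
  qed
qed

end

text \<open>The other clauses hold for the adjoint of every additive map of the cone, so only the
  condition on pairs remains.\<close>

lemma (in cone_map) two_antipositive_R:
  assumes "\<And>x1 x2 f1 f2. x1 \<in> elems A \<Longrightarrow> x2 \<in> elems A \<Longrightarrow> f1 \<in> l2 J \<Longrightarrow> f2 \<in> l2 J \<Longrightarrow>
       inner2 (R (adj J x1 \<circ> x1) f1) f1 + inner2 (R (adj J x1 \<circ> x2) f1) f2 +
       inner2 (R (adj J x2 \<circ> x1) f2) f1 + inner2 (R (adj J x2 \<circ> x2) f2) f2 \<in> \<real>\<^sub>\<ge>\<^sub>0"
  shows "two_antipositive R"
  unfolding two_antipositive_def
  by (intro conjI ballI allI impI)
    ((rule R_elems, assumption) | (rule R_add, assumption, assumption) | (rule R_smul, assumption) |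
     (rule R_adj, assumption) | (rule R_positive, assumption, assumption) |
     (rule assms, assumption, assumption, assumption, assumption))+

text \<open>\<open>F1\<close> and \<open>F2\<close> are the assignments for \<complex> and for the
  two by two matrices, acting on the bases \<open>e 0\<close> and \<open>e 0\<close>,
  \<open>e 1\<close>.\<close>

locale corner_choi = vn_algebra A for A :: "'j opalg" +
  fixes e :: "nat \<Rightarrow> 'u" and F1 F2 :: "('u opr \<Rightarrow> 'j opr \<Rightarrow> complex) \<Rightarrow> ('u \<times> 'j) opr \<Rightarrow> complex"
  assumes e01: "e 0 \<noteq> e 1"
    and onto1: "F1 ` Nor (full {e 0}) A = predual (tensor {e 0})"
    and onto2: "F2 ` Nor (full {e 0, e 1}) A = predual (tensor {e 0, e 1})"
    and match1: "\<phi> \<in> Nor (full {e 0}) A \<Longrightarrow>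
      completely_positive (full {e 0}) A \<phi> \<longleftrightarrow> F1 \<phi> \<in> predual_pos (tensor {e 0})"
    and match2: "\<phi> \<in> Nor (full {e 0, e 1}) A \<Longrightarrow>
      completely_positive (full {e 0, e 1}) A \<phi> \<longleftrightarrow> F2 \<phi> \<in> predual_pos (tensor {e 0, e 1})"
    and corners: "projection {e 0, e 1} p \<Longrightarrow> \<phi> \<in> Nor (full {e 0, e 1}) A \<Longrightarrow>
      F1 (comp_on (full {e 0}) \<phi> (corner e p)) =
      comp_on (tensor {e 0}) (F2 \<phi>) (tensor_id (full {e 0}) (full {e 0, e 1}) A (corner e p))"
begin

abbreviation "E \<equiv> {e 0, e 1}"
abbreviation "amp \<equiv> tensor_op {e 0} J (id_op {e 0})"

text \<open>The assignment for the algebra \<complex>, where a map is identified with its value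
  \<psi> at the identity and \<complex> \<otimes> A with A through \<open>amp\<close>.\<close>

definition theta :: "('j opr \<Rightarrow> complex) \<Rightarrow> 'j opr \<Rightarrow> complex" where
  "theta \<psi> y = (if y \<in> elems A then F1 (mat_map {e 0} (\<lambda>_ _. \<psi>)) (amp y) else 0)"

lemma single_Nor: "\<psi> \<in> predual A \<Longrightarrow> mat_map {e 0} (\<lambda>_ _. \<psi>) \<in> Nor (full {e 0}) A"
  by (rule mat_map_Nor) auto

lemma F1_predual: "\<phi> \<in> Nor (full {e 0}) A \<Longrightarrow> F1 \<phi> \<in> predual (tensor {e 0})"
  using onto1 by blast

lemma F2_predual: "\<phi> \<in> Nor (full E) A \<Longrightarrow> F2 \<phi> \<in> predual (tensor E)"
  using onto2 by blast

lemma theta_predual: "\<psi> \<in> predual A \<Longrightarrow> theta \<psi> \<in> predual A"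
  unfolding theta_def[abs_def] by (rule predual_tensor_op[OF F1_predual[OF single_Nor]]) auto

lemma theta_pos: assumes \<psi>: "\<psi> \<in> predual_pos A" shows "theta \<psi> \<in> predual_pos A"
proof (rule predual_posI)
  interpret M: op_space "tensor {e 0}" by (rule tensor_op_space)
  show "theta \<psi> \<in> predual A" by (rule theta_predual[OF predual_pos_predual[OF \<psi>]])
  fix y assume y: "y \<in> elems A" "positive_op J y"
  have "F1 (mat_map {e 0} (\<lambda>_ _. \<psi>)) \<in> predual_pos (tensor {e 0})"
    using match1[OF single_Nor[OF predual_pos_predual[OF \<psi>]]] scalar_mat_map_completely_positive[OF \<psi>, of "e 0"] by blast
  from M.predual_pos_nonneg[OF this tensor_mem[OF _ id_op_bop y(1)]] amplification_positive[OF y(2), of "e 0"]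
  show "theta \<psi> y \<in> \<real>\<^sub>\<ge>\<^sub>0" using y(1) by (simp add: theta_def)
qed

text \<open>Every element of \<complex> \<otimes> A has the form \<open>amp y\<close>, so positivity
  passes from \<open>theta \<psi>\<close> to the assigned functional. Matching makes the map
  completely positive, and its value at the identity is \<psi>.\<close>

lemma theta_reflects: assumes \<psi>: "\<psi> \<in> predual A" and p: "theta \<psi> \<in> predual_pos A" shows "\<psi> \<in> predual_pos A"
proof -
  interpret M: op_space "tensor {e 0}" by (rule tensor_op_space)
  let ?\<phi> = "mat_map {e 0} (\<lambda>_ _. \<psi>)"
  have N: "?\<phi> \<in> Nor (full {e 0}) A" by (rule single_Nor[OF \<psi>])
  have "F1 ?\<phi> \<in> predual_pos (tensor {e 0})"
  proof (rule M.predual_posI[OF F1_predual[OF N]])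
    fix z assume z: "z \<in> elems (tensor {e 0})" "positive_op (index (tensor {e 0})) z"
    note s = tensor_single[OF z(1)]
    have "theta \<psi> (ent (e 0) (e 0) z) \<in> \<real>\<^sub>\<ge>\<^sub>0"
      by (rule predual_pos_nonneg[OF p s(1) ent_positive]) (use z(2) in simp)
    moreover have "theta \<psi> (ent (e 0) (e 0) z) = F1 ?\<phi> z"
      unfolding theta_def using s(1) by (simp only: if_True s(2)[symmetric])
    ultimately show "F1 ?\<phi> z \<in> \<real>\<^sub>\<ge>\<^sub>0" by (simp only:)
  qed
  then have cp: "completely_positive (full {e 0}) A ?\<phi>" using match1[OF N] by blast
  interpret F: vn_algebra "full {e 0}" by (rule full_algebra)
  have "?\<phi> (id_op {e 0}) \<in> predual_pos A"
    by (rule cp_positive[OF cp _ N]) (use F.id_positive in auto)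
  moreover have "?\<phi> (id_op {e 0}) = \<psi>"
  proof -
    have one: "basis2 (e 0) \<in> l2 {e 0}" by auto
    have id1: "id_op {e 0} (basis2 (e 0)) (e 0) = 1" unfolding id_op_def if_P[OF one] by (simp add: basis2_def)
    have "?\<phi> (id_op {e 0}) = smul1 (id_op {e 0} (basis2 (e 0)) (e 0)) \<psi>"
      unfolding mat_map_def if_P[OF id_op_bop] by simp
    then show ?thesis unfolding id1 smul1_simps .
  qed
  ultimately show ?thesis by (simp only:)
qed

text \<open>Naturality at the corner, evaluated at 1 \<otimes> y: composing \<phi> with the corner
  gives the map of \<complex> with value \<open>\<phi> p\<close> at the identity, and 1 \<otimes> y
  is sent to p \<otimes> y.\<close>

lemma theta_corner:
  assumes \<phi>: "\<phi> \<in> Nor (full E) A" and p: "projection E p" and y: "y \<in> elems A"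
  shows "theta (\<phi> p) y = F2 \<phi> (tensor_op E J p y)"
proof -
  have pb: "p \<in> bounded_ops E" using p by (simp add: projection_def)
  have "comp_on (full {e 0}) \<phi> (corner e p) = mat_map {e 0} (\<lambda>_ _. \<phi> p)"
  proof (rule ext)
    fix X
    have c: "corner e p X = smul2 (X (basis2 (e 0)) (e 0)) p" by (simp add: corner_def basis2_def)
    have s: "\<phi> (smul2 (X (basis2 (e 0)) (e 0)) p) = smul1 (X (basis2 (e 0)) (e 0)) (\<phi> p)"
      by (rule Nor_smul[OF \<phi>]) (use pb in simp)
    show "comp_on (full {e 0}) \<phi> (corner e p) X = mat_map {e 0} (\<lambda>_ _. \<phi> p) X"
      unfolding comp_on_def mat_map_def c s by simp
  qed
  then have "theta (\<phi> p) y = F1 (comp_on (full {e 0}) \<phi> (corner e p)) (amp y)" using y by (simp only: theta_def if_True)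
  also have "\<dots> = comp_on (tensor {e 0}) (F2 \<phi>) (tensor_id (full {e 0}) (full E) A (corner e p)) (amp y)"
    by (simp only: corners[OF p \<phi>])
  also have "\<dots> = F2 \<phi> (tensor_id (full {e 0}) (full E) A (corner e p) (amp y))"
    unfolding comp_on_def using tensor_mem[OF _ id_op_bop y, of "{e 0}"] by (simp only: if_True finite.emptyI finite.insertI)
  also have "\<dots> = F2 \<phi> (tensor_op E J p y)" by (subst tensor_id_corner[OF _ pb y]) auto
  finally show ?thesis .
qed

lemma finite_E: "finite E" by simp

lemma unit_projection: "a \<in> E \<Longrightarrow> projection E (mat_unit E a a)"
  unfolding mat_unit_outer by (rule outer_projection) (simp_all add: inner2_basis2, simp add: basis2_def)

lemma id_projection: "projection E (id_op E)"
  by (simp add: projection_def)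

lemma id_E: "id_op E = mat_unit E (e 0) (e 0) + mat_unit E (e 1) (e 1)"
proof (rule op_eqI[of _ E])
  fix f assume f: "f \<in> l2 E"
  have "f = (\<Sum>i\<in>E. smul1 (f i) (basis2 i))" by (rule finite_expansion) (use l2_zeroD[OF f] in auto)
  also have "\<dots> = smul1 (f (e 0)) (basis2 (e 0)) + smul1 (f (e 1)) (basis2 (e 1))" using e01 by simp
  finally show "id_op E f = (mat_unit E (e 0) (e 0) + mat_unit E (e 1) (e 1)) f" using f by (simp add: mat_unit_def)
qed auto

text \<open>One map carries \<psi> and \<psi>' as its diagonal values. The corners at the two
  diagonal units and at their sum, the identity, are all computed by the same functional
  \<open>F2 \<phi>\<close>, which is additive. Only the diagonal values of \<phi> enter.\<close>

lemma theta_add: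
  assumes \<psi>: "\<psi> \<in> predual A" "\<psi>' \<in> predual A" shows "theta (\<psi> + \<psi>') = theta \<psi> + theta \<psi>'"
proof (rule predual_eqI)
  interpret M: op_space "tensor E" by (rule tensor_op_space)
  show "theta (\<psi> + \<psi>') \<in> predual A" "theta \<psi> + theta \<psi>' \<in> predual A" using \<psi> by (auto intro!: theta_predual)
  define \<phi> where "\<phi> = mat_map E (\<lambda>i j. if i = e 0 then \<psi> else \<psi>')"
  have N: "\<phi> \<in> Nor (full E) A" unfolding \<phi>_def by (rule mat_map_Nor) (use \<psi> in auto)
  have u: "\<phi> (mat_unit E (e 0) (e 0)) = \<psi>" "\<phi> (mat_unit E (e 1) (e 1)) = \<psi>'"
    unfolding \<phi>_def using e01 by (simp_all add: mat_map_unit)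
  have i: "\<phi> (id_op E) = \<psi> + \<psi>'" unfolding id_E u[symmetric] by (rule Nor_add[OF N]) auto
  have b: "mat_unit E (e 0) (e 0) \<in> bounded_ops E" "mat_unit E (e 1) (e 1) \<in> bounded_ops E" by auto
  fix y assume y: "y \<in> elems A"
  have "theta (\<psi> + \<psi>') y = F2 \<phi> (tensor_op E J (id_op E) y)"
    using theta_corner[OF N id_projection y] unfolding i .
  also have "\<dots> = F2 \<phi> (tensor_op E J (mat_unit E (e 0) (e 0)) y) + F2 \<phi> (tensor_op E J (mat_unit E (e 1) (e 1)) y)"
    unfolding id_E tensor_op_linear(3)[OF finite_E b elem_bop[OF y] elem_bop[OF y]]
    by (rule M.predual_plus[OF F2_predual[OF N] tensor_mem[OF finite_E b(1) y] tensor_mem[OF finite_E b(2) y]])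
  also have "\<dots> = theta \<psi> y + theta \<psi>' y"
    using theta_corner[OF N unit_projection y, of "e 0"] theta_corner[OF N unit_projection y, of "e 1"] unfolding u by simp
  finally show "theta (\<psi> + \<psi>') y = (theta \<psi> + theta \<psi>') y" by (simp only: fun_apply1)
qed

text \<open>Equal images make the image of each difference 0, which is positive. Since \<theta>
  reflects positivity, both differences are positive.\<close>

lemma theta_inj: "inj_on theta (predual_pos A)"
proof (rule inj_onI)
  fix \<psi> \<psi>' assume m: "\<psi> \<in> predual_pos A" "\<psi>' \<in> predual_pos A" and eq: "theta \<psi> = theta \<psi>'"
  have p: "\<psi> - \<psi>' \<in> predual_pos A" if m: "\<psi> \<in> predual A" "\<psi>' \<in> predual A" and eq: "theta \<psi> = theta \<psi>'" for \<psi> \<psi>'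
  proof (rule theta_reflects)
    show d: "\<psi> - \<psi>' \<in> predual A" using m by simp
    have "theta (\<psi> - \<psi>') + theta \<psi>' = theta \<psi>" unfolding theta_add[OF d m(2), symmetric] by (simp only: diff_add_cancel)
    then have "theta (\<psi> - \<psi>') = 0" unfolding eq by (simp only: add_cancel_left_left)
    then show "theta (\<psi> - \<psi>') \<in> predual_pos A" by simp
  qed
  have m': "\<psi> \<in> predual A" "\<psi>' \<in> predual A" using m by auto
  show "\<psi> = \<psi>'"
  proof (rule predual_eq_on_positive[OF m'])
    fix b assume b: "b \<in> elems A" "positive_op J b"
    have "(\<psi> - \<psi>') b \<in> \<real>\<^sub>\<ge>\<^sub>0" "(\<psi>' - \<psi>) b \<in> \<real>\<^sub>\<ge>\<^sub>0"
      using predual_pos_nonneg[OF p[OF m' eq] b] predual_pos_nonneg[OF p[OF m'(2,1) eq[symmetric]] b] by auto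
    then show "\<psi> b = \<psi>' b" by (auto simp: complex_nonneg_Reals_iff complex_eq_iff)
  qed
qed

text \<open>Transported to \<complex> \<otimes> A, the functional is assigned to some \<phi>.
  Matching makes \<phi> completely positive, so its value at the identity lies in the cone.\<close>

lemma theta_onto: assumes \<rho>: "\<rho> \<in> predual_pos A" shows "\<rho> \<in> theta ` predual_pos A"
proof -
  interpret M: op_space "tensor {e 0}" by (rule tensor_op_space)
  interpret F: vn_algebra "full {e 0}" by (rule full_algebra)
  define \<rho>' where "\<rho>' z = (if z \<in> elems (tensor {e 0}) then \<rho> (ent (e 0) (e 0) z) else 0)" for z
  have r: "\<rho>' \<in> predual (tensor {e 0})" unfolding \<rho>'_def[abs_def] by (rule predual_ent) (use \<rho> in simp)
  have rp: "\<rho>' \<in> predual_pos (tensor {e 0})"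
  proof (rule M.predual_posI[OF r])
    fix z assume z: "z \<in> elems (tensor {e 0})" "positive_op (index (tensor {e 0})) z"
    have "positive_op J (ent (e 0) (e 0) z)" using z(2) by (intro ent_positive) simp
    from predual_pos_nonneg[OF \<rho> tensor_single(1)[OF z(1)] this] show "\<rho>' z \<in> \<real>\<^sub>\<ge>\<^sub>0"
      using z(1) by (simp only: \<rho>'_def if_True)
  qed
  have "\<rho>' \<in> F1 ` Nor (full {e 0}) A" unfolding onto1 by (rule r)
  then obtain \<phi> where \<phi>: "\<phi> \<in> Nor (full {e 0}) A" "F1 \<phi> = \<rho>'"
    by (rule imageE) (rule that, assumption, rule sym, assumption)
  have cp: "completely_positive (full {e 0}) A \<phi>" using match1[OF \<phi>(1)] rp unfolding \<phi>(2) by blast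
  have pos: "\<phi> (id_op {e 0}) \<in> predual_pos A" by (rule cp_positive[OF cp _ \<phi>(1)]) (use F.id_positive in auto)
  have "theta (\<phi> (id_op {e 0})) = \<rho>"
  proof (rule predual_eqI)
    show "theta (\<phi> (id_op {e 0})) \<in> predual A" "\<rho> \<in> predual A" using pos \<rho> by (auto intro: theta_predual)
    fix y assume y: "y \<in> elems A"
    have "theta (\<phi> (id_op {e 0})) y = \<rho>' (amp y)"
      using y Nor_full_single[OF \<phi>(1)] \<phi>(2) by (simp only: theta_def if_True)
    also have "\<dots> = \<rho> y"
      using tensor_mem[OF _ id_op_bop y, of "{e 0}"]
      by (simp only: \<rho>'_def if_True finite.emptyI finite.insertI ent_amplification[OF elem_bop[OF y]])
    finally show "theta (\<phi> (id_op {e 0})) y = \<rho> y" .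
  qed
  then show ?thesis using pos by blast
qed

definition theta_inv :: "('j opr \<Rightarrow> complex) \<Rightarrow> 'j opr \<Rightarrow> complex" where
  "theta_inv = inv_into (predual_pos A) theta"

lemma theta_inv:
  "\<omega> \<in> predual_pos A \<Longrightarrow> theta_inv \<omega> \<in> predual_pos A"
  "\<omega> \<in> predual_pos A \<Longrightarrow> theta (theta_inv \<omega>) = \<omega>"
  "\<omega> \<in> predual_pos A \<Longrightarrow> theta_inv (theta \<omega>) = \<omega>"
  unfolding theta_inv_def using inv_into_into[OF theta_onto] f_inv_into_f[OF theta_onto] inv_into_f_f[OF theta_inj] by blast+

lemma cone_theta: "cone_map A theta"
  by unfold_locales (use theta_pos theta_add in \<open>auto simp: predual_pos_predual\<close>)

lemma cone_theta_inv: "cone_map A theta_inv"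
proof unfold_locales
  show "theta_inv \<omega> \<in> predual_pos A" if "\<omega> \<in> predual_pos A" for \<omega> using theta_inv(1)[OF that] .
  fix \<omega> \<rho> assume w: "\<omega> \<in> predual_pos A" "\<rho> \<in> predual_pos A"
  have "theta (theta_inv \<omega> + theta_inv \<rho>) = \<omega> + \<rho>"
    using theta_add[OF predual_pos_predual predual_pos_predual, OF theta_inv(1)[OF w(1)] theta_inv(1)[OF w(2)]]
    unfolding theta_inv(2)[OF w(1)] theta_inv(2)[OF w(2)] .
  then show "theta_inv (\<omega> + \<rho>) = theta_inv \<omega> + theta_inv \<rho>"
    using theta_inv(3)[OF add_pos[OF theta_inv(1)[OF w(1)] theta_inv(1)[OF w(2)]]] by (simp only:)
qed

sublocale c: cone_map A theta by (rule cone_theta)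
sublocale d: cone_map A theta_inv by (rule cone_theta_inv)

text \<open>Both sides are linear in the matrix argument. At a rank one projection they agree by
  \<open>theta_corner\<close>, since complete positivity puts the value of \<phi> in the cone, where
  \<open>T\<close> is \<theta>; \<open>outer_vanishes\<close> extends this to matrix units.\<close>

lemma F2_unit:
  assumes \<phi>: "\<phi> \<in> Nor (full E) A" and cp: "completely_positive (full E) A \<phi>"
    and ab: "a \<in> E" "b \<in> E" and y: "y \<in> elems A"
  shows "F2 \<phi> (tensor_op E J (mat_unit E a b) y) = c.T (\<phi> (mat_unit E a b)) y"
proof -
  interpret M: op_space "tensor E" by (rule tensor_op_space)
  have yb: "y \<in> bounded_ops J" using y by simp
  have pr: "\<phi> X \<in> predual A" if "X \<in> bounded_ops E" for X by (rule Nor_predual[OF \<phi>]) (use that in simp)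
  have tm: "tensor_op E J X y \<in> elems (tensor E)" if "X \<in> bounded_ops E" for X by (rule tensor_mem[OF finite_E that y])
  define G where "G X = F2 \<phi> (tensor_op E J X y) - c.T (\<phi> X) y" for X
  have "G (outer E (basis2 a) (basis2 b)) = 0"
  proof (rule outer_vanishes)
    show "basis2 a \<in> l2 E" "basis2 b \<in> l2 E" by (rule basis2_l2[OF ab(1)] basis2_l2[OF ab(2)])+
    fix X Y assume X: "X \<in> bounded_ops E" and Y: "Y \<in> bounded_ops E"
    have "c.T (\<phi> (X + Y)) = c.T (\<phi> X) + c.T (\<phi> Y)"
      using Nor_add[OF \<phi>, of X Y] X Y by (simp only: opalg.sel c.T_add pr)
    then show "G (X + Y) = G X + G Y"
      unfolding G_def tensor_op_linear(3)[OF finite_E X Y yb yb] M.predual_plus[OF F2_predual[OF \<phi>] tm[OF X] tm[OF Y]] by simp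
  next
    fix k X assume X: "X \<in> bounded_ops E"
    have "c.T (\<phi> (smul2 k X)) = smul1 k (c.T (\<phi> X))"
      using Nor_smul[OF \<phi>, of X k] X by (simp only: opalg.sel c.T_smul pr)
    then show "G (smul2 k X) = k * G X"
      unfolding G_def tensor_op_linear(4)[OF finite_E X X yb yb] M.predual_scale[OF F2_predual[OF \<phi>] tm[OF X]]
      by (simp add: right_diff_distrib)
  next
    fix v :: "'u vec" assume v: "v \<in> l2 E" "inner2 v v = 1"
    have "\<phi> (outer E v v) \<in> predual_pos A" by (rule cp_positive[OF cp finite_E \<phi> outer_positive[OF v(1)]])
    then have "c.T (\<phi> (outer E v v)) = theta (\<phi> (outer E v v))" by (rule c.T_pos)
    then show "G (outer E v v) = 0" unfolding G_def using theta_corner[OF \<phi> outer_projection[OF v] y] by simp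
  qed
  then show ?thesis unfolding G_def mat_unit_outer by simp
qed

lemma sum_E: "(\<Sum>i\<in>E. g i) = g (e 0) + g (e 1)" for g :: "'u \<Rightarrow> complex"
  using e01 by simp

lemma R_two_antipositive: "two_antipositive c.R"
proof -
  interpret M: op_space "tensor E" by (rule tensor_op_space)
  have "inner2 (c.R (adj J x1 \<circ> x1) f1) f1 + inner2 (c.R (adj J x1 \<circ> x2) f1) f2 +
       inner2 (c.R (adj J x2 \<circ> x1) f2) f1 + inner2 (c.R (adj J x2 \<circ> x2) f2) f2 \<in> \<real>\<^sub>\<ge>\<^sub>0"
    if x: "x1 \<in> elems A" "x2 \<in> elems A" and f: "f1 \<in> l2 J" "f2 \<in> l2 J" for x1 x2 f1 f2
  proof -
    define X where "X i = (if i = e 0 then x1 else x2)" for i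
    define h where "h i = (if i = e 0 then f1 else f2)" for i
    have X: "X i \<in> elems A" and h: "h i \<in> l2 J" for i using x f by (auto simp: X_def h_def)
    have XX: "adj J (X i) \<circ> X j \<in> elems A" for i j using X by auto
    define \<phi> where "\<phi> = mat_map E (\<lambda>i j. vec_functional A (h i) (h j))"
    have N: "\<phi> \<in> Nor (full E) A" unfolding \<phi>_def by (rule mat_map_Nor) (use h in auto)
    have cp: "completely_positive (full E) A \<phi>" unfolding \<phi>_def by (rule vec_mat_map_completely_positive) (use h in auto)
    have u: "\<phi> (mat_unit E i j) = vec_functional A (h i) (h j)" if "i \<in> E" "j \<in> E" for i j
      unfolding \<phi>_def by (rule mat_map_unit[OF finite_E that])
    define t where "t i j = tensor_op E J (mat_unit E i j) (adj J (X i) \<circ> X j)" for i j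
    have tm: "t i j \<in> elems (tensor E)" if "i \<in> E" "j \<in> E" for i j
      unfolding t_def by (rule tensor_mem[OF finite_E mat_unit_bop[OF that] XX])
    define Z where "Z = (\<Sum>i\<in>E. \<Sum>j\<in>E. t i j)"
    have Zm: "Z \<in> elems (tensor E)" unfolding Z_def by (intro M.sum_mem tm)
    \<comment> \<open>\<open>Z\<close> is written with elementary tensors so that
      \<open>F2_unit\<close> applies to each summand, and recognised as a Gram matrix for
      positivity.\<close>
    have "Z = block E J (\<lambda>i j. adj J (X i) \<circ> X j)"
    proof (rule block_eqI[OF finite_E])
      show "Z \<in> bounded_ops (E \<times> J)" using M.elem_bop[OF Zm] by simp
      show "block E J (\<lambda>i j. adj J (X i) \<circ> X j) \<in> bounded_ops (E \<times> J)" by (rule block_bop[OF finite_E elem_bop[OF XX]])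
      fix i j assume ij: "i \<in> E" "j \<in> E"
      have "ent i j Z = (\<Sum>k\<in>E. \<Sum>l\<in>E. ent i j (t k l))" unfolding Z_def ent_sum ..
      also have "\<dots> = (\<Sum>k\<in>E. \<Sum>l\<in>E. if l = j then (if k = i then adj J (X i) \<circ> X j else 0) else 0)"
      proof (intro sum.cong refl)
        fix k l assume kl: "k \<in> E" "l \<in> E"
        have "ent i j (t k l) = smul2 (if i = k \<and> j = l then 1 else 0) (adj J (X k) \<circ> X l)"
          unfolding t_def ent_tensor[OF finite_E mat_unit_bop[OF kl] elem_bop[OF XX] ij] mat_unit_entry[OF kl(2) ij(2)] ..
        then show "ent i j (t k l) = (if l = j then (if k = i then adj J (X i) \<circ> X j else 0) else 0)"
          by (cases "k = i"; cases "l = j") auto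
      qed
      also have "\<dots> = (\<Sum>k\<in>E. if k = i then adj J (X i) \<circ> X j else 0)"
        by (intro sum.cong refl) (simp only: sum.delta[OF finite_E] ij if_True)
      also have "\<dots> = adj J (X i) \<circ> X j" by (simp only: sum.delta[OF finite_E] ij if_True)
      also have "\<dots> = ent i j (block E J (\<lambda>i j. adj J (X i) \<circ> X j))"
        by (rule ent_block[OF finite_E ij elem_bop[OF XX], symmetric])
      finally show "ent i j Z = ent i j (block E J (\<lambda>i j. adj J (X i) \<circ> X j))" .
    qed
    then have Zp: "positive_op (index (tensor E)) Z" using gram_block_positive[OF finite_E, of X J] X by simp
    have "F2 \<phi> \<in> predual_pos (tensor E)" using match2[OF N] cp by blast
    from M.predual_pos_nonneg[OF this Zm Zp] have "F2 \<phi> Z \<in> \<real>\<^sub>\<ge>\<^sub>0" .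
    also have "F2 \<phi> Z = (\<Sum>i\<in>E. F2 \<phi> (\<Sum>j\<in>E. t i j))"
      unfolding Z_def by (rule M.predual_sum[OF F2_predual[OF N] finite_E]) (rule M.sum_mem, rule tm)
    also have "\<dots> = (\<Sum>i\<in>E. \<Sum>j\<in>E. F2 \<phi> (t i j))"
    proof (rule sum.cong[OF refl])
      fix i assume i: "i \<in> E"
      show "F2 \<phi> (\<Sum>j\<in>E. t i j) = (\<Sum>j\<in>E. F2 \<phi> (t i j))"
        by (rule M.predual_sum[OF F2_predual[OF N] finite_E]) (rule tm[OF i])
    qed
    also have "\<dots> = (\<Sum>i\<in>E. \<Sum>j\<in>E. inner2 (c.R (adj J (X i) \<circ> X j) (h i)) (h j))"
      by (intro sum.cong refl) (simp only: t_def F2_unit[OF N cp _ _ XX] u c.inner2_R[OF XX h h])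
    finally have "(\<Sum>i\<in>E. \<Sum>j\<in>E. inner2 (c.R (adj J (X i) \<circ> X j) (h i)) (h j)) \<in> \<real>\<^sub>\<ge>\<^sub>0" .
    then show ?thesis unfolding sum_E using e01 by (simp add: X_def h_def add.assoc)
  qed
  then show ?thesis by (rule c.two_antipositive_R)
qed

lemma R_inverses:
  assumes x: "x \<in> elems A" shows "c.R (d.R x) = x" "d.R (c.R x) = x"
  using R_inverse[where A=A and \<theta>=theta and \<theta>'=theta_inv, OF cone_theta cone_theta_inv _ x]
    R_inverse[where A=A and \<theta>=theta_inv and \<theta>'=theta, OF cone_theta_inv cone_theta _ x] theta_inv(2,3)
  by simp_all

text \<open>Used for off-diagonal values of \<phi>, which lie outside the cone where
  \<open>theta_inv\<close> inverts \<theta>; obtained from \<open>R_inverses\<close> by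
  duality.\<close>

lemma T_inverse: assumes \<omega>: "\<omega> \<in> predual A" and x: "x \<in> elems A" shows "d.T (c.T \<omega>) x = \<omega> x"
proof -
  have "d.T (c.T \<omega>) x = c.T \<omega> (d.R x)" by (rule d.functional_R[OF c.T_predual[OF \<omega>] x, symmetric])
  also have "\<dots> = \<omega> (c.R (d.R x))" by (rule c.functional_R[OF \<omega> d.R_elems[OF x], symmetric])
  also have "c.R (d.R x) = x" by (rule R_inverses(1)[OF x])
  finally show ?thesis .
qed

text \<open>The direct sum \<zeta> of the two vectors defines a vector functional on the tensor
  product. It is assigned to some \<phi>, completely positive by matching, and \<open>eq\<close>
  computes the values of \<phi> through the inverse of \<open>T\<close>, with \<open>h i\<close> and
  \<open>h j\<close> exchanged.\<close>

lemma R_inv_two_antipositive: "two_antipositive d.R"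
proof -
  interpret M: op_space "tensor E" by (rule tensor_op_space)
  have "inner2 (d.R (adj J x1 \<circ> x1) f1) f1 + inner2 (d.R (adj J x1 \<circ> x2) f1) f2 +
       inner2 (d.R (adj J x2 \<circ> x1) f2) f1 + inner2 (d.R (adj J x2 \<circ> x2) f2) f2 \<in> \<real>\<^sub>\<ge>\<^sub>0"
    if x: "x1 \<in> elems A" "x2 \<in> elems A" and f: "f1 \<in> l2 J" "f2 \<in> l2 J" for x1 x2 f1 f2
  proof -
    define X where "X i = (if i = (0 :: nat) then x1 else x2)" for i
    define h where "h i = (if i = e 0 then f1 else f2)" for i
    have X: "X i \<in> elems A" and h: "h j \<in> l2 J" for i j using x f by (auto simp: X_def h_def)
    have XX: "adj J (X i) \<circ> X j \<in> elems A" for i j using X by auto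
    define \<zeta> where "\<zeta> = (\<Sum>i\<in>E. emb i (h i))"
    have \<zeta>: "\<zeta> \<in> l2 (E \<times> J)" unfolding \<zeta>_def by (rule l2_sum) (use h in auto)
    have sl: "slice i \<zeta> = h i" if "i \<in> E" for i
      unfolding \<zeta>_def slice_sum slice_simps using that by (simp only: sum.delta'[OF finite_E] if_True)
    define \<omega> where "\<omega> = vec_functional (tensor E) \<zeta> \<zeta>"
    have \<omega>: "\<omega> \<in> predual_pos (tensor E)" unfolding \<omega>_def by (rule M.vec_functional_pos) (use \<zeta> in simp)
    have "\<omega> \<in> F2 ` Nor (full E) A" unfolding onto2 by (rule M.predual_pos_predual[OF \<omega>])
    then obtain \<phi> where \<phi>: "\<phi> \<in> Nor (full E) A" "F2 \<phi> = \<omega>"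
      by (rule imageE) (rule that, assumption, rule sym, assumption)
    have cp: "completely_positive (full E) A \<phi>" using match2[OF \<phi>(1)] \<omega> unfolding \<phi>(2) by blast
    have eq: "\<phi> (mat_unit E i j) = d.T (vec_functional A (h j) (h i))" if ij: "i \<in> E" "j \<in> E" for i j
    proof -
      have pr: "\<phi> (mat_unit E i j) \<in> predual A" by (rule Nor_predual[OF \<phi>(1)]) (use ij in simp)
      have "c.T (\<phi> (mat_unit E i j)) = vec_functional A (h j) (h i)"
      proof (rule predual_eqI)
        show "c.T (\<phi> (mat_unit E i j)) \<in> predual A" by (rule c.T_predual[OF pr])
        show "vec_functional A (h j) (h i) \<in> predual A" by (rule vec_functional_predual[OF h h])
        fix y assume y: "y \<in> elems A"
        have yb: "y \<in> bounded_ops J" using y by simp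
        let ?t = "tensor_op E J (mat_unit E i j) y"
        have tb: "?t \<in> bounded_ops (E \<times> J)" by (rule tensor_op_bop[OF finite_E mat_unit_bop[OF ij] yb])
        have "c.T (\<phi> (mat_unit E i j)) y = \<omega> ?t" using F2_unit[OF \<phi>(1) cp ij y] unfolding \<phi>(2) by (rule sym)
        also have "\<dots> = inner2 (?t \<zeta>) \<zeta>"
          unfolding \<omega>_def vec_functional_def using tensor_mem[OF finite_E mat_unit_bop[OF ij] y] by (simp only: if_True)
        also have "\<dots> = (\<Sum>k\<in>E. \<Sum>l\<in>E. if l = j then (if k = i then inner2 (y (h j)) (h i) else 0) else 0)"
          unfolding inner2_entries[OF tb finite_E \<zeta> \<zeta>]
        proof (intro sum.cong refl)
          fix k l assume kl: "k \<in> E" "l \<in> E"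
          have "inner2 (ent k l ?t (slice l \<zeta>)) (slice k \<zeta>) = (if k = i \<and> l = j then 1 else 0) * inner2 (y (h l)) (h k)"
            unfolding ent_tensor[OF finite_E mat_unit_bop[OF ij] yb kl] mat_unit_entry[OF ij(2) kl(2)] smul2_apply
              inner2_smul_left sl[OF kl(1)] sl[OF kl(2)] ..
          then show "inner2 (ent k l ?t (slice l \<zeta>)) (slice k \<zeta>) = (if l = j then (if k = i then inner2 (y (h j)) (h i) else 0) else 0)"
            by simp
        qed
        also have "\<dots> = (\<Sum>k\<in>E. if k = i then inner2 (y (h j)) (h i) else 0)"
          by (intro sum.cong refl) (simp only: sum.delta[OF finite_E] ij if_True)
        also have "\<dots> = inner2 (y (h j)) (h i)" by (simp only: sum.delta[OF finite_E] ij if_True)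
        finally show "c.T (\<phi> (mat_unit E i j)) y = vec_functional A (h j) (h i) y"
          using y by (simp only: vec_functional_def if_True)
      qed
      then have "d.T (vec_functional A (h j) (h i)) = d.T (c.T (\<phi> (mat_unit E i j)))" by (simp only:)
      also have "\<dots> = \<phi> (mat_unit E i j)"
        by (rule predual_eqI[OF d.T_predual[OF c.T_predual[OF pr]] pr T_inverse[OF pr]])
      finally show ?thesis by (rule sym)
    qed
    \<comment> \<open>\<open>cp_gram\<close> pairs the unit at (i, j) with the transposed product;
      together with the exchanged vectors in \<open>eq\<close> this is the condition on pairs for
      \<open>d.R\<close>.\<close>
    have "(\<Sum>i<2. \<Sum>j<2. \<phi> (mat_unit E (e i) (e j)) (adj J (X j) \<circ> X i)) \<in> \<real>\<^sub>\<ge>\<^sub>0"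
    proof (rule cp_gram[OF cp finite_E])
      show "e i \<in> E" if "i < 2" for i using that by (cases "i = 0") (auto simp: less_2_cases_iff)
      show "X i \<in> elems A" for i by (rule X)
    qed
    also have "(\<Sum>i<2. \<Sum>j<2. \<phi> (mat_unit E (e i) (e j)) (adj J (X j) \<circ> X i)) =
      (\<Sum>i<2. \<Sum>j<2. inner2 (d.R (adj J (X j) \<circ> X i) (h (e j))) (h (e i)))"
    proof (intro sum.cong refl)
      fix i j :: nat assume "i \<in> {..<2}" "j \<in> {..<2}"
      then have "e i \<in> E" "e j \<in> E" by (auto simp: less_2_cases_iff)
      then show "\<phi> (mat_unit E (e i) (e j)) (adj J (X j) \<circ> X i) = inner2 (d.R (adj J (X j) \<circ> X i) (h (e j))) (h (e i))"
        by (simp only: eq d.inner2_R[OF XX h h])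
    qed
    finally have "(\<Sum>i<2. \<Sum>j<2. inner2 (d.R (adj J (X j) \<circ> X i) (h (e j))) (h (e i))) \<in> \<real>\<^sub>\<ge>\<^sub>0" .
    moreover have two: "(\<Sum>i<2. g i) = g 0 + g 1" for g :: "nat \<Rightarrow> complex" by (simp add: numeral_2_eq_2)
    ultimately show ?thesis unfolding two using e01 by (simp add: X_def h_def algebra_simps)
  qed
  then show ?thesis by (rule d.two_antipositive_R)
qed

theorem anti_isomorphic: "anti_isomorphic_to_itself A"
  by (rule anti_isomorphic_of_two_antipositive[OF R_two_antipositive R_inv_two_antipositive
      R_inverses(1) R_inverses(2) c.R_continuous])

end

section \<open>Passage from the family of assignments to the corners\<close>

lemma Mat_1: "Mat e 1 = full {e 0}"
  unfolding Mat_def by (simp add: lessThan_Suc)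

lemma Mat_2: "Mat e 2 = full {e 0, e 1}"
proof -
  have "{..<2 :: nat} = {0, 1}" by auto
  then show ?thesis unfolding Mat_def by simp
qed

text \<open>Shows that naturality at normal star homomorphisms covers the corners. The map is a
  fixed operator times the only matrix coordinate, which is a vector functional and is
  multiplicative on a one-dimensional algebra.\<close>

lemma corner_normal_star_hom:
  assumes p: "projection K p"
  shows "normal_star_hom (full {e 0}) (full K) (corner e p)"
proof -
  interpret F: vn_algebra "full {e 0}" by (rule full_algebra)
  interpret G: vn_algebra "full K" by (rule full_algebra)
  let ?b = "basis2 (e 0)"
  have c: "corner e p x = smul2 (x ?b (e 0)) p" for x by (simp add: corner_def basis2_def)
  have pb: "p \<in> bounded_ops K" and pp: "p \<circ> p = p" and pa: "adj K p = p" using p by (auto simp: projection_def)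
  have b: "?b \<in> l2 {e 0}" by simp
  have coord: "x ?b (e 0) = inner2 (x ?b) ?b" for x by (simp only: inner2_basis2)
  have cont: "continuous_map (ultraweak (full {e 0})) (ultraweak (full K)) (corner e p)"
  proof (rule G.continuous_into_ultraweak)
    show "corner e p x \<in> elems (full K)" for x unfolding c using pb by simp
    fix \<xi> \<eta> assume f: "l2_family (index (full K)) \<xi>" "l2_family (index (full K)) \<eta>"
    have f': "l2_family K \<xi>" "l2_family K \<eta>" using f by auto
    define s where "s = (\<Sum>k. inner2 (p (\<xi> k)) (\<eta> k))"
    have "(\<Sum>k. inner2 (corner e p x (\<xi> k)) (\<eta> k)) = s * inner2 (x ?b) ?b" for x
      unfolding c smul2_apply inner2_smul_left coord s_def
      by (subst suminf_mult[OF series_summable[OF pb f'], of "inner2 (x ?b) ?b"]) (rule mult.commute)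
    moreover have "continuous_map (ultraweak (full {e 0})) euclidean (\<lambda>x. s * inner2 (x ?b) ?b)"
      using continuous_map_compose[OF F.continuous_vec[of ?b ?b], of euclidean "(*) s"] b
      by (simp add: comp_def continuous_map_iff_continuous2 continuous_on_mult_left)
    ultimately show "continuous_map (ultraweak (full {e 0})) euclidean (\<lambda>x. \<Sum>k. inner2 (corner e p x (\<xi> k)) (\<eta> k))"
      by (simp only:)
  qed
  have lin: "linear_on (elems (full {e 0})) smul2 smul2 (corner e p)"
    unfolding linear_on_def c
  proof (intro conjI ballI allI)
    show "smul2 ((x + y) ?b (e 0)) p = smul2 (x ?b (e 0)) p + smul2 (y ?b (e 0)) p" for x y
      by (rule ext) (simp add: smul1_add_left)
    show "smul2 (smul2 k x ?b (e 0)) p = smul2 k (smul2 (x ?b (e 0)) p)" for k x by simp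
  qed
  have star: "corner e p (adj {e 0} x) = adj K (corner e p x)" if x: "x \<in> bounded_ops {e 0}" for x
  proof -
    have "adj {e 0} x ?b (e 0) = cnj (x ?b (e 0))"
      unfolding coord inner2_adj_left[OF x b b] inner2_cnj ..
    then show ?thesis unfolding c adj_smul[OF pb] pa by (simp only:)
  qed
  have mult: "corner e p (x \<circ> y) = corner e p x \<circ> corner e p y"
    if x: "x \<in> bounded_ops {e 0}" and y: "y \<in> bounded_ops {e 0}" for x y
  proof -
    have "y ?b = smul2 (y ?b (e 0)) (id_op {e 0}) ?b" by (rule fun_cong[OF single_expand[OF y]])
    then have "y ?b = smul1 (y ?b (e 0)) ?b" unfolding smul2_apply id_op_apply[OF b] .
    then have "x (y ?b) = smul1 (y ?b (e 0)) (x ?b)" using bop_smul[OF x b] by metis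
    then have e: "(x \<circ> y) ?b (e 0) = y ?b (e 0) * x ?b (e 0)" by (simp only: comp_apply smul1_apply)
    show ?thesis
      unfolding c e comp_smul_left comp_smul_right[OF pb pb] pp smul2_simps by (simp only: mult.commute)
  qed
  show ?thesis
    unfolding normal_star_hom_def normal_map_def opalg.sel using lin cont star mult by (simp only: opalg.sel) blast
qed

text \<open>Specialises the family to the index sets \<open>{e 0}\<close> and
  \<open>{e 0, e 1}\<close>, and the compatibility to n = 2.\<close>

lemma anti_isomorphic_of_corner_compatible:
  assumes N: "von_neumann_algebra N" and e: "e 0 \<noteq> e 1"
    and J: "\<And>A. von_neumann_algebra A \<Longrightarrow> onto_normal_functionals A N (J A) \<and> matches_positivity A N (J A)"
    and compat: "compatible_with_corners e N J"
  shows "anti_isomorphic_to_itself N"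
proof (rule corner_choi.anti_isomorphic, rule corner_choi.intro[OF vn_algebra.intro[OF N]], rule corner_choi_axioms.intro)
  let ?F = "J (full {e 0})" and ?G = "J (full {e 0, e 1})"
  note a = J[OF full_algebra_vn, of "{e 0}"] J[OF full_algebra_vn, of "{e 0, e 1}"]
  show "?F ` Nor (full {e 0}) N = predual (vn_tensor (full {e 0}) N)"
    "?G ` Nor (full {e 0, e 1}) N = predual (vn_tensor (full {e 0, e 1}) N)"
    using a unfolding onto_normal_functionals_def by blast+
  show "completely_positive (full {e 0}) N \<phi> \<longleftrightarrow> ?F \<phi> \<in> predual_pos (vn_tensor (full {e 0}) N)"
    if "\<phi> \<in> Nor (full {e 0}) N" for \<phi> using a(1) that unfolding matches_positivity_def by blast
  show "completely_positive (full {e 0, e 1}) N \<phi> \<longleftrightarrow> ?G \<phi> \<in> predual_pos (vn_tensor (full {e 0, e 1}) N)"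
    if "\<phi> \<in> Nor (full {e 0, e 1}) N" for \<phi> using a(2) that unfolding matches_positivity_def by blast
  fix p \<phi> assume p: "projection {e 0, e 1} p" and \<phi>: "\<phi> \<in> Nor (full {e 0, e 1}) N"
  have "natural_at N J (full {e 0}) (full {e 0, e 1}) (corner e p)"
    using compat[unfolded compatible_with_corners_def, rule_format, of 2 p] p unfolding Mat_1 Mat_2 opalg.sel by simp
  then show "?F (comp_on (full {e 0}) \<phi> (corner e p)) =
      comp_on (vn_tensor (full {e 0}) N) (?G \<phi>) (tensor_id (full {e 0}) (full {e 0, e 1}) N (corner e p))"
    using \<phi> unfolding natural_at_def by blast
qed (rule e)

lemma natural_cj_isomorphism_corner_compatible:
  assumes N: "von_neumann_algebra N" and J: "natural_cj_isomorphism N J"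
  shows "von_neumann_algebra A \<Longrightarrow> onto_normal_functionals A N (J A) \<and> matches_positivity A N (J A)"
    and "compatible_with_corners e N J"
proof -
  have iso: "cj_isomorphism A N (J A)" if "von_neumann_algebra A" for A
    using J that unfolding natural_cj_isomorphism_def by blast
  interpret N: vn_algebra N by (rule vn_algebra.intro[OF N])
  show "onto_normal_functionals A N (J A) \<and> matches_positivity A N (J A)" if A: "von_neumann_algebra A"
  proof
    interpret A: vn_algebra A by (rule vn_algebra.intro[OF A])
    interpret P: op_space_pair A N ..
    interpret M: op_space "vn_tensor A N" by (rule vn_tensor_op_space)
    have "homeomorphic_map (Nor_topology A N) (predual_topology (vn_tensor A N)) (J A)"
      using iso[OF A] unfolding cj_isomorphism_def by blast
    from homeomorphic_imp_surjective_map[OF this] show "onto_normal_functionals A N (J A)"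
      unfolding P.topspace_Nor_topology M.topspace_predual_topology onto_normal_functionals_def .
    show "matches_positivity A N (J A)" using iso[OF A] unfolding cj_isomorphism_def by blast
  qed
  show "compatible_with_corners e N J"
    unfolding compatible_with_corners_def
  proof (intro allI impI)
    fix n :: nat and p assume p: "projection (index (Mat e n)) p"
    have M: "Mat e n = full (e ` {..<n})" by (simp only: Mat_def)
    have "normal_star_hom (Mat e 1) (Mat e n) (corner e p)"
      using corner_normal_star_hom p unfolding Mat_1 M opalg.sel by blast
    moreover have "von_neumann_algebra (Mat e k)" for k unfolding Mat_def by (rule full_algebra_vn)
    ultimately show "natural_at N J (Mat e 1) (Mat e n) (corner e p)"
      using J unfolding natural_cj_isomorphism_def by blast
  qed
qed

theorem corollary3p7:
  fixes N :: "'j opalg" and e :: "nat \<Rightarrow> 'u"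
  assumes "is_factor N"
    and "\<not> anti_isomorphic_to_itself N"
    and "inj e"
  shows "(\<nexists>J :: 'u opalg \<Rightarrow> ('u opr \<Rightarrow> 'j opr \<Rightarrow> complex) \<Rightarrow> ('u \<times> 'j) opr \<Rightarrow> complex.
            natural_cj_isomorphism N J) \<and>
         (\<nexists>J :: 'u opalg \<Rightarrow> ('u opr \<Rightarrow> 'j opr \<Rightarrow> complex) \<Rightarrow> ('u \<times> 'j) opr \<Rightarrow> complex.
            (\<forall>A. von_neumann_algebra A \<longrightarrow>
               onto_normal_functionals A N (J A) \<and> matches_positivity A N (J A)) \<and>
            compatible_with_corners e N J)"
proof -
  have N: "von_neumann_algebra N" using assms(1) by (simp add: is_factor_def)
  have e: "e 0 \<noteq> e 1" using assms(3) by (simp add: inj_eq)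
  have no: "\<not> ((\<forall>A. von_neumann_algebra A \<longrightarrow> onto_normal_functionals A N (J A) \<and> matches_positivity A N (J A)) \<and>
      compatible_with_corners e N J)" for J
    using anti_isomorphic_of_corner_compatible[OF N e, of J] assms(2) by blast
  moreover have "\<not> natural_cj_isomorphism N J" for J :: "'u opalg \<Rightarrow> ('u opr \<Rightarrow> 'j opr \<Rightarrow> complex) \<Rightarrow> ('u \<times> 'j) opr \<Rightarrow> complex"
    using no[of J] natural_cj_isomorphism_corner_compatible[OF N, of J] by blast
  ultimately show ?thesis by blast
qed

end
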